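(* Let $C$ be a formal multicurve over an affine scheme $S$, and let $\Omega$ be its module of differential forms. For any divisor $D=\operatorname{spec}(\mathcal{O}_C/I_D)$ on $C$, there is a natural isomorphism $$\operatorname{Hom}_{\mathcal{O}_S}(\mathcal{O}_D,\mathcal{O}_S)=(I_D^{-1}/\mathcal{O}_C)\otimes_{\mathcal{O}_C}\Omega.$$ Moreover, if a map $\phi\colon\mathcal{O}_D\to\mathcal{O}_S$ corresponds to a meromorphic form $\mu$, then $\phi(1)=\operatorname{res}(\mu)$.
   Context: All rings are commutative with unit. $S=\operatorname{spec}(k)$, $\mathcal{O}_S=k$. A formal ring is a complete Hausdorff linearly topologised ring $R$; $\operatorname{spf}(R)=\operatorname{colim}_J\operatorname{spec}(R/J)$ ($J$ open), $\mathcal{O}_{\operatorname{spf}(R)}=R$. A formal multicurve over $S$ is a formal scheme $C=\operatorname{spf}(R)$ over $S$ such that (i) there is a regular element $y\in R$ such that for all $m\geq 0$ the ideal $Ry^m$ is open, $R/y^m$ is a finitely generated free $k$-module, and $R=\varprojlim_m R/y^m$; (ii) the ideal $I_\Delta$ of the diagonal in $C\times_SC=\operatorname{spf}(R\widehat{\otimes}_kR)$ is generated by a single regular element $d$ (a difference function). Put $\Omega=I_\Delta/I_\Delta^2$, which is free of rank one over $\mathcal{O}_C=R$, generated by the image $\alpha$ of $d$. A divisor on $C$ is a closed subscheme $D=\operatorname{spec}(R/I_D)$ where $I_D$ is an open ideal generated by a single regular element and $\mathcal{O}_D=R/I_D$ is a finitely generated projective $k$-module. An element $f\in\mathcal{O}_C$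 is divisorial if it is not a zero-divisor and $\mathcal{O}_C/f$ is a projective $\mathcal{O}_S$-module of finite rank. $\mathcal{M}_C$ is the ring obtained from $\mathcal{O}_C$ by inverting all divisorial elements (meromorphic functions), and $I_D^{-1}=\{g\in\mathcal{M}_C: gI_D\subseteq\mathcal{O}_C\}$. Elements of $\mathcal{M}_C\otimes_{\mathcal{O}_C}\Omega$ are meromorphic differential forms. The isomorphism and the residue. The natural isomorphism is given explicitly as follows: let $f$ be a generator of $I_D$, and let $e\in R\widehat{\otimes}_kR$ be the unique element with $1\otimes f-f\otimes 1=de$; then $\phi\in\operatorname{Hom}_{\mathcal{O}_S}(\mathcal{O}_D,\mathcal{O}_S)$ corresponds to $\Psi_D(\phi)=\bigl((1\otimes\phi)(e)/f\bigr)\otimes\alpha$, where $(1\otimes\phi)(e)\in\mathcal{O}_D$ is computed from the image of $e$ in $\mathcal{O}_D\otimes_k\mathcal{O}_D$ (this is independent of the choices of $d$ and $f$). The residue map $\operatorname{res}\colon\mathcal{M}_C\otimes_{\mathcal{O}_C}\Omega\to\mathcal{O}_S$ is the unique map whose restriction to $I_D^{-1}\otimes_{\mathcal{O}_C}\Omega$, for every divisor $D$, is the composite $$I_D^{-1}\otimes_{\mathcal{O}_C}\Omega\to(I_D^{-1}/\mathcal{O}_C)\otimes_{\mathcal{O}_C}\Omega\xrightarrow{\Psi_D^{-1}}\operatorname{Hom}_{\mathcal{O}_S}(\mathcal{O}_D,\mathcal{O}_S)\xrightarrow{\phi\mapsto\phi(1)}\mathcal{O}_S$$ (these are compatible as $D$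 varies). When $C$ is the formal completion of $\mathbb{A}^1_S$ along the vanishing locus of a monic polynomial, it agrees with the classical residue: for polynomials $p,q$ with $q$ monic, $\operatorname{res}(p(x)\,dx/q(x))$ is the coefficient of $x^{-1}$ in the expansion of $p/q$ as a series $\sum_{n=-\infty}^Na_nx^n$. *)

theory Defs
  imports
    "HOL-Algebra.Free_Abelian_Groups"
    "HOL-Algebra.QuotRing"
    "HOL-Algebra.Ideal_Product"
    "HOL-Algebra.Module"
    "HOL-Analysis.T1_Spaces"
    "HOL-Analysis.Function_Topology"
begin

section \<open>Modules\<close>

text \<open>
  An algebra over a ring is a record of type \<open>module\<close>, whose ring fields give the ring and whose
  field \<open>smult\<close> gives the scalars.  The same record type is used for modules without a
  multiplication; then the fields \<open>mult\<close> and \<open>one\<close> carry no information.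
\<close>

definition self_module :: "('a, 'x) ring_scheme \<Rightarrow> ('a, 'a) module" where
  "self_module A = \<lparr>carrier = carrier A, mult = mult A, one = one A, zero = zero A, add = add A,
     smult = mult A\<rparr>"

text \<open>Linear maps are extensional, so that they are determined by their values on the carrier.\<close>

definition lin_maps ::
  "('a, 'x) ring_scheme \<Rightarrow> ('a, 'b) module \<Rightarrow> ('a, 'c) module \<Rightarrow> ('b \<Rightarrow> 'c) set" where
  "lin_maps A M N = {h \<in> carrier M \<rightarrow>\<^sub>E carrier N.
     (\<forall>x\<in>carrier M. \<forall>y\<in>carrier M. h (x \<oplus>\<^bsub>M\<^esub> y) = h x \<oplus>\<^bsub>N\<^esub> h y) \<and>
     (\<forall>a\<in>carrier A. \<forall>x\<in>carrier M. h (a \<odot>\<^bsub>M\<^esub> x) = a \<odot>\<^bsub>N\<^esub> h x)}"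

definition lin_isos ::
  "('a, 'x) ring_scheme \<Rightarrow> ('a, 'b) module \<Rightarrow> ('a, 'c) module \<Rightarrow> ('b \<Rightarrow> 'c) set" where
  "lin_isos A M N = {h \<in> lin_maps A M N. bij_betw h (carrier M) (carrier N)}"

definition coord_module :: "('a, 'x) ring_scheme \<Rightarrow> nat \<Rightarrow> ('a, nat \<Rightarrow> 'a) module" where
  "coord_module A n = \<lparr>carrier = {..<n} \<rightarrow>\<^sub>E carrier A,
     mult = (\<lambda>u v. \<lambda>i\<in>{..<n}. u i \<otimes>\<^bsub>A\<^esub> v i), one = (\<lambda>i\<in>{..<n}. \<one>\<^bsub>A\<^esub>),
     zero = (\<lambda>i\<in>{..<n}. \<zero>\<^bsub>A\<^esub>), add = (\<lambda>u v. \<lambda>i\<in>{..<n}. u i \<oplus>\<^bsub>A\<^esub> v i),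
     smult = (\<lambda>a u. \<lambda>i\<in>{..<n}. a \<otimes>\<^bsub>A\<^esub> u i)\<rparr>"

definition fin_free :: "('a, 'x) ring_scheme \<Rightarrow> ('a, 'b) module \<Rightarrow> bool" where
  "fin_free A M \<longleftrightarrow> (\<exists>n. lin_isos A (coord_module A n) M \<noteq> {})"

text \<open>Finitely generated projective modules: the direct summands of the modules \<open>A\<^sup>n\<close>.\<close>

definition fin_projective :: "('a, 'x) ring_scheme \<Rightarrow> ('a, 'b) module \<Rightarrow> bool" where
  "fin_projective A M \<longleftrightarrow>
     (\<exists>n. \<exists>i\<in>lin_maps A M (coord_module A n). \<exists>p\<in>lin_maps A (coord_module A n) M.
        \<forall>x\<in>carrier M. p (i x) = x)"

text \<open>The ring part of \<open>quot M N\<close> is the library's \<open>M Quot N\<close>.\<close>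

definition quot :: "('a, 'b) module \<Rightarrow> 'b set \<Rightarrow> ('a, 'b set) module" where
  "quot M N = \<lparr>carrier = carrier (M Quot N), mult = mult (M Quot N), one = one (M Quot N),
     zero = zero (M Quot N), add = add (M Quot N),
     smult = (\<lambda>a X. \<Union>x\<in>X. N +>\<^bsub>M\<^esub> (a \<odot>\<^bsub>M\<^esub> x))\<rparr>"

text \<open>For an \<open>A\<close>-algebra \<open>B\<close>, a \<open>B\<close>-module regarded as an \<open>A\<close>-module.\<close>

definition restrict_scalars :: "('a, 'b) module \<Rightarrow> ('b, 'c) module \<Rightarrow> ('a, 'c) module" where
  "restrict_scalars B M = \<lparr>carrier = carrier M, mult = mult M, one = one M, zero = zero M,
     add = add M, smult = (\<lambda>a x. (a \<odot>\<^bsub>B\<^esub> \<one>\<^bsub>B\<^esub>) \<odot>\<^bsub>M\<^esub> x)\<rparr>"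


section \<open>Tensor products\<close>

text \<open>
  \<open>M \<otimes>\<^sub>A N\<close> is the free abelian group on pairs modulo the usual relations.  If \<open>M\<close> and \<open>N\<close> are
  \<open>A\<close>-algebras, then the multiplication is \<open>(x \<otimes> z)(x' \<otimes> z') = xx' \<otimes> zz'\<close>.
\<close>

abbreviation tensor_gens :: "('a, 'b) module \<Rightarrow> ('a, 'c) module \<Rightarrow> ('b \<times> 'c \<Rightarrow>\<^sub>0 int) monoid" where
  "tensor_gens M N \<equiv> free_Abelian_group (carrier M \<times> carrier N)"

definition tensor_rels ::
  "('a, 'x) ring_scheme \<Rightarrow> ('a, 'b) module \<Rightarrow> ('a, 'c) module \<Rightarrow> ('b \<times> 'c \<Rightarrow>\<^sub>0 int) set" where
  "tensor_rels A M N = generate (tensor_gens M N)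
     ({frag_of (x \<oplus>\<^bsub>M\<^esub> y, z) - frag_of (x, z) - frag_of (y, z) | x y z.
         x \<in> carrier M \<and> y \<in> carrier M \<and> z \<in> carrier N} \<union>
      {frag_of (x, z \<oplus>\<^bsub>N\<^esub> w) - frag_of (x, z) - frag_of (x, w) | x z w.
         x \<in> carrier M \<and> z \<in> carrier N \<and> w \<in> carrier N} \<union>
      {frag_of (a \<odot>\<^bsub>M\<^esub> x, z) - frag_of (x, a \<odot>\<^bsub>N\<^esub> z) | a x z.
         a \<in> carrier A \<and> x \<in> carrier M \<and> z \<in> carrier N})"

definition tensor_class ::
  "('a, 'x) ring_scheme \<Rightarrow> ('a, 'b) module \<Rightarrow> ('a, 'c) module \<Rightarrow>
   ('b \<times> 'c \<Rightarrow>\<^sub>0 int) \<Rightarrow> ('b \<times> 'c \<Rightarrow>\<^sub>0 int) set" where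
  "tensor_class A M N u = tensor_rels A M N #>\<^bsub>tensor_gens M N\<^esub> u"

definition tens ::
  "('a, 'x) ring_scheme \<Rightarrow> ('a, 'b) module \<Rightarrow> ('a, 'c) module \<Rightarrow>
   'b \<Rightarrow> 'c \<Rightarrow> ('b \<times> 'c \<Rightarrow>\<^sub>0 int) set" where
  "tens A M N x z = tensor_class A M N (frag_of (x, z))"

definition tensor ::
  "('a, 'x) ring_scheme \<Rightarrow> ('a, 'b) module \<Rightarrow> ('a, 'c) module \<Rightarrow>
   ('a, ('b \<times> 'c \<Rightarrow>\<^sub>0 int) set) module" where
  "tensor A M N = \<lparr>
     carrier = carrier (tensor_gens M N Mod tensor_rels A M N),
     mult = (\<lambda>X Y. \<Union>u\<in>X. \<Union>v\<in>Y. tensor_class A M N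
        (frag_extend (\<lambda>(x, z). frag_extend (\<lambda>(x', z'). frag_of (x \<otimes>\<^bsub>M\<^esub> x', z \<otimes>\<^bsub>N\<^esub> z')) v) u)),
     one = tens A M N \<one>\<^bsub>M\<^esub> \<one>\<^bsub>N\<^esub>,
     zero = one (tensor_gens M N Mod tensor_rels A M N),
     add = mult (tensor_gens M N Mod tensor_rels A M N),
     smult = (\<lambda>a X. \<Union>u\<in>X. tensor_class A M N
        (frag_extend (\<lambda>(x, z). frag_of (a \<odot>\<^bsub>M\<^esub> x, z)) u))\<rparr>"

text \<open>
  The additive map from a tensor product to \<open>P\<close> that sends \<open>x \<otimes> z\<close> to \<open>b x z\<close>, where \<open>b\<close> is
  biadditive and balanced over the base ring.
\<close>

definition tensor_lift ::
  "('c, 'x) ring_scheme \<Rightarrow> ('a \<Rightarrow> 'b \<Rightarrow> 'c) \<Rightarrow> ('a \<times> 'b \<Rightarrow>\<^sub>0 int) set \<Rightarrow> 'c" where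
  "tensor_lift P b X = the_elem
     ((\<lambda>u. \<Oplus>\<^bsub>P\<^esub>p\<in>Poly_Mapping.keys u. [Poly_Mapping.lookup u p] \<cdot>\<^bsub>P\<^esub> b (fst p) (snd p)) ` X)"


section \<open>Rings of fractions\<close>

inductive_set mult_closure :: "('a, 'x) ring_scheme \<Rightarrow> 'a set \<Rightarrow> 'a set"
  for A :: "('a, 'x) ring_scheme" and S :: "'a set" where
  one: "\<one>\<^bsub>A\<^esub> \<in> mult_closure A S"
| mult: "s \<in> S \<Longrightarrow> t \<in> mult_closure A S \<Longrightarrow> s \<otimes>\<^bsub>A\<^esub> t \<in> mult_closure A S"

text \<open>The fraction \<open>r/s\<close> in the ring obtained from \<open>A\<close> by inverting the elements of \<open>S\<close>.\<close>

definition fraction :: "('a, 'x) ring_scheme \<Rightarrow> 'a set \<Rightarrow> 'a \<Rightarrow> 'a \<Rightarrow> ('a \<times> 'a) set" where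
  "fraction A S r s = {(r', s'). r' \<in> carrier A \<and> s' \<in> mult_closure A S \<and>
     (\<exists>t\<in>mult_closure A S. t \<otimes>\<^bsub>A\<^esub> (r \<otimes>\<^bsub>A\<^esub> s') = t \<otimes>\<^bsub>A\<^esub> (r' \<otimes>\<^bsub>A\<^esub> s))}"

definition localise :: "('a, 'x) ring_scheme \<Rightarrow> 'a set \<Rightarrow> ('a, ('a \<times> 'a) set) module" where
  "localise A S = \<lparr>
     carrier = {fraction A S r s | r s. r \<in> carrier A \<and> s \<in> mult_closure A S},
     mult = (\<lambda>X Y. \<Union>(r, s)\<in>X. \<Union>(r', s')\<in>Y. fraction A S (r \<otimes>\<^bsub>A\<^esub> r') (s \<otimes>\<^bsub>A\<^esub> s')),
     one = fraction A S \<one>\<^bsub>A\<^esub> \<one>\<^bsub>A\<^esub>,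
     zero = fraction A S \<zero>\<^bsub>A\<^esub> \<one>\<^bsub>A\<^esub>,
     add = (\<lambda>X Y. \<Union>(r, s)\<in>X. \<Union>(r', s')\<in>Y.
        fraction A S ((r \<otimes>\<^bsub>A\<^esub> s') \<oplus>\<^bsub>A\<^esub> (r' \<otimes>\<^bsub>A\<^esub> s)) (s \<otimes>\<^bsub>A\<^esub> s')),
     smult = (\<lambda>a X. \<Union>(r, s)\<in>X. fraction A S (a \<otimes>\<^bsub>A\<^esub> r) s)\<rparr>"


section \<open>Formal rings\<close>

definition regular_elt :: "('a, 'x) ring_scheme \<Rightarrow> 'a \<Rightarrow> bool" where
  "regular_elt A x \<longleftrightarrow> x \<in> carrier A \<and> (\<forall>z\<in>carrier A. x \<otimes>\<^bsub>A\<^esub> z = \<zero>\<^bsub>A\<^esub> \<longrightarrow> z = \<zero>\<^bsub>A\<^esub>)"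

definition open_ideals :: "('r, 'x) ring_scheme \<Rightarrow> 'r topology \<Rightarrow> 'r set set" where
  "open_ideals R T = {J. ideal J R \<and> openin T J}"

text \<open>
  The inverse limit of the rings \<open>R/J\<close> over a family of ideals.  If \<open>J \<subseteq> K\<close>, then a coset \<open>X\<close> of
  \<open>J\<close> is mapped by \<open>R/J \<rightarrow> R/K\<close> to the coset of \<open>K\<close> that contains it.
\<close>

definition quot_limit :: "('r, 'x) ring_scheme \<Rightarrow> 'r set set \<Rightarrow> ('r set \<Rightarrow> 'r set) set" where
  "quot_limit R \<J> = {F \<in> (\<Pi>\<^sub>E J\<in>\<J>. carrier (R Quot J)). \<forall>J\<in>\<J>. \<forall>K\<in>\<J>. J \<subseteq> K \<longrightarrow> F J \<subseteq> F K}"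

definition limit_topology :: "('r, 'x) ring_scheme \<Rightarrow> 'r set set \<Rightarrow> ('r set \<Rightarrow> 'r set) topology" where
  "limit_topology R \<J> = subtopology
     (product_topology (\<lambda>J. discrete_topology (carrier (R Quot J))) \<J>) (quot_limit R \<J>)"

definition to_limit :: "('r, 'x) ring_scheme \<Rightarrow> 'r set set \<Rightarrow> 'r \<Rightarrow> 'r set \<Rightarrow> 'r set" where
  "to_limit R \<J> x = (\<lambda>J\<in>\<J>. J +>\<^bsub>R\<^esub> x)"

text \<open>The last two conditions are the Hausdorff property and completeness.\<close>

definition formal_ring :: "('r, 'x) ring_scheme \<Rightarrow> 'r topology \<Rightarrow> bool" where
  "formal_ring R T \<longleftrightarrow> cring R \<and> topspace T = carrier R \<and>
     continuous_map (prod_topology T T) T (\<lambda>(x, y). x \<oplus>\<^bsub>R\<^esub> y) \<and>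
     continuous_map T T (\<lambda>x. \<ominus>\<^bsub>R\<^esub> x) \<and>
     continuous_map (prod_topology T T) T (\<lambda>(x, y). x \<otimes>\<^bsub>R\<^esub> y) \<and>
     (\<forall>U. openin T U \<and> \<zero>\<^bsub>R\<^esub> \<in> U \<longrightarrow> (\<exists>J\<in>open_ideals R T. J \<subseteq> U)) \<and>
     Hausdorff_space T \<and>
     to_limit R (open_ideals R T) ` carrier R = quot_limit R (open_ideals R T)"


section \<open>The completed tensor square\<close>

text \<open>
  The ring of functions on \<open>spf(R) \<times>\<^sub>S spf(R)\<close>, the inverse limit of the rings
  \<open>R/I \<otimes>\<^sub>k R/J\<close> over all pairs of open ideals.  For a coset \<open>X\<close> of \<open>I\<close> and \<open>I \<subseteq> I'\<close>, the set
  \<open>I' <+> X\<close> is the image of \<open>X\<close> in \<open>R/I'\<close>.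
\<close>

type_synonym 'r tensor_square = "'r set \<times> 'r set \<Rightarrow> ('r set \<times> 'r set \<Rightarrow>\<^sub>0 int) set"

definition quot_tensor ::
  "('k, 'x) ring_scheme \<Rightarrow> ('k, 'r) module \<Rightarrow> 'r set \<times> 'r set \<Rightarrow>
   ('k, ('r set \<times> 'r set \<Rightarrow>\<^sub>0 int) set) module" where
  "quot_tensor k R P = tensor k (quot R (fst P)) (quot R (snd P))"

definition tensor_square ::
  "('k, 'x) ring_scheme \<Rightarrow> ('k, 'r) module \<Rightarrow> 'r topology \<Rightarrow> 'r tensor_square ring" where
  "tensor_square k R T = (let \<P> = open_ideals R T \<times> open_ideals R T in \<lparr>
     carrier = {F \<in> (\<Pi>\<^sub>E P\<in>\<P>. carrier (quot_tensor k R P)).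
        \<forall>(I, J)\<in>\<P>. \<forall>(I', J')\<in>\<P>. I \<subseteq> I' \<and> J \<subseteq> J' \<longrightarrow>
          tensor_lift (quot_tensor k R (I', J'))
            (\<lambda>X Y. tens k (quot R I') (quot R J') (I' <+>\<^bsub>R\<^esub> X) (J' <+>\<^bsub>R\<^esub> Y)) (F (I, J))
          = F (I', J')},
     mult = (\<lambda>F G. \<lambda>P\<in>\<P>. F P \<otimes>\<^bsub>quot_tensor k R P\<^esub> G P),
     one = (\<lambda>P\<in>\<P>. \<one>\<^bsub>quot_tensor k R P\<^esub>),
     zero = (\<lambda>P\<in>\<P>. \<zero>\<^bsub>quot_tensor k R P\<^esub>),
     add = (\<lambda>F G. \<lambda>P\<in>\<P>. F P \<oplus>\<^bsub>quot_tensor k R P\<^esub> G P)\<rparr>)"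

definition left_incl ::
  "('k, 'x) ring_scheme \<Rightarrow> ('k, 'r) module \<Rightarrow> 'r topology \<Rightarrow> 'r \<Rightarrow> 'r tensor_square" where
  "left_incl k R T r = (\<lambda>(I, J)\<in>open_ideals R T \<times> open_ideals R T.
     tens k (quot R I) (quot R J) (I +>\<^bsub>R\<^esub> r) (J +>\<^bsub>R\<^esub> \<one>\<^bsub>R\<^esub>))"

definition right_incl ::
  "('k, 'x) ring_scheme \<Rightarrow> ('k, 'r) module \<Rightarrow> 'r topology \<Rightarrow> 'r \<Rightarrow> 'r tensor_square" where
  "right_incl k R T r = (\<lambda>(I, J)\<in>open_ideals R T \<times> open_ideals R T.
     tens k (quot R I) (quot R J) (I +>\<^bsub>R\<^esub> \<one>\<^bsub>R\<^esub>) (J +>\<^bsub>R\<^esub> r))"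

text \<open>
  The multiplication map from the completed tensor square to \<open>R\<close>, which corresponds to the diagonal:
  modulo an open ideal \<open>J\<close> it is the multiplication \<open>R/J \<otimes>\<^sub>k R/J \<rightarrow> R/J\<close>.
\<close>

definition codiagonal :: "('k, 'r) module \<Rightarrow> 'r topology \<Rightarrow> 'r tensor_square \<Rightarrow> 'r" where
  "codiagonal R T F = (THE r. r \<in> carrier R \<and>
     (\<forall>J\<in>open_ideals R T. J +>\<^bsub>R\<^esub> r =
        tensor_lift (quot R J) (\<lambda>X Y. X \<otimes>\<^bsub>quot R J\<^esub> Y) (F (J, J))))"

definition diag_ideal ::
  "('k, 'x) ring_scheme \<Rightarrow> ('k, 'r) module \<Rightarrow> 'r topology \<Rightarrow> 'r tensor_square set" where
  "diag_ideal k R T = a_kernel (tensor_square k R T) R (codiagonal R T)"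


section \<open>Formal multicurves\<close>

definition difference_function ::
  "('k, 'x) ring_scheme \<Rightarrow> ('k, 'r) module \<Rightarrow> 'r topology \<Rightarrow> 'r tensor_square \<Rightarrow> bool" where
  "difference_function k R T d \<longleftrightarrow>
     regular_elt (tensor_square k R T) d \<and> diag_ideal k R T = PIdl\<^bsub>tensor_square k R T\<^esub> d"

text \<open>
  \<open>C = spf(R)\<close> over \<open>S = spec(k)\<close>.  The identity \<open>R = lim R/y\<^sup>m\<close> is one of topological rings, so the
  topology of \<open>R\<close> is the \<open>y\<close>-adic one.
\<close>

definition formal_multicurve ::
  "('k, 'x) ring_scheme \<Rightarrow> ('k, 'r) module \<Rightarrow> 'r topology \<Rightarrow> bool" where
  "formal_multicurve k R T \<longleftrightarrow> algebra k R \<and> formal_ring R T \<and>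
     (\<exists>y. regular_elt R y \<and>
        (\<forall>m::nat. openin T (PIdl\<^bsub>R\<^esub> (y [^]\<^bsub>R\<^esub> m)) \<and> fin_free k (quot R (PIdl\<^bsub>R\<^esub> (y [^]\<^bsub>R\<^esub> m)))) \<and>
        (let \<Y> = {PIdl\<^bsub>R\<^esub> (y [^]\<^bsub>R\<^esub> m) | m::nat. True} in
           homeomorphic_map T (limit_topology R \<Y>) (to_limit R \<Y>))) \<and>
     (\<exists>d. difference_function k R T d)"

text \<open>
  \<open>\<Omega> = I\<^sub>\<Delta>/I\<^sub>\<Delta>\<^sup>2\<close>, on which \<open>r \<in> R\<close> acts as multiplication by \<open>r \<otimes> 1\<close> (equivalently, by \<open>1 \<otimes> r\<close>).
\<close>

definition differentials ::
  "('k, 'x) ring_scheme \<Rightarrow> ('k, 'r) module \<Rightarrow> 'r topology \<Rightarrow> ('r, 'r tensor_square set) module" where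
  "differentials k R T = (let Q = tensor_square k R T; I = diag_ideal k R T in
     quot \<lparr>carrier = I, mult = mult Q, one = one Q, zero = zero Q, add = add Q,
        smult = (\<lambda>r F. left_incl k R T r \<otimes>\<^bsub>Q\<^esub> F)\<rparr> (ideal_prod Q I I))"

definition diff_class ::
  "('k, 'x) ring_scheme \<Rightarrow> ('k, 'r) module \<Rightarrow> 'r topology \<Rightarrow> 'r tensor_square \<Rightarrow>
   'r tensor_square set" where
  "diff_class k R T F =
     ideal_prod (tensor_square k R T) (diag_ideal k R T) (diag_ideal k R T) +>\<^bsub>tensor_square k R T\<^esub> F"


section \<open>Divisors and meromorphic forms\<close>

text \<open>A divisor \<open>D\<close> is represented by its ideal \<open>I\<^sub>D\<close>; thus \<open>\<O>\<^sub>D\<close> is \<open>quot R I\<close>.\<close>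

definition divisor ::
  "('k, 'x) ring_scheme \<Rightarrow> ('k, 'r) module \<Rightarrow> 'r topology \<Rightarrow> 'r set \<Rightarrow> bool" where
  "divisor k R T I \<longleftrightarrow> I \<in> open_ideals R T \<and> (\<exists>f. regular_elt R f \<and> I = PIdl\<^bsub>R\<^esub> f) \<and>
     fin_projective k (quot R I)"

definition divisorial :: "('k, 'x) ring_scheme \<Rightarrow> ('k, 'r) module \<Rightarrow> 'r set" where
  "divisorial k R = {f. regular_elt R f \<and> fin_projective k (quot R (PIdl\<^bsub>R\<^esub> f))}"

definition meromorphic ::
  "('k, 'x) ring_scheme \<Rightarrow> ('k, 'r) module \<Rightarrow> ('r, ('r \<times> 'r) set) module" where
  "meromorphic k R = localise R (divisorial k R)"

abbreviation mero_frac ::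
  "('k, 'x) ring_scheme \<Rightarrow> ('k, 'r) module \<Rightarrow> 'r \<Rightarrow> 'r \<Rightarrow> ('r \<times> 'r) set" where
  "mero_frac k R \<equiv> fraction R (divisorial k R)"

text \<open>\<open>\<O>\<^sub>C\<close> as a subring of \<open>\<M>\<^sub>C\<close>.\<close>

definition holomorphic :: "('k, 'x) ring_scheme \<Rightarrow> ('k, 'r) module \<Rightarrow> ('r \<times> 'r) set set" where
  "holomorphic k R = (\<lambda>r. mero_frac k R r \<one>\<^bsub>R\<^esub>) ` carrier R"

definition inverse_ideal ::
  "('k, 'x) ring_scheme \<Rightarrow> ('k, 'r) module \<Rightarrow> 'r set \<Rightarrow> ('r, ('r \<times> 'r) set) module" where
  "inverse_ideal k R I = (meromorphic k R)\<lparr>carrier := {g \<in> carrier (meromorphic k R).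
     \<forall>a\<in>I. g \<otimes>\<^bsub>meromorphic k R\<^esub> mero_frac k R a \<one>\<^bsub>R\<^esub> \<in> holomorphic k R}\<rparr>"

definition polar_parts ::
  "('k, 'x) ring_scheme \<Rightarrow> ('k, 'r) module \<Rightarrow> 'r set \<Rightarrow> ('r, ('r \<times> 'r) set set) module" where
  "polar_parts k R I = quot (inverse_ideal k R I) (holomorphic k R)"

definition mero_forms where
  "mero_forms k R T = tensor R (meromorphic k R) (differentials k R T)"

definition inverse_forms where
  "inverse_forms k R T I = tensor R (inverse_ideal k R I) (differentials k R T)"

definition polar_forms where
  "polar_forms k R T I = tensor R (polar_parts k R I) (differentials k R T)"

definition inverse_to_mero where
  "inverse_to_mero k R T = tensor_lift (mero_forms k R T)
     (\<lambda>g w. tens R (meromorphic k R) (differentials k R T) g w)"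

definition inverse_to_polar where
  "inverse_to_polar k R T I = tensor_lift (polar_forms k R T I)
     (\<lambda>g w. tens R (polar_parts k R I) (differentials k R T)
        (holomorphic k R +>\<^bsub>inverse_ideal k R I\<^esub> g) w)"

text \<open>For \<open>I\<^sub>E \<subseteq> I\<^sub>D\<close>, a coset of \<open>\<O>\<^sub>C\<close> in \<open>I\<^sub>D\<^sup>-\<^sup>1\<close> is literally a coset of \<open>\<O>\<^sub>C\<close> in \<open>I\<^sub>E\<^sup>-\<^sup>1\<close>.\<close>

definition polar_to_polar where
  "polar_to_polar k R T E = tensor_lift (polar_forms k R T E)
     (\<lambda>G w. tens R (polar_parts k R E) (differentials k R T) G w)"


section \<open>Duality and residues\<close>

text \<open>\<open>Hom\<^sub>k(\<O>\<^sub>D, k)\<close> with the \<open>R\<close>-module structure \<open>(r\<phi>)(a) = \<phi>(ra)\<close>.\<close>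

definition dual ::
  "('k, 'x) ring_scheme \<Rightarrow> ('k, 'r) module \<Rightarrow> 'r set \<Rightarrow> ('r, 'r set \<Rightarrow> 'k) module" where
  "dual k R I = \<lparr>carrier = lin_maps k (quot R I) (self_module k),
     mult = undefined, one = undefined,
     zero = (\<lambda>X\<in>carrier (quot R I). \<zero>\<^bsub>k\<^esub>),
     add = (\<lambda>\<phi> \<psi>. \<lambda>X\<in>carrier (quot R I). \<phi> X \<oplus>\<^bsub>k\<^esub> \<psi> X),
     smult = (\<lambda>r \<phi>. \<lambda>X\<in>carrier (quot R I). \<phi> ((I +>\<^bsub>R\<^esub> r) \<otimes>\<^bsub>quot R I\<^esub> X))\<rparr>"

text \<open>
  The form \<open>((1 \<otimes> \<phi>)(e)/f) \<otimes> \<alpha>\<close>, where \<open>1 \<otimes> f - f \<otimes> 1 = de\<close>.  As \<open>I\<^sub>D = Rf\<close> is open, the image of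
  \<open>e\<close> in \<open>\<O>\<^sub>D \<otimes> \<O>\<^sub>D\<close> is the component of \<open>e\<close> at \<open>(I\<^sub>D, I\<^sub>D)\<close>.  If \<open>c \<in> \<O>\<^sub>D\<close> is the coset \<open>r + Rf\<close>, then
  the set of all \<open>x/f\<close> with \<open>x \<in> c\<close> is the coset \<open>r/f + R\<close>, which is the element \<open>c/f\<close> of
  \<open>I\<^sub>D\<^sup>-\<^sup>1/\<O>\<^sub>C\<close>.
\<close>

definition duality_formula where
  "duality_formula k R T I d f \<phi> =
     (let Q = tensor_square k R T;
          e = (THE e. e \<in> carrier Q \<and> right_incl k R T f \<ominus>\<^bsub>Q\<^esub> left_incl k R T f = d \<otimes>\<^bsub>Q\<^esub> e);
          c = tensor_lift (quot R I) (\<lambda>X Y. \<phi> Y \<odot>\<^bsub>quot R I\<^esub> X) (e (I, I))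
      in tens R (polar_parts k R I) (differentials k R T)
           ((\<lambda>x. mero_frac k R x f) ` c) (diff_class k R T d))"

text \<open>\<open>\<Psi>\<^sub>D\<close> is the common value of the formula for all choices of \<open>d\<close> and \<open>f\<close>.\<close>

definition duality_map where
  "duality_map k R T I = (\<lambda>\<phi>\<in>carrier (dual k R I).
     THE \<omega>. \<forall>d f. difference_function k R T d \<and> regular_elt R f \<and> I = PIdl\<^bsub>R\<^esub> f \<longrightarrow>
       \<omega> = duality_formula k R T I d f \<phi>)"

text \<open>
  The \<open>k\<close>-linear map \<open>\<rho>\<close> on \<open>\<M>\<^sub>C \<otimes> \<Omega>\<close> restricts on \<open>I\<^sub>D\<^sup>-\<^sup>1 \<otimes> \<Omega>\<close>, for every divisor \<open>D\<close>, to the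
  projection to \<open>(I\<^sub>D\<^sup>-\<^sup>1/\<O>\<^sub>C) \<otimes> \<Omega>\<close> followed by the inverse of \<open>\<Psi>\<^sub>D\<close> and by evaluation at \<open>1\<close>.
\<close>

definition is_residue_map where
  "is_residue_map k R T \<rho> \<longleftrightarrow>
     \<rho> \<in> lin_maps k (restrict_scalars R (mero_forms k R T)) (self_module k) \<and>
     (\<forall>I. divisor k R T I \<longrightarrow> (\<forall>z\<in>carrier (inverse_forms k R T I).
        \<rho> (inverse_to_mero k R T z) =
          (inv_into (carrier (dual k R I)) (duality_map k R T I) (inverse_to_polar k R T I z))
            \<one>\<^bsub>quot R I\<^esub>))"

definition residue where
  "residue k R T = (THE \<rho>. is_residue_map k R T \<rho>)"

text \<open>
  The functional \<open>\<phi>\<close> on \<open>\<O>\<^sub>D\<close> corresponds to the meromorphic form \<open>\<mu>\<close>: the form lies in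
  \<open>I\<^sub>D\<^sup>-\<^sup>1 \<otimes> \<Omega>\<close>, and its class modulo \<open>\<O>\<^sub>C \<otimes> \<Omega>\<close> is \<open>\<Psi>\<^sub>D(\<phi>)\<close>.
\<close>

definition corresponds where
  "corresponds k R T I \<phi> \<mu> \<longleftrightarrow> (\<exists>z\<in>carrier (inverse_forms k R T I).
     inverse_to_mero k R T z = \<mu> \<and> inverse_to_polar k R T I z = duality_map k R T I \<phi>)"

end

theory Submission imports Defs begin

text \<open>
  Let \<open>B = R/I\<close> for a divisor with ideal \<open>I = Rf\<close>.  In \<open>B \<otimes> B\<close> the image of \<open>e\<close> generates the annihilator of
  the image of \<open>d\<close>.  A projection onto this annihilator, built from a dual basis of \<open>B\<close>, has trace \<open>1\<close>,
  and this provides a functional on \<open>B\<close> whose image under \<open>\<phi> \<mapsto> (1 \<otimes> \<phi>)(e)\<close> is \<open>1\<close>; as this map is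
  \<open>B\<close>-linear, it is then an isomorphism of the dual of \<open>B\<close> with \<open>B\<close>.

  The isomorphisms for all divisors prescribe the residue on the fractions \<open>r/f\<close>.  A divisorial element \<open>s\<close>
  need not generate an open ideal, so a fraction \<open>r/s\<close> need not be of this form.  Its residue is found
  by extending the functionals \<open>\<rho>\<^sub>m(r) = res(r/y\<^sup>m)\<close> from \<open>sR\<close> to \<open>R\<close>, subject to
  \<open>\<rho>\<^sub>m\<^sub>+\<^sub>1(yr) = \<rho>\<^sub>m(r)\<close>.  For functionals \<open>\<phi>\<^sub>m\<close> that vanish on \<open>sR\<close> put \<open>G\<^sub>m(x) = \<Sum>\<^sub>n \<phi>\<^sub>n\<^sub>+\<^sub>m(x) y\<^sup>n\<close>.  The trace
  over \<open>R/s\<close> of \<open>x \<mapsto> b G\<^sub>m(x)\<close> is \<open>\<phi>\<^sub>m(b)\<close> plus the trace of \<open>x \<mapsto> y b G\<^sub>m\<^sub>+\<^sub>1(x)\<close>.  With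
  \<open>tr(gh) = tr(hg)\<close> this gives the uniqueness of the extension, and a correction term for its existence.
\<close>

text \<open>The annihilator of d is computed in the completed tensor square, where d is regular: a
  relation dt = 0 in B \<otimes> B is lifted to an element dx of the kernel of the reduction, and d
  and f are then cancelled. The obstacle is this kernel. In an uncompleted tensor product it is
  generated by f \<otimes> 1 and 1 \<otimes> f; in the completion, division by f has to be realised
  by a continuous k-linear operator on R. Hence the operators g \<otimes> h on the completion, and
  the need for the powers of y to be cofinal among the open ideals.

  The whole family rho_m, and not rho_0 alone, is extended because the fractions r/(s y^m) tie the
  denominator s to the denominators y^m, as sr/(s y^m) = r/y^m. A single functional that vanishes on
  sR is arbitrary on R/s; a family with phi_{m+1}(yr) = phi_m(r) is rigid. The two maps to be
  commuted under the trace are multiplication by y and x \<mapsto> b G_{m+1}(x): their products are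
  b G_m(x) and y b G_{m+1}(x). The correction term is the same trace, formed with the failure of an
  arbitrary linear extension to be compatible.\<close>

section \<open>Additive maps and finite sums\<close>

definition additive_map :: "('a, 'x) ring_scheme \<Rightarrow> ('b, 'y) ring_scheme \<Rightarrow> ('a \<Rightarrow> 'b) \<Rightarrow> bool" where
  "additive_map M P h \<longleftrightarrow> h \<in> carrier M \<rightarrow> carrier P \<and>
     (\<forall>x\<in>carrier M. \<forall>y\<in>carrier M. h (x \<oplus>\<^bsub>M\<^esub> y) = h x \<oplus>\<^bsub>P\<^esub> h y)"

lemma additive_mapI:
  assumes "\<And>x. x \<in> carrier M \<Longrightarrow> h x \<in> carrier P"
    and "\<And>x y. x \<in> carrier M \<Longrightarrow> y \<in> carrier M \<Longrightarrow> h (x \<oplus>\<^bsub>M\<^esub> y) = h x \<oplus>\<^bsub>P\<^esub> h y"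
  shows "additive_map M P h"
  using assms by (auto simp: additive_map_def)

lemma additive_map_closed: "additive_map M P h \<Longrightarrow> x \<in> carrier M \<Longrightarrow> h x \<in> carrier P"
  by (auto simp: additive_map_def)

lemma additive_map_add:
  "additive_map M P h \<Longrightarrow> x \<in> carrier M \<Longrightarrow> y \<in> carrier M \<Longrightarrow> h (x \<oplus>\<^bsub>M\<^esub> y) = h x \<oplus>\<^bsub>P\<^esub> h y"
  by (auto simp: additive_map_def)

lemma additive_map_group_hom:
  assumes "abelian_group M" "abelian_group P" "additive_map M P h"
  shows "abelian_group_hom M P h"
  using assms
  by (intro abelian_group_homI)
    (auto intro!: group_hom.intro group_hom_axioms.intro homI abelian_group.a_group
      simp: additive_map_def)

lemma additive_map_zero:
  assumes "abelian_group M" "abelian_group P" "additive_map M P h"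
  shows "h \<zero>\<^bsub>M\<^esub> = \<zero>\<^bsub>P\<^esub>"
  by (rule abelian_group_hom.hom_zero[OF additive_map_group_hom[OF assms]])

lemma additive_map_uminus:
  assumes "abelian_group M" "abelian_group P" "additive_map M P h" "x \<in> carrier M"
  shows "h (\<ominus>\<^bsub>M\<^esub> x) = \<ominus>\<^bsub>P\<^esub> h x"
  by (rule abelian_group_hom.hom_a_inv[OF additive_map_group_hom[OF assms(1-3)] assms(4)])

lemma additive_map_minus:
  assumes "abelian_group M" "abelian_group P" "additive_map M P h" "x \<in> carrier M" "y \<in> carrier M"
  shows "h (x \<ominus>\<^bsub>M\<^esub> y) = h x \<ominus>\<^bsub>P\<^esub> h y"
  using assms
  by (simp add: a_minus_def additive_map_add additive_map_uminus abelian_group.a_inv_closed)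

lemma additive_map_finsum:
  assumes M: "abelian_group M" and P: "abelian_group P" and h: "additive_map M P h"
    and f: "f \<in> A \<rightarrow> carrier M"
  shows "h (\<Oplus>\<^bsub>M\<^esub>i\<in>A. f i) = (\<Oplus>\<^bsub>P\<^esub>i\<in>A. h (f i))"
proof -
  interpret M: abelian_group M by (rule M)
  interpret P: abelian_group P by (rule P)
  show ?thesis
    using f
  proof (induction A rule: infinite_finite_induct)
    case (infinite A)
    then show ?case by (simp add: additive_map_zero[OF M P h])
  next
    case empty
    then show ?case by (simp add: additive_map_zero[OF M P h])
  next
    case (insert x A)
    then have "f x \<in> carrier M" "f \<in> A \<rightarrow> carrier M" by auto
    moreover have "(\<lambda>i. h (f i)) \<in> A \<rightarrow> carrier P" "h (f x) \<in> carrier P"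
      using calculation by (auto intro: additive_map_closed[OF h])
    moreover have "h (f x \<oplus>\<^bsub>M\<^esub> (\<Oplus>\<^bsub>M\<^esub>i\<in>A. f i)) = h (f x) \<oplus>\<^bsub>P\<^esub> h (\<Oplus>\<^bsub>M\<^esub>i\<in>A. f i)"
      using calculation by (intro additive_map_add[OF h]) auto
    ultimately show ?case
      using insert by simp
  qed
qed

text \<open>The exchange of summations behind both trace identities, \<open>ex_unit\<close> and
  \<open>tr_commute\<close>.\<close>

lemma (in abelian_monoid) finsum_swap:
  assumes "finite A" "finite B" "\<And>i j. i \<in> A \<Longrightarrow> j \<in> B \<Longrightarrow> f i j \<in> carrier G"
  shows "(\<Oplus>i\<in>A. \<Oplus>j\<in>B. f i j) = (\<Oplus>j\<in>B. \<Oplus>i\<in>A. f i j)"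
  using assms
proof (induction A rule: finite_induct)
  case empty
  then show ?case by simp
next
  case (insert a A)
  have "(\<Oplus>j\<in>B. \<Oplus>i\<in>insert a A. f i j) = (\<Oplus>j\<in>B. f a j \<oplus> (\<Oplus>i\<in>A. f i j))"
    using insert by (intro finsum_cong') (auto simp: Pi_def)
  also have "\<dots> = (\<Oplus>j\<in>B. f a j) \<oplus> (\<Oplus>j\<in>B. \<Oplus>i\<in>A. f i j)"
    using insert by (intro finsum_addf) (auto simp: Pi_def)
  finally show ?case
    using insert by (simp add: Pi_def)
qed

text \<open>Factor groups are multiplicative in HOL-Algebra; this moves their laws to the additive
  parts of \<open>quot\<close> and \<open>tensor\<close>, whose carriers, sums and zeros are
  literally those of the factor group.\<close>

lemma abelian_group_of_comm_group:
  assumes "comm_group G" "carrier M = carrier G" "add M = mult G" "zero M = one G"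
  shows "abelian_group M"
proof -
  interpret comm_group G by fact
  show ?thesis
    using assms(2-)
    by (intro abelian_groupI) (auto intro: m_assoc m_comm simp: l_inv_ex)
qed

lemma (in abelian_group) minus_eq_zero_iff:
  assumes "x \<in> carrier G" "y \<in> carrier G"
  shows "x \<ominus> y = \<zero> \<longleftrightarrow> x = y"
proof
  assume "x \<ominus> y = \<zero>"
  then show "x = y"
    using minus_equality[of x "\<ominus> y"] assms by (simp add: a_minus_def)
qed (simp add: a_minus_def r_neg assms)

lemma (in Module.module) smult_additive_map: "a \<in> carrier R \<Longrightarrow> additive_map M M (\<lambda>x. a \<odot>\<^bsub>M\<^esub> x)"
  by (rule additive_mapI) (auto simp: smult_r_distr)

section \<open>Quotient modules\<close>

text \<open>One locale for three quotients: the \<open>k\<close>-algebras \<open>R/J\<close>, the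
  polar parts and the differentials. The last two are \<open>R\<close>-modules without a
  multiplication of interest, so the algebra case is a separate extension.\<close>

locale quotient_module = Module.module A M + additive_subgroup N M
  for A :: "('a, 'x) ring_scheme" (structure) and M :: "('a, 'b) module" (structure) and N +
  assumes smult_mem: "a \<in> carrier A \<Longrightarrow> x \<in> N \<Longrightarrow> a \<odot>\<^bsub>M\<^esub> x \<in> N"
begin

sublocale abelian_subgroup N M
  by (rule abelian_subgroupI3[OF additive_subgroup_axioms M.abelian_group_axioms])

abbreviation "q x \<equiv> N +>\<^bsub>M\<^esub> x"

lemma quot_simps:
  "carrier (quot M N) = a_rcosets\<^bsub>M\<^esub> N" "zero (quot M N) = N" "add (quot M N) = set_add M"
  "one (quot M N) = q \<one>\<^bsub>M\<^esub>" "mult (quot M N) = rcoset_mult M N"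
  by (simp_all add: quot_def FactRing_def)

lemma quot_carrier: "carrier (quot M N) = q ` carrier M"
  by (auto simp: quot_simps A_RCOSETS_def')

lemma coset_mem_carrier: "x \<in> carrier M \<Longrightarrow> q x \<in> carrier (quot M N)"
  by (simp add: quot_carrier)

lemma coset_subset: "x \<in> carrier M \<Longrightarrow> q x \<subseteq> carrier M"
  by (rule M.a_r_coset_subset_G[OF a_subset])

lemma coset_eq_iff:
  assumes "x \<in> carrier M" "y \<in> carrier M"
  shows "q x = q y \<longleftrightarrow> x \<ominus>\<^bsub>M\<^esub> y \<in> N"
proof
  assume "q x = q y"
  then have "x \<in> q y" using a_rcos_self[OF assms(1)] by simp
  then show "x \<ominus>\<^bsub>M\<^esub> y \<in> N"
    using a_rcos_module[OF assms(2,1)] by (simp add: a_minus_def)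
next
  assume "x \<ominus>\<^bsub>M\<^esub> y \<in> N"
  then have "x \<in> q y"
    using a_rcos_module[OF assms(2,1)] by (simp add: a_minus_def)
  then show "q x = q y"
    using M.a_repr_independence[OF _ assms(2) a_subgroup] by simp
qed

lemma mem_coset_iff:
  assumes "x \<in> carrier M" "y \<in> carrier M"
  shows "y \<in> q x \<longleftrightarrow> y \<ominus>\<^bsub>M\<^esub> x \<in> N"
  using a_rcos_module[OF assms(1,2)] by (simp add: a_minus_def)

lemma mem_coset_iff':
  assumes "x \<in> carrier M"
  shows "y \<in> q x \<longleftrightarrow> y \<in> carrier M \<and> q y = q x"
  using assms coset_subset[OF assms] mem_coset_iff[OF assms] coset_eq_iff[OF _ assms] by blast

lemma coset_zero: "q \<zero>\<^bsub>M\<^esub> = N"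
  by (simp add: a_subset)

lemma coset_eq_zero_iff: "x \<in> carrier M \<Longrightarrow> q x = N \<longleftrightarrow> x \<in> N"
  using coset_eq_iff[of x "\<zero>\<^bsub>M\<^esub>"] M.minus_equality[of "\<zero>\<^bsub>M\<^esub>" "\<zero>\<^bsub>M\<^esub>"]
  by (simp add: a_minus_def coset_zero)

lemma coset_add:
  "x \<in> carrier M \<Longrightarrow> y \<in> carrier M \<Longrightarrow> q x \<oplus>\<^bsub>quot M N\<^esub> q y = q (x \<oplus>\<^bsub>M\<^esub> y)"
  by (simp add: quot_simps a_rcos_sum)

lemma coset_smult:
  assumes a: "a \<in> carrier A" and x: "x \<in> carrier M"
  shows "a \<odot>\<^bsub>quot M N\<^esub> q x = q (a \<odot>\<^bsub>M\<^esub> x)"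
proof -
  have "q (a \<odot>\<^bsub>M\<^esub> y) = q (a \<odot>\<^bsub>M\<^esub> x)" if "y \<in> q x" for y
  proof -
    have y: "y \<in> carrier M" "y \<ominus>\<^bsub>M\<^esub> x \<in> N"
      using that mem_coset_iff x coset_subset by auto
    then have "a \<odot>\<^bsub>M\<^esub> y \<ominus>\<^bsub>M\<^esub> a \<odot>\<^bsub>M\<^esub> x = a \<odot>\<^bsub>M\<^esub> (y \<ominus>\<^bsub>M\<^esub> x)"
      using a x by (simp add: a_minus_def smult_r_distr smult_r_minus)
    then show ?thesis
      using a x y smult_mem by (simp add: coset_eq_iff)
  qed
  \<comment> \<open>The union that defines the scalar action of \<open>quot\<close> is over equal
    cosets, and \<open>q x\<close> is not empty.\<close>
  then have "(\<Union>y\<in>q x. q (a \<odot>\<^bsub>M\<^esub> y)) = (\<Union>y\<in>q x. q (a \<odot>\<^bsub>M\<^esub> x))"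
    by (intro SUP_cong) auto
  moreover have "q x \<noteq> {}" using a_rcos_self x by blast
  ultimately show ?thesis
    by (simp add: quot_def)
qed

lemma coset_additive: "additive_map M (quot M N) q"
  by (rule additive_mapI) (auto simp: coset_mem_carrier coset_add)

lemma abelian_group_quot: "abelian_group (quot M N)"
  by (rule abelian_group_of_comm_group[OF a_factorgroup_is_comm_group])
    (simp_all add: quot_simps A_FactGroup_def')

lemma module_quot: "Module.module A (quot M N)"
  by (intro moduleI abelian_group_quot R.is_cring)
    (auto simp: quot_carrier coset_smult coset_add smult_l_distr smult_r_distr smult_assoc1)

end

locale quotient_algebra = algebra A M + ideal N M
  for A :: "('a, 'x) ring_scheme" (structure) and M :: "('a, 'b) module" (structure) and N
begin

lemma smult_eq_mult: "a \<in> carrier A \<Longrightarrow> x \<in> carrier M \<Longrightarrow> a \<odot>\<^bsub>M\<^esub> x = (a \<odot>\<^bsub>M\<^esub> \<one>\<^bsub>M\<^esub>) \<otimes>\<^bsub>M\<^esub> x"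
  by (simp add: smult_assoc2)

sublocale quotient_module A M N
proof (unfold_locales)
  show "a \<odot>\<^bsub>M\<^esub> x \<in> N" if "a \<in> carrier A" "x \<in> N" for a x
    using that smult_eq_mult[of a x] I_l_closed Icarr by simp
qed

lemma coset_mult:
  "x \<in> carrier M \<Longrightarrow> y \<in> carrier M \<Longrightarrow> q x \<otimes>\<^bsub>quot M N\<^esub> q y = q (x \<otimes>\<^bsub>M\<^esub> y)"
  by (simp add: quot_simps rcoset_mult_add)

lemma cring_quot: "cring (quot M N)"
proof -
  interpret Q: abelian_group "quot M N" by (rule abelian_group_quot)
  show ?thesis
  proof (intro cringI comm_monoidI Q.abelian_group_axioms)
    fix X Y Z assume "X \<in> carrier (quot M N)" "Y \<in> carrier (quot M N)" "Z \<in> carrier (quot M N)"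
    then show "X \<otimes>\<^bsub>quot M N\<^esub> Y \<otimes>\<^bsub>quot M N\<^esub> Z = X \<otimes>\<^bsub>quot M N\<^esub> (Y \<otimes>\<^bsub>quot M N\<^esub> Z)"
      "(X \<oplus>\<^bsub>quot M N\<^esub> Y) \<otimes>\<^bsub>quot M N\<^esub> Z = X \<otimes>\<^bsub>quot M N\<^esub> Z \<oplus>\<^bsub>quot M N\<^esub> Y \<otimes>\<^bsub>quot M N\<^esub> Z"
      by (auto simp: quot_carrier coset_mult coset_add l_distr m_assoc)
  next
    fix X Y assume "X \<in> carrier (quot M N)" "Y \<in> carrier (quot M N)"
    then show "X \<otimes>\<^bsub>quot M N\<^esub> Y = Y \<otimes>\<^bsub>quot M N\<^esub> X"
      by (auto simp: quot_carrier coset_mult m_comm)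
  qed (auto simp: quot_carrier coset_mult coset_mem_carrier quot_simps(4))
qed

lemma algebra_quot: "algebra A (quot M N)"
proof -
  interpret Q: Module.module A "quot M N" by (rule module_quot)
  interpret C: cring "quot M N" by (rule cring_quot)
  show ?thesis
    by unfold_locales (auto simp: quot_carrier coset_mult coset_smult smult_assoc2)
qed

lemma coset_one: "q \<one>\<^bsub>M\<^esub> = \<one>\<^bsub>quot M N\<^esub>"
  by (simp add: quot_simps)

end

section \<open>Tensor products of modules\<close>

locale tensor_product = left: Module.module A M + right: Module.module A N
  for A :: "('a, 'x) ring_scheme" (structure) and M :: "('a, 'b) module" and N :: "('a, 'c) module"
begin

abbreviation "F \<equiv> tensor_gens M N"
abbreviation "H \<equiv> tensor_rels A M N"
abbreviation "cls \<equiv> tensor_class A M N"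
abbreviation "T \<equiv> tensor A M N"
abbreviation "tn \<equiv> tens A M N"

lemma F_group: "comm_group F"
  by (rule abelian_free_Abelian_group)

text \<open>The generators of \<open>tensor_rels\<close> get a name so that an induction over
  \<open>generate\<close> can treat them by cases.\<close>

definition rels :: "('b \<times> 'c \<Rightarrow>\<^sub>0 int) set" where
  "rels = {frag_of (x \<oplus>\<^bsub>M\<^esub> y, z) - frag_of (x, z) - frag_of (y, z) | x y z.
         x \<in> carrier M \<and> y \<in> carrier M \<and> z \<in> carrier N} \<union>
      {frag_of (x, z \<oplus>\<^bsub>N\<^esub> w) - frag_of (x, z) - frag_of (x, w) | x z w.
         x \<in> carrier M \<and> z \<in> carrier N \<and> w \<in> carrier N} \<union>
      {frag_of (a \<odot>\<^bsub>M\<^esub> x, z) - frag_of (x, a \<odot>\<^bsub>N\<^esub> z) | a x z.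
         a \<in> carrier A \<and> x \<in> carrier M \<and> z \<in> carrier N}"

lemma H_eq: "H = generate F rels"
  by (simp add: tensor_rels_def rels_def)

lemma rels_subset_F: "rels \<subseteq> carrier F"
  by (auto simp: rels_def dest!: subsetD[OF keys_diff])

lemma H_subgroup: "subgroup H F"
  unfolding H_eq
  by (rule group.generate_is_subgroup[OF group_free_Abelian_group rels_subset_F])

lemma H_normal: "H \<lhd> F"
  by (rule comm_group.subgroup_imp_normal[OF F_group H_subgroup])

lemma H_keys: "u \<in> H \<Longrightarrow> Poly_Mapping.keys u \<subseteq> carrier M \<times> carrier N"
  by (drule subsetD[OF subgroup.subset[OF H_subgroup]]) simp

lemma H_closed: "0 \<in> H" "u \<in> H \<Longrightarrow> v \<in> H \<Longrightarrow> u + v \<in> H" "u \<in> H \<Longrightarrow> - u \<in> H"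
proof -
  show "0 \<in> H" using subgroup.one_closed[OF H_subgroup] by simp
  show "u \<in> H \<Longrightarrow> v \<in> H \<Longrightarrow> u + v \<in> H" using subgroup.m_closed[OF H_subgroup, of u v] by simp
  show "u \<in> H \<Longrightarrow> - u \<in> H"
    using subgroup.m_inv_closed[OF H_subgroup, of u] H_keys[of u] by simp
qed

lemma cls_def': "cls u = {h + u | h. h \<in> H}"
  by (auto simp: tensor_class_def r_coset_def)

lemma mem_cls: "u \<in> cls u"
  unfolding cls_def' using H_closed(1) by (metis (mono_tags, lifting) add_0 mem_Collect_eq)

lemma cls_eq_iff: "cls u = cls v \<longleftrightarrow> u - v \<in> H"
proof
  assume "cls u = cls v"
  then have "u \<in> cls v" using mem_cls[of u] by simp
  then obtain h where "u = h + v" "h \<in> H" unfolding cls_def' by blast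
  then show "u - v \<in> H" by simp
next
  assume uv: "u - v \<in> H"
  have "h + u \<in> cls v" if "h \<in> H" for h
  proof -
    have "h + u = (h + (u - v)) + v" by (simp add: algebra_simps)
    moreover have "h + (u - v) \<in> H" using that uv by (rule H_closed(2))
    ultimately show ?thesis unfolding cls_def' by blast
  qed
  moreover have "h + v \<in> cls u" if "h \<in> H" for h
  proof -
    have "h + v = (h + - (u - v)) + u" by (simp add: algebra_simps)
    moreover have "h + - (u - v) \<in> H" using that H_closed(3)[OF uv] by (rule H_closed(2))
    ultimately show ?thesis unfolding cls_def' by blast
  qed
  ultimately have "cls u \<subseteq> cls v \<and> cls v \<subseteq> cls u"
    unfolding cls_def'[of u] cls_def'[of v] by fast
  then show "cls u = cls v" by blast
qed

lemma T_simps: "carrier T = cls ` carrier F" "add T = set_mult F" "zero T = H" "one T = tn \<one>\<^bsub>M\<^esub> \<one>\<^bsub>N\<^esub>"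
  by (auto simp: tensor_def carrier_FactGroup tensor_class_def)

lemma cls_0: "cls 0 = H"
  by (auto simp: cls_def')

lemma cls_add:
  "Poly_Mapping.keys u \<subseteq> carrier M \<times> carrier N \<Longrightarrow> Poly_Mapping.keys v \<subseteq> carrier M \<times> carrier N \<Longrightarrow>
   cls u \<oplus>\<^bsub>T\<^esub> cls v = cls (u + v)"
  using normal.rcos_sum[OF H_normal, of u v] by (simp add: T_simps tensor_class_def)

lemma abelian_group_T: "abelian_group T"
  by (rule abelian_group_of_comm_group[OF comm_group.abelian_FactGroup[OF F_group H_subgroup]])
    (simp_all add: tensor_def)

lemma cls_closed: "Poly_Mapping.keys u \<subseteq> carrier M \<times> carrier N \<Longrightarrow> cls u \<in> carrier T"
  by (simp add: T_simps)

lemma cls_hom: "cls \<in> hom F (add_monoid T)"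
  by (rule homI) (simp_all add: cls_closed cls_add)

lemma tn_closed: "x \<in> carrier M \<Longrightarrow> z \<in> carrier N \<Longrightarrow> tn x z \<in> carrier T"
  by (simp add: tens_def cls_closed)

lemma H_rels:
  "x \<in> carrier M \<Longrightarrow> y \<in> carrier M \<Longrightarrow> z \<in> carrier N \<Longrightarrow>
    frag_of (x \<oplus>\<^bsub>M\<^esub> y, z) - frag_of (x, z) - frag_of (y, z) \<in> H"
  "x \<in> carrier M \<Longrightarrow> z \<in> carrier N \<Longrightarrow> w \<in> carrier N \<Longrightarrow>
    frag_of (x, z \<oplus>\<^bsub>N\<^esub> w) - frag_of (x, z) - frag_of (x, w) \<in> H"
  "a \<in> carrier A \<Longrightarrow> x \<in> carrier M \<Longrightarrow> z \<in> carrier N \<Longrightarrow>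
    frag_of (a \<odot>\<^bsub>M\<^esub> x, z) - frag_of (x, a \<odot>\<^bsub>N\<^esub> z) \<in> H"
  unfolding H_eq by (rule generate.incl; (simp only: rels_def)?; blast)+

lemma tn_add_left: "x \<in> carrier M \<Longrightarrow> y \<in> carrier M \<Longrightarrow> z \<in> carrier N \<Longrightarrow>
    tn (x \<oplus>\<^bsub>M\<^esub> y) z = tn x z \<oplus>\<^bsub>T\<^esub> tn y z"
  using H_rels(1)[of x y z] by (simp add: tens_def cls_add cls_eq_iff diff_diff_eq)

lemma tn_add_right: "x \<in> carrier M \<Longrightarrow> z \<in> carrier N \<Longrightarrow> w \<in> carrier N \<Longrightarrow>
    tn x (z \<oplus>\<^bsub>N\<^esub> w) = tn x z \<oplus>\<^bsub>T\<^esub> tn x w"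
  using H_rels(2)[of x z w] by (simp add: tens_def cls_add cls_eq_iff diff_diff_eq)

lemma tn_balanced: "a \<in> carrier A \<Longrightarrow> x \<in> carrier M \<Longrightarrow> z \<in> carrier N \<Longrightarrow>
    tn (a \<odot>\<^bsub>M\<^esub> x) z = tn x (a \<odot>\<^bsub>N\<^esub> z)"
  using H_rels(3)[of a x z] by (simp add: tens_def cls_eq_iff)

lemma tn_additive_left: "z \<in> carrier N \<Longrightarrow> additive_map M T (\<lambda>x. tn x z)"
  by (rule additive_mapI) (auto simp: tn_closed tn_add_left)

lemma tn_additive_right: "x \<in> carrier M \<Longrightarrow> additive_map N T (\<lambda>z. tn x z)"
  by (rule additive_mapI) (auto simp: tn_closed tn_add_right)

lemma F_hom_0: assumes "abelian_group P" "h \<in> hom F (add_monoid P)" shows "h 0 = \<zero>\<^bsub>P\<^esub>"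
proof -
  interpret P: abelian_group P by fact
  interpret group_hom F "add_monoid P" h
    using assms P.a_group by (auto intro!: group_hom.intro group_hom_axioms.intro)
  show ?thesis using hom_one by simp
qed

lemma F_hom_add:
  assumes "h \<in> hom F (add_monoid P)" "Poly_Mapping.keys u \<subseteq> carrier M \<times> carrier N" "Poly_Mapping.keys v \<subseteq> carrier M \<times> carrier N"
  shows "h (u + v) = h u \<oplus>\<^bsub>P\<^esub> h v"
  using hom_mult[OF assms(1), of u v] assms(2,3) by simp

lemma F_hom_uminus:
  assumes "abelian_group P" "h \<in> hom F (add_monoid P)" "Poly_Mapping.keys u \<subseteq> carrier M \<times> carrier N"
  shows "h (- u) = \<ominus>\<^bsub>P\<^esub> h u"
proof -
  interpret P: abelian_group P by fact
  interpret group_hom F "add_monoid P" h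
    using assms P.a_group by (auto intro!: group_hom.intro group_hom_axioms.intro)
  show ?thesis using hom_inv[of u] assms(3) by (simp add: a_inv_def)
qed

lemma F_hom_diff:
  assumes "abelian_group P" "h \<in> hom F (add_monoid P)" "Poly_Mapping.keys u \<subseteq> carrier M \<times> carrier N" "Poly_Mapping.keys v \<subseteq> carrier M \<times> carrier N"
  shows "h (u - v) = h u \<ominus>\<^bsub>P\<^esub> h v"
  using F_hom_add[OF assms(2,3), of "-v"] F_hom_uminus[OF assms(1,2,4)] assms(4)
  by (simp add: a_minus_def)

lemma F_hom_eq:
  assumes P: "abelian_group P" and h: "h \<in> hom F (add_monoid P)" and g: "g \<in> hom F (add_monoid P)"
    and eq: "\<And>x z. x \<in> carrier M \<Longrightarrow> z \<in> carrier N \<Longrightarrow> h (frag_of (x, z)) = g (frag_of (x, z))"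
    and u: "Poly_Mapping.keys u \<subseteq> carrier M \<times> carrier N"
  shows "h u = g u"
proof (rule free_Abelian_group_induct[OF u, of "\<lambda>u. h u = g u"])
  show "h 0 = g 0" by (simp add: F_hom_0[OF P h] F_hom_0[OF P g])
  show "h (u - v) = g (u - v)"
    if "Poly_Mapping.keys u \<subseteq> carrier M \<times> carrier N" "Poly_Mapping.keys v \<subseteq> carrier M \<times> carrier N"
      "h u = g u" "h v = g v" for u v
    using that by (simp add: F_hom_diff[OF P h] F_hom_diff[OF P g])
  show "h (frag_of p) = g (frag_of p)" if "p \<in> carrier M \<times> carrier N" for p
    using that by (auto simp: eq)
qed

text \<open>A homomorphism that respects the three kinds of relations vanishes on the subgroup they
  generate. This is the single source of independence of representatives for
  \<open>tensor_lift\<close> and for the scalar action and multiplication of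
  \<open>tensor\<close>.\<close>

lemma F_hom_const:
  assumes P: "abelian_group P" and h: "h \<in> hom F (add_monoid P)"
    and l: "\<And>x y z. x \<in> carrier M \<Longrightarrow> y \<in> carrier M \<Longrightarrow> z \<in> carrier N \<Longrightarrow>
      h (frag_of (x \<oplus>\<^bsub>M\<^esub> y, z)) = h (frag_of (x, z)) \<oplus>\<^bsub>P\<^esub> h (frag_of (y, z))"
    and r: "\<And>x z w. x \<in> carrier M \<Longrightarrow> z \<in> carrier N \<Longrightarrow> w \<in> carrier N \<Longrightarrow>
      h (frag_of (x, z \<oplus>\<^bsub>N\<^esub> w)) = h (frag_of (x, z)) \<oplus>\<^bsub>P\<^esub> h (frag_of (x, w))"
    and b: "\<And>a x z. a \<in> carrier A \<Longrightarrow> x \<in> carrier M \<Longrightarrow> z \<in> carrier N \<Longrightarrow>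
      h (frag_of (a \<odot>\<^bsub>M\<^esub> x, z)) = h (frag_of (x, a \<odot>\<^bsub>N\<^esub> z))"
    and v: "v \<in> cls u" and u: "Poly_Mapping.keys u \<subseteq> carrier M \<times> carrier N"
  shows "h v = h u"
proof -
  interpret P: abelian_group P by fact
  have frag: "h (frag_of (x, z)) \<in> carrier P" if "x \<in> carrier M" "z \<in> carrier N" for x z
    using hom_in_carrier[OF h, of "frag_of (x, z)"] that by simp
  have gen: "Poly_Mapping.keys w \<subseteq> carrier M \<times> carrier N \<and> h w = \<zero>\<^bsub>P\<^esub>" if "w \<in> rels" for w
  proof
    show "Poly_Mapping.keys w \<subseteq> carrier M \<times> carrier N"
      using subsetD[OF rels_subset_F that] by simp
    show "h w = \<zero>\<^bsub>P\<^esub>"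
      using that unfolding rels_def
    proof (elim UnE CollectE exE conjE)
      fix x y z assume *: "w = frag_of (x \<oplus>\<^bsub>M\<^esub> y, z) - frag_of (x, z) - frag_of (y, z)"
        "x \<in> carrier M" "y \<in> carrier M" "z \<in> carrier N"
      show ?thesis
        using * frag l[of x y z]
        by (simp add: diff_diff_eq F_hom_diff[OF P h] F_hom_add[OF h] P.r_neg a_minus_def
            order.trans[OF keys_add])
    next
      fix x y z assume *: "w = frag_of (x, y \<oplus>\<^bsub>N\<^esub> z) - frag_of (x, y) - frag_of (x, z)"
        "x \<in> carrier M" "y \<in> carrier N" "z \<in> carrier N"
      show ?thesis
        using * frag r[of x y z]
        by (simp add: diff_diff_eq F_hom_diff[OF P h] F_hom_add[OF h] P.r_neg a_minus_def
            order.trans[OF keys_add])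
    next
      fix a x z assume *: "w = frag_of (a \<odot>\<^bsub>M\<^esub> x, z) - frag_of (x, a \<odot>\<^bsub>N\<^esub> z)"
        "a \<in> carrier A" "x \<in> carrier M" "z \<in> carrier N"
      show ?thesis
        using * frag b[of a x z] by (simp add: F_hom_diff[OF P h] P.r_neg a_minus_def)
    qed
  qed
  have kill: "Poly_Mapping.keys w \<subseteq> carrier M \<times> carrier N \<and> h w = \<zero>\<^bsub>P\<^esub>" if "w \<in> H" for w
    using that unfolding H_eq
  proof (induction w rule: generate.induct)
    case one
    then show ?case by (simp add: F_hom_0[OF P h])
  next
    case (incl w)
    then show ?case by (rule gen)
  next
    case (inv w)
    then show ?case using gen[OF inv] F_hom_uminus[OF P h, of w] P.minus_equality[of "\<zero>\<^bsub>P\<^esub>" "\<zero>\<^bsub>P\<^esub>"] by simp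
  next
    case (eng w w')
    then show ?case
      using F_hom_add[OF h, of w w'] by (simp add: order.trans[OF keys_add])
  qed
  obtain w where w: "w \<in> H" "v = w + u" using v unfolding cls_def' by blast
  have "h v = h w \<oplus>\<^bsub>P\<^esub> h u"
    using w kill[of w] u by (simp add: F_hom_add[OF h])
  then show ?thesis
    using kill[OF w(1)] hom_in_carrier[OF h, of u] u by simp
qed

text \<open>Zero and negatives need no cases, because zero is the pure tensor of zeros and a minus
  sign can be absorbed into the left factor.\<close>

lemma T_induct [consumes 1, case_names tens add]:
  assumes X: "X \<in> carrier T"
    and t: "\<And>x z. x \<in> carrier M \<Longrightarrow> z \<in> carrier N \<Longrightarrow> Q (tn x z)"
    and a: "\<And>X Y. X \<in> carrier T \<Longrightarrow> Y \<in> carrier T \<Longrightarrow> Q X \<Longrightarrow> Q Y \<Longrightarrow> Q (X \<oplus>\<^bsub>T\<^esub> Y)"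
  shows "Q X"
proof -
  interpret T: abelian_group T by (rule abelian_group_T)
  obtain u where u: "X = cls u" "Poly_Mapping.keys u \<subseteq> carrier M \<times> carrier N"
    using X by (auto simp: T_simps)
  have neg: "cls (- frag_of (x, z)) = tn (\<ominus>\<^bsub>M\<^esub> x) z" if "x \<in> carrier M" "z \<in> carrier N" for x z
    using F_hom_uminus[OF abelian_group_T cls_hom, of "frag_of (x, z)"] that
      additive_map_uminus[OF left.abelian_group_axioms abelian_group_T tn_additive_left]
    by (simp add: tens_def)
  have zero: "H = tn \<zero>\<^bsub>M\<^esub> \<zero>\<^bsub>N\<^esub>"
    using additive_map_zero[OF left.abelian_group_axioms abelian_group_T tn_additive_left[of "\<zero>\<^bsub>N\<^esub>"]]
    by (simp add: T_simps)
  \<comment> \<open>The induction over the free abelian group runs through differences, whereas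
    \<open>Q\<close> is only closed under sums; the claim is therefore carried for \<open>u\<close>
    and its negative together.\<close>
  have "Q (cls u) \<and> Q (cls (- u))"
  proof (rule free_Abelian_group_induct[OF u(2), of "\<lambda>u. Q (cls u) \<and> Q (cls (- u))"])
    show "Q (cls 0) \<and> Q (cls (- 0))"
      using t[of "\<zero>\<^bsub>M\<^esub>" "\<zero>\<^bsub>N\<^esub>"] by (simp add: cls_0 zero)
    show "Q (cls (u - v)) \<and> Q (cls (- (u - v)))"
      if "Poly_Mapping.keys u \<subseteq> carrier M \<times> carrier N" "Poly_Mapping.keys v \<subseteq> carrier M \<times> carrier N"
        "Q (cls u) \<and> Q (cls (- u))" "Q (cls v) \<and> Q (cls (- v))" for u v
    proof -
      have "cls (u - v) = cls u \<oplus>\<^bsub>T\<^esub> cls (- v)" "cls (- (u - v)) = cls v \<oplus>\<^bsub>T\<^esub> cls (- u)"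
        using that by (simp_all add: cls_add)
      then show ?thesis using that by (simp add: a cls_closed)
    qed
    show "Q (cls (frag_of p)) \<and> Q (cls (- frag_of p))" if "p \<in> carrier M \<times> carrier N" for p
      using that t neg by (auto simp: tens_def)
  qed
  then show ?thesis using u by simp
qed

definition balanced :: "('p, 'y) ring_scheme \<Rightarrow> ('b \<Rightarrow> 'c \<Rightarrow> 'p) \<Rightarrow> bool" where
  "balanced P b \<longleftrightarrow> (\<forall>x\<in>carrier M. additive_map N P (b x)) \<and>
     (\<forall>z\<in>carrier N. additive_map M P (\<lambda>x. b x z)) \<and>
     (\<forall>a\<in>carrier A. \<forall>x\<in>carrier M. \<forall>z\<in>carrier N. b (a \<odot>\<^bsub>M\<^esub> x) z = b x (a \<odot>\<^bsub>N\<^esub> z))"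

lemma balancedI:
  assumes "\<And>x z. x \<in> carrier M \<Longrightarrow> z \<in> carrier N \<Longrightarrow> b x z \<in> carrier P"
    and "\<And>x y z. x \<in> carrier M \<Longrightarrow> y \<in> carrier M \<Longrightarrow> z \<in> carrier N \<Longrightarrow> b (x \<oplus>\<^bsub>M\<^esub> y) z = b x z \<oplus>\<^bsub>P\<^esub> b y z"
    and "\<And>x z w. x \<in> carrier M \<Longrightarrow> z \<in> carrier N \<Longrightarrow> w \<in> carrier N \<Longrightarrow> b x (z \<oplus>\<^bsub>N\<^esub> w) = b x z \<oplus>\<^bsub>P\<^esub> b x w"
    and "\<And>a x z. a \<in> carrier A \<Longrightarrow> x \<in> carrier M \<Longrightarrow> z \<in> carrier N \<Longrightarrow> b (a \<odot>\<^bsub>M\<^esub> x) z = b x (a \<odot>\<^bsub>N\<^esub> z)"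
  shows "balanced P b"
  using assms by (simp add: balanced_def additive_map_def)

lemma balanced_closed: "balanced P b \<Longrightarrow> x \<in> carrier M \<Longrightarrow> z \<in> carrier N \<Longrightarrow> b x z \<in> carrier P"
  using additive_map_closed[of N P "b x" z] by (simp add: balanced_def)

text \<open>The value of \<open>tensor_lift\<close> computed at one representative.\<close>

definition lift_frag :: "('p, 'y) ring_scheme \<Rightarrow> ('b \<Rightarrow> 'c \<Rightarrow> 'p) \<Rightarrow> ('b \<times> 'c \<Rightarrow>\<^sub>0 int) \<Rightarrow> 'p" where
  "lift_frag P b u = (\<Oplus>\<^bsub>P\<^esub>p\<in>Poly_Mapping.keys u. [Poly_Mapping.lookup u p] \<cdot>\<^bsub>P\<^esub> b (fst p) (snd p))"

lemma lift_frag_hom: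
  assumes P: "abelian_group P"
    and b: "\<And>x z. x \<in> carrier M \<Longrightarrow> z \<in> carrier N \<Longrightarrow> b x z \<in> carrier P"
  shows "lift_frag P b \<in> hom F (add_monoid P)"
proof -
  interpret P: abelian_group P by fact
  let ?g = "\<lambda>(u :: 'b \<times> 'c \<Rightarrow>\<^sub>0 int) p. [Poly_Mapping.lookup u p] \<cdot>\<^bsub>P\<^esub> b (fst p) (snd p)"
  have closed: "?g u \<in> S \<rightarrow> carrier P" if "S \<subseteq> carrier M \<times> carrier N" for u S
  proof
    fix p assume "p \<in> S"
    then have "b (fst p) (snd p) \<in> carrier P" using that by (intro b) auto
    then show "?g u p \<in> carrier P" by simp
  qed
  \<comment> \<open>Cancellation may make the support of a sum smaller than the union of the
    supports, so all sums are first extended to a common finite set.\<close>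
  have ext: "lift_frag P b u = (\<Oplus>\<^bsub>P\<^esub>p\<in>S. ?g u p)"
    if "finite S" "Poly_Mapping.keys u \<subseteq> S" "S \<subseteq> carrier M \<times> carrier N" for u S
    unfolding lift_frag_def
  proof (rule P.add.finprod_mono_neutral_cong_left)
    show "?g u \<in> S \<rightarrow> carrier P" using closed[OF that(3)] .
    show "?g u i = \<zero>\<^bsub>P\<^esub>" if "i \<in> S - Poly_Mapping.keys u" for i
      using that by (simp add: in_keys_iff add_pow_def int_pow_def)
  qed (use that in auto)
  show ?thesis
  proof (rule homI)
    show "lift_frag P b u \<in> carrier (add_monoid P)" if "u \<in> carrier F" for u
      using that closed[of "Poly_Mapping.keys u" u] by (simp add: lift_frag_def)
    fix u v assume uv: "u \<in> carrier F" "v \<in> carrier F"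
    define S where "S = Poly_Mapping.keys u \<union> Poly_Mapping.keys v"
    have S: "finite S" "Poly_Mapping.keys u \<subseteq> S" "Poly_Mapping.keys v \<subseteq> S"
      "Poly_Mapping.keys (u + v) \<subseteq> S" "S \<subseteq> carrier M \<times> carrier N"
      using uv keys_add[of u v] by (auto simp: S_def)
    have "lift_frag P b (u + v) = (\<Oplus>\<^bsub>P\<^esub>p\<in>S. ?g u p \<oplus>\<^bsub>P\<^esub> ?g v p)"
      unfolding ext[OF S(1,4,5)]
      using S(5) b by (intro P.finsum_cong') (auto simp: lookup_add P.add.int_pow_mult Pi_def)
    also have "\<dots> = lift_frag P b u \<oplus>\<^bsub>P\<^esub> lift_frag P b v"
      unfolding ext[OF S(1,2,5)] ext[OF S(1,3,5)] by (rule P.finsum_addf) (use closed[OF S(5)] in auto)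
    finally show "lift_frag P b (u \<otimes>\<^bsub>F\<^esub> v) = lift_frag P b u \<otimes>\<^bsub>add_monoid P\<^esub> lift_frag P b v"
      by simp
  qed
qed

lemma lift_frag_of:
  assumes P: "abelian_group P" and "b x z \<in> carrier P"
  shows "lift_frag P b (frag_of (x, z)) = b x z"
proof -
  interpret P: abelian_group P by fact
  show ?thesis using assms(2) by (simp add: lift_frag_def)
qed

text \<open>All representatives give the same value by \<open>F_hom_const\<close>, so the set inside
  \<open>tensor_lift\<close> is a singleton.\<close>

lemma tensor_lift_cls:
  assumes P: "abelian_group P" and b: "balanced P b"
    and u: "Poly_Mapping.keys u \<subseteq> carrier M \<times> carrier N"
  shows "tensor_lift P b (cls u) = lift_frag P b u"
proof -
  have bc: "b x z \<in> carrier P" if "x \<in> carrier M" "z \<in> carrier N" for x z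
    using balanced_closed[OF b that] .
  note hom = lift_frag_hom[OF P bc]
  have "lift_frag P b v = lift_frag P b u" if "v \<in> cls u" for v
  proof (rule F_hom_const[OF P hom _ _ _ that u])
    show "lift_frag P b (frag_of (x \<oplus>\<^bsub>M\<^esub> y, z)) = lift_frag P b (frag_of (x, z)) \<oplus>\<^bsub>P\<^esub> lift_frag P b (frag_of (y, z))"
      if "x \<in> carrier M" "y \<in> carrier M" "z \<in> carrier N" for x y z
      using b that additive_map_add[of M P "\<lambda>x. b x z" x y]
      by (simp add: balanced_def lift_frag_of[OF P bc])
    show "lift_frag P b (frag_of (x, z \<oplus>\<^bsub>N\<^esub> w)) = lift_frag P b (frag_of (x, z)) \<oplus>\<^bsub>P\<^esub> lift_frag P b (frag_of (x, w))"
      if "x \<in> carrier M" "z \<in> carrier N" "w \<in> carrier N" for x z w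
      using b that by (simp add: balanced_def additive_map_add lift_frag_of[OF P bc])
    show "lift_frag P b (frag_of (a \<odot>\<^bsub>M\<^esub> x, z)) = lift_frag P b (frag_of (x, a \<odot>\<^bsub>N\<^esub> z))"
      if "a \<in> carrier A" "x \<in> carrier M" "z \<in> carrier N" for a x z
      using b that by (simp add: balanced_def lift_frag_of[OF P bc])
  qed
  then have "lift_frag P b ` cls u = (\<lambda>_. lift_frag P b u) ` cls u" by (rule image_cong[OF refl])
  then have "lift_frag P b ` cls u = {lift_frag P b u}" by (simp add: image_constant[OF mem_cls])
  then show ?thesis
    by (simp add: tensor_lift_def lift_frag_def[abs_def])
qed

lemma tensor_lift_additive:
  assumes P: "abelian_group P" and b: "balanced P b"
  shows "additive_map T P (tensor_lift P b)"
proof -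
  have bc: "b x z \<in> carrier P" if "x \<in> carrier M" "z \<in> carrier N" for x z
    using balanced_closed[OF b that] .
  note hom = lift_frag_hom[OF P bc]
  show ?thesis
  proof (rule additive_mapI)
    show "tensor_lift P b X \<in> carrier P" if "X \<in> carrier T" for X
      using that hom_in_carrier[OF hom] by (auto simp: T_simps tensor_lift_cls[OF P b])
    show "tensor_lift P b (X \<oplus>\<^bsub>T\<^esub> Y) = tensor_lift P b X \<oplus>\<^bsub>P\<^esub> tensor_lift P b Y"
      if "X \<in> carrier T" "Y \<in> carrier T" for X Y
      using that by (auto simp: T_simps(1) tensor_lift_cls[OF P b] cls_add F_hom_add[OF hom] order.trans[OF keys_add])
  qed
qed

lemma tensor_lift_tn:
  assumes P: "abelian_group P" and b: "balanced P b" and x: "x \<in> carrier M" and z: "z \<in> carrier N"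
  shows "tensor_lift P b (tn x z) = b x z"
proof -
  have bc: "b x z \<in> carrier P"
    using balanced_closed[OF b x z] .
  then show ?thesis using x z by (simp add: tens_def tensor_lift_cls[OF P b] lift_frag_of[OF P])
qed

lemma frag_extend_keys:
  assumes "\<And>p. p \<in> carrier M \<times> carrier N \<Longrightarrow> Poly_Mapping.keys (g p) \<subseteq> carrier M \<times> carrier N"
    and "Poly_Mapping.keys u \<subseteq> carrier M \<times> carrier N"
  shows "Poly_Mapping.keys (frag_extend g u) \<subseteq> carrier M \<times> carrier N"
  using assms keys_frag_extend[of g u] by blast

lemma smult_hom:
  assumes a: "a \<in> carrier A"
  shows "(\<lambda>u. cls (frag_extend (\<lambda>(x, z). frag_of (a \<odot>\<^bsub>M\<^esub> x, z)) u)) \<in> hom F (add_monoid T)"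
proof -
  have "Poly_Mapping.keys (frag_extend (\<lambda>(x, z). frag_of (a \<odot>\<^bsub>M\<^esub> x, z)) u) \<subseteq> carrier M \<times> carrier N"
    if "Poly_Mapping.keys u \<subseteq> carrier M \<times> carrier N" for u :: "'b \<times> 'c \<Rightarrow>\<^sub>0 int"
    by (rule frag_extend_keys[OF _ that]) (use a in auto)
  then show ?thesis by (intro homI) (simp_all add: frag_extend_add cls_add cls_closed)
qed

lemma smult_cls:
  assumes a: "a \<in> carrier A" and u: "Poly_Mapping.keys u \<subseteq> carrier M \<times> carrier N"
  shows "a \<odot>\<^bsub>T\<^esub> cls u = cls (frag_extend (\<lambda>(x, z). frag_of (a \<odot>\<^bsub>M\<^esub> x, z)) u)"
proof -
  let ?h = "\<lambda>u. cls (frag_extend (\<lambda>(x, z). frag_of (a \<odot>\<^bsub>M\<^esub> x, z)) u)"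
  have "?h v = ?h u" if "v \<in> cls u" for v
  proof (rule F_hom_const[OF abelian_group_T smult_hom[OF a] _ _ _ that u])
    fix b x z assume *: "b \<in> carrier A" "x \<in> carrier M" "z \<in> carrier N"
    have "a \<odot>\<^bsub>M\<^esub> (b \<odot>\<^bsub>M\<^esub> x) = b \<odot>\<^bsub>M\<^esub> (a \<odot>\<^bsub>M\<^esub> x)"
      using * a by (simp add: left.smult_assoc1[symmetric] left.R.m_comm)
    then show "cls (frag_extend (\<lambda>(x, z). frag_of (a \<odot>\<^bsub>M\<^esub> x, z)) (frag_of (b \<odot>\<^bsub>M\<^esub> x, z))) =
       cls (frag_extend (\<lambda>(x, z). frag_of (a \<odot>\<^bsub>M\<^esub> x, z)) (frag_of (x, b \<odot>\<^bsub>N\<^esub> z)))"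
      using * a tn_balanced[of b "a \<odot>\<^bsub>M\<^esub> x" z] by (simp add: tens_def)
  qed (use a in \<open>auto simp: tens_def[symmetric] left.smult_r_distr tn_add_left tn_add_right\<close>)
  then have "(\<Union>v\<in>cls u. ?h v) = (\<Union>v\<in>cls u. ?h u)" by (intro SUP_cong) auto
  moreover have "u \<in> cls u" by (rule mem_cls)
  ultimately show ?thesis by (auto simp: tensor_def)
qed

lemma smult_tn: "a \<in> carrier A \<Longrightarrow> x \<in> carrier M \<Longrightarrow> z \<in> carrier N \<Longrightarrow> a \<odot>\<^bsub>T\<^esub> tn x z = tn (a \<odot>\<^bsub>M\<^esub> x) z"
  by (simp add: tens_def smult_cls)

lemma smult_additive: assumes "a \<in> carrier A" shows "additive_map T T (\<lambda>X. a \<odot>\<^bsub>T\<^esub> X)"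
proof (rule additive_mapI)
  show "a \<odot>\<^bsub>T\<^esub> X \<in> carrier T" if "X \<in> carrier T" for X
    using that assms hom_in_carrier[OF smult_hom[OF assms]] by (auto simp: T_simps(1) smult_cls)
  show "a \<odot>\<^bsub>T\<^esub> (X \<oplus>\<^bsub>T\<^esub> Y) = a \<odot>\<^bsub>T\<^esub> X \<oplus>\<^bsub>T\<^esub> a \<odot>\<^bsub>T\<^esub> Y" if "X \<in> carrier T" "Y \<in> carrier T" for X Y
    using that assms by (auto simp: T_simps(1) smult_cls cls_add F_hom_add[OF smult_hom[OF assms]] order.trans[OF keys_add])
qed

lemma module_T: "Module.module A T"
proof -
  interpret T: abelian_group T by (rule abelian_group_T)
  have sc: "a \<odot>\<^bsub>T\<^esub> X \<in> carrier T" if "a \<in> carrier A" "X \<in> carrier T" for a X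
    using additive_map_closed[OF smult_additive] that by blast
  have sa: "a \<odot>\<^bsub>T\<^esub> (X \<oplus>\<^bsub>T\<^esub> Y) = a \<odot>\<^bsub>T\<^esub> X \<oplus>\<^bsub>T\<^esub> a \<odot>\<^bsub>T\<^esub> Y" if "a \<in> carrier A" "X \<in> carrier T" "Y \<in> carrier T" for a X Y
    using additive_map_add[OF smult_additive] that by blast
  show ?thesis
  proof (rule moduleI[OF left.R.is_cring abelian_group_T sc _ sa])
    fix a b X assume ab: "a \<in> carrier A" "b \<in> carrier A" and X: "X \<in> carrier T"
    show "(a \<oplus> b) \<odot>\<^bsub>T\<^esub> X = a \<odot>\<^bsub>T\<^esub> X \<oplus>\<^bsub>T\<^esub> b \<odot>\<^bsub>T\<^esub> X"
      using X
    proof (induction X rule: T_induct)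
      case (tens x z)
      then show ?case using ab by (simp add: smult_tn left.smult_l_distr tn_add_left)
    next
      case (add X Y)
      then show ?case using ab by (simp add: sa sc T.a_ac)
    qed
    show "(a \<otimes> b) \<odot>\<^bsub>T\<^esub> X = a \<odot>\<^bsub>T\<^esub> (b \<odot>\<^bsub>T\<^esub> X)"
      using X by (induction X rule: T_induct) (use ab in \<open>simp_all add: smult_tn left.smult_assoc1 sa sc\<close>)
  next
    fix X assume X: "X \<in> carrier T"
    show "\<one> \<odot>\<^bsub>T\<^esub> X = X"
      using X by (induction X rule: T_induct) (simp_all add: smult_tn sa)
  qed
qed

end

locale tensor_algebra = left: algebra A M + right: algebra A N
  for A :: "('a, 'x) ring_scheme" (structure) and M :: "('a, 'b) module" and N :: "('a, 'c) module"

sublocale tensor_algebra \<subseteq> tensor_product A M N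
  by (rule tensor_product.intro) (rule left.module right.module)+

context tensor_algebra
begin

definition frag_mult :: "('b \<times> 'c \<Rightarrow>\<^sub>0 int) \<Rightarrow> ('b \<times> 'c \<Rightarrow>\<^sub>0 int) \<Rightarrow> ('b \<times> 'c \<Rightarrow>\<^sub>0 int)" where
  "frag_mult u v =
     frag_extend (\<lambda>(x, z). frag_extend (\<lambda>(x', z'). frag_of (x \<otimes>\<^bsub>M\<^esub> x', z \<otimes>\<^bsub>N\<^esub> z')) v) u"

lemma frag_mult_keys:
  assumes u: "Poly_Mapping.keys u \<subseteq> carrier M \<times> carrier N" and v: "Poly_Mapping.keys v \<subseteq> carrier M \<times> carrier N"
  shows "Poly_Mapping.keys (frag_mult u v) \<subseteq> carrier M \<times> carrier N"
  unfolding frag_mult_def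
proof (rule frag_extend_keys[OF _ u])
  fix p assume "p \<in> carrier M \<times> carrier N"
  then obtain x z where p: "p = (x, z)" "x \<in> carrier M" "z \<in> carrier N" by auto
  have "Poly_Mapping.keys (frag_extend (\<lambda>(x', z'). frag_of (x \<otimes>\<^bsub>M\<^esub> x', z \<otimes>\<^bsub>N\<^esub> z')) v) \<subseteq> carrier M \<times> carrier N"
    by (rule frag_extend_keys[OF _ v]) (use p in auto)
  then show "Poly_Mapping.keys (case p of (x, z) \<Rightarrow> frag_extend (\<lambda>(x', z'). frag_of (x \<otimes>\<^bsub>M\<^esub> x', z \<otimes>\<^bsub>N\<^esub> z')) v) \<subseteq> carrier M \<times> carrier N"
    by (simp add: p)
qed

lemma frag_mult_add_left: "frag_mult (u + u') v = frag_mult u v + frag_mult u' v"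
  by (simp add: frag_mult_def frag_extend_add)

lemma frag_mult_diff_left: "frag_mult (u - u') v = frag_mult u v - frag_mult u' v"
  by (simp add: frag_mult_def frag_extend_diff)

text \<open>Commutativity already holds for representatives supported on the carriers. Independence
  of representatives therefore has to be proved in the left factor only.\<close>

lemma frag_mult_comm:
  assumes u: "Poly_Mapping.keys u \<subseteq> carrier M \<times> carrier N" and v: "Poly_Mapping.keys v \<subseteq> carrier M \<times> carrier N"
  shows "frag_mult u v = frag_mult v u"
proof -
  have right_diff: "frag_mult u (v - w) = frag_mult u v - frag_mult u w" for u v w
  proof (rule free_Abelian_group_induct[of u UNIV "\<lambda>u. frag_mult u (v - w) = frag_mult u v - frag_mult u w"])
    show "frag_mult (a - b) (v - w) = frag_mult (a - b) v - frag_mult (a - b) w"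
      if "frag_mult a (v - w) = frag_mult a v - frag_mult a w" "frag_mult b (v - w) = frag_mult b v - frag_mult b w" for a b
      using that by (simp add: frag_mult_diff_left)
  qed (auto simp: frag_mult_def frag_extend_diff)
  have zero: "frag_mult u 0 = 0" for u using right_diff[of u 0 0] by simp
  show ?thesis
  proof (rule free_Abelian_group_induct[OF u, of "\<lambda>u. frag_mult u v = frag_mult v u"])
    show "frag_mult 0 v = frag_mult v 0" using zero by (simp add: frag_mult_def)
    show "frag_mult (a - b) v = frag_mult v (a - b)" if "frag_mult a v = frag_mult v a" "frag_mult b v = frag_mult v b" for a b
      using that by (simp add: frag_mult_diff_left right_diff)
    fix p assume p: "p \<in> carrier M \<times> carrier N"
    show "frag_mult (frag_of p) v = frag_mult v (frag_of p)"
    proof (rule free_Abelian_group_induct[OF v, of "\<lambda>v. frag_mult (frag_of p) v = frag_mult v (frag_of p)"])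
      show "frag_mult (frag_of p) 0 = frag_mult 0 (frag_of p)" using zero by (simp add: frag_mult_def)
      show "frag_mult (frag_of p) (a - b) = frag_mult (a - b) (frag_of p)"
        if "frag_mult (frag_of p) a = frag_mult a (frag_of p)" "frag_mult (frag_of p) b = frag_mult b (frag_of p)" for a b
        using that by (simp add: frag_mult_diff_left right_diff)
      show "frag_mult (frag_of p) (frag_of q) = frag_mult (frag_of q) (frag_of p)" if "q \<in> carrier M \<times> carrier N" for q
        using p that by (auto simp: frag_mult_def left.m_comm right.m_comm)
    qed
  qed
qed

lemma frag_mult_hom:
  assumes v: "Poly_Mapping.keys v \<subseteq> carrier M \<times> carrier N"
  shows "(\<lambda>u. cls (frag_mult u v)) \<in> hom F (add_monoid T)"
  using v by (intro homI) (simp_all add: frag_mult_add_left cls_closed cls_add frag_mult_keys)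

lemma frag_mult_hom_right:
  assumes u: "Poly_Mapping.keys u \<subseteq> carrier M \<times> carrier N"
  shows "(\<lambda>v. cls (frag_mult u v)) \<in> hom F (add_monoid T)"
proof (intro homI)
  fix v w assume "v \<in> carrier F" "w \<in> carrier F"
  then have vw: "Poly_Mapping.keys v \<subseteq> carrier M \<times> carrier N" "Poly_Mapping.keys w \<subseteq> carrier M \<times> carrier N" by simp_all
  then have "Poly_Mapping.keys (v + w) \<subseteq> carrier M \<times> carrier N" using keys_add[of v w] by blast
  then show "cls (frag_mult u (v \<otimes>\<^bsub>F\<^esub> w)) = cls (frag_mult u v) \<otimes>\<^bsub>add_monoid T\<^esub> cls (frag_mult u w)"
    using u vw by (simp add: frag_mult_comm[OF u] frag_mult_add_left cls_add frag_mult_keys)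
qed (use u in \<open>simp add: cls_closed frag_mult_keys\<close>)

text \<open>For each kind of relation in the left factor both sides are homomorphisms in
  \<open>v\<close>, so by \<open>F_hom_eq\<close> they need only be compared at pairs, where the
  relation of the tensor product applies.\<close>

lemma frag_mult_const_left:
  assumes u: "Poly_Mapping.keys u \<subseteq> carrier M \<times> carrier N" and v: "Poly_Mapping.keys v \<subseteq> carrier M \<times> carrier N"
    and w: "w \<in> cls u"
  shows "cls (frag_mult w v) = cls (frag_mult u v)"
proof (rule F_hom_const[OF abelian_group_T frag_mult_hom[OF v] _ _ _ w u])
  have one: "frag_mult (frag_of (x, z)) (frag_of (x', z')) = frag_of (x \<otimes>\<^bsub>M\<^esub> x', z \<otimes>\<^bsub>N\<^esub> z')" for x z x' z'
    by (simp add: frag_mult_def)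
  fix x y z assume *: "x \<in> carrier M" "y \<in> carrier M" "z \<in> carrier N"
  have k: "Poly_Mapping.keys (frag_of (x, z)) \<subseteq> carrier M \<times> carrier N" "Poly_Mapping.keys (frag_of (y, z)) \<subseteq> carrier M \<times> carrier N"
    "Poly_Mapping.keys (frag_of (x \<oplus>\<^bsub>M\<^esub> y, z)) \<subseteq> carrier M \<times> carrier N"
    using * by auto
  have "cls (frag_mult (frag_of (x \<oplus>\<^bsub>M\<^esub> y, z)) v) = cls (frag_mult (frag_of (x, z) + frag_of (y, z)) v)"
  proof (rule F_hom_eq[OF abelian_group_T frag_mult_hom_right frag_mult_hom_right _ v])
    show "Poly_Mapping.keys (frag_of (x, z) + frag_of (y, z)) \<subseteq> carrier M \<times> carrier N"
      using k keys_add[of "frag_of (x, z)" "frag_of (y, z)"] by blast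
    show "cls (frag_mult (frag_of (x \<oplus>\<^bsub>M\<^esub> y, z)) (frag_of (x', z'))) = cls (frag_mult (frag_of (x, z) + frag_of (y, z)) (frag_of (x', z')))"
      if "x' \<in> carrier M" "z' \<in> carrier N" for x' z'
      using * that tn_add_left[of "x \<otimes>\<^bsub>M\<^esub> x'" "y \<otimes>\<^bsub>M\<^esub> x'" "z \<otimes>\<^bsub>N\<^esub> z'"]
      by (simp add: one frag_mult_add_left left.l_distr tens_def cls_add)
  qed (use k in auto)
  then show "cls (frag_mult (frag_of (x \<oplus>\<^bsub>M\<^esub> y, z)) v) = cls (frag_mult (frag_of (x, z)) v) \<oplus>\<^bsub>T\<^esub> cls (frag_mult (frag_of (y, z)) v)"
    using k by (simp add: frag_mult_add_left cls_add frag_mult_keys[OF _ v])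
next
  have one: "frag_mult (frag_of (x, z)) (frag_of (x', z')) = frag_of (x \<otimes>\<^bsub>M\<^esub> x', z \<otimes>\<^bsub>N\<^esub> z')" for x z x' z'
    by (simp add: frag_mult_def)
  fix x z y assume *: "x \<in> carrier M" "z \<in> carrier N" "y \<in> carrier N"
  have k: "Poly_Mapping.keys (frag_of (x, z)) \<subseteq> carrier M \<times> carrier N" "Poly_Mapping.keys (frag_of (x, y)) \<subseteq> carrier M \<times> carrier N"
    "Poly_Mapping.keys (frag_of (x, z \<oplus>\<^bsub>N\<^esub> y)) \<subseteq> carrier M \<times> carrier N"
    using * by auto
  have "cls (frag_mult (frag_of (x, z \<oplus>\<^bsub>N\<^esub> y)) v) = cls (frag_mult (frag_of (x, z) + frag_of (x, y)) v)"
  proof (rule F_hom_eq[OF abelian_group_T frag_mult_hom_right frag_mult_hom_right _ v])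
    show "Poly_Mapping.keys (frag_of (x, z) + frag_of (x, y)) \<subseteq> carrier M \<times> carrier N"
      using k keys_add[of "frag_of (x, z)" "frag_of (x, y)"] by blast
    show "cls (frag_mult (frag_of (x, z \<oplus>\<^bsub>N\<^esub> y)) (frag_of (x', z'))) = cls (frag_mult (frag_of (x, z) + frag_of (x, y)) (frag_of (x', z')))"
      if "x' \<in> carrier M" "z' \<in> carrier N" for x' z'
      using * that tn_add_right[of "x \<otimes>\<^bsub>M\<^esub> x'" "z \<otimes>\<^bsub>N\<^esub> z'" "y \<otimes>\<^bsub>N\<^esub> z'"]
      by (simp add: one frag_mult_add_left right.l_distr tens_def cls_add)
  qed (use k in auto)
  then show "cls (frag_mult (frag_of (x, z \<oplus>\<^bsub>N\<^esub> y)) v) = cls (frag_mult (frag_of (x, z)) v) \<oplus>\<^bsub>T\<^esub> cls (frag_mult (frag_of (x, y)) v)"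
    using k by (simp add: frag_mult_add_left cls_add frag_mult_keys[OF _ v])
next
  have one: "frag_mult (frag_of (x, z)) (frag_of (x', z')) = frag_of (x \<otimes>\<^bsub>M\<^esub> x', z \<otimes>\<^bsub>N\<^esub> z')" for x z x' z'
    by (simp add: frag_mult_def)
  fix a x z assume *: "a \<in> carrier A" "x \<in> carrier M" "z \<in> carrier N"
  show "cls (frag_mult (frag_of (a \<odot>\<^bsub>M\<^esub> x, z)) v) = cls (frag_mult (frag_of (x, a \<odot>\<^bsub>N\<^esub> z)) v)"
  proof (rule F_hom_eq[OF abelian_group_T frag_mult_hom_right frag_mult_hom_right _ v])
    show "cls (frag_mult (frag_of (a \<odot>\<^bsub>M\<^esub> x, z)) (frag_of (x', z'))) = cls (frag_mult (frag_of (x, a \<odot>\<^bsub>N\<^esub> z)) (frag_of (x', z')))"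
      if "x' \<in> carrier M" "z' \<in> carrier N" for x' z'
      using * that tn_balanced[of a "x \<otimes>\<^bsub>M\<^esub> x'" "z \<otimes>\<^bsub>N\<^esub> z'"]
      by (simp add: one left.smult_assoc2 right.smult_assoc2 tens_def)
  qed (use * in auto)
qed

lemma mult_cls:
  assumes u: "Poly_Mapping.keys u \<subseteq> carrier M \<times> carrier N" and v: "Poly_Mapping.keys v \<subseteq> carrier M \<times> carrier N"
  shows "cls u \<otimes>\<^bsub>T\<^esub> cls v = cls (frag_mult u v)"
proof -
  have mem_keys: "Poly_Mapping.keys w \<subseteq> carrier M \<times> carrier N"
    if "w \<in> cls u" "Poly_Mapping.keys u \<subseteq> carrier M \<times> carrier N" for w u
  proof -
    obtain h where "h \<in> H" "w = h + u" using \<open>w \<in> cls u\<close> unfolding cls_def' by blast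
    then show ?thesis using H_keys[of h] keys_add[of h u] that(2) by blast
  qed
  have const: "cls (frag_mult u' v') = cls (frag_mult u v)" if "u' \<in> cls u" "v' \<in> cls v" for u' v'
  proof -
    have k: "Poly_Mapping.keys u' \<subseteq> carrier M \<times> carrier N" "Poly_Mapping.keys v' \<subseteq> carrier M \<times> carrier N"
      using mem_keys that u v by blast+
    have "cls (frag_mult u' v') = cls (frag_mult u v')" by (rule frag_mult_const_left[OF u k(2) that(1)])
    also have "\<dots> = cls (frag_mult v' u)" using frag_mult_comm[OF u k(2)] by simp
    also have "\<dots> = cls (frag_mult v u)" by (rule frag_mult_const_left[OF v u that(2)])
    finally show ?thesis using frag_mult_comm[OF u v] by simp
  qed
  have "cls u \<otimes>\<^bsub>T\<^esub> cls v = (\<Union>u'\<in>cls u. \<Union>v'\<in>cls v. cls (frag_mult u' v'))"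
    by (simp add: tensor_def frag_mult_def)
  also have "\<dots> = (\<Union>u'\<in>cls u. \<Union>v'\<in>cls v. cls (frag_mult u v))"
    by (intro SUP_cong refl) (simp add: const)
  also have "\<dots> = cls (frag_mult u v)" using mem_cls[of u] mem_cls[of v] by auto
  finally show ?thesis .
qed

lemma mult_tn:
  "x \<in> carrier M \<Longrightarrow> z \<in> carrier N \<Longrightarrow> x' \<in> carrier M \<Longrightarrow> z' \<in> carrier N \<Longrightarrow>
   tn x z \<otimes>\<^bsub>T\<^esub> tn x' z' = tn (x \<otimes>\<^bsub>M\<^esub> x') (z \<otimes>\<^bsub>N\<^esub> z')"
  by (simp add: tens_def mult_cls frag_mult_def)

lemma mult_add_left:
  assumes "X \<in> carrier T" "Y \<in> carrier T" "Z \<in> carrier T"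
  shows "(X \<oplus>\<^bsub>T\<^esub> Y) \<otimes>\<^bsub>T\<^esub> Z = X \<otimes>\<^bsub>T\<^esub> Z \<oplus>\<^bsub>T\<^esub> Y \<otimes>\<^bsub>T\<^esub> Z"
  using assms
  by (auto simp: T_simps(1) cls_add mult_cls frag_mult_add_left frag_mult_keys order.trans[OF keys_add])

lemma mult_comm_T: "X \<in> carrier T \<Longrightarrow> Y \<in> carrier T \<Longrightarrow> X \<otimes>\<^bsub>T\<^esub> Y = Y \<otimes>\<^bsub>T\<^esub> X"
  using frag_mult_comm by (auto simp: T_simps(1) mult_cls)

lemma mult_closed_T: "X \<in> carrier T \<Longrightarrow> Y \<in> carrier T \<Longrightarrow> X \<otimes>\<^bsub>T\<^esub> Y \<in> carrier T"
  by (auto simp: T_simps(1) mult_cls frag_mult_keys)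

lemma one_T: "\<one>\<^bsub>T\<^esub> = tn \<one>\<^bsub>M\<^esub> \<one>\<^bsub>N\<^esub>" by (rule T_simps(4))

lemma cring_T: "cring T"
proof -
  interpret T: abelian_group T by (rule abelian_group_T)
  have add_right: "Z \<otimes>\<^bsub>T\<^esub> (X \<oplus>\<^bsub>T\<^esub> Y) = Z \<otimes>\<^bsub>T\<^esub> X \<oplus>\<^bsub>T\<^esub> Z \<otimes>\<^bsub>T\<^esub> Y"
    if "X \<in> carrier T" "Y \<in> carrier T" "Z \<in> carrier T" for X Y Z
    using that mult_add_left[of X Y Z] by (simp add: mult_comm_T)
  show ?thesis
  proof (intro cringI comm_monoidI abelian_group_T mult_add_left)
    show "\<one>\<^bsub>T\<^esub> \<in> carrier T" by (simp add: one_T tn_closed)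
    show "\<one>\<^bsub>T\<^esub> \<otimes>\<^bsub>T\<^esub> X = X" if "X \<in> carrier T" for X
      using that
    proof (induction X rule: T_induct)
      case (tens x z) then show ?case by (simp add: one_T mult_tn)
    next
      case (add X Y) then show ?case using \<open>\<one>\<^bsub>T\<^esub> \<in> carrier T\<close> by (simp add: add_right)
    qed
    fix X Y Z assume X: "X \<in> carrier T" and Y: "Y \<in> carrier T" and Z: "Z \<in> carrier T"
    show "X \<otimes>\<^bsub>T\<^esub> Y \<otimes>\<^bsub>T\<^esub> Z = X \<otimes>\<^bsub>T\<^esub> (Y \<otimes>\<^bsub>T\<^esub> Z)"
      using X
    proof (induction X rule: T_induct)
      case (tens x z)
      show ?case
        using Y
      proof (induction Y rule: T_induct)
        case (tens x' z')
        show ?case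
          using Z
        proof (induction Z rule: T_induct)
          case (tens x'' z'')
          then show ?case using \<open>x \<in> carrier M\<close> \<open>z \<in> carrier N\<close> \<open>x' \<in> carrier M\<close> \<open>z' \<in> carrier N\<close>
            by (simp add: mult_tn left.m_assoc right.m_assoc)
        next
          case (add Z Z')
          then show ?case using \<open>x \<in> carrier M\<close> \<open>z \<in> carrier N\<close> \<open>x' \<in> carrier M\<close> \<open>z' \<in> carrier N\<close>
            by (simp add: add_right tn_closed mult_closed_T)
        qed
      next
        case (add Y Y')
        then show ?case using Z \<open>x \<in> carrier M\<close> \<open>z \<in> carrier N\<close>
          by (simp add: add_right mult_add_left tn_closed mult_closed_T)
      qed
    next
      case (add X X')
      then show ?case using Y Z by (simp add: mult_add_left mult_closed_T)
    qed
  qed (auto simp: mult_closed_T mult_comm_T)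
qed

lemma tensor_lift_mult:
  assumes P: "cring P" and b: "balanced P b"
    and m: "\<And>x z x' z'. x \<in> carrier M \<Longrightarrow> z \<in> carrier N \<Longrightarrow> x' \<in> carrier M \<Longrightarrow> z' \<in> carrier N \<Longrightarrow>
      b (x \<otimes>\<^bsub>M\<^esub> x') (z \<otimes>\<^bsub>N\<^esub> z') = b x z \<otimes>\<^bsub>P\<^esub> b x' z'"
    and X: "X \<in> carrier T" and Y: "Y \<in> carrier T"
  shows "tensor_lift P b (X \<otimes>\<^bsub>T\<^esub> Y) = tensor_lift P b X \<otimes>\<^bsub>P\<^esub> tensor_lift P b Y"
proof -
  interpret P: cring P by fact
  interpret T: cring T by (rule cring_T)
  note l = tensor_lift_additive[OF P.abelian_group_axioms b]
  note lt = tensor_lift_tn[OF P.abelian_group_axioms b]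
  show ?thesis
    using X
  proof (induction X rule: T_induct)
    case (tens x z)
    show ?case
      using Y
    proof (induction Y rule: T_induct)
      case (tens x' z')
      then show ?case using \<open>x \<in> carrier M\<close> \<open>z \<in> carrier N\<close> by (simp add: mult_tn lt m)
    next
      case (add Y Y')
      then show ?case using \<open>x \<in> carrier M\<close> \<open>z \<in> carrier N\<close>
        by (simp add: T.r_distr P.r_distr tn_closed additive_map_add[OF l] additive_map_closed[OF l])
    qed
  next
    case (add X X')
    then show ?case using Y
      by (simp add: T.l_distr P.l_distr additive_map_add[OF l] additive_map_closed[OF l])
  qed
qed

end

section \<open>Tensoring with a free module of rank one\<close>

text \<open>If \<open>co z\<close> is the coordinate of \<open>z\<close> with respect to
  \<open>w\<close>, the inverse sends the tensor of \<open>m\<close> and \<open>z\<close> to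
  \<open>co z\<close> times \<open>m\<close>. With the generator \<alpha> of the differentials in
  place of \<open>w\<close>, every kind of form can be written as
  \<open>g \<otimes> \<alpha>\<close>.\<close>

lemma tensor_free_rank_one:
  fixes A :: "('a, 'x) ring_scheme" and M :: "('a, 'b) module" and N :: "('a, 'c) module"
  assumes M: "Module.module A M" and N: "Module.module A N" and w: "w \<in> carrier N"
    and bij: "bij_betw (\<lambda>r. r \<odot>\<^bsub>N\<^esub> w) (carrier A) (carrier N)"
  shows "bij_betw (\<lambda>m. tens A M N m w) (carrier M) (carrier (tensor A M N))"
proof -
  interpret tensor_product A M N using M N by (rule tensor_product.intro)
  interpret T: Module.module A T by (rule module_T)
  define co where "co z = the_inv_into (carrier A) (\<lambda>r. r \<odot>\<^bsub>N\<^esub> w) z" for z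
  have co: "co z \<in> carrier A" "co z \<odot>\<^bsub>N\<^esub> w = z" if "z \<in> carrier N" for z
    using that bij the_inv_into_into[of "\<lambda>r. r \<odot>\<^bsub>N\<^esub> w" "carrier A" z "carrier A"] f_the_inv_into_f_bij_betw[OF bij]
    by (auto simp: co_def bij_betw_def)
  have co_eq: "co z = r" if "r \<in> carrier A" "r \<odot>\<^bsub>N\<^esub> w = z" for r z
    using that bij the_inv_into_f_f[of "\<lambda>r. r \<odot>\<^bsub>N\<^esub> w" "carrier A" r] by (auto simp: co_def bij_betw_def)
  have bal: "balanced M (\<lambda>m z. co z \<odot>\<^bsub>M\<^esub> m)"
  proof (rule balancedI)
    show "co z \<odot>\<^bsub>M\<^esub> x \<in> carrier M" if "x \<in> carrier M" "z \<in> carrier N" for x z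
      using that co by simp
    show "co z \<odot>\<^bsub>M\<^esub> (x \<oplus>\<^bsub>M\<^esub> y) = co z \<odot>\<^bsub>M\<^esub> x \<oplus>\<^bsub>M\<^esub> co z \<odot>\<^bsub>M\<^esub> y"
      if "x \<in> carrier M" "y \<in> carrier M" "z \<in> carrier N" for x y z
      using that co by (simp add: left.smult_r_distr)
    show "co (z \<oplus>\<^bsub>N\<^esub> z') \<odot>\<^bsub>M\<^esub> x = co z \<odot>\<^bsub>M\<^esub> x \<oplus>\<^bsub>M\<^esub> co z' \<odot>\<^bsub>M\<^esub> x"
      if "x \<in> carrier M" "z \<in> carrier N" "z' \<in> carrier N" for x z z'
    proof -
      have "co (z \<oplus>\<^bsub>N\<^esub> z') = co z \<oplus>\<^bsub>A\<^esub> co z'"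
        using that co w by (intro co_eq) (simp_all add: right.smult_l_distr)
      then show ?thesis using that co by (simp add: left.smult_l_distr)
    qed
    show "co z \<odot>\<^bsub>M\<^esub> (a \<odot>\<^bsub>M\<^esub> x) = co (a \<odot>\<^bsub>N\<^esub> z) \<odot>\<^bsub>M\<^esub> x"
      if "a \<in> carrier A" "x \<in> carrier M" "z \<in> carrier N" for a x z
    proof -
      have "co (a \<odot>\<^bsub>N\<^esub> z) = co z \<otimes>\<^bsub>A\<^esub> a"
        using that co w by (intro co_eq) (simp_all add: left.R.m_comm right.smult_assoc1)
      then show ?thesis using that co by (simp add: left.smult_assoc1)
    qed
  qed
  note l = tensor_lift_additive[OF left.abelian_group_axioms bal]
  show ?thesis
  proof (rule bij_betw_byWitness[where f' = "tensor_lift M (\<lambda>m z. co z \<odot>\<^bsub>M\<^esub> m)"])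
    show "\<forall>m\<in>carrier M. tensor_lift M (\<lambda>m z. co z \<odot>\<^bsub>M\<^esub> m) (tn m w) = m"
      using w co_eq[of "\<one>\<^bsub>A\<^esub>" w] by (simp add: tensor_lift_tn[OF left.abelian_group_axioms bal])
    show "\<forall>X\<in>carrier T. tn (tensor_lift M (\<lambda>m z. co z \<odot>\<^bsub>M\<^esub> m) X) w = X"
    proof
      fix X assume "X \<in> carrier T"
      then show "tn (tensor_lift M (\<lambda>m z. co z \<odot>\<^bsub>M\<^esub> m) X) w = X"
      proof (induction X rule: T_induct)
        case (tens x z)
        then show ?case using co[of z] w tn_balanced[of "co z" x w]
          by (simp add: tensor_lift_tn[OF left.abelian_group_axioms bal])
      next
        case (add X Y)
        then show ?case using w
          by (simp add: additive_map_add[OF l] additive_map_closed[OF l] tn_add_left)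
      qed
    qed
    show "(\<lambda>m. tn m w) ` carrier M \<subseteq> carrier T" using w tn_closed by auto
    show "tensor_lift M (\<lambda>m z. co z \<odot>\<^bsub>M\<^esub> m) ` carrier T \<subseteq> carrier M"
      using additive_map_closed[OF l] by auto
  qed
qed

lemma PIdl_mem_iff: "y \<in> PIdl\<^bsub>R\<^esub> x \<longleftrightarrow> (\<exists>z\<in>carrier R. y = z \<otimes>\<^bsub>R\<^esub> x)"
  by (auto simp: cgenideal_def)

section \<open>The completed tensor square\<close>

locale formal_algebra = algebra k R for k :: "'k ring" and R :: "('k, 'r) module" (structure) +
  fixes T :: "'r topology"
  assumes formal: "formal_ring R T"
begin

abbreviation "OI \<equiv> open_ideals R T"
abbreviation "QT I J \<equiv> tensor k (quot R I) (quot R J)"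
abbreviation "tq I J a b \<equiv> tens k (quot R I) (quot R J) (I +> a) (J +> b)"
abbreviation "Q \<equiv> tensor_square k R T"

lemma R_ring: "ring R"
  using M_cring by (rule cring.axioms)

lemma OI_ideal: "J \<in> OI \<Longrightarrow> ideal J R"
  by (simp add: open_ideals_def)

lemma OI_quot: "J \<in> OI \<Longrightarrow> quotient_algebra k R J"
  by (intro quotient_algebra.intro algebra_axioms OI_ideal)

lemma OI_Int: "I \<in> OI \<Longrightarrow> J \<in> OI \<Longrightarrow> I \<inter> J \<in> OI"
  by (auto simp: open_ideals_def intro: ring.i_intersect[OF R_ring] openin_Int)

lemma topspace_T: "topspace T = carrier R"
  using formal by (simp add: formal_ring_def)

lemma OI_subset: "J \<in> OI \<Longrightarrow> J \<subseteq> carrier R"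
  by (auto dest!: OI_ideal intro: ideal.Icarr)

lemma OI_separated:
  assumes r: "r \<in> carrier R" "\<And>J. J \<in> OI \<Longrightarrow> r \<in> J"
  shows "r = \<zero>"
proof (rule ccontr)
  assume "r \<noteq> \<zero>"
  moreover have "Hausdorff_space T" using formal by (simp add: formal_ring_def)
  ultimately obtain U V where UV: "openin T U" "openin T V" "r \<in> U" "\<zero> \<in> V" "disjnt U V"
    using r topspace_T by (metis Hausdorff_space_def M.zero_closed)
  moreover have "\<forall>U. openin T U \<and> \<zero> \<in> U \<longrightarrow> (\<exists>J\<in>OI. J \<subseteq> U)"
    using formal by (simp add: formal_ring_def)
  ultimately obtain J where "J \<in> OI" "J \<subseteq> V" by meson
  then show False using r(2) UV by (auto simp: disjnt_def)
qed

text \<open>Existence is completeness and uniqueness is the Hausdorff property. Both the codiagonal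
  and the power series in the parameter are constructed from this form.\<close>

lemma OI_complete:
  assumes F: "\<And>J. J \<in> OI \<Longrightarrow> F J \<in> carrier (quot R J)"
    and c: "\<And>J K. J \<in> OI \<Longrightarrow> K \<in> OI \<Longrightarrow> J \<subseteq> K \<Longrightarrow> F J \<subseteq> F K"
  shows "\<exists>!r. r \<in> carrier R \<and> (\<forall>J\<in>OI. J +> r = F J)"
proof -
  have "restrict F OI \<in> quot_limit R OI"
    using F c by (simp add: quot_limit_def quot_def)
  then obtain r where r: "r \<in> carrier R" "restrict F OI = to_limit R OI r"
    using formal unfolding formal_ring_def by blast
  have rF: "J +> r = F J" if "J \<in> OI" for J
    using fun_cong[OF r(2), of J] that by (simp add: to_limit_def)
  show ?thesis
  proof (rule ex1I[of _ r])
    fix s assume s: "s \<in> carrier R \<and> (\<forall>J\<in>OI. J +> s = F J)"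
    have "s \<ominus> r \<in> J" if J: "J \<in> OI" for J
    proof -
      interpret quotient_algebra k R J by (rule OI_quot[OF J])
      show ?thesis using coset_eq_iff[of s r] rF[OF J] s r J by simp
    qed
    then have "s \<ominus> r = \<zero>" using s r by (intro OI_separated) auto
    then show "s = r" using s r M.minus_eq_zero_iff[of s r] by simp
  qed (use r rF in auto)
qed

lemma QT_tensor_algebra: "I \<in> OI \<Longrightarrow> J \<in> OI \<Longrightarrow> tensor_algebra k (quot R I) (quot R J)"
  by (intro tensor_algebra.intro quotient_algebra.algebra_quot OI_quot)

lemma QT_cring: "I \<in> OI \<Longrightarrow> J \<in> OI \<Longrightarrow> cring (QT I J)"
  by (rule tensor_algebra.cring_T[OF QT_tensor_algebra])

lemma QT_group: "I \<in> OI \<Longrightarrow> J \<in> OI \<Longrightarrow> abelian_group (QT I J)"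
  using QT_cring cring.axioms(1) ring.is_abelian_group by blast

lemma coset_closed: "J \<in> OI \<Longrightarrow> a \<in> carrier R \<Longrightarrow> J +> a \<in> carrier (quot R J)"
proof -
  assume "J \<in> OI" and a: "a \<in> carrier R"
  then interpret quotient_algebra k R J by (intro OI_quot)
  show ?thesis by (rule coset_mem_carrier[OF a])
qed

lemma QT_product: "I \<in> OI \<Longrightarrow> J \<in> OI \<Longrightarrow> tensor_product k (quot R I) (quot R J)"
  by (intro tensor_product.intro algebra.module quotient_algebra.algebra_quot OI_quot)

lemma tq_closed: "I \<in> OI \<Longrightarrow> J \<in> OI \<Longrightarrow> a \<in> carrier R \<Longrightarrow> b \<in> carrier R \<Longrightarrow> tq I J a b \<in> carrier (QT I J)"
  by (intro tensor_product.tn_closed coset_closed QT_product)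

lemma QT_induct [consumes 3, case_names tens add]:
  assumes "X \<in> carrier (QT I J)" and IJ: "I \<in> OI" "J \<in> OI"
    and t: "\<And>a b. a \<in> carrier R \<Longrightarrow> b \<in> carrier R \<Longrightarrow> P (tq I J a b)"
    and a: "\<And>X Y. X \<in> carrier (QT I J) \<Longrightarrow> Y \<in> carrier (QT I J) \<Longrightarrow> P X \<Longrightarrow> P Y \<Longrightarrow> P (X \<oplus>\<^bsub>QT I J\<^esub> Y)"
  shows "P X"
  using assms(1)
proof (induction X rule: tensor_product.T_induct[OF QT_product[OF IJ], consumes 1, case_names tens add])
  case (tens x z)
  interpret I: quotient_algebra k R I by (rule OI_quot[OF IJ(1)])
  interpret J: quotient_algebra k R J by (rule OI_quot[OF IJ(2)])
  show ?case using tens t by (auto simp: I.quot_carrier J.quot_carrier)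
qed (use a in auto)

lemma tq_add_left:
  assumes "I \<in> OI" "J \<in> OI" "a \<in> carrier R" "a' \<in> carrier R" "b \<in> carrier R"
  shows "tq I J (a \<oplus> a') b = tq I J a b \<oplus>\<^bsub>QT I J\<^esub> tq I J a' b"
proof -
  interpret I: quotient_algebra k R I by (rule OI_quot[OF assms(1)])
  show ?thesis
    using tensor_product.tn_add_left[OF QT_product[OF assms(1,2)] coset_closed coset_closed coset_closed] assms
    by (simp add: I.coset_add)
qed

lemma tq_add_right:
  assumes "I \<in> OI" "J \<in> OI" "a \<in> carrier R" "b \<in> carrier R" "b' \<in> carrier R"
  shows "tq I J a (b \<oplus> b') = tq I J a b \<oplus>\<^bsub>QT I J\<^esub> tq I J a b'"
proof -
  interpret J: quotient_algebra k R J by (rule OI_quot[OF assms(2)])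
  show ?thesis
    using tensor_product.tn_add_right[OF QT_product[OF assms(1,2)] coset_closed coset_closed coset_closed] assms
    by (simp add: J.coset_add)
qed

lemma tq_mult:
  assumes "I \<in> OI" "J \<in> OI" "a \<in> carrier R" "a' \<in> carrier R" "b \<in> carrier R" "b' \<in> carrier R"
  shows "tq I J a b \<otimes>\<^bsub>QT I J\<^esub> tq I J a' b' = tq I J (a \<otimes> a') (b \<otimes> b')"
proof -
  interpret I: quotient_algebra k R I by (rule OI_quot[OF assms(1)])
  interpret J: quotient_algebra k R J by (rule OI_quot[OF assms(2)])
  show ?thesis
    using tensor_algebra.mult_tn[OF QT_tensor_algebra[OF assms(1,2)] coset_closed coset_closed coset_closed coset_closed] assms
    by (simp add: J.coset_mult I.coset_mult)
qed

lemma tq_balanced: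
  assumes "I \<in> OI" "J \<in> OI" "c \<in> carrier k" "a \<in> carrier R" "b \<in> carrier R"
  shows "tq I J (c \<odot> a) b = tq I J a (c \<odot> b)"
proof -
  interpret I: quotient_algebra k R I by (rule OI_quot[OF assms(1)])
  interpret J: quotient_algebra k R J by (rule OI_quot[OF assms(2)])
  show ?thesis
    using tensor_product.tn_balanced[OF QT_product[OF assms(1,2)] assms(3) coset_closed coset_closed] assms
    by (simp add: J.coset_smult I.coset_smult)
qed

lemma one_QT: assumes "I \<in> OI" "J \<in> OI" shows "\<one>\<^bsub>QT I J\<^esub> = tq I J \<one> \<one>"
proof -
  interpret I: quotient_algebra k R I by (rule OI_quot[OF assms(1)])
  interpret J: quotient_algebra k R J by (rule OI_quot[OF assms(2)])
  show ?thesis by (simp add: tensor_algebra.one_T[OF QT_tensor_algebra[OF assms]] I.coset_one J.coset_one)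
qed

text \<open>The choice of representatives is immaterial when \<open>b\<close> is \<open>k_bilinear\<close>.\<close>

definition coset_lift :: "('p, 'y) ring_scheme \<Rightarrow> 'r set \<Rightarrow> 'r set \<Rightarrow> ('r \<Rightarrow> 'r \<Rightarrow> 'p) \<Rightarrow> ('r set \<times> 'r set \<Rightarrow>\<^sub>0 int) set \<Rightarrow> 'p" where
  "coset_lift P I J b = tensor_lift P (\<lambda>X Y. b (SOME x. x \<in> X) (SOME y. y \<in> Y))"

text \<open>The target carries no scalar action, so linearity over \<open>k\<close> enters as
  balance only. Vanishing on \<open>I\<close> and \<open>J\<close> makes the values depend on
  cosets.\<close>

definition k_bilinear :: "('p, 'y) ring_scheme \<Rightarrow> 'r set \<Rightarrow> 'r set \<Rightarrow> ('r \<Rightarrow> 'r \<Rightarrow> 'p) \<Rightarrow> bool" where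
  "k_bilinear P I J b \<longleftrightarrow>
    (\<forall>x\<in>carrier R. \<forall>y\<in>carrier R. b x y \<in> carrier P) \<and>
    (\<forall>x\<in>carrier R. \<forall>y\<in>carrier R. \<forall>z\<in>carrier R. b (x \<oplus> y) z = b x z \<oplus>\<^bsub>P\<^esub> b y z) \<and>
    (\<forall>x\<in>carrier R. \<forall>y\<in>carrier R. \<forall>z\<in>carrier R. b x (y \<oplus> z) = b x y \<oplus>\<^bsub>P\<^esub> b x z) \<and>
    (\<forall>c\<in>carrier k. \<forall>x\<in>carrier R. \<forall>y\<in>carrier R. b (c \<odot> x) y = b x (c \<odot> y)) \<and>
    (\<forall>x\<in>I. \<forall>y\<in>carrier R. b x y = \<zero>\<^bsub>P\<^esub>) \<and> (\<forall>x\<in>carrier R. \<forall>y\<in>J. b x y = \<zero>\<^bsub>P\<^esub>)"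

text \<open>The function \<open>c\<close> is constrained only through representatives. The same
  lemma thus serves the literal functions in \<open>trans\<close> and \<open>mul\<close> and the
  chosen representatives in \<open>coset_lift\<close>.\<close>

lemma tensor_lift_bilinear:
  assumes P: "abelian_group P" and IJ: "I \<in> OI" "J \<in> OI" and b: "k_bilinear P I J b"
    and c: "\<And>x y. x \<in> carrier R \<Longrightarrow> y \<in> carrier R \<Longrightarrow> c (I +> x) (J +> y) = b x y"
  shows "additive_map (QT I J) P (tensor_lift P c)"
    and "\<And>x y. x \<in> carrier R \<Longrightarrow> y \<in> carrier R \<Longrightarrow> tensor_lift P c (tq I J x y) = b x y"
    and "tensor_product.balanced k (quot R I) (quot R J) P c"
proof -
  interpret P: abelian_group P by (rule P)
  interpret I: quotient_algebra k R I by (rule OI_quot[OF IJ(1)])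
  interpret J: quotient_algebra k R J by (rule OI_quot[OF IJ(2)])
  interpret tensor_product k "quot R I" "quot R J" by (rule QT_product[OF IJ])
  have bal: "balanced P c"
    by (rule balancedI)
      (use b in \<open>auto simp: I.quot_carrier J.quot_carrier c I.coset_add J.coset_add I.coset_smult J.coset_smult k_bilinear_def\<close>)
  then show "balanced P c" .
  show "additive_map (QT I J) P (tensor_lift P c)" by (rule tensor_lift_additive[OF P bal])
  show "tensor_lift P c (tq I J x y) = b x y" if "x \<in> carrier R" "y \<in> carrier R" for x y
    using tensor_lift_tn[OF P bal, of "I +> x" "J +> y"] that c coset_closed IJ by simp
qed

lemma k_bilinear_coset_eq:
  assumes P: "abelian_group P" and IJ: "I \<in> OI" "J \<in> OI" and b: "k_bilinear P I J b"
    and x: "x \<in> carrier R" "x' \<in> I +> x" and y: "y \<in> carrier R" "y' \<in> J +> y"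
  shows "b x' y' = b x y"
proof -
  interpret P: abelian_group P by (rule P)
  interpret I: quotient_algebra k R I by (rule OI_quot[OF IJ(1)])
  interpret J: quotient_algebra k R J by (rule OI_quot[OF IJ(2)])
  have x': "x' \<in> carrier R" using x I.mem_coset_iff' by blast
  have y': "y' \<in> carrier R" using y J.mem_coset_iff' by blast
  define u v where "u = x' \<ominus> x" and "v = y' \<ominus> y"
  have u: "u \<in> I" "u \<in> carrier R" and v: "v \<in> J" "v \<in> carrier R"
    using x y x' y' I.mem_coset_iff J.mem_coset_iff by (auto simp: u_def v_def)
  have "x' = u \<oplus> x" "y' = v \<oplus> y"
    using x x' y y' by (simp_all add: u_def v_def a_minus_def M.a_assoc M.l_neg)
  then show ?thesis using u v x y b by (simp add: k_bilinear_def)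
qed

lemma coset_lift:
  assumes P: "abelian_group P" and IJ: "I \<in> OI" "J \<in> OI" and b: "k_bilinear P I J b"
  shows "additive_map (QT I J) P (coset_lift P I J b)"
    and "\<And>x y. x \<in> carrier R \<Longrightarrow> y \<in> carrier R \<Longrightarrow> coset_lift P I J b (tq I J x y) = b x y"
proof -
  interpret I: quotient_algebra k R I by (rule OI_quot[OF IJ(1)])
  interpret J: quotient_algebra k R J by (rule OI_quot[OF IJ(2)])
  have *: "b (SOME x'. x' \<in> I +> x) (SOME y'. y' \<in> J +> y) = b x y"
    if "x \<in> carrier R" "y \<in> carrier R" for x y
    by (rule k_bilinear_coset_eq[OF P IJ b])
      (use that I.a_rcos_self J.a_rcos_self in \<open>auto intro: someI_ex[of "\<lambda>x. x \<in> _"]\<close>)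
  show "additive_map (QT I J) P (coset_lift P I J b)"
    unfolding coset_lift_def by (rule tensor_lift_bilinear(1)[OF P IJ b]) (rule *)
  show "coset_lift P I J b (tq I J x y) = b x y" if "x \<in> carrier R" "y \<in> carrier R" for x y
    unfolding coset_lift_def by (rule tensor_lift_bilinear(2)[OF P IJ b]) (use * that in auto)
qed

lemma QT_map_eq:
  assumes P: "abelian_group P" and IJ: "I \<in> OI" "J \<in> OI"
    and "additive_map (QT I J) P g" "additive_map (QT I J) P h"
    and "\<And>x y. x \<in> carrier R \<Longrightarrow> y \<in> carrier R \<Longrightarrow> g (tq I J x y) = h (tq I J x y)"
    and X: "X \<in> carrier (QT I J)"
  shows "g X = h X"
  using X IJ
  by (induction X rule: QT_induct)
    (auto simp: assms additive_map_add[OF assms(4)] additive_map_add[OF assms(5)])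

end

section \<open>Transition maps and the ring structure of the inverse limit\<close>

context formal_algebra
begin

text \<open>The transition map of the inverse limit, in the literal form in which
  \<open>tensor_square\<close> contains it.\<close>

definition trans :: "'r set \<Rightarrow> 'r set \<Rightarrow> 'r set \<Rightarrow> 'r set \<Rightarrow> ('r set \<times> 'r set \<Rightarrow>\<^sub>0 int) set \<Rightarrow> ('r set \<times> 'r set \<Rightarrow>\<^sub>0 int) set" where
  "trans I J I' J' = tensor_lift (QT I' J')
     (\<lambda>X Y. tens k (quot R I') (quot R J') (I' <+>\<^bsub>R\<^esub> X) (J' <+>\<^bsub>R\<^esub> Y))"

lemma set_add_coset:
  assumes "I \<in> OI" "I' \<in> OI" "I \<subseteq> I'" "x \<in> carrier R"
  shows "I' <+>\<^bsub>R\<^esub> (I +> x) = I' +> x"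
proof -
  interpret I: quotient_algebra k R I by (rule OI_quot[OF assms(1)])
  interpret I': quotient_algebra k R I' by (rule OI_quot[OF assms(2)])
  have "(h \<oplus> (i \<oplus> x)) \<in> I' +> x" if "h \<in> I'" "i \<in> I" for h i
  proof -
    have "h \<oplus> i \<in> I'" "h \<in> carrier R" "i \<in> carrier R" using that assms I'.a_Hcarr by auto
    then have "h \<oplus> (i \<oplus> x) = (h \<oplus> i) \<oplus> x" using assms by (simp add: M.a_assoc)
    then show ?thesis using \<open>h \<oplus> i \<in> I'\<close> by (auto simp: a_r_coset_def')
  qed
  moreover have "h \<oplus> x \<in> I' <+>\<^bsub>R\<^esub> (I +> x)" if "h \<in> I'" for h
    using that I.a_rcos_self[OF assms(4)] by (auto simp: set_add_def')
  ultimately show ?thesis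
    by (auto simp: set_add_def' a_r_coset_def')
qed

lemma k_bilinear_tq:
  assumes "I' \<in> OI" "J' \<in> OI" "I \<subseteq> I'" "J \<subseteq> J'"
  shows "k_bilinear (QT I' J') I J (tq I' J')"
proof -
  interpret I': quotient_algebra k R I' by (rule OI_quot[OF assms(1)])
  interpret J': quotient_algebra k R J' by (rule OI_quot[OF assms(2)])
  interpret tp: tensor_product k "quot R I'" "quot R J'" by (rule QT_product[OF assms(1,2)])
  have [simp]: "tens k (quot R I') (quot R J') I' (J' +> y) = \<zero>\<^bsub>QT I' J'\<^esub>" if "y \<in> carrier R" for y
    using additive_map_zero[OF tp.left.abelian_group_axioms tp.abelian_group_T tp.tn_additive_left, of "J' +> y"]
      that assms by (simp add: coset_closed I'.quot_simps)
  have [simp]: "tens k (quot R I') (quot R J') (I' +> x) J' = \<zero>\<^bsub>QT I' J'\<^esub>" if "x \<in> carrier R" for x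
    using additive_map_zero[OF tp.right.abelian_group_axioms tp.abelian_group_T tp.tn_additive_right, of "I' +> x"]
      that assms by (simp add: coset_closed J'.quot_simps)
  have "I' +> x = I'" if "x \<in> I" for x using that assms I'.coset_eq_zero_iff I'.a_Hcarr by blast
  moreover have "J' +> x = J'" if "x \<in> J" for x using that assms J'.coset_eq_zero_iff J'.a_Hcarr by blast
  ultimately show ?thesis
    unfolding k_bilinear_def using assms
    by (auto simp: tq_closed tq_add_left tq_add_right tq_balanced)
qed

lemma trans:
  assumes "I \<in> OI" "J \<in> OI" "I' \<in> OI" "J' \<in> OI" "I \<subseteq> I'" "J \<subseteq> J'"
  shows "additive_map (QT I J) (QT I' J') (trans I J I' J')"
    and "\<And>x y. x \<in> carrier R \<Longrightarrow> y \<in> carrier R \<Longrightarrow> trans I J I' J' (tq I J x y) = tq I' J' x y"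
    and "\<And>X Y. X \<in> carrier (QT I J) \<Longrightarrow> Y \<in> carrier (QT I J) \<Longrightarrow>
      trans I J I' J' (X \<otimes>\<^bsub>QT I J\<^esub> Y) = trans I J I' J' X \<otimes>\<^bsub>QT I' J'\<^esub> trans I J I' J' Y"
    and "trans I J I' J' \<one>\<^bsub>QT I J\<^esub> = \<one>\<^bsub>QT I' J'\<^esub>"
proof -
  note bl = tensor_lift_bilinear[OF QT_group[OF assms(3,4)] assms(1,2) k_bilinear_tq[OF assms(3-6)],
      of "\<lambda>X Y. tens k (quot R I') (quot R J') (I' <+>\<^bsub>R\<^esub> X) (J' <+>\<^bsub>R\<^esub> Y)"]
  have sa: "tens k (quot R I') (quot R J') (I' <+>\<^bsub>R\<^esub> (I +> x)) (J' <+>\<^bsub>R\<^esub> (J +> y)) = tq I' J' x y"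
    if "x \<in> carrier R" "y \<in> carrier R" for x y
    using that assms by (simp add: set_add_coset)
  show "additive_map (QT I J) (QT I' J') (trans I J I' J')"
    unfolding trans_def by (rule bl(1)[OF sa])
  show t: "trans I J I' J' (tq I J x y) = tq I' J' x y" if "x \<in> carrier R" "y \<in> carrier R" for x y
    unfolding trans_def using bl(2)[OF sa] that by blast
  show "trans I J I' J' \<one>\<^bsub>QT I J\<^esub> = \<one>\<^bsub>QT I' J'\<^esub>" by (simp add: one_QT assms t)
  interpret I: quotient_algebra k R I by (rule OI_quot[OF assms(1)])
  interpret J: quotient_algebra k R J by (rule OI_quot[OF assms(2)])
  interpret ta: tensor_algebra k "quot R I" "quot R J" by (rule QT_tensor_algebra[OF assms(1,2)])
  show "trans I J I' J' (X \<otimes>\<^bsub>QT I J\<^esub> Y) = trans I J I' J' X \<otimes>\<^bsub>QT I' J'\<^esub> trans I J I' J' Y"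
    if "X \<in> carrier (QT I J)" "Y \<in> carrier (QT I J)" for X Y
    unfolding trans_def
  proof (rule ta.tensor_lift_mult[OF QT_cring[OF assms(3,4)] bl(3)[OF sa] _ that])
    show "tens k (quot R I') (quot R J') (I' <+>\<^bsub>R\<^esub> x \<otimes>\<^bsub>quot R I\<^esub> x') (J' <+>\<^bsub>R\<^esub> z \<otimes>\<^bsub>quot R J\<^esub> z') =
        tens k (quot R I') (quot R J') (I' <+>\<^bsub>R\<^esub> x) (J' <+>\<^bsub>R\<^esub> z) \<otimes>\<^bsub>QT I' J'\<^esub>
        tens k (quot R I') (quot R J') (I' <+>\<^bsub>R\<^esub> x') (J' <+>\<^bsub>R\<^esub> z')"
      if "x \<in> carrier (quot R I)" "z \<in> carrier (quot R J)" "x' \<in> carrier (quot R I)" "z' \<in> carrier (quot R J)" for x z x' z'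
      using that assms
      by (auto simp: I.quot_carrier J.quot_carrier set_add_coset I.coset_mult J.coset_mult tq_mult)
  qed
qed

lemma Q_mem_iff:
  "F \<in> carrier Q \<longleftrightarrow> F \<in> extensional (OI \<times> OI) \<and> (\<forall>I\<in>OI. \<forall>J\<in>OI. F (I, J) \<in> carrier (QT I J)) \<and>
    (\<forall>I\<in>OI. \<forall>J\<in>OI. \<forall>I'\<in>OI. \<forall>J'\<in>OI. I \<subseteq> I' \<longrightarrow> J \<subseteq> J' \<longrightarrow> trans I J I' J' (F (I, J)) = F (I', J'))"
  by (auto simp: tensor_square_def Let_def quot_tensor_def trans_def PiE_def Pi_def)

lemma Q_component: "F \<in> carrier Q \<Longrightarrow> I \<in> OI \<Longrightarrow> J \<in> OI \<Longrightarrow> F (I, J) \<in> carrier (QT I J)"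
  by (simp add: Q_mem_iff)

lemma Q_trans: "F \<in> carrier Q \<Longrightarrow> I \<in> OI \<Longrightarrow> J \<in> OI \<Longrightarrow> I' \<in> OI \<Longrightarrow> J' \<in> OI \<Longrightarrow> I \<subseteq> I' \<Longrightarrow> J \<subseteq> J' \<Longrightarrow>
    trans I J I' J' (F (I, J)) = F (I', J')"
  by (simp add: Q_mem_iff)

lemma Q_eqI:
  assumes "F \<in> carrier Q" "G \<in> carrier Q" "\<And>I J. I \<in> OI \<Longrightarrow> J \<in> OI \<Longrightarrow> F (I, J) = G (I, J)"
  shows "F = G"
  by (rule extensionalityI[of _ "OI \<times> OI"]) (use assms in \<open>auto simp: Q_mem_iff\<close>)

lemma Q_ops:
  assumes "I \<in> OI" "J \<in> OI"
  shows "(F \<oplus>\<^bsub>Q\<^esub> G) (I, J) = F (I, J) \<oplus>\<^bsub>QT I J\<^esub> G (I, J)"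
    "(F \<otimes>\<^bsub>Q\<^esub> G) (I, J) = F (I, J) \<otimes>\<^bsub>QT I J\<^esub> G (I, J)"
    "\<zero>\<^bsub>Q\<^esub> (I, J) = \<zero>\<^bsub>QT I J\<^esub>" "\<one>\<^bsub>Q\<^esub> (I, J) = \<one>\<^bsub>QT I J\<^esub>"
  using assms by (simp_all add: tensor_square_def Let_def quot_tensor_def)

lemma Q_ops_extensional:
  "F \<oplus>\<^bsub>Q\<^esub> G \<in> extensional (OI \<times> OI)" "F \<otimes>\<^bsub>Q\<^esub> G \<in> extensional (OI \<times> OI)"
  "\<zero>\<^bsub>Q\<^esub> \<in> extensional (OI \<times> OI)" "\<one>\<^bsub>Q\<^esub> \<in> extensional (OI \<times> OI)"
  by (simp_all add: tensor_square_def Let_def)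

lemma QT_closed:
  assumes "I \<in> OI" "J \<in> OI"
  shows "X \<in> carrier (QT I J) \<Longrightarrow> Y \<in> carrier (QT I J) \<Longrightarrow> X \<oplus>\<^bsub>QT I J\<^esub> Y \<in> carrier (QT I J)"
    "X \<in> carrier (QT I J) \<Longrightarrow> Y \<in> carrier (QT I J) \<Longrightarrow> X \<otimes>\<^bsub>QT I J\<^esub> Y \<in> carrier (QT I J)"
    "\<zero>\<^bsub>QT I J\<^esub> \<in> carrier (QT I J)" "\<one>\<^bsub>QT I J\<^esub> \<in> carrier (QT I J)" "X \<in> carrier (QT I J) \<Longrightarrow> \<ominus>\<^bsub>QT I J\<^esub> X \<in> carrier (QT I J)"
proof -
  interpret cring "QT I J" by (rule QT_cring[OF assms])
  show "X \<in> carrier (QT I J) \<Longrightarrow> Y \<in> carrier (QT I J) \<Longrightarrow> X \<oplus>\<^bsub>QT I J\<^esub> Y \<in> carrier (QT I J)"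
    "X \<in> carrier (QT I J) \<Longrightarrow> Y \<in> carrier (QT I J) \<Longrightarrow> X \<otimes>\<^bsub>QT I J\<^esub> Y \<in> carrier (QT I J)"
    "\<zero>\<^bsub>QT I J\<^esub> \<in> carrier (QT I J)" "\<one>\<^bsub>QT I J\<^esub> \<in> carrier (QT I J)" "X \<in> carrier (QT I J) \<Longrightarrow> \<ominus>\<^bsub>QT I J\<^esub> X \<in> carrier (QT I J)"
    by simp_all
qed

lemma Q_closed:
  "F \<in> carrier Q \<Longrightarrow> G \<in> carrier Q \<Longrightarrow> F \<oplus>\<^bsub>Q\<^esub> G \<in> carrier Q"
  "F \<in> carrier Q \<Longrightarrow> G \<in> carrier Q \<Longrightarrow> F \<otimes>\<^bsub>Q\<^esub> G \<in> carrier Q"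
  "\<zero>\<^bsub>Q\<^esub> \<in> carrier Q" "\<one>\<^bsub>Q\<^esub> \<in> carrier Q"
  using trans QT_group
  by (simp_all add: Q_mem_iff[of "_ \<oplus>\<^bsub>Q\<^esub> _"] Q_mem_iff[of "_ \<otimes>\<^bsub>Q\<^esub> _"] Q_mem_iff[of "\<zero>\<^bsub>Q\<^esub>"] Q_mem_iff[of "\<one>\<^bsub>Q\<^esub>"]
      Q_ops Q_ops_extensional Q_component Q_trans QT_closed additive_map_add[OF trans(1)] additive_map_zero[OF _ _ trans(1)])

lemma cring_Q: "cring Q"
proof -
  have neg: "\<exists>G\<in>carrier Q. G \<oplus>\<^bsub>Q\<^esub> F = \<zero>\<^bsub>Q\<^esub>" if F: "F \<in> carrier Q" for F
  proof -
    define G where "G = (\<lambda>(I, J)\<in>OI \<times> OI. \<ominus>\<^bsub>QT I J\<^esub> F (I, J))"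
    have "G \<in> carrier Q"
      unfolding Q_mem_iff[of G] using F by (auto simp: G_def Q_component QT_closed additive_map_uminus[OF QT_group QT_group trans(1)] Q_trans)
    moreover have "G \<oplus>\<^bsub>Q\<^esub> F = \<zero>\<^bsub>Q\<^esub>"
    proof (rule Q_eqI)
      fix I J assume IJ: "I \<in> OI" "J \<in> OI"
      interpret cring "QT I J" by (rule QT_cring[OF IJ])
      show "(G \<oplus>\<^bsub>Q\<^esub> F) (I, J) = \<zero>\<^bsub>Q\<^esub> (I, J)"
        using IJ F by (simp add: Q_ops G_def Q_component l_neg)
    qed (use F \<open>G \<in> carrier Q\<close> in \<open>auto intro: Q_closed\<close>)
    ultimately show ?thesis by blast
  qed
  show ?thesis
  proof (intro cringI abelian_groupI comm_monoidI)
    fix F G H assume *: "F \<in> carrier Q" "G \<in> carrier Q" "H \<in> carrier Q"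
    show "F \<oplus>\<^bsub>Q\<^esub> G \<oplus>\<^bsub>Q\<^esub> H = F \<oplus>\<^bsub>Q\<^esub> (G \<oplus>\<^bsub>Q\<^esub> H)" "F \<otimes>\<^bsub>Q\<^esub> G \<otimes>\<^bsub>Q\<^esub> H = F \<otimes>\<^bsub>Q\<^esub> (G \<otimes>\<^bsub>Q\<^esub> H)"
      "(F \<oplus>\<^bsub>Q\<^esub> G) \<otimes>\<^bsub>Q\<^esub> H = F \<otimes>\<^bsub>Q\<^esub> H \<oplus>\<^bsub>Q\<^esub> G \<otimes>\<^bsub>Q\<^esub> H"
      by (rule Q_eqI; (intro Q_closed *)?;
          simp add: Q_ops Q_component * cring.cring_simprules(7)[OF QT_cring] cring.cring_simprules(11,13)[OF QT_cring])+
  next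
    fix F G assume *: "F \<in> carrier Q" "G \<in> carrier Q"
    show "F \<oplus>\<^bsub>Q\<^esub> G = G \<oplus>\<^bsub>Q\<^esub> F" "F \<otimes>\<^bsub>Q\<^esub> G = G \<otimes>\<^bsub>Q\<^esub> F"
      by (rule Q_eqI; (intro Q_closed *)?;
          simp add: Q_ops Q_component * cring.cring_simprules(10)[OF QT_cring] cring.cring_simprules(14)[OF QT_cring])+
  next
    fix F assume *: "F \<in> carrier Q"
    show "\<zero>\<^bsub>Q\<^esub> \<oplus>\<^bsub>Q\<^esub> F = F" "\<one>\<^bsub>Q\<^esub> \<otimes>\<^bsub>Q\<^esub> F = F"
      by (rule Q_eqI; (intro Q_closed *)?;
          simp add: Q_ops Q_component * cring.cring_simprules(8)[OF QT_cring] cring.cring_simprules(12)[OF QT_cring])+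
  qed (auto intro: Q_closed neg)
qed

end

section \<open>The two inclusions and the codiagonal\<close>

context formal_algebra
begin

abbreviation "l \<equiv> left_incl k R T"
abbreviation "r \<equiv> right_incl k R T"
abbreviation "\<mu> \<equiv> codiagonal R T"

interpretation Q: cring Q by (rule cring_Q)

lemma incl_component:
  "I \<in> OI \<Longrightarrow> J \<in> OI \<Longrightarrow> l a (I, J) = tq I J a \<one>"
  "I \<in> OI \<Longrightarrow> J \<in> OI \<Longrightarrow> r a (I, J) = tq I J \<one> a"
  by (simp_all add: left_incl_def right_incl_def)

lemma incl_closed: "a \<in> carrier R \<Longrightarrow> l a \<in> carrier Q" "a \<in> carrier R \<Longrightarrow> r a \<in> carrier Q"
proof -
  have "l a \<in> extensional (OI \<times> OI)" "r a \<in> extensional (OI \<times> OI)"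
    by (simp_all add: left_incl_def right_incl_def)
  then show "a \<in> carrier R \<Longrightarrow> l a \<in> carrier Q" "a \<in> carrier R \<Longrightarrow> r a \<in> carrier Q"
    by (simp_all add: Q_mem_iff[of "l a"] Q_mem_iff[of "r a"] incl_component tq_closed trans(2))
qed

lemma incl_hom: "l \<in> ring_hom R Q" "r \<in> ring_hom R Q"
  by (rule ring_hom_memI;
      (rule Q_eqI)?; simp add: incl_closed Q.m_closed Q.add.m_closed incl_component Q_ops tq_mult tq_add_left tq_add_right one_QT)+

definition mul :: "'r set \<Rightarrow> ('r set \<times> 'r set \<Rightarrow>\<^sub>0 int) set \<Rightarrow> 'r set" where
  "mul J = tensor_lift (quot R J) (\<lambda>X Y. X \<otimes>\<^bsub>quot R J\<^esub> Y)"

lemma mul: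
  assumes J: "J \<in> OI"
  shows "additive_map (QT J J) (quot R J) (mul J)"
    and "\<And>x y. x \<in> carrier R \<Longrightarrow> y \<in> carrier R \<Longrightarrow> mul J (tq J J x y) = J +> (x \<otimes> y)"
    and "\<And>X Y. X \<in> carrier (QT J J) \<Longrightarrow> Y \<in> carrier (QT J J) \<Longrightarrow>
      mul J (X \<otimes>\<^bsub>QT J J\<^esub> Y) = mul J X \<otimes>\<^bsub>quot R J\<^esub> mul J Y"
proof -
  interpret J: quotient_algebra k R J by (rule OI_quot[OF J])
  interpret B: cring "quot R J" by (rule J.cring_quot)
  interpret ta: tensor_algebra k "quot R J" "quot R J" by (rule QT_tensor_algebra[OF J J])
  have b: "k_bilinear (quot R J) J J (\<lambda>x y. J +> (x \<otimes> y))"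
  proof -
    have "J +> (x \<otimes> y) = J" "J +> (y \<otimes> x) = J" if "x \<in> J" "y \<in> carrier R" for x y
      using that J.I_r_closed J.I_l_closed J.a_Hcarr J.coset_eq_zero_iff by auto
    moreover have "c \<odot> x \<otimes> y = x \<otimes> (c \<odot> y)" if "c \<in> carrier k" "x \<in> carrier R" "y \<in> carrier R" for c x y
      using that by (metis m_comm smult_assoc2 smult_closed)
    ultimately show ?thesis
      by (auto simp: k_bilinear_def J.coset_mem_carrier J.coset_add l_distr r_distr J.quot_simps(2))
  qed
  note bl = tensor_lift_bilinear[OF B.abelian_group_axioms J J b, of "\<lambda>X Y. X \<otimes>\<^bsub>quot R J\<^esub> Y"]
  show "additive_map (QT J J) (quot R J) (mul J)"
    unfolding mul_def by (rule bl(1)) (simp add: J.coset_mult)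
  show "mul J (tq J J x y) = J +> (x \<otimes> y)" if "x \<in> carrier R" "y \<in> carrier R" for x y
    unfolding mul_def by (rule bl(2)) (simp_all add: J.coset_mult that)
  have bal: "ta.balanced (quot R J) (\<lambda>X Y. X \<otimes>\<^bsub>quot R J\<^esub> Y)"
    by (rule bl(3)) (simp add: J.coset_mult)
  show "mul J (X \<otimes>\<^bsub>QT J J\<^esub> Y) = mul J X \<otimes>\<^bsub>quot R J\<^esub> mul J Y"
    if "X \<in> carrier (QT J J)" "Y \<in> carrier (QT J J)" for X Y
    unfolding mul_def by (rule ta.tensor_lift_mult[OF B.is_cring bal _ that]) (simp add: B.m_ac)
qed

lemma set_add_mono: "A \<subseteq> A' \<Longrightarrow> B \<subseteq> B' \<Longrightarrow> A <+>\<^bsub>R\<^esub> B \<subseteq> A' <+>\<^bsub>R\<^esub> B'"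
  unfolding set_add_def' by fast

text \<open>Compatibility with the transition maps is stated as an inclusion of cosets because
  \<open>OI_complete\<close> asks for it in this form. Addition of sets is monotone, so it suffices
  to look at pure tensors.\<close>

lemma mul_mono:
  assumes "J \<in> OI" "K \<in> OI" "J \<subseteq> K" "X \<in> carrier (QT J J)"
  shows "mul J X \<subseteq> mul K (trans J J K K X)"
  using assms(4,1,1)
proof (induction X rule: QT_induct)
  case (tens a b)
  then have "mul J (tq J J a b) = J +> (a \<otimes> b)"
    "mul K (trans J J K K (tq J J a b)) = K +> (a \<otimes> b)"
    using assms by (simp_all add: mul trans(2))
  then show ?case using assms by (auto simp: a_r_coset_def')
next
  case (add X Y)
  interpret J: quotient_algebra k R J by (rule OI_quot[OF assms(1)])
  interpret K: quotient_algebra k R K by (rule OI_quot[OF assms(2)])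
  note t = trans(1)[OF assms(1,1,2,2,3,3)]
  have "mul J (X \<oplus>\<^bsub>QT J J\<^esub> Y) = mul J X <+>\<^bsub>R\<^esub> mul J Y"
    using add by (simp only: additive_map_add[OF mul(1)[OF assms(1)]] J.quot_simps(3))
  moreover have "mul K (trans J J K K (X \<oplus>\<^bsub>QT J J\<^esub> Y)) = mul K (trans J J K K X) <+>\<^bsub>R\<^esub> mul K (trans J J K K Y)"
    using add by (simp only: additive_map_add[OF t] additive_map_add[OF mul(1)[OF assms(2)]] additive_map_closed[OF t] K.quot_simps(3))
  ultimately show ?case
    using add.IH by (simp only: set_add_mono)
qed

text \<open>\<open>OI_complete\<close>, applied to the products modulo the open ideals, justifies
  the definite description in \<open>codiagonal\<close>.\<close>

lemma codiagonal_spec: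
  assumes F: "F \<in> carrier Q"
  shows "\<mu> F \<in> carrier R" and "\<And>J. J \<in> OI \<Longrightarrow> J +> \<mu> F = mul J (F (J, J))"
proof -
  have "\<exists>!a. a \<in> carrier R \<and> (\<forall>J\<in>OI. J +> a = mul J (F (J, J)))"
  proof (rule OI_complete)
    show "mul J (F (J, J)) \<in> carrier (quot R J)" if "J \<in> OI" for J
      by (rule additive_map_closed[OF mul(1) Q_component]) (rule that F)+
    show "mul J (F (J, J)) \<subseteq> mul K (F (K, K))" if "J \<in> OI" "K \<in> OI" "J \<subseteq> K" for J K
      using mul_mono[OF that Q_component[OF F that(1) that(1)]] Q_trans[OF F that(1,1,2,2,3,3)] by simp
  qed
  from theI'[OF this] show "\<mu> F \<in> carrier R" and "\<And>J. J \<in> OI \<Longrightarrow> J +> \<mu> F = mul J (F (J, J))"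
    by (simp_all add: codiagonal_def mul_def)
qed

lemma OI_coset_eqI:
  assumes "a \<in> carrier R" "b \<in> carrier R" "\<And>J. J \<in> OI \<Longrightarrow> J +> a = J +> b"
  shows "a = b"
proof -
  have "a \<ominus> b = \<zero>"
  proof (rule OI_separated)
    fix J assume J: "J \<in> OI"
    interpret quotient_algebra k R J by (rule OI_quot[OF J])
    show "a \<ominus> b \<in> J" using coset_eq_iff assms J by blast
  qed (use assms in simp)
  then show ?thesis using assms M.minus_eq_zero_iff by blast
qed

lemma codiagonal_incl: "a \<in> carrier R \<Longrightarrow> \<mu> (l a) = a" "a \<in> carrier R \<Longrightarrow> \<mu> (r a) = a"
  by (rule OI_coset_eqI; simp add: codiagonal_spec incl_closed incl_component mul)+

lemma codiagonal_hom: "\<mu> \<in> ring_hom Q R"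
proof (rule ring_hom_memI)
  show "\<mu> F \<in> carrier R" if "F \<in> carrier Q" for F by (rule codiagonal_spec[OF that])
  fix F G assume F: "F \<in> carrier Q" and G: "G \<in> carrier Q"
  show "\<mu> (F \<otimes>\<^bsub>Q\<^esub> G) = \<mu> F \<otimes> \<mu> G"
  proof (rule OI_coset_eqI)
    fix J assume J: "J \<in> OI"
    interpret quotient_algebra k R J by (rule OI_quot[OF J])
    show "J +> \<mu> (F \<otimes>\<^bsub>Q\<^esub> G) = J +> (\<mu> F \<otimes> \<mu> G)"
      using F G J coset_mult[of "\<mu> F" "\<mu> G"] by (simp add: codiagonal_spec Q_ops mul(3) Q_component)
  qed (use F G in \<open>simp_all add: codiagonal_spec\<close>)
  show "\<mu> (F \<oplus>\<^bsub>Q\<^esub> G) = \<mu> F \<oplus> \<mu> G"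
  proof (rule OI_coset_eqI)
    fix J assume J: "J \<in> OI"
    interpret quotient_algebra k R J by (rule OI_quot[OF J])
    show "J +> \<mu> (F \<oplus>\<^bsub>Q\<^esub> G) = J +> (\<mu> F \<oplus> \<mu> G)"
      using F G J coset_add[of "\<mu> F" "\<mu> G"] by (simp add: codiagonal_spec Q_ops additive_map_add[OF mul(1)] Q_component)
  qed (use F G in \<open>simp_all add: codiagonal_spec\<close>)
next
  show "\<mu> \<one>\<^bsub>Q\<^esub> = \<one>"
    using codiagonal_incl(1)[of "\<one>"] ring_hom_one[OF incl_hom(1)] by simp
qed

section \<open>Linear operators on the completed tensor square\<close>

definition k_linear :: "('r \<Rightarrow> 'r) \<Rightarrow> bool" where
  "k_linear g \<longleftrightarrow> additive_map R R g \<and> (\<forall>c\<in>carrier k. \<forall>x\<in>carrier R. g (c \<odot> x) = c \<odot> g x)"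

text \<open>Open ideals suffice to express continuity, since the maps are additive and these ideals
  form a base at zero.\<close>

definition k_continuous :: "('r \<Rightarrow> 'r) \<Rightarrow> bool" where
  "k_continuous g \<longleftrightarrow> k_linear g \<and> (\<forall>J\<in>OI. \<exists>J'\<in>OI. g ` J' \<subseteq> J)"

lemma k_linear_closed: "k_linear g \<Longrightarrow> x \<in> carrier R \<Longrightarrow> g x \<in> carrier R"
  by (auto simp: k_linear_def additive_map_def)

lemma k_linear_id: "k_continuous (\<lambda>x. x)"
  by (auto simp: k_continuous_def k_linear_def additive_map_def)

lemma k_bilinear_pullback:
  assumes b: "k_bilinear P I J b" and g: "k_linear g" "g ` I' \<subseteq> I" and h: "k_linear h" "h ` J' \<subseteq> J"
  shows "k_bilinear P I' J' (\<lambda>x y. b (g x) (h y))"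
  using assms unfolding k_bilinear_def k_linear_def additive_map_def by (auto simp: Pi_def image_subset_iff)

text \<open>The operator \<open>g \<otimes> h\<close> on the completion. Its component at
  \<open>(I, J)\<close> is computed from the component of \<open>F\<close> at a pair small enough to
  be mapped into \<open>(I, J)\<close>; \<open>tensor_op_component\<close> shows that any such pair
  will do.\<close>

definition tensor_op :: "('r \<Rightarrow> 'r) \<Rightarrow> ('r \<Rightarrow> 'r) \<Rightarrow> 'r tensor_square \<Rightarrow> 'r tensor_square" where
  "tensor_op g h F = (\<lambda>(I, J)\<in>OI \<times> OI.
     let I' = (SOME I'. I' \<in> OI \<and> g ` I' \<subseteq> I); J' = (SOME J'. J' \<in> OI \<and> h ` J' \<subseteq> J)
     in coset_lift (QT I J) I' J' (\<lambda>x y. tq I J (g x) (h y)) (F (I', J')))"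

text \<open>Two admissible pairs are compared through their intersection, and shrinking a pair
  changes nothing because the components of \<open>F\<close> are compatible.\<close>

lemma tensor_op_component:
  assumes g: "k_linear g" and h: "k_linear h" and F: "F \<in> carrier Q" and IJ: "I \<in> OI" "J \<in> OI"
    and I': "I' \<in> OI" "g ` I' \<subseteq> I" and J': "J' \<in> OI" "h ` J' \<subseteq> J"
  shows "tensor_op g h F (I, J) = coset_lift (QT I J) I' J' (\<lambda>x y. tq I J (g x) (h y)) (F (I', J'))"
proof -
  let ?b = "\<lambda>x y. tq I J (g x) (h y)"
  have bil: "k_bilinear (QT I J) I1 J1 ?b" if "g ` I1 \<subseteq> I" "h ` J1 \<subseteq> J" for I1 J1
    by (rule k_bilinear_pullback[OF k_bilinear_tq[OF IJ order_refl order_refl] g that(1) h that(2)])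
  have shrink: "coset_lift (QT I J) I1 J1 ?b (F (I1, J1)) = coset_lift (QT I J) I2 J2 ?b (F (I2, J2))"
    if "I1 \<in> OI" "J1 \<in> OI" "I2 \<in> OI" "J2 \<in> OI" "I2 \<subseteq> I1" "J2 \<subseteq> J1" "g ` I1 \<subseteq> I" "h ` J1 \<subseteq> J" for I1 J1 I2 J2
  proof -
    have s: "g ` I2 \<subseteq> I" "h ` J2 \<subseteq> J"
      using image_mono[OF that(5), of g] image_mono[OF that(6), of h] that(7,8) by blast+
    note t = trans[OF that(3,4,1,2,5,6)]
    note c1 = coset_lift[OF QT_group[OF IJ] that(1,2) bil[OF that(7,8)]]
    note c2 = coset_lift[OF QT_group[OF IJ] that(3,4) bil[OF s]]
    have "coset_lift (QT I J) I1 J1 ?b (trans I2 J2 I1 J1 X) = coset_lift (QT I J) I2 J2 ?b X"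
      if "X \<in> carrier (QT I2 J2)" for X
      using that \<open>I2 \<in> OI\<close> \<open>J2 \<in> OI\<close>
      by (induction X rule: QT_induct)
        (simp_all add: c1(2) c2(2) t(2) additive_map_add[OF c1(1)] additive_map_add[OF c2(1)] additive_map_add[OF t(1)] additive_map_closed[OF t(1)])
    from this[OF Q_component[OF F that(3,4)]] show ?thesis by (simp add: Q_trans[OF F] that)
  qed
  let ?I1 = "SOME I'. I' \<in> OI \<and> g ` I' \<subseteq> I" and ?J1 = "SOME J'. J' \<in> OI \<and> h ` J' \<subseteq> J"
  have I1: "?I1 \<in> OI \<and> g ` ?I1 \<subseteq> I" by (rule someI[of "\<lambda>I'. I' \<in> OI \<and> g ` I' \<subseteq> I" I']) (simp add: I')
  have J1: "?J1 \<in> OI \<and> h ` ?J1 \<subseteq> J" by (rule someI[of "\<lambda>J'. J' \<in> OI \<and> h ` J' \<subseteq> J" J']) (simp add: J')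
  have "tensor_op g h F (I, J) = coset_lift (QT I J) ?I1 ?J1 ?b (F (?I1, ?J1))"
    using IJ by (simp add: tensor_op_def Let_def)
  also have "\<dots> = coset_lift (QT I J) (?I1 \<inter> I') (?J1 \<inter> J') ?b (F (?I1 \<inter> I', ?J1 \<inter> J'))"
    using I1 J1 I' J' by (intro shrink) (auto intro: OI_Int)
  also have "\<dots> = coset_lift (QT I J) I' J' ?b (F (I', J'))"
    using I1 J1 I' J' by (intro shrink[symmetric]) (auto intro: OI_Int)
  finally show ?thesis .
qed

lemma k_continuousE:
  assumes "k_continuous g" "J \<in> OI"
  obtains J' where "J' \<in> OI" "g ` J' \<subseteq> J"
  using assms by (auto simp: k_continuous_def)

lemma tensor_op_closed:
  assumes g: "k_continuous g" and h: "k_continuous h" and F: "F \<in> carrier Q"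
  shows "tensor_op g h F \<in> carrier Q"
proof -
  have gl: "k_linear g" and hl: "k_linear h" using g h by (auto simp: k_continuous_def)
  have *: "tensor_op g h F (I, J) \<in> carrier (QT I J) \<and> trans I J I' J' (tensor_op g h F (I, J)) = tensor_op g h F (I', J')"
    if IJ: "I \<in> OI" "J \<in> OI" and IJ': "I' \<in> OI" "J' \<in> OI" and sub: "I \<subseteq> I'" "J \<subseteq> J'" for I J I' J'
  proof -
    obtain I1 where I1: "I1 \<in> OI" "g ` I1 \<subseteq> I" using k_continuousE[OF g IJ(1)] .
    obtain J1 where J1: "J1 \<in> OI" "h ` J1 \<subseteq> J" using k_continuousE[OF h IJ(2)] .
    have s: "g ` I1 \<subseteq> I'" "h ` J1 \<subseteq> J'" using I1 J1 sub by auto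
    note b = k_bilinear_pullback[OF k_bilinear_tq[OF IJ order_refl order_refl] gl I1(2) hl J1(2)]
    note b' = k_bilinear_pullback[OF k_bilinear_tq[OF IJ' order_refl order_refl] gl s(1) hl s(2)]
    note c = coset_lift[OF QT_group[OF IJ] I1(1) J1(1) b]
    note c' = coset_lift[OF QT_group[OF IJ'] I1(1) J1(1) b']
    note t = trans[OF IJ IJ' sub]
    have "trans I J I' J' (coset_lift (QT I J) I1 J1 (\<lambda>x y. tq I J (g x) (h y)) X) =
        coset_lift (QT I' J') I1 J1 (\<lambda>x y. tq I' J' (g x) (h y)) X" if "X \<in> carrier (QT I1 J1)" for X
      using that I1(1) J1(1)
      by (induction X rule: QT_induct)
        (simp_all add: c(2) c'(2) t(2) k_linear_closed[OF gl] k_linear_closed[OF hl]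
          additive_map_add[OF c(1)] additive_map_add[OF c'(1)] additive_map_add[OF t(1)] additive_map_closed[OF c(1)])
    then show ?thesis
      using tensor_op_component[OF gl hl F IJ I1 J1] tensor_op_component[OF gl hl F IJ' I1(1) s(1) J1(1) s(2)]
        additive_map_closed[OF c(1) Q_component[OF F I1(1) J1(1)]] Q_component[OF F I1(1) J1(1)]
      by simp
  qed
  have "tensor_op g h F \<in> extensional (OI \<times> OI)" by (simp add: tensor_op_def)
  with * show ?thesis by (simp add: Q_mem_iff[of "tensor_op g h F"])
qed

end

section \<open>Duality for a finite projective algebra\<close>

text \<open>The situation of a divisor stripped of its topology. The functions \<open>\<phi>\<close>
  and elements \<open>x\<close> form a dual basis of the algebra \<open>B\<close>. By
  \<open>diff\<close> and \<open>mult_d\<close> the element \<open>d\<close> generates the kernel of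
  the multiplication of \<open>B\<close>; by \<open>de\<close> and \<open>ann\<close> the element
  \<open>e\<close> generates the annihilator of \<open>d\<close>, and coefficients from the left
  factor suffice.\<close>

locale frobenius_pair = tensor_algebra A B B
  for A :: "('a, 'x) ring_scheme" (structure) and B :: "('a, 'b) module" +
  fixes n :: nat and \<phi> :: "nat \<Rightarrow> 'b \<Rightarrow> 'a" and x :: "nat \<Rightarrow> 'b"
    and d e :: "('b \<times> 'b \<Rightarrow>\<^sub>0 int) set"
  assumes \<phi>: "i < n \<Longrightarrow> \<phi> i \<in> lin_maps A B (self_module A)"
    and x: "i < n \<Longrightarrow> x i \<in> carrier B"
    and dual_basis: "b \<in> carrier B \<Longrightarrow> b = (\<Oplus>\<^bsub>B\<^esub>i\<in>{..<n}. \<phi> i b \<odot>\<^bsub>B\<^esub> x i)"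
    and d: "d \<in> carrier T" and e: "e \<in> carrier T"
    and diff: "b \<in> carrier B \<Longrightarrow> \<exists>t\<in>carrier T. d \<otimes>\<^bsub>T\<^esub> t = tn \<one>\<^bsub>B\<^esub> b \<ominus>\<^bsub>T\<^esub> tn b \<one>\<^bsub>B\<^esub>"
    and mult_d: "tensor_lift B (\<lambda>X Y. X \<otimes>\<^bsub>B\<^esub> Y) d = \<zero>\<^bsub>B\<^esub>"
    and de: "d \<otimes>\<^bsub>T\<^esub> e = \<zero>\<^bsub>T\<^esub>"
    and ann: "t \<in> carrier T \<Longrightarrow> d \<otimes>\<^bsub>T\<^esub> t = \<zero>\<^bsub>T\<^esub> \<Longrightarrow> \<exists>b\<in>carrier B. t = tn b \<one>\<^bsub>B\<^esub> \<otimes>\<^bsub>T\<^esub> e"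
begin

interpretation T: cring T by (rule cring_T)

abbreviation "Dual \<equiv> lin_maps A B (self_module A)"
abbreviation "lam b \<equiv> tn b \<one>\<^bsub>B\<^esub>"
abbreviation "rho b \<equiv> tn \<one>\<^bsub>B\<^esub> b"

text \<open>The contraction \<open>1 \<otimes> \<psi>\<close> from \<open>B \<otimes> B\<close> to
  \<open>B\<close>; at \<open>e\<close> it gives the map \<open>c\<close> that is to be
  inverted.\<close>

definition L :: "('b \<Rightarrow> 'a) \<Rightarrow> ('b \<times> 'b \<Rightarrow>\<^sub>0 int) set \<Rightarrow> 'b" where
  "L \<psi> = tensor_lift B (\<lambda>X Y. \<psi> Y \<odot>\<^bsub>B\<^esub> X)"

definition c :: "('b \<Rightarrow> 'a) \<Rightarrow> 'b" where
  "c \<psi> = L \<psi> e"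

lemma Dual_iff: "\<psi> \<in> Dual \<longleftrightarrow> \<psi> \<in> extensional (carrier B) \<and> additive_map B A \<psi> \<and>
    (\<forall>a\<in>carrier A. \<forall>b\<in>carrier B. \<psi> (a \<odot>\<^bsub>B\<^esub> b) = a \<otimes>\<^bsub>A\<^esub> \<psi> b)"
  by (auto simp: lin_maps_def self_module_def additive_map_def PiE_def)

lemma Dual_closed: "\<psi> \<in> Dual \<Longrightarrow> b \<in> carrier B \<Longrightarrow> \<psi> b \<in> carrier A"
  by (auto simp: Dual_iff additive_map_def)

lemma Dual_add: "\<psi> \<in> Dual \<Longrightarrow> a \<in> carrier B \<Longrightarrow> b \<in> carrier B \<Longrightarrow> \<psi> (a \<oplus>\<^bsub>B\<^esub> b) = \<psi> a \<oplus>\<^bsub>A\<^esub> \<psi> b"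
  by (simp add: Dual_iff additive_map_add)

lemma Dual_smult: "\<psi> \<in> Dual \<Longrightarrow> a \<in> carrier A \<Longrightarrow> b \<in> carrier B \<Longrightarrow> \<psi> (a \<odot>\<^bsub>B\<^esub> b) = a \<otimes>\<^bsub>A\<^esub> \<psi> b"
  by (simp add: Dual_iff)

lemma smult_mult: "a \<in> carrier A \<Longrightarrow> b \<in> carrier B \<Longrightarrow> b' \<in> carrier B \<Longrightarrow> a \<odot>\<^bsub>B\<^esub> (b \<otimes>\<^bsub>B\<^esub> b') = b \<otimes>\<^bsub>B\<^esub> (a \<odot>\<^bsub>B\<^esub> b')"
  by (metis left.m_comm left.smult_assoc2 left.smult_closed)

lemma Dual_translate: "\<psi> \<in> Dual \<Longrightarrow> b \<in> carrier B \<Longrightarrow> (\<lambda>X\<in>carrier B. \<psi> (b \<otimes>\<^bsub>B\<^esub> X)) \<in> Dual"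
  by (auto simp: Dual_iff additive_map_def left.r_distr smult_mult[symmetric] Pi_def)

lemma L_balanced: "\<psi> \<in> Dual \<Longrightarrow> balanced B (\<lambda>X Y. \<psi> Y \<odot>\<^bsub>B\<^esub> X)"
  by (rule balancedI)
    (simp_all add: Dual_closed Dual_add Dual_smult left.smult_r_distr left.smult_l_distr left.smult_assoc1[symmetric] left.R.m_comm)

lemma L_additive: "\<psi> \<in> Dual \<Longrightarrow> additive_map T B (L \<psi>)"
  unfolding L_def by (rule tensor_lift_additive[OF left.abelian_group_axioms L_balanced])

lemma L_closed: "\<psi> \<in> Dual \<Longrightarrow> t \<in> carrier T \<Longrightarrow> L \<psi> t \<in> carrier B"
  by (rule additive_map_closed[OF L_additive])

lemma L_add: "\<psi> \<in> Dual \<Longrightarrow> t \<in> carrier T \<Longrightarrow> u \<in> carrier T \<Longrightarrow> L \<psi> (t \<oplus>\<^bsub>T\<^esub> u) = L \<psi> t \<oplus>\<^bsub>B\<^esub> L \<psi> u"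
  by (rule additive_map_add[OF L_additive])

lemma L_tn: "\<psi> \<in> Dual \<Longrightarrow> a \<in> carrier B \<Longrightarrow> b \<in> carrier B \<Longrightarrow> L \<psi> (tn a b) = \<psi> b \<odot>\<^bsub>B\<^esub> a"
  unfolding L_def by (rule tensor_lift_tn[OF left.abelian_group_axioms L_balanced])

lemma L_lam:
  assumes "\<psi> \<in> Dual" "b \<in> carrier B" "t \<in> carrier T"
  shows "L \<psi> (lam b \<otimes>\<^bsub>T\<^esub> t) = b \<otimes>\<^bsub>B\<^esub> L \<psi> t"
  using assms(3)
  by (induction t rule: T_induct)
    (use assms in \<open>simp_all add: mult_tn L_tn tn_closed Dual_closed smult_mult L_add L_closed T.r_distr left.r_distr\<close>)

lemma L_rho:
  assumes "\<psi> \<in> Dual" "b \<in> carrier B" "t \<in> carrier T"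
  shows "L \<psi> (rho b \<otimes>\<^bsub>T\<^esub> t) = L (\<lambda>X\<in>carrier B. \<psi> (b \<otimes>\<^bsub>B\<^esub> X)) t"
proof -
  define \<chi> where "\<chi> = (\<lambda>X\<in>carrier B. \<psi> (b \<otimes>\<^bsub>B\<^esub> X))"
  have \<chi>: "\<chi> \<in> Dual" "\<And>X. X \<in> carrier B \<Longrightarrow> \<chi> X = \<psi> (b \<otimes>\<^bsub>B\<^esub> X)"
    using Dual_translate[OF assms(1,2)] by (simp_all add: \<chi>_def)
  have "L \<psi> (rho b \<otimes>\<^bsub>T\<^esub> t) = L \<chi> t"
    using assms(3)
    by (induction t rule: T_induct)
      (use assms \<chi> in \<open>simp_all add: mult_tn L_tn tn_closed L_add L_closed T.r_distr\<close>)
  then show ?thesis by (simp add: \<chi>_def)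
qed

lemma lam_closed: "b \<in> carrier B \<Longrightarrow> lam b \<in> carrier T" "b \<in> carrier B \<Longrightarrow> rho b \<in> carrier T"
  by (simp_all add: tn_closed)

text \<open>Over its left factor, \<open>B \<otimes> B\<close> inherits the dual basis of
  \<open>B\<close>: the coordinates become the contractions \<open>L (\<phi> i)\<close> and the
  basis elements become \<open>1 \<otimes> x i\<close>.\<close>

lemma expand:
  assumes "t \<in> carrier T"
  shows "t = (\<Oplus>\<^bsub>T\<^esub>i\<in>{..<n}. lam (L (\<phi> i) t) \<otimes>\<^bsub>T\<^esub> rho (x i))"
  using assms
proof (induction t rule: T_induct)
  case (tens a b)
  have "(\<Oplus>\<^bsub>T\<^esub>i\<in>{..<n}. lam (L (\<phi> i) (tn a b)) \<otimes>\<^bsub>T\<^esub> rho (x i)) = (\<Oplus>\<^bsub>T\<^esub>i\<in>{..<n}. tn a (\<phi> i b \<odot>\<^bsub>B\<^esub> x i))"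
    using tens by (intro T.finsum_cong') (simp_all add: L_tn mult_tn \<phi> x Dual_closed[OF \<phi>] tn_balanced tn_closed left.smult_assoc2)
  also have "\<dots> = tn a (\<Oplus>\<^bsub>B\<^esub>i\<in>{..<n}. \<phi> i b \<odot>\<^bsub>B\<^esub> x i)"
    using tens by (intro additive_map_finsum[OF left.abelian_group_axioms T.abelian_group_axioms tn_additive_right, symmetric])
      (simp_all add: Dual_closed[OF \<phi>] x)
  also have "\<dots> = tn a b" using dual_basis[OF tens(2)] by simp
  finally show ?case by simp
next
  case (add t u)
  have "(\<Oplus>\<^bsub>T\<^esub>i\<in>{..<n}. lam (L (\<phi> i) (t \<oplus>\<^bsub>T\<^esub> u)) \<otimes>\<^bsub>T\<^esub> rho (x i)) =
      (\<Oplus>\<^bsub>T\<^esub>i\<in>{..<n}. lam (L (\<phi> i) t) \<otimes>\<^bsub>T\<^esub> rho (x i) \<oplus>\<^bsub>T\<^esub> lam (L (\<phi> i) u) \<otimes>\<^bsub>T\<^esub> rho (x i))"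
    using add by (intro T.finsum_cong') (simp_all add: L_add L_closed \<phi> x tn_add_left tn_closed T.l_distr)
  also have "\<dots> = t \<oplus>\<^bsub>T\<^esub> u"
    using add by (subst T.finsum_addf) (simp_all add: L_closed \<phi> x tn_closed add(3,4)[symmetric])
  finally show ?case by simp
qed

lemma c_closed: "\<psi> \<in> Dual \<Longrightarrow> c \<psi> \<in> carrier B"
  by (simp add: c_def L_closed e)

text \<open>The difference of the two factors is a multiple of \<open>d\<close>, and
  \<open>d\<close> annihilates \<open>e\<close>. Hence the two actions of \<open>B\<close> agree on
  \<open>e\<close>.\<close>

lemma d_rho_lam:
  assumes "b \<in> carrier B"
  shows "rho b \<otimes>\<^bsub>T\<^esub> e = lam b \<otimes>\<^bsub>T\<^esub> e"
proof -
  obtain t where t: "t \<in> carrier T" "d \<otimes>\<^bsub>T\<^esub> t = rho b \<ominus>\<^bsub>T\<^esub> lam b" using diff[OF assms] by blast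
  have "(rho b \<ominus>\<^bsub>T\<^esub> lam b) \<otimes>\<^bsub>T\<^esub> e = t \<otimes>\<^bsub>T\<^esub> (d \<otimes>\<^bsub>T\<^esub> e)"
    using t d e by (simp add: t(2)[symmetric] T.m_ac)
  then have "rho b \<otimes>\<^bsub>T\<^esub> e \<ominus>\<^bsub>T\<^esub> lam b \<otimes>\<^bsub>T\<^esub> e = \<zero>\<^bsub>T\<^esub>"
    using t e assms by (simp add: de a_minus_def T.l_distr T.l_minus lam_closed)
  then show ?thesis using e assms by (simp add: T.minus_eq_zero_iff lam_closed)
qed

text \<open>This is the \<open>B\<close>-linearity of \<open>c\<close>: translating the functional
  acts through the right factor, and on \<open>e\<close> the right factor may be traded for the left
  one.\<close>

lemma c_translate:
  assumes "\<psi> \<in> Dual" "b \<in> carrier B"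
  shows "c (\<lambda>X\<in>carrier B. \<psi> (b \<otimes>\<^bsub>B\<^esub> X)) = b \<otimes>\<^bsub>B\<^esub> c \<psi>"
  unfolding c_def using L_rho[OF assms e] L_lam[OF assms e] d_rho_lam[OF assms(2)] by simp

definition m :: "('b \<times> 'b \<Rightarrow>\<^sub>0 int) set \<Rightarrow> 'b" where
  "m = tensor_lift B (\<lambda>X Y. X \<otimes>\<^bsub>B\<^esub> Y)"

lemma m:
  shows "additive_map T B m" "\<And>a b. a \<in> carrier B \<Longrightarrow> b \<in> carrier B \<Longrightarrow> m (tn a b) = a \<otimes>\<^bsub>B\<^esub> b"
    "\<And>t u. t \<in> carrier T \<Longrightarrow> u \<in> carrier T \<Longrightarrow> m (t \<otimes>\<^bsub>T\<^esub> u) = m t \<otimes>\<^bsub>B\<^esub> m u"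
proof -
  have bal: "balanced B (\<lambda>X Y. X \<otimes>\<^bsub>B\<^esub> Y)"
    by (rule balancedI) (simp_all add: left.l_distr left.r_distr left.smult_assoc2 smult_mult)
  show "additive_map T B m" unfolding m_def by (rule tensor_lift_additive[OF left.abelian_group_axioms bal])
  show "m (tn a b) = a \<otimes>\<^bsub>B\<^esub> b" if "a \<in> carrier B" "b \<in> carrier B" for a b
    unfolding m_def by (rule tensor_lift_tn[OF left.abelian_group_axioms bal that])
  show "m (t \<otimes>\<^bsub>T\<^esub> u) = m t \<otimes>\<^bsub>B\<^esub> m u" if "t \<in> carrier T" "u \<in> carrier T" for t u
    unfolding m_def by (rule tensor_lift_mult[OF left.is_cring bal _ that]) (simp add: left.m_ac)
qed

lemma L_finsum:
  assumes "\<psi> \<in> Dual" "g \<in> {..<n} \<rightarrow> carrier T"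
  shows "L \<psi> (\<Oplus>\<^bsub>T\<^esub>i\<in>{..<n}. g i) = (\<Oplus>\<^bsub>B\<^esub>i\<in>{..<n}. L \<psi> (g i))"
  by (rule additive_map_finsum[OF T.abelian_group_axioms left.abelian_group_axioms L_additive[OF assms(1)] assms(2)])

lemma m_expand:
  assumes "t \<in> carrier T"
  shows "m t = (\<Oplus>\<^bsub>B\<^esub>i\<in>{..<n}. L (\<phi> i) t \<otimes>\<^bsub>B\<^esub> x i)"
proof -
  have "m t = m (\<Oplus>\<^bsub>T\<^esub>i\<in>{..<n}. lam (L (\<phi> i) t) \<otimes>\<^bsub>T\<^esub> rho (x i))" using expand[OF assms] by simp
  also have "\<dots> = (\<Oplus>\<^bsub>B\<^esub>i\<in>{..<n}. m (lam (L (\<phi> i) t) \<otimes>\<^bsub>T\<^esub> rho (x i)))"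
    by (rule additive_map_finsum[OF T.abelian_group_axioms left.abelian_group_axioms m(1)])
      (simp add: lam_closed L_closed assms \<phi> x)
  also have "\<dots> = (\<Oplus>\<^bsub>B\<^esub>i\<in>{..<n}. L (\<phi> i) t \<otimes>\<^bsub>B\<^esub> x i)"
    by (rule left.finsum_cong') (simp_all add: lam_closed L_closed assms \<phi> x m)
  finally show ?thesis .
qed

text \<open>
  The operator \<open>p = id - q \<circ> d\<close> with \<open>q t = \<Sum> L\<^sub>i(t) q\<^sub>i\<close> and \<open>d q\<^sub>i = 1 \<otimes> x\<^sub>i - x\<^sub>i \<otimes> 1\<close> projects onto
  the annihilator of \<open>d\<close>, which \<open>e\<close> generates.  The trace of \<open>p\<close> is \<open>1\<close>, as \<open>d \<circ> q\<close> is the projection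
  onto the kernel of the multiplication.
\<close>

lemma ex_unit:
  obtains s where "\<And>j. j < n \<Longrightarrow> s j \<in> carrier B" "(\<Oplus>\<^bsub>B\<^esub>j\<in>{..<n}. s j \<otimes>\<^bsub>B\<^esub> c (\<phi> j)) = \<one>\<^bsub>B\<^esub>"
proof -
  have "\<forall>i\<in>{..<n}. \<exists>t. t \<in> carrier T \<and> d \<otimes>\<^bsub>T\<^esub> t = rho (x i) \<ominus>\<^bsub>T\<^esub> lam (x i)"
    using diff x by blast
  then obtain q where q: "\<And>i. i < n \<Longrightarrow> q i \<in> carrier T" "\<And>i. i < n \<Longrightarrow> d \<otimes>\<^bsub>T\<^esub> q i = rho (x i) \<ominus>\<^bsub>T\<^esub> lam (x i)"
    by (auto dest!: bchoice)
  \<comment> \<open>\<open>g j\<close>, \<open>h j\<close> and \<open>p j\<close> are the values at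
    \<open>1 \<otimes> x j\<close> of multiplication by \<open>d\<close>, of
    \<open>q \<circ> d\<close> and of the projection.\<close>
  define g where "g j = d \<otimes>\<^bsub>T\<^esub> rho (x j)" for j
  have g: "g j \<in> carrier T" if "j < n" for j using that x d by (simp add: g_def lam_closed)
  define h where "h j = (\<Oplus>\<^bsub>T\<^esub>i\<in>{..<n}. lam (L (\<phi> i) (g j)) \<otimes>\<^bsub>T\<^esub> q i)" for j
  have hc: "h j \<in> carrier T" if "j < n" for j
    unfolding h_def using that by (intro T.finsum_closed) (simp add: lam_closed L_closed g \<phi> q)
  define p where "p j = rho (x j) \<ominus>\<^bsub>T\<^esub> h j" for j
  have pc: "p j \<in> carrier T" if "j < n" for j using that hc x by (simp add: p_def lam_closed)
  have mg: "m (g j) = \<zero>\<^bsub>B\<^esub>" if "j < n" for j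
    using that mult_d x d by (simp add: g_def m(3) lam_closed m_def[symmetric] additive_map_closed[OF m(1)])
  \<comment> \<open>On the kernel of the multiplication \<open>d \<circ> q\<close> is the identity:
    the sum splits into the expansion of \<open>g j\<close> and the term
    \<open>m (g j) \<otimes> 1\<close>, which vanishes.\<close>
  have dh: "d \<otimes>\<^bsub>T\<^esub> h j = g j" if j: "j < n" for j
  proof -
    have "d \<otimes>\<^bsub>T\<^esub> h j = (\<Oplus>\<^bsub>T\<^esub>i\<in>{..<n}. d \<otimes>\<^bsub>T\<^esub> (lam (L (\<phi> i) (g j)) \<otimes>\<^bsub>T\<^esub> q i))"
      unfolding h_def using j by (intro T.finsum_rdistr) (simp_all add: d lam_closed L_closed g \<phi> q)
    also have "\<dots> = (\<Oplus>\<^bsub>T\<^esub>i\<in>{..<n}. lam (L (\<phi> i) (g j)) \<otimes>\<^bsub>T\<^esub> rho (x i) \<oplus>\<^bsub>T\<^esub> \<ominus>\<^bsub>T\<^esub> lam (L (\<phi> i) (g j) \<otimes>\<^bsub>B\<^esub> x i))"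
    proof (rule T.finsum_cong')
      fix i assume "i \<in> {..<n}"
      then have i: "i < n" by simp
      have "d \<otimes>\<^bsub>T\<^esub> (lam (L (\<phi> i) (g j)) \<otimes>\<^bsub>T\<^esub> q i) = lam (L (\<phi> i) (g j)) \<otimes>\<^bsub>T\<^esub> (d \<otimes>\<^bsub>T\<^esub> q i)"
        using i j d by (simp add: T.m_lcomm lam_closed L_closed g \<phi> q(1))
      also have "\<dots> = lam (L (\<phi> i) (g j)) \<otimes>\<^bsub>T\<^esub> rho (x i) \<oplus>\<^bsub>T\<^esub> \<ominus>\<^bsub>T\<^esub> (lam (L (\<phi> i) (g j)) \<otimes>\<^bsub>T\<^esub> lam (x i))"
        using i j by (simp add: q(2) a_minus_def T.r_distr T.r_minus lam_closed L_closed g \<phi> x)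
      finally show "d \<otimes>\<^bsub>T\<^esub> (lam (L (\<phi> i) (g j)) \<otimes>\<^bsub>T\<^esub> q i) =
          lam (L (\<phi> i) (g j)) \<otimes>\<^bsub>T\<^esub> rho (x i) \<oplus>\<^bsub>T\<^esub> \<ominus>\<^bsub>T\<^esub> lam (L (\<phi> i) (g j) \<otimes>\<^bsub>B\<^esub> x i)"
        using i j by (simp add: mult_tn L_closed g \<phi> x)
    qed (use j in \<open>simp_all add: lam_closed L_closed g \<phi> x\<close>)
    also have "\<dots> = g j \<oplus>\<^bsub>T\<^esub> (\<Oplus>\<^bsub>T\<^esub>i\<in>{..<n}. \<ominus>\<^bsub>T\<^esub> lam (L (\<phi> i) (g j) \<otimes>\<^bsub>B\<^esub> x i))"
      using j by (subst T.finsum_addf) (simp_all add: lam_closed L_closed g \<phi> x expand[symmetric])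
    also have "(\<Oplus>\<^bsub>T\<^esub>i\<in>{..<n}. \<ominus>\<^bsub>T\<^esub> lam (L (\<phi> i) (g j) \<otimes>\<^bsub>B\<^esub> x i)) = \<ominus>\<^bsub>T\<^esub> lam (\<Oplus>\<^bsub>B\<^esub>i\<in>{..<n}. L (\<phi> i) (g j) \<otimes>\<^bsub>B\<^esub> x i)"
      using j by (intro additive_map_finsum[OF left.abelian_group_axioms T.abelian_group_axioms, of "\<lambda>b. \<ominus>\<^bsub>T\<^esub> lam b", symmetric] additive_mapI)
        (auto simp: lam_closed L_closed g \<phi> x tn_add_left T.minus_add)
    also have "(\<Oplus>\<^bsub>B\<^esub>i\<in>{..<n}. L (\<phi> i) (g j) \<otimes>\<^bsub>B\<^esub> x i) = \<zero>\<^bsub>B\<^esub>"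
      using m_expand[OF g[OF j]] mg[OF j] by simp
    also have "lam \<zero>\<^bsub>B\<^esub> = \<zero>\<^bsub>T\<^esub>"
      by (rule additive_map_zero[OF left.abelian_group_axioms T.abelian_group_axioms tn_additive_left]) simp
    finally show ?thesis using g[OF j] by (simp add: T.minus_zero)
  qed
  have "\<exists>b\<in>carrier B. p j = lam b \<otimes>\<^bsub>T\<^esub> e" if j: "j < n" for j
  proof (rule ann[OF pc[OF j]])
    have "d \<otimes>\<^bsub>T\<^esub> p j = g j \<ominus>\<^bsub>T\<^esub> d \<otimes>\<^bsub>T\<^esub> h j"
      using j x d hc by (simp add: p_def g_def a_minus_def T.r_distr T.r_minus lam_closed)
    then show "d \<otimes>\<^bsub>T\<^esub> p j = \<zero>\<^bsub>T\<^esub>" using dh[OF j] g[OF j] by (simp add: T.minus_eq_zero_iff)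
  qed
  then have "\<forall>j\<in>{..<n}. \<exists>b. b \<in> carrier B \<and> p j = lam b \<otimes>\<^bsub>T\<^esub> e" by blast
  then obtain s where s: "\<And>j. j < n \<Longrightarrow> s j \<in> carrier B" "\<And>j. j < n \<Longrightarrow> p j = lam (s j) \<otimes>\<^bsub>T\<^esub> e"
    by (auto dest!: bchoice)
  \<comment> \<open>The trace of the identity of \<open>B\<close>. It occurs in the traces of the
    identity and of \<open>d \<circ> q\<close> and cancels at the end.\<close>
  define W where "W = (\<Oplus>\<^bsub>B\<^esub>j\<in>{..<n}. \<phi> j (x j) \<odot>\<^bsub>B\<^esub> \<one>\<^bsub>B\<^esub>)"
  have Wc: "W \<in> carrier B" by (simp add: W_def Dual_closed[OF \<phi>] x)
  have Lh: "L (\<phi> j) (h j) = (\<Oplus>\<^bsub>B\<^esub>i\<in>{..<n}. L (\<phi> i) (g j) \<otimes>\<^bsub>B\<^esub> L (\<phi> j) (q i))" if j: "j < n" for j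
    unfolding h_def using j
    by (subst L_finsum) (auto simp: \<phi> lam_closed L_closed g q L_lam intro!: left.finsum_cong')
  \<comment> \<open>Summation over \<open>j\<close> reassembles \<open>q i\<close> from its
    expansion and leaves the \<open>i\<close>-th term of the trace of
    \<open>d \<circ> q\<close>.\<close>
  have Lq: "(\<Oplus>\<^bsub>B\<^esub>j\<in>{..<n}. L (\<phi> i) (g j) \<otimes>\<^bsub>B\<^esub> L (\<phi> j) (q i)) = L (\<phi> i) (d \<otimes>\<^bsub>T\<^esub> q i)" if i: "i < n" for i
  proof -
    have "d \<otimes>\<^bsub>T\<^esub> q i = d \<otimes>\<^bsub>T\<^esub> (\<Oplus>\<^bsub>T\<^esub>j\<in>{..<n}. lam (L (\<phi> j) (q i)) \<otimes>\<^bsub>T\<^esub> rho (x j))" using expand[OF q(1)[OF i]] by simp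
    also have "\<dots> = (\<Oplus>\<^bsub>T\<^esub>j\<in>{..<n}. d \<otimes>\<^bsub>T\<^esub> (lam (L (\<phi> j) (q i)) \<otimes>\<^bsub>T\<^esub> rho (x j)))"
      using i by (intro T.finsum_rdistr) (simp_all add: d lam_closed L_closed \<phi> q x)
    also have "\<dots> = (\<Oplus>\<^bsub>T\<^esub>j\<in>{..<n}. lam (L (\<phi> j) (q i)) \<otimes>\<^bsub>T\<^esub> g j)"
      using i by (intro T.finsum_cong') (simp_all add: g_def T.m_lcomm d lam_closed L_closed \<phi> q x)
    finally have "L (\<phi> i) (d \<otimes>\<^bsub>T\<^esub> q i) = (\<Oplus>\<^bsub>B\<^esub>j\<in>{..<n}. L (\<phi> i) (lam (L (\<phi> j) (q i)) \<otimes>\<^bsub>T\<^esub> g j))"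
      using i by (simp add: L_finsum \<phi> lam_closed L_closed q g)
    also have "\<dots> = (\<Oplus>\<^bsub>B\<^esub>j\<in>{..<n}. L (\<phi> i) (g j) \<otimes>\<^bsub>B\<^esub> L (\<phi> j) (q i))"
      using i by (intro left.finsum_cong') (simp_all add: L_lam L_closed \<phi> q g left.m_comm)
    finally show ?thesis by simp
  qed
  have Ldq: "L (\<phi> i) (d \<otimes>\<^bsub>T\<^esub> q i) = \<phi> i (x i) \<odot>\<^bsub>B\<^esub> \<one>\<^bsub>B\<^esub> \<ominus>\<^bsub>B\<^esub> \<phi> i \<one>\<^bsub>B\<^esub> \<odot>\<^bsub>B\<^esub> x i" if i: "i < n" for i
    using i by (simp add: q(2) additive_map_minus[OF T.abelian_group_axioms left.abelian_group_axioms L_additive] \<phi> L_tn x lam_closed)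
  have Lp: "L (\<phi> j) (p j) = \<phi> j (x j) \<odot>\<^bsub>B\<^esub> \<one>\<^bsub>B\<^esub> \<ominus>\<^bsub>B\<^esub> L (\<phi> j) (h j)" if "j < n" for j
    using that by (simp add: p_def additive_map_minus[OF T.abelian_group_axioms left.abelian_group_axioms L_additive] \<phi> L_tn x lam_closed hc)
  have "(\<Oplus>\<^bsub>B\<^esub>j\<in>{..<n}. s j \<otimes>\<^bsub>B\<^esub> c (\<phi> j)) = (\<Oplus>\<^bsub>B\<^esub>j\<in>{..<n}. L (\<phi> j) (p j))"
    by (rule left.finsum_cong') (simp_all add: s L_lam \<phi> e c_def L_closed)
  also have "\<dots> = (\<Oplus>\<^bsub>B\<^esub>j\<in>{..<n}. \<phi> j (x j) \<odot>\<^bsub>B\<^esub> \<one>\<^bsub>B\<^esub> \<oplus>\<^bsub>B\<^esub> \<ominus>\<^bsub>B\<^esub> L (\<phi> j) (h j))"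
    by (rule left.finsum_cong') (simp_all add: Lp \<phi> x hc L_closed Dual_closed[OF \<phi>] a_minus_def)
  also have "\<dots> = W \<oplus>\<^bsub>B\<^esub> (\<Oplus>\<^bsub>B\<^esub>j\<in>{..<n}. \<ominus>\<^bsub>B\<^esub> L (\<phi> j) (h j))"
    unfolding W_def by (rule left.finsum_addf) (simp_all add: \<phi> x hc L_closed Dual_closed[OF \<phi>])
  also have "(\<Oplus>\<^bsub>B\<^esub>j\<in>{..<n}. \<ominus>\<^bsub>B\<^esub> L (\<phi> j) (h j)) = \<ominus>\<^bsub>B\<^esub> (\<Oplus>\<^bsub>B\<^esub>j\<in>{..<n}. L (\<phi> j) (h j))"
    by (rule additive_map_finsum[OF left.abelian_group_axioms left.abelian_group_axioms, of "\<lambda>b. \<ominus>\<^bsub>B\<^esub> b", symmetric])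
      (auto intro!: additive_mapI simp: left.minus_add L_closed \<phi> hc)
  \<comment> \<open>The trace of \<open>q \<circ> d\<close> is turned into that of
    \<open>d \<circ> q\<close>, whose terms are explicit because \<open>d\<close> times
    \<open>q i\<close> is a known difference.\<close>
  also have "(\<Oplus>\<^bsub>B\<^esub>j\<in>{..<n}. L (\<phi> j) (h j)) = (\<Oplus>\<^bsub>B\<^esub>j\<in>{..<n}. \<Oplus>\<^bsub>B\<^esub>i\<in>{..<n}. L (\<phi> i) (g j) \<otimes>\<^bsub>B\<^esub> L (\<phi> j) (q i))"
    by (rule left.finsum_cong') (simp_all add: Lh L_closed \<phi> g q)
  also have "\<dots> = (\<Oplus>\<^bsub>B\<^esub>i\<in>{..<n}. \<Oplus>\<^bsub>B\<^esub>j\<in>{..<n}. L (\<phi> i) (g j) \<otimes>\<^bsub>B\<^esub> L (\<phi> j) (q i))"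
    by (rule left.finsum_swap) (simp_all add: L_closed \<phi> g q)
  also have "\<dots> = (\<Oplus>\<^bsub>B\<^esub>i\<in>{..<n}. \<phi> i (x i) \<odot>\<^bsub>B\<^esub> \<one>\<^bsub>B\<^esub> \<oplus>\<^bsub>B\<^esub> \<ominus>\<^bsub>B\<^esub> (\<phi> i \<one>\<^bsub>B\<^esub> \<odot>\<^bsub>B\<^esub> x i))"
    by (rule left.finsum_cong') (simp_all add: Lq Ldq a_minus_def Dual_closed[OF \<phi>] x)
  also have "\<dots> = W \<oplus>\<^bsub>B\<^esub> (\<Oplus>\<^bsub>B\<^esub>i\<in>{..<n}. \<ominus>\<^bsub>B\<^esub> (\<phi> i \<one>\<^bsub>B\<^esub> \<odot>\<^bsub>B\<^esub> x i))"
    unfolding W_def by (rule left.finsum_addf) (simp_all add: x Dual_closed[OF \<phi>])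
  also have "(\<Oplus>\<^bsub>B\<^esub>i\<in>{..<n}. \<ominus>\<^bsub>B\<^esub> (\<phi> i \<one>\<^bsub>B\<^esub> \<odot>\<^bsub>B\<^esub> x i)) = \<ominus>\<^bsub>B\<^esub> (\<Oplus>\<^bsub>B\<^esub>i\<in>{..<n}. \<phi> i \<one>\<^bsub>B\<^esub> \<odot>\<^bsub>B\<^esub> x i)"
    by (rule additive_map_finsum[OF left.abelian_group_axioms left.abelian_group_axioms, of "\<lambda>b. \<ominus>\<^bsub>B\<^esub> b", symmetric])
      (auto intro!: additive_mapI simp: left.minus_add Dual_closed[OF \<phi>] x)
  \<comment> \<open>This sum expands the unit in the dual basis; the unit is all that remains of the
    trace of the projection.\<close>
  also have "(\<Oplus>\<^bsub>B\<^esub>i\<in>{..<n}. \<phi> i \<one>\<^bsub>B\<^esub> \<odot>\<^bsub>B\<^esub> x i) = \<one>\<^bsub>B\<^esub>" using dual_basis[of "\<one>\<^bsub>B\<^esub>"] by simp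
  also have "W \<oplus>\<^bsub>B\<^esub> \<ominus>\<^bsub>B\<^esub> (W \<oplus>\<^bsub>B\<^esub> \<ominus>\<^bsub>B\<^esub> \<one>\<^bsub>B\<^esub>) = \<one>\<^bsub>B\<^esub>"
    using Wc by (simp add: left.minus_add left.r_neg2)
  finally show ?thesis using that s(1) by blast
qed

text \<open>The coefficients of \<open>ex_unit\<close> combine the \<open>\<phi> j\<close> into a
  functional \<open>\<epsilon>\<close> with \<open>c \<epsilon> = 1\<close>, and linearity of
  \<open>c\<close> gives surjectivity. The inverse formula comes from a symmetry: contracting
  \<open>e\<close> with \<open>\<epsilon>\<close> on the left also gives 1.\<close>

theorem ex_generator:
  obtains \<epsilon> where "\<epsilon> \<in> Dual" "\<And>b. b \<in> carrier B \<Longrightarrow> c (\<lambda>X\<in>carrier B. \<epsilon> (b \<otimes>\<^bsub>B\<^esub> X)) = b"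
    "\<And>\<psi> X. \<psi> \<in> Dual \<Longrightarrow> X \<in> carrier B \<Longrightarrow> \<psi> X = \<epsilon> (c \<psi> \<otimes>\<^bsub>B\<^esub> X)"
proof -
  obtain s where s: "\<And>j. j < n \<Longrightarrow> s j \<in> carrier B" "(\<Oplus>\<^bsub>B\<^esub>j\<in>{..<n}. s j \<otimes>\<^bsub>B\<^esub> c (\<phi> j)) = \<one>\<^bsub>B\<^esub>"
    using ex_unit by blast
  define tr where "tr j = (\<lambda>X\<in>carrier B. \<phi> j (s j \<otimes>\<^bsub>B\<^esub> X))" for j
  have tr: "tr j \<in> Dual" if "j < n" for j using that \<phi> s(1) Dual_translate by (simp add: tr_def)
  have tr_app: "tr j X = \<phi> j (s j \<otimes>\<^bsub>B\<^esub> X)" if "X \<in> carrier B" for j X using that by (simp add: tr_def)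
  define \<epsilon> where "\<epsilon> = (\<lambda>X\<in>carrier B. \<Oplus>\<^bsub>A\<^esub>j\<in>{..<n}. \<phi> j (s j \<otimes>\<^bsub>B\<^esub> X))"
  have cl: "\<phi> j (s j \<otimes>\<^bsub>B\<^esub> X) \<in> carrier A" if "j < n" "X \<in> carrier B" for j X
    using that by (simp add: Dual_closed[OF \<phi>] s)
  have \<epsilon>: "\<epsilon> \<in> Dual"
    unfolding Dual_iff
  proof (intro conjI ballI additive_mapI)
    fix X Y assume X: "X \<in> carrier B" and Y: "Y \<in> carrier B"
    have "(\<Oplus>\<^bsub>A\<^esub>j\<in>{..<n}. \<phi> j (s j \<otimes>\<^bsub>B\<^esub> (X \<oplus>\<^bsub>B\<^esub> Y))) =
        (\<Oplus>\<^bsub>A\<^esub>j\<in>{..<n}. \<phi> j (s j \<otimes>\<^bsub>B\<^esub> X) \<oplus>\<^bsub>A\<^esub> \<phi> j (s j \<otimes>\<^bsub>B\<^esub> Y))"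
      using X Y by (intro left.R.finsum_cong') (simp_all add: left.r_distr s Dual_add[OF \<phi>] Dual_closed[OF \<phi>])
    also have "\<dots> = (\<Oplus>\<^bsub>A\<^esub>j\<in>{..<n}. \<phi> j (s j \<otimes>\<^bsub>B\<^esub> X)) \<oplus>\<^bsub>A\<^esub> (\<Oplus>\<^bsub>A\<^esub>j\<in>{..<n}. \<phi> j (s j \<otimes>\<^bsub>B\<^esub> Y))"
      using X Y by (intro left.R.finsum_addf) (simp_all add: cl)
    finally show "\<epsilon> (X \<oplus>\<^bsub>B\<^esub> Y) = \<epsilon> X \<oplus>\<^bsub>A\<^esub> \<epsilon> Y" using X Y by (simp add: \<epsilon>_def)
  next
    fix a X assume a: "a \<in> carrier A" and X: "X \<in> carrier B"
    have "(\<Oplus>\<^bsub>A\<^esub>j\<in>{..<n}. \<phi> j (s j \<otimes>\<^bsub>B\<^esub> (a \<odot>\<^bsub>B\<^esub> X))) = (\<Oplus>\<^bsub>A\<^esub>j\<in>{..<n}. a \<otimes>\<^bsub>A\<^esub> \<phi> j (s j \<otimes>\<^bsub>B\<^esub> X))"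
      using a X by (intro left.R.finsum_cong') (simp_all add: smult_mult[symmetric] s Dual_smult[OF \<phi>] Dual_closed[OF \<phi>])
    also have "\<dots> = a \<otimes>\<^bsub>A\<^esub> (\<Oplus>\<^bsub>A\<^esub>j\<in>{..<n}. \<phi> j (s j \<otimes>\<^bsub>B\<^esub> X))"
      using a X by (intro left.R.finsum_rdistr[symmetric]) (simp_all add: cl)
    finally show "\<epsilon> (a \<odot>\<^bsub>B\<^esub> X) = a \<otimes>\<^bsub>A\<^esub> \<epsilon> X" using a X by (simp add: \<epsilon>_def)
  qed (auto simp: \<epsilon>_def cl)
  \<comment> \<open>The contraction is additive in the functional, so \<open>\<epsilon>\<close> may
    be contracted summand by summand.\<close>
  have Le: "L \<epsilon> t = (\<Oplus>\<^bsub>B\<^esub>j\<in>{..<n}. L (tr j) t)" if "t \<in> carrier T" for t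
    using that
  proof (induction t rule: T_induct)
    case (tens a b)
    have "L \<epsilon> (tn a b) = (\<Oplus>\<^bsub>A\<^esub>j\<in>{..<n}. \<phi> j (s j \<otimes>\<^bsub>B\<^esub> b)) \<odot>\<^bsub>B\<^esub> a"
      using tens \<epsilon> by (simp add: L_tn) (simp add: \<epsilon>_def)
    also have "\<dots> = (\<Oplus>\<^bsub>B\<^esub>j\<in>{..<n}. \<phi> j (s j \<otimes>\<^bsub>B\<^esub> b) \<odot>\<^bsub>B\<^esub> a)"
      using tens by (intro additive_map_finsum[OF left.R.abelian_group_axioms left.abelian_group_axioms] additive_mapI)
        (auto simp: left.smult_l_distr cl)
    also have "\<dots> = (\<Oplus>\<^bsub>B\<^esub>j\<in>{..<n}. L (tr j) (tn a b))"
      using tens by (intro left.finsum_cong') (auto simp: L_tn[OF tr] tr_app cl)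
    finally show ?case .
  next
    case (add t u)
    have "(\<Oplus>\<^bsub>B\<^esub>j\<in>{..<n}. L (tr j) (t \<oplus>\<^bsub>T\<^esub> u)) = (\<Oplus>\<^bsub>B\<^esub>j\<in>{..<n}. L (tr j) t \<oplus>\<^bsub>B\<^esub> L (tr j) u)"
      using add by (intro left.finsum_cong') (auto simp: L_add[OF tr] L_closed[OF tr])
    also have "\<dots> = L \<epsilon> t \<oplus>\<^bsub>B\<^esub> L \<epsilon> u"
      using add by (subst left.finsum_addf) (auto simp: L_closed[OF tr])
    finally show ?case using add \<epsilon> by (simp add: L_add)
  qed
  have "(\<Oplus>\<^bsub>B\<^esub>j\<in>{..<n}. L (tr j) e) = (\<Oplus>\<^bsub>B\<^esub>j\<in>{..<n}. s j \<otimes>\<^bsub>B\<^esub> c (\<phi> j))"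
    using c_translate[OF \<phi> s(1)] by (intro left.finsum_cong') (auto simp: tr_def c_def s L_closed \<phi> e)
  then have ce: "c \<epsilon> = \<one>\<^bsub>B\<^esub>" using Le[OF e] s(2) by (simp add: c_def)
  then have gen: "c (\<lambda>X\<in>carrier B. \<epsilon> (b \<otimes>\<^bsub>B\<^esub> X)) = b" if "b \<in> carrier B" for b
    using that c_translate[OF \<epsilon> that] by simp
  \<comment> \<open>As \<open>e\<close> is the sum of the tensors
    \<open>c (\<phi> i) \<otimes> x i\<close>, this is the contraction of \<open>e\<close> with
    \<open>\<epsilon>\<close> in the left factor.\<close>
  define u where "u = (\<Oplus>\<^bsub>B\<^esub>i\<in>{..<n}. \<epsilon> (c (\<phi> i)) \<odot>\<^bsub>B\<^esub> x i)"
  have uc: "u \<in> carrier B" by (simp add: u_def Dual_closed[OF \<epsilon>] c_closed \<phi> x)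
  \<comment> \<open>Both sides are the value of \<open>\<epsilon> \<otimes> \<psi>\<close> at
    \<open>e\<close>, with the two factors contracted in either order.\<close>
  have eps_c: "\<epsilon> (c \<psi>) = \<psi> u" if \<psi>: "\<psi> \<in> Dual" for \<psi>
  proof -
    have "c \<psi> = L \<psi> (\<Oplus>\<^bsub>T\<^esub>i\<in>{..<n}. lam (L (\<phi> i) e) \<otimes>\<^bsub>T\<^esub> rho (x i))"
      using expand[OF e] by (simp add: c_def)
    also have "\<dots> = (\<Oplus>\<^bsub>B\<^esub>i\<in>{..<n}. \<psi> (x i) \<odot>\<^bsub>B\<^esub> c (\<phi> i))"
      using \<psi> by (subst L_finsum) (auto simp: lam_closed L_closed \<phi> e x mult_tn L_tn c_def Dual_closed[OF \<psi>] intro!: left.finsum_cong')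
    finally have "\<epsilon> (c \<psi>) = \<epsilon> (\<Oplus>\<^bsub>B\<^esub>i\<in>{..<n}. \<psi> (x i) \<odot>\<^bsub>B\<^esub> c (\<phi> i))" by simp
    also have "\<dots> = (\<Oplus>\<^bsub>A\<^esub>i\<in>{..<n}. \<epsilon> (\<psi> (x i) \<odot>\<^bsub>B\<^esub> c (\<phi> i)))"
      using \<epsilon> \<psi> by (intro additive_map_finsum[OF left.abelian_group_axioms left.R.abelian_group_axioms]) (auto simp: Dual_iff[of \<epsilon>] Dual_closed[OF \<psi>] x c_closed \<phi>)
    also have "\<dots> = (\<Oplus>\<^bsub>A\<^esub>i\<in>{..<n}. \<psi> (\<epsilon> (c (\<phi> i)) \<odot>\<^bsub>B\<^esub> x i))"
      using \<epsilon> \<psi> by (intro left.R.finsum_cong') (auto simp: Dual_smult Dual_closed x c_closed \<phi> left.R.m_comm)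
    also have "\<dots> = \<psi> u"
      unfolding u_def using \<psi> by (intro additive_map_finsum[OF left.abelian_group_axioms left.R.abelian_group_axioms, symmetric])
        (auto simp: Dual_iff[of \<psi>] Dual_closed[OF \<epsilon>] x c_closed \<phi>)
    finally show ?thesis .
  qed
  have main: "\<epsilon> (b \<otimes>\<^bsub>B\<^esub> c \<psi>) = \<psi> (b \<otimes>\<^bsub>B\<^esub> u)" if "\<psi> \<in> Dual" "b \<in> carrier B" for \<psi> b
    using eps_c[OF Dual_translate[OF that]] c_translate[OF that] uc by simp
  \<comment> \<open>For \<open>\<psi> = \<epsilon>\<close> the symmetry says that
    \<open>\<epsilon>\<close> and its translate by \<open>u\<close> coincide. Applying
    \<open>c\<close> to both gives \<open>u = 1\<close>.\<close>
  have eq: "(\<lambda>X\<in>carrier B. \<epsilon> (\<one>\<^bsub>B\<^esub> \<otimes>\<^bsub>B\<^esub> X)) = (\<lambda>X\<in>carrier B. \<epsilon> (u \<otimes>\<^bsub>B\<^esub> X))"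
  proof (rule restrict_ext)
    fix X assume "X \<in> carrier B"
    then show "\<epsilon> (\<one>\<^bsub>B\<^esub> \<otimes>\<^bsub>B\<^esub> X) = \<epsilon> (u \<otimes>\<^bsub>B\<^esub> X)"
      using main[OF \<epsilon>, of X] uc by (simp add: ce left.m_comm)
  qed
  have u1: "u = \<one>\<^bsub>B\<^esub>"
    by (rule trans[OF gen[OF uc, symmetric] trans[OF arg_cong[OF eq, of c, symmetric] gen[OF left.one_closed]]])
  have "\<psi> X = \<epsilon> (c \<psi> \<otimes>\<^bsub>B\<^esub> X)" if "\<psi> \<in> Dual" "X \<in> carrier B" for \<psi> X
  proof -
    have "\<epsilon> (c \<psi> \<otimes>\<^bsub>B\<^esub> X) = \<epsilon> (X \<otimes>\<^bsub>B\<^esub> c \<psi>)"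
      using left.m_comm[OF c_closed[OF that(1)] that(2)] by simp
    also have "\<dots> = \<psi> (X \<otimes>\<^bsub>B\<^esub> \<one>\<^bsub>B\<^esub>)" using main[OF that] by (simp only: u1)
    finally show ?thesis using that(2) by simp
  qed
  then show ?thesis using that \<epsilon> gen by blast
qed

end

section \<open>Finitely generated projective modules\<close>

text \<open>The functionals are the coordinates of the embedding into a free module, and the
  elements are the images of the standard basis under the retraction.\<close>

lemma fin_projective_dual_basis:
  assumes M: "Module.module A M" and P: "fin_projective A M"
  obtains n \<phi> x where "\<And>i. i < (n::nat) \<Longrightarrow> \<phi> i \<in> lin_maps A M (self_module A)"
    "\<And>i. i < n \<Longrightarrow> x i \<in> carrier M"
    "\<And>b. b \<in> carrier M \<Longrightarrow> b = (\<Oplus>\<^bsub>M\<^esub>i\<in>{..<n}. \<phi> i b \<odot>\<^bsub>M\<^esub> x i)"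
proof -
  interpret Module.module A M by (rule M)
  obtain n j p where j: "j \<in> lin_maps A M (coord_module A n)" and p: "p \<in> lin_maps A (coord_module A n) M"
    and pj: "\<And>x. x \<in> carrier M \<Longrightarrow> p (j x) = x"
    using P by (auto simp: fin_projective_def)
  define \<phi> where "\<phi> i = (\<lambda>b\<in>carrier M. j b i)" for i
  define e where "e i = (\<lambda>l\<in>{..<n}. if l = i then \<one>\<^bsub>A\<^esub> else \<zero>\<^bsub>A\<^esub>)" for i
  define x where "x i = p (e i)" for i
  have ec: "e i \<in> carrier (coord_module A n)" for i by (auto simp: e_def coord_module_def)
  have jc: "j b \<in> {..<n} \<rightarrow>\<^sub>E carrier A" if "b \<in> carrier M" for b
    using that j by (auto simp: lin_maps_def coord_module_def)
  have "\<phi> i \<in> lin_maps A M (self_module A)" if "i < n" for i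
  proof -
    have "j b i \<in> carrier A" if "b \<in> carrier M" for b using jc[OF that] \<open>i < n\<close> by auto
    then show ?thesis
      using j \<open>i < n\<close> by (auto simp: \<phi>_def lin_maps_def self_module_def coord_module_def)
  qed
  moreover have xc: "x i \<in> carrier M" for i
    using p ec by (auto simp: x_def lin_maps_def)
  moreover have "b = (\<Oplus>\<^bsub>M\<^esub>i\<in>{..<n}. \<phi> i b \<odot>\<^bsub>M\<^esub> x i)" if b: "b \<in> carrier M" for b
  proof -
    define u where "u = j b"
    have u: "u i \<in> carrier A" if "i < n" for i using jc[OF b] that by (auto simp: u_def)
    \<comment> \<open>The truncation of \<open>u\<close> to its first \<open>m\<close> coordinates.
      Adding one coordinate at a time reduces the claim to the additivity of \<open>p\<close> for
      two summands.\<close>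
    define t where "t m = (\<lambda>i\<in>{..<n}. if i < m then u i else \<zero>\<^bsub>A\<^esub>)" for m
    have tc: "t m \<in> carrier (coord_module A n)" for m using u by (auto simp: t_def coord_module_def)
    have "p (t m) = (\<Oplus>\<^bsub>M\<^esub>i\<in>{..<m}. u i \<odot>\<^bsub>M\<^esub> x i)" if "m \<le> n" for m
      using that
    proof (induction m)
      case 0
      \<comment> \<open>The truncation \<open>t 0\<close> is its own zero multiple, so linearity
        sends it to zero.\<close>
      have "t 0 = \<zero>\<^bsub>A\<^esub> \<odot>\<^bsub>coord_module A n\<^esub> t 0"
        by (auto simp: coord_module_def t_def)
      moreover have "p (\<zero>\<^bsub>A\<^esub> \<odot>\<^bsub>coord_module A n\<^esub> t 0) = \<zero>\<^bsub>A\<^esub> \<odot>\<^bsub>M\<^esub> p (t 0)"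
        using p tc by (auto simp: lin_maps_def)
      moreover have "p (t 0) \<in> carrier M" using p tc by (auto simp: lin_maps_def)
      ultimately show ?case by (metis M.finsum_empty lessThan_0 smult_l_null)
    next
      case (Suc m)
      have "t (Suc m) = t m \<oplus>\<^bsub>coord_module A n\<^esub> u m \<odot>\<^bsub>coord_module A n\<^esub> e m"
        using Suc.prems u by (auto simp: coord_module_def t_def e_def fun_eq_iff less_Suc_eq)
      moreover have "u m \<odot>\<^bsub>coord_module A n\<^esub> e m \<in> carrier (coord_module A n)"
        using Suc.prems u by (auto simp: coord_module_def e_def)
      ultimately have "p (t (Suc m)) = p (t m) \<oplus>\<^bsub>M\<^esub> u m \<odot>\<^bsub>M\<^esub> x m"
        using p tc[of m] ec[of m] u[of m] Suc.prems by (simp add: lin_maps_def x_def)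
      then show ?case using Suc u xc
        by (simp add: M.finsum_closed M.a_comm lessThan_Suc Pi_def)
    qed
    from this[of n] have "p (t n) = (\<Oplus>\<^bsub>M\<^esub>i\<in>{..<n}. u i \<odot>\<^bsub>M\<^esub> x i)" by simp
    moreover have "t n = u" using jc[OF b] by (auto simp: t_def u_def PiE_def extensional_def fun_eq_iff)
    ultimately show ?thesis using pj[OF b] b by (simp add: u_def \<phi>_def)
  qed
  ultimately show ?thesis using that by blast
qed

text \<open>The inverse of the coordinate isomorphism is a linear section. This turns the freeness
  of the quotients by powers of the parameter into the projectivity that \<open>divisor\<close>
  demands.\<close>

lemma fin_free_projective:
  assumes M: "Module.module A M" and F: "fin_free A M"
  shows "fin_projective A M"
proof -
  interpret Module.module A M by (rule M)
  obtain n h where h: "h \<in> lin_maps A (coord_module A n) M" and bij: "bij_betw h (carrier (coord_module A n)) (carrier M)"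
    using F by (auto simp: fin_free_def lin_isos_def)
  let ?C = "coord_module A n"
  have closed: "u \<oplus>\<^bsub>?C\<^esub> v \<in> carrier ?C" "a \<odot>\<^bsub>?C\<^esub> u \<in> carrier ?C"
    if "u \<in> carrier ?C" "v \<in> carrier ?C" "a \<in> carrier A" for u v a
    using that by (auto simp: coord_module_def Pi_iff PiE_def)
  define j where "j = (\<lambda>x\<in>carrier M. inv_into (carrier ?C) h x)"
  have jc: "j x \<in> carrier ?C" "h (j x) = x" if "x \<in> carrier M" for x
    using that bij by (auto simp: j_def bij_betw_def inv_into_into f_inv_into_f)
  have j_eq: "j x = u" if "u \<in> carrier ?C" "h u = x" for u x
    using that bij by (auto simp: j_def bij_betw_def)
  have "j \<in> lin_maps A M ?C"
    unfolding lin_maps_def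
  proof (intro CollectI conjI ballI)
    show "j \<in> carrier M \<rightarrow>\<^sub>E carrier ?C" using jc by (auto simp: j_def)
    show "j (x \<oplus>\<^bsub>M\<^esub> y) = j x \<oplus>\<^bsub>?C\<^esub> j y" if "x \<in> carrier M" "y \<in> carrier M" for x y
      using that h jc closed[OF jc(1) jc(1) R.zero_closed, of x y] by (intro j_eq) (auto simp: lin_maps_def)
    show "j (a \<odot>\<^bsub>M\<^esub> x) = a \<odot>\<^bsub>?C\<^esub> j x" if "a \<in> carrier A" "x \<in> carrier M" for a x
      using that h jc closed[OF jc(1) jc(1), of x x a] by (intro j_eq) (auto simp: lin_maps_def)
  qed
  then show ?thesis using h jc unfolding fin_projective_def by blast
qed

section \<open>Multicurves\<close>

lemma (in cring) regular_mult:
  assumes "regular_elt R f" "regular_elt R g"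
  shows "regular_elt R (f \<otimes> g)"
proof -
  have fc: "f \<in> carrier R" "g \<in> carrier R" using assms by (simp_all add: regular_elt_def)
  have "z = \<zero>" if z: "z \<in> carrier R" "f \<otimes> g \<otimes> z = \<zero>" for z
  proof -
    have "f \<otimes> (g \<otimes> z) = \<zero>" using z fc by (simp add: m_assoc)
    then have "g \<otimes> z = \<zero>" using assms(1) z(1) fc unfolding regular_elt_def by blast
    then show ?thesis using assms(2) z(1) unfolding regular_elt_def by blast
  qed
  then show ?thesis using fc by (simp add: regular_elt_def)
qed

lemma (in cring) regular_cancel:
  assumes "regular_elt R f" "a \<in> carrier R" "b \<in> carrier R" "f \<otimes> a = f \<otimes> b"
  shows "a = b"
proof -
  have "f \<otimes> (a \<ominus> b) = \<zero>"
    using assms by (simp add: regular_elt_def a_minus_def r_distr r_minus r_neg)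
  then have "a \<ominus> b = \<zero>" using assms by (simp add: regular_elt_def)
  then show ?thesis using assms(2,3) minus_eq_zero_iff by blast
qed

text \<open>A parameter \<open>y\<close> and a difference function \<open>d\<close> are fixed here,
  although \<open>duality_map\<close> and \<open>residue\<close> mention neither. The independence
  of \<open>d\<close> is obtained later by instantiating the locale a second time.\<close>

locale multicurve = formal_algebra k R T for k :: "'k ring" and R :: "('k, 'r) module" (structure) and T :: "'r topology" +
  fixes y :: 'r and d :: "'r tensor_square"
  assumes y: "regular_elt R y"
    and y_open: "openin T (PIdl (y [^] (m::nat)))"
    and y_free: "fin_free k (quot R (PIdl (y [^] (m::nat))))"
    and y_limit: "homeomorphic_map T (limit_topology R {PIdl (y [^] m) | m::nat. True})
       (to_limit R {PIdl (y [^] m) | m::nat. True})"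
    and d: "difference_function k R T d"
begin

interpretation Q: cring Q by (rule cring_Q)

abbreviation "yp m \<equiv> y [^] (m::nat)"

lemma yc: "y \<in> carrier R" using y by (simp add: regular_elt_def)

lemma yp_closed: "yp m \<in> carrier R" using yc by simp

lemma yp_regular: "regular_elt R (yp m)"
proof (induction m)
  case 0
  then show ?case by (simp add: regular_elt_def)
next
  case (Suc m)
  then show ?case using regular_mult[of "yp m" y] y by simp
qed

lemma y_ideal: "PIdl (yp m) \<in> OI"
  using cgenideal_ideal[OF yp_closed] y_open by (simp add: open_ideals_def)

lemma y_mono: "m \<le> m' \<Longrightarrow> PIdl (yp m') \<subseteq> PIdl (yp m)"
proof
  fix z assume "m \<le> m'" "z \<in> PIdl (yp m')"
  then obtain a where a: "a \<in> carrier R" "z = a \<otimes> yp m'" by (auto simp: PIdl_mem_iff)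
  have "yp m' = yp (m' - m) \<otimes> yp m" using nat_pow_mult[OF yc, of "m' - m" m] \<open>m \<le> m'\<close> by simp
  then have "z = (a \<otimes> yp (m' - m)) \<otimes> yp m" using a yp_closed by (simp add: m_assoc)
  then show "z \<in> PIdl (yp m)" using a yp_closed by (auto simp: PIdl_mem_iff)
qed

text \<open>The image of \<open>J\<close> under the homeomorphism is open in the limit and hence
  contains a basic open neighbourhood of zero. Elements divisible by a high power of
  \<open>y\<close> meet all its constraints, and injectivity brings them back into
  \<open>J\<close>.\<close>

lemma y_cofinal:
  assumes J: "J \<in> OI"
  obtains m where "PIdl (yp m) \<subseteq> J"
proof -
  let ?Y = "{PIdl (yp m) | m::nat. True}"
  let ?g = "to_limit R ?Y"
  let ?X = "\<lambda>J. discrete_topology (carrier (R Quot J))"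
  have Jc: "J \<subseteq> carrier R" and J0: "\<zero> \<in> J"
    using OI_subset[OF J] additive_subgroup.zero_closed[OF ideal.axioms(1)[OF OI_ideal[OF J]]] by auto
  have "openin (limit_topology R ?Y) (?g ` J)"
    using homeomorphic_imp_open_map[OF y_limit] J by (auto simp: open_map_def open_ideals_def)
  then obtain U where U: "openin (product_topology ?X ?Y) U" "?g ` J = U \<inter> quot_limit R ?Y"
    by (auto simp: limit_topology_def openin_subtopology)
  have "?g \<zero> \<in> U" using J0 U(2) by blast
  then obtain V where V: "finite {i \<in> ?Y. V i \<noteq> topspace (?X i)}" "?g \<zero> \<in> Pi\<^sub>E ?Y V" "Pi\<^sub>E ?Y V \<subseteq> U"
    using U(1) unfolding openin_product_topology_alt by meson
  \<comment> \<open>A basic open set of the product constrains finitely many coordinates, and the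
    ideals form a chain, so one power of \<open>y\<close> lies in all of them.\<close>
  have "\<exists>m. \<forall>i\<in>S. PIdl (yp m) \<subseteq> i" if "finite S" "S \<subseteq> ?Y" for S
    using that
  proof (induction S rule: finite_induct)
    case (insert i S)
    then obtain m m' where "\<forall>i\<in>S. PIdl (yp m) \<subseteq> i" "i = PIdl (yp m')" by auto
    then have "\<forall>i\<in>insert i S. PIdl (yp (max m m')) \<subseteq> i"
      using y_mono[of m "max m m'"] y_mono[of m' "max m m'"] by auto
    then show ?case by blast
  qed simp
  from this[OF V(1) Collect_restrict] obtain m where "\<forall>i\<in>{i \<in> ?Y. V i \<noteq> topspace (?X i)}. PIdl (yp m) \<subseteq> i" ..
  note sub = bspec[OF this]
  have m: "PIdl (yp m) \<subseteq> i" if "i \<in> ?Y" "V i \<noteq> topspace (?X i)" for i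
    by (rule sub, rule CollectI, rule conjI, rule that(1), rule that(2))
  have "PIdl (yp m) \<subseteq> J"
  proof
    fix z assume z: "z \<in> PIdl (yp m)"
    then have zc: "z \<in> carrier R" using OI_subset[OF y_ideal] by blast
    have "?g z \<in> Pi\<^sub>E ?Y V"
    proof (rule PiE_I)
      fix i assume i: "i \<in> ?Y"
      then have iO: "i \<in> OI" using y_ideal by blast
      interpret quotient_algebra k R i by (rule OI_quot[OF iO])
      show "?g z i \<in> V i"
      proof (cases "V i = topspace (?X i)")
        case True
        have "i +> z \<in> carrier (R Quot i)" using coset_mem_carrier[OF zc] by (simp add: quot_def)
        then show ?thesis using i True by (simp add: to_limit_def)
      next
        case False
        then have "z \<in> i" using m[OF i] z by blast
        then have "i +> z = i +> \<zero>" by (simp only: coset_zero coset_eq_zero_iff[OF zc])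
        then have "?g z i = ?g \<zero> i" using i by (simp add: to_limit_def)
        then show ?thesis using PiE_mem[OF V(2) i] by simp
      qed
    qed (simp add: to_limit_def)
    then have "?g z \<in> U" using V(3) by blast
    moreover have "?g z \<in> quot_limit R ?Y"
      using homeomorphic_imp_surjective_map[OF y_limit] zc topspace_T by (auto simp: limit_topology_def)
    ultimately have "?g z \<in> ?g ` J" using U(2) by blast
    then show "z \<in> J"
      using homeomorphic_imp_injective_map[OF y_limit] zc Jc topspace_T by (auto dest: inj_onD)
  qed
  then show ?thesis using that by blast
qed

lemma y_divisor: "divisor k R T (PIdl (yp m))"
  unfolding divisor_def
  using y_ideal yp_regular fin_free_projective[OF algebra.module[OF quotient_algebra.algebra_quot[OF OI_quot[OF y_ideal]]] y_free]
  by blast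

lemma dc: "d \<in> carrier Q" and d_cancel: "F \<in> carrier Q \<Longrightarrow> d \<otimes>\<^bsub>Q\<^esub> F = \<zero>\<^bsub>Q\<^esub> \<Longrightarrow> F = \<zero>\<^bsub>Q\<^esub>"
  and d_regular: "regular_elt Q d"
  using d by (auto simp: difference_function_def regular_elt_def)

lemma diag_iff: "F \<in> carrier Q \<Longrightarrow> \<mu> F = \<zero> \<longleftrightarrow> (\<exists>G\<in>carrier Q. F = d \<otimes>\<^bsub>Q\<^esub> G)"
proof -
  assume F: "F \<in> carrier Q"
  have "\<mu> F = \<zero> \<longleftrightarrow> F \<in> diag_ideal k R T"
    using F by (simp add: diag_ideal_def a_kernel_def')
  also have "\<dots> \<longleftrightarrow> (\<exists>G\<in>carrier Q. F = G \<otimes>\<^bsub>Q\<^esub> d)" using d by (simp add: difference_function_def PIdl_mem_iff)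
  finally show ?thesis using dc by (auto simp: Q.m_comm)
qed

lemma incl_diff: "a \<in> carrier R \<Longrightarrow> \<exists>G\<in>carrier Q. r a \<ominus>\<^bsub>Q\<^esub> l a = d \<otimes>\<^bsub>Q\<^esub> G"
proof -
  assume a: "a \<in> carrier R"
  interpret h: ring_hom_cring Q R \<mu>
    by (intro ring_hom_cring.intro ring_hom_cring_axioms.intro cring_Q M_cring codiagonal_hom)
  have "\<mu> (r a \<ominus>\<^bsub>Q\<^esub> l a) = \<zero>"
    using a by (simp add: a_minus_def incl_closed codiagonal_incl M.r_neg)
  then show ?thesis using a diag_iff[of "r a \<ominus>\<^bsub>Q\<^esub> l a"] by (simp add: incl_closed)
qed

end

section \<open>The kernel of the reduction to the tensor square of a divisor\<close>

lemma additive_map_plus: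
  assumes "abelian_group P" "additive_map M P g" "additive_map M P h"
  shows "additive_map M P (\<lambda>X. g X \<oplus>\<^bsub>P\<^esub> h X)"
proof -
  interpret abelian_group P by fact
  show ?thesis
    using assms(2,3)
    by (intro additive_mapI) (simp_all add: additive_map_add additive_map_closed a_ac)
qed

lemma additive_map_lmult:
  assumes "cring P" "c \<in> carrier P" "additive_map M P g"
  shows "additive_map M P (\<lambda>X. c \<otimes>\<^bsub>P\<^esub> g X)"
proof -
  interpret cring P by fact
  show ?thesis
    using assms(2,3) by (intro additive_mapI) (simp_all add: additive_map_add additive_map_closed r_distr)
qed

context multicurve
begin

interpretation Q: cring Q by (rule cring_Q)

text \<open>Substituting \<open>a = s a + f q(a)\<close> in both factors writes \<open>G\<close> as
  \<open>(s \<otimes> s)(G)\<close> plus multiples of \<open>l f\<close> and \<open>r f\<close>, and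
  the first term depends only on the component at \<open>(I, I)\<close>. The work lies in making
  \<open>q \<otimes> 1\<close> and \<open>s \<otimes> q\<close> operators on the completion.\<close>

lemma kernel_component:
  assumes f: "regular_elt R f" and I: "I = PIdl f" "I \<in> OI" and P: "fin_projective k (quot R I)"
    and G: "G \<in> carrier Q" "G (I, I) = \<zero>\<^bsub>QT I I\<^esub>"
  obtains U V where "U \<in> carrier Q" "V \<in> carrier Q" "G = l f \<otimes>\<^bsub>Q\<^esub> U \<oplus>\<^bsub>Q\<^esub> r f \<otimes>\<^bsub>Q\<^esub> V"
proof -
  have fc: "f \<in> carrier R" using f by (simp add: regular_elt_def)
  interpret I: quotient_algebra k R I by (rule OI_quot[OF I(2)])
  interpret B: Module.module k "quot R I" by (rule I.module_quot)
  obtain n \<phi> x' where \<phi>: "\<And>i. i < (n::nat) \<Longrightarrow> \<phi> i \<in> lin_maps k (quot R I) (self_module k)"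
    and x': "\<And>i. i < n \<Longrightarrow> x' i \<in> carrier (quot R I)"
    and db: "\<And>b. b \<in> carrier (quot R I) \<Longrightarrow> b = (\<Oplus>\<^bsub>quot R I\<^esub>i\<in>{..<n}. \<phi> i b \<odot>\<^bsub>quot R I\<^esub> x' i)"
    using fin_projective_dual_basis[OF B.module_axioms P] by blast
  have "\<forall>i\<in>{..<n}. \<exists>a. a \<in> carrier R \<and> x' i = I +> a" using x' by (fastforce simp: I.quot_carrier)
  then obtain x where x: "\<And>i. i < n \<Longrightarrow> x i \<in> carrier R" "\<And>i. i < n \<Longrightarrow> x' i = I +> x i"
    by (auto dest!: bchoice)
  define lm where "lm i a = \<phi> i (I +> a)" for i a
  have lc: "lm i a \<in> carrier k" and la: "lm i (a \<oplus> b) = lm i a \<oplus>\<^bsub>k\<^esub> lm i b" and ls: "lm i (c \<odot> a) = c \<otimes>\<^bsub>k\<^esub> lm i a"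
    if "i < n" "a \<in> carrier R" "b \<in> carrier R" "c \<in> carrier k" for i a b c
    using \<phi>[OF that(1)] that I.coset_mem_carrier
    by (auto simp: lm_def lin_maps_def self_module_def I.coset_add[symmetric] I.coset_smult[symmetric])
  \<comment> \<open>A lift to \<open>R\<close> of the identity of \<open>R/I\<close>, built from a
    dual basis: it is \<open>k\<close>-linear, vanishes on \<open>I\<close>, and preserves cosets of
    \<open>I\<close>.\<close>
  define s where "s a = (\<Oplus>i\<in>{..<n}. lm i a \<odot> x i)" for a
  have sc: "s a \<in> carrier R" if "a \<in> carrier R" for a
    unfolding s_def using that lc[OF _ that that R.zero_closed] x by (intro M.finsum_closed) auto
  have s_add: "s (a \<oplus> b) = s a \<oplus> s b" if "a \<in> carrier R" "b \<in> carrier R" for a b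
  proof -
    have "s (a \<oplus> b) = (\<Oplus>i\<in>{..<n}. lm i a \<odot> x i \<oplus> lm i b \<odot> x i)"
      unfolding s_def using that lc[OF _ _ _ R.zero_closed] la[OF _ _ _ R.zero_closed] x
      by (intro M.finsum_cong') (auto simp: smult_l_distr)
    also have "\<dots> = s a \<oplus> s b"
      unfolding s_def using that lc[OF _ _ _ R.zero_closed] x by (intro M.finsum_addf) auto
    finally show ?thesis .
  qed
  have s_smult: "s (c \<odot> a) = c \<odot> s a" if "c \<in> carrier k" "a \<in> carrier R" for a c
  proof -
    have "s (c \<odot> a) = (\<Oplus>i\<in>{..<n}. c \<odot> (lm i a \<odot> x i))"
      unfolding s_def using that lc[OF _ that(2,2,1)] ls[OF _ that(2,2,1)] x
      by (intro M.finsum_cong') (auto simp: smult_assoc1)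
    also have "\<dots> = c \<odot> s a"
      unfolding s_def using that lc[OF _ that(2,2,1)] x by (intro finsum_smult_ldistr[symmetric]) auto
    finally show ?thesis .
  qed
  have s_coset: "I +> s a = I +> a" if "a \<in> carrier R" for a
  proof -
    have "I +> s a = (\<Oplus>\<^bsub>quot R I\<^esub>i\<in>{..<n}. I +> (lm i a \<odot> x i))"
      unfolding s_def using that lc[OF _ that that R.zero_closed] x
      by (intro additive_map_finsum[OF M.abelian_group_axioms B.abelian_group_axioms I.coset_additive]) auto
    also have "\<dots> = (\<Oplus>\<^bsub>quot R I\<^esub>i\<in>{..<n}. \<phi> i (I +> a) \<odot>\<^bsub>quot R I\<^esub> x' i)"
      using that lc[OF _ that that R.zero_closed] x x'
      by (intro B.finsum_cong') (auto simp: I.coset_smult lm_def[symmetric])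
    also have "\<dots> = I +> a" using db[OF I.coset_mem_carrier[OF that]] by simp
    finally show ?thesis .
  qed
  have s_0: "s a = \<zero>" if "a \<in> I" for a
  proof -
    have "I +> a = I +> \<zero>" using that by (simp only: I.coset_eq_zero_iff[OF I.a_Hcarr[OF that]] I.coset_zero)
    then have "s a = s \<zero>" by (simp add: s_def lm_def)
    also have "\<dots> = \<zero>" using s_smult[of "\<zero>\<^bsub>k\<^esub>" "\<zero>"] sc by simp
    finally show ?thesis .
  qed
  have ex_q: "\<exists>b\<in>carrier R. a \<ominus> s a = f \<otimes> b" if "a \<in> carrier R" for a
  proof -
    have "a \<ominus> s a \<in> I" using s_coset[OF that] I.coset_eq_iff[OF that sc[OF that]] by simp
    then show ?thesis using fc by (auto simp: I(1) PIdl_mem_iff m_comm)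
  qed
  then obtain q where q: "\<And>a. a \<in> carrier R \<Longrightarrow> q a \<in> carrier R" "\<And>a. a \<in> carrier R \<Longrightarrow> a \<ominus> s a = f \<otimes> q a"
    using bchoice[of "carrier R" "\<lambda>a b. b \<in> carrier R \<and> a \<ominus> s a = f \<otimes> b"] by blast
  have q_eqI: "q a = b" if "a \<in> carrier R" "b \<in> carrier R" "a \<ominus> s a = f \<otimes> b" for a b
    using regular_cancel[OF f q(1)[OF that(1)] that(2)] q(2)[OF that(1)] that(3) by simp
  have decomp: "a = s a \<oplus> f \<otimes> q a" if "a \<in> carrier R" for a
    using q(2)[OF that, symmetric] that sc[OF that] by (simp add: a_minus_def M.a_lcomm M.r_neg)
  have s_lin: "k_linear s" using sc s_add s_smult by (auto simp: k_linear_def intro!: additive_mapI)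
  have q_lin: "k_linear q"
    unfolding k_linear_def
  proof (intro conjI ballI additive_mapI)
    show "q (a \<oplus> b) = q a \<oplus> q b" if "a \<in> carrier R" "b \<in> carrier R" for a b
    proof (rule q_eqI)
      have "(a \<oplus> b) \<ominus> s (a \<oplus> b) = (a \<ominus> s a) \<oplus> (b \<ominus> s b)"
        using that sc by (simp add: s_add a_minus_def M.minus_add M.a_ac)
      then show "(a \<oplus> b) \<ominus> s (a \<oplus> b) = f \<otimes> (q a \<oplus> q b)"
        using that q fc by (simp add: r_distr)
    qed (use that q in auto)
    show "q (c \<odot> a) = c \<odot> q a" if "c \<in> carrier k" "a \<in> carrier R" for c a
    proof (rule q_eqI)
      have "c \<odot> a \<ominus> s (c \<odot> a) = c \<odot> (a \<ominus> s a)"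
        using that sc by (simp add: s_smult a_minus_def smult_r_distr smult_r_minus)
      also have "\<dots> = f \<otimes> (c \<odot> q a)"
        using that q fc by (metis m_comm smult_assoc2 smult_closed)
      finally show "c \<odot> a \<ominus> s (c \<odot> a) = f \<otimes> (c \<odot> q a)" .
    qed (use that q in auto)
  qed (use q in auto)
  have s_img: "s ` I \<subseteq> J" if "J \<in> OI" for J
    using s_0 additive_subgroup.zero_closed[OF ideal.axioms(1)[OF OI_ideal[OF that]]] by auto
  have s_cont: "k_continuous s" using s_lin s_img I(2) unfolding k_continuous_def by blast
  \<comment> \<open>On \<open>I\<close> the map \<open>q\<close> is division by \<open>f\<close>. If
    \<open>y^N = hf\<close>, the quotient of \<open>a y^(m+N)\<close> is \<open>a h y^m\<close>, so
    the ideal of \<open>y^(m+N)\<close> goes into that of \<open>y^m\<close>.\<close>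
  have q_cont: "k_continuous q"
    unfolding k_continuous_def
  proof (intro conjI q_lin ballI)
    fix J assume J: "J \<in> OI"
    obtain m where m: "PIdl (yp m) \<subseteq> J" using y_cofinal[OF J] .
    obtain N where N: "PIdl (yp N) \<subseteq> I" using y_cofinal[OF I(2)] .
    have "yp N \<in> PIdl (yp N)" using yp_closed by (intro cgenideal_self)
    then have "yp N \<in> PIdl f" using N unfolding I(1) by blast
    then obtain h where h: "h \<in> carrier R" "yp N = h \<otimes> f" unfolding PIdl_mem_iff by blast
    have "q z \<in> J" if zN: "z \<in> PIdl (yp (m + N))" for z
    proof -
      obtain a where a: "a \<in> carrier R" "z = a \<otimes> yp (m + N)" using zN unfolding PIdl_mem_iff by blast
      have z: "z = (a \<otimes> h \<otimes> yp m) \<otimes> f"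
        using a h fc yp_closed yc by (simp add: nat_pow_mult[symmetric] m_ac)
      then have "z \<in> I" using a h yp_closed by (auto simp: I(1) PIdl_mem_iff)
      then have "q z = a \<otimes> h \<otimes> yp m"
        using z a h fc yp_closed s_0 by (intro q_eqI) (simp_all add: m_comm a_minus_def minus_zero)
      then have "q z \<in> PIdl (yp m)" using a h by (auto simp: PIdl_mem_iff)
      then show ?thesis using m by blast
    qed
    then show "\<exists>J'\<in>OI. q ` J' \<subseteq> J" using y_ideal by blast
  qed
  have id_lin: "k_linear (\<lambda>a. a)" using k_linear_id by (simp add: k_continuous_def)
  define U where "U = tensor_op q (\<lambda>a. a) G"
  define V where "V = tensor_op s q G"
  have UV: "U \<in> carrier Q" "V \<in> carrier Q"
    unfolding U_def V_def by (intro tensor_op_closed q_cont s_cont k_linear_id G)+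
  have "G = l f \<otimes>\<^bsub>Q\<^esub> U \<oplus>\<^bsub>Q\<^esub> r f \<otimes>\<^bsub>Q\<^esub> V"
  proof (rule Q_eqI)
    fix I0 J0 assume IJ: "I0 \<in> OI" "J0 \<in> OI"
    obtain I' where I': "I' \<in> OI" "q ` I' \<subseteq> I0" using k_continuousE[OF q_cont IJ(1)] .
    obtain J' where J': "J' \<in> OI" "q ` J' \<subseteq> J0" using k_continuousE[OF q_cont IJ(2)] .
    \<comment> \<open>Small enough for all operators at once: \<open>I'\<close> serves
      \<open>q\<close>, the ideal \<open>I\<close> serves \<open>s\<close>, and \<open>I0\<close>
      serves the identity; likewise for \<open>J1\<close>.\<close>
    define I1 where "I1 = I' \<inter> (I \<inter> I0)"
    define J1 where "J1 = J' \<inter> (I \<inter> J0)"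
    have IJ1: "I1 \<in> OI" "J1 \<in> OI" using IJ I' J' I(2) by (auto simp: I1_def J1_def intro!: OI_Int)
    have img: "q ` I1 \<subseteq> I0" "q ` J1 \<subseteq> J0" "s ` I1 \<subseteq> I0" "s ` J1 \<subseteq> J0" "(\<lambda>a. a) ` J1 \<subseteq> J0" "(\<lambda>a. a) ` I1 \<subseteq> I0"
      using I'(2) J'(2) s_img[OF IJ(1)] s_img[OF IJ(2)] by (auto simp: I1_def J1_def)
    interpret P: cring "QT I0 J0" by (rule QT_cring[OF IJ])
    note bl = k_bilinear_pullback[OF k_bilinear_tq[OF IJ order_refl order_refl]]
    note cU = coset_lift[OF QT_group[OF IJ] IJ1 bl[OF q_lin img(1) id_lin img(5)]]
    note cV = coset_lift[OF QT_group[OF IJ] IJ1 bl[OF s_lin img(3) q_lin img(2)]]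
    note cS = coset_lift[OF QT_group[OF IJ] IJ1 bl[OF s_lin img(3) s_lin img(4)]]
    note t = trans[OF IJ1 IJ, unfolded I1_def J1_def]
    let ?A = "coset_lift (QT I0 J0) I1 J1 (\<lambda>x y. tq I0 J0 (s x) (s y))"
    let ?U = "coset_lift (QT I0 J0) I1 J1 (\<lambda>x y. tq I0 J0 (q x) y)"
    let ?V = "coset_lift (QT I0 J0) I1 J1 (\<lambda>x y. tq I0 J0 (s x) (q y))"
    let ?L = "tq I0 J0 f \<one>" and ?R = "tq I0 J0 \<one> f"
    have sub: "I1 \<subseteq> I0" "J1 \<subseteq> J0" by (auto simp: I1_def J1_def)
    have LR: "?L \<in> carrier (QT I0 J0)" "?R \<in> carrier (QT I0 J0)" using tq_closed IJ fc by auto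
    \<comment> \<open>On pure tensors this reads \<open>a \<otimes> b = s a \<otimes> s b + f q(a)
      \<otimes> b + s a \<otimes> f q(b)\<close>.\<close>
    have "trans I1 J1 I0 J0 X = ?A X \<oplus>\<^bsub>QT I0 J0\<^esub> (?L \<otimes>\<^bsub>QT I0 J0\<^esub> ?U X \<oplus>\<^bsub>QT I0 J0\<^esub> ?R \<otimes>\<^bsub>QT I0 J0\<^esub> ?V X)"
      if X: "X \<in> carrier (QT I1 J1)" for X
    proof (rule QT_map_eq[OF QT_group[OF IJ] IJ1 trans(1)[OF IJ1 IJ sub] _ _ X])
      show "additive_map (QT I1 J1) (QT I0 J0)
          (\<lambda>X. ?A X \<oplus>\<^bsub>QT I0 J0\<^esub> (?L \<otimes>\<^bsub>QT I0 J0\<^esub> ?U X \<oplus>\<^bsub>QT I0 J0\<^esub> ?R \<otimes>\<^bsub>QT I0 J0\<^esub> ?V X))"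
        by (intro additive_map_plus additive_map_lmult QT_group IJ QT_cring LR cU(1) cV(1) cS(1))
      fix a b assume a: "a \<in> carrier R" and b: "b \<in> carrier R"
      have "tq I0 J0 a b = tq I0 J0 (s a \<oplus> f \<otimes> q a) b" using decomp[OF a] by simp
      also have "\<dots> = tq I0 J0 (s a) b \<oplus>\<^bsub>QT I0 J0\<^esub> tq I0 J0 (f \<otimes> q a) b"
        using a b fc IJ sc q by (simp add: tq_add_left)
      also have "tq I0 J0 (s a) b = tq I0 J0 (s a) (s b \<oplus> f \<otimes> q b)" using decomp[OF b] by simp
      also have "\<dots> = tq I0 J0 (s a) (s b) \<oplus>\<^bsub>QT I0 J0\<^esub> tq I0 J0 (s a) (f \<otimes> q b)"
        using a b fc IJ sc q by (simp add: tq_add_right)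
      finally have "tq I0 J0 a b = tq I0 J0 (s a) (s b) \<oplus>\<^bsub>QT I0 J0\<^esub> (tq I0 J0 (f \<otimes> q a) b \<oplus>\<^bsub>QT I0 J0\<^esub> tq I0 J0 (s a) (f \<otimes> q b))"
        using a b fc IJ sc q by (simp add: tq_closed P.a_ac)
      then show "trans I1 J1 I0 J0 (tq I1 J1 a b) = ?A (tq I1 J1 a b) \<oplus>\<^bsub>QT I0 J0\<^esub>
          (?L \<otimes>\<^bsub>QT I0 J0\<^esub> ?U (tq I1 J1 a b) \<oplus>\<^bsub>QT I0 J0\<^esub> ?R \<otimes>\<^bsub>QT I0 J0\<^esub> ?V (tq I1 J1 a b))"
        using a b fc sc q by (simp add: trans(2)[OF IJ1 IJ sub] cU(2) cV(2) cS(2) tq_mult IJ)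
    qed
    from this[OF Q_component[OF G(1) IJ1]]
    have "G (I0, J0) = tensor_op s s G (I0, J0) \<oplus>\<^bsub>QT I0 J0\<^esub> (?L \<otimes>\<^bsub>QT I0 J0\<^esub> U (I0, J0) \<oplus>\<^bsub>QT I0 J0\<^esub> ?R \<otimes>\<^bsub>QT I0 J0\<^esub> V (I0, J0))"
      using tensor_op_component[OF s_lin s_lin G(1) IJ IJ1(1) img(3) IJ1(2) img(4)]
        tensor_op_component[OF q_lin id_lin G(1) IJ IJ1(1) img(1) IJ1(2) img(5)]
        tensor_op_component[OF s_lin q_lin G(1) IJ IJ1(1) img(3) IJ1(2) img(2)]
      by (simp add: Q_trans[OF G(1) IJ1 IJ sub] U_def V_def)
    \<comment> \<open>Since \<open>s\<close> factors through \<open>R/I\<close>, this component can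
      be computed from \<open>G (I, I)\<close>, which is zero.\<close>
    moreover have "tensor_op s s G (I0, J0) = \<zero>\<^bsub>QT I0 J0\<^esub>"
      using tensor_op_component[OF s_lin s_lin G(1) IJ I(2) s_img[OF IJ(1)] I(2) s_img[OF IJ(2)]] G(2)
        additive_map_zero[OF QT_group[OF I(2) I(2)] QT_group[OF IJ]
          coset_lift(1)[OF QT_group[OF IJ] I(2) I(2) bl[OF s_lin s_img[OF IJ(1)] s_lin s_img[OF IJ(2)]]]]
      by simp
    ultimately show "G (I0, J0) = (l f \<otimes>\<^bsub>Q\<^esub> U \<oplus>\<^bsub>Q\<^esub> r f \<otimes>\<^bsub>Q\<^esub> V) (I0, J0)"
      using IJ LR UV Q_component by (simp add: Q_ops incl_component)
  qed (use G UV fc in \<open>simp_all add: incl_closed\<close>)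
  then show ?thesis using that UV by blast
qed

end

section \<open>The element e of a divisor, the annihilator of d, and change of divisor\<close>

lemma (in abelian_group) add_minus_cancel:
  "x \<in> carrier G \<Longrightarrow> z \<in> carrier G \<Longrightarrow> x \<oplus> (z \<ominus> x) = z"
  by (metis a_inv_closed a_minus_def a_lcomm r_neg r_zero)

lemma (in abelian_group) minus_add_minus:
  assumes "x \<in> carrier G" "z \<in> carrier G" "w \<in> carrier G"
  shows "(x \<ominus> z) \<oplus> (w \<ominus> x) = w \<ominus> z"
proof -
  have "(x \<ominus> z) \<oplus> (w \<ominus> x) = \<ominus> z \<oplus> (x \<oplus> (w \<ominus> x))"
    using assms by (simp add: a_minus_def a_ac)
  also have "\<dots> = w \<ominus> z" using assms by (simp add: add_minus_cancel) (simp add: a_minus_def a_comm)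
  finally show ?thesis .
qed

text \<open>The right factor can be moved into the functional, which is then zero. In
  \<open>dual_coeff_mult\<close> this removes the second summand of the element \<open>e\<close> of
  a product.\<close>

lemma (in frobenius_pair) L_rho_zero:
  assumes "\<psi> \<in> Dual" "b \<in> carrier B" "\<And>X. X \<in> carrier B \<Longrightarrow> \<psi> (b \<otimes>\<^bsub>B\<^esub> X) = \<zero>" "t \<in> carrier T"
  shows "L \<psi> (rho b \<otimes>\<^bsub>T\<^esub> t) = \<zero>\<^bsub>B\<^esub>"
proof -
  interpret T: cring T by (rule cring_T)
  show ?thesis
    using assms(4)
    by (induction t rule: T_induct)
      (use assms in \<open>simp_all add: mult_tn L_tn tn_closed L_add L_closed T.r_distr\<close>)
qed

context multicurve
begin

interpretation Q: cring Q by (rule cring_Q)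

definition e_of :: "'r \<Rightarrow> 'r tensor_square" where
  "e_of f = (THE e. e \<in> carrier Q \<and> r f \<ominus>\<^bsub>Q\<^esub> l f = d \<otimes>\<^bsub>Q\<^esub> e)"

lemma e_of_eqI:
  assumes "e \<in> carrier Q" "r f \<ominus>\<^bsub>Q\<^esub> l f = d \<otimes>\<^bsub>Q\<^esub> e"
  shows "e_of f = e"
  unfolding e_of_def
proof (rule the_equality)
  fix e' assume e': "e' \<in> carrier Q \<and> r f \<ominus>\<^bsub>Q\<^esub> l f = d \<otimes>\<^bsub>Q\<^esub> e'"
  then have "d \<otimes>\<^bsub>Q\<^esub> e' = d \<otimes>\<^bsub>Q\<^esub> e" using assms(2) by (simp only:)
  then show "e' = e" using Q.regular_cancel[OF d_regular _ assms(1)] e' by blast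
qed (use assms in simp)

lemma e_of: "f \<in> carrier R \<Longrightarrow> e_of f \<in> carrier Q" "f \<in> carrier R \<Longrightarrow> r f \<ominus>\<^bsub>Q\<^esub> l f = d \<otimes>\<^bsub>Q\<^esub> e_of f"
  using incl_diff[of f] e_of_eqI by auto

text \<open>Generators are carried in place of ideals, because the duality formula and the fractions
  need the denominator itself.\<close>

definition divisor_gen :: "'r \<Rightarrow> bool" where
  "divisor_gen f \<longleftrightarrow> regular_elt R f \<and> divisor k R T (PIdl f)"

lemma divisor_genD:
  assumes "divisor_gen f"
  shows "regular_elt R f" "f \<in> carrier R" "PIdl f \<in> OI" "fin_projective k (quot R (PIdl f))"
  using assms by (auto simp: divisor_gen_def divisor_def regular_elt_def)

abbreviation "Dl I \<equiv> lin_maps k (quot R I) (self_module k)"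

text \<open>The numerator \<open>(1 \<otimes> \<psi>)(e)\<close> of the duality formula.\<close>

definition dual_coeff :: "'r \<Rightarrow> ('r set \<Rightarrow> 'k) \<Rightarrow> 'r set" where
  "dual_coeff f \<psi> = tensor_lift (quot R (PIdl f)) (\<lambda>X Y. \<psi> Y \<odot>\<^bsub>quot R (PIdl f)\<^esub> X)
     (e_of f (PIdl f, PIdl f))"

text \<open>Each pure tensor is the component of a product of a left and a right inclusion, and sums
  lift to sums.\<close>

lemma QT_lift:
  assumes IJ: "I \<in> OI" "J \<in> OI" and X: "X \<in> carrier (QT I J)"
  obtains F where "F \<in> carrier Q" "F (I, J) = X"
proof -
  have "\<exists>F\<in>carrier Q. F (I, J) = X"
    using X IJ
  proof (induction X rule: QT_induct)
    case (tens a b)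
    then have "l a \<otimes>\<^bsub>Q\<^esub> r b \<in> carrier Q" "(l a \<otimes>\<^bsub>Q\<^esub> r b) (I, J) = tq I J a b"
      using IJ by (simp_all add: incl_closed Q_ops incl_component tq_mult)
    then show ?case by blast
  next
    case (add X Y)
    then obtain F G where "F \<in> carrier Q" "F (I, J) = X" "G \<in> carrier Q" "G (I, J) = Y" by blast
    then have "F \<oplus>\<^bsub>Q\<^esub> G \<in> carrier Q" "(F \<oplus>\<^bsub>Q\<^esub> G) (I, J) = X \<oplus>\<^bsub>QT I J\<^esub> Y" using IJ by (simp_all add: Q_ops)
    then show ?case by blast
  qed
  then show ?thesis using that by blast
qed

lemma component_hom: "I \<in> OI \<Longrightarrow> J \<in> OI \<Longrightarrow> additive_map Q (QT I J) (\<lambda>F. F (I, J))"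
  by (rule additive_mapI) (auto simp: Q_component Q_ops)

lemma component_minus:
  "I \<in> OI \<Longrightarrow> J \<in> OI \<Longrightarrow> F \<in> carrier Q \<Longrightarrow> G \<in> carrier Q \<Longrightarrow> (F \<ominus>\<^bsub>Q\<^esub> G) (I, J) = F (I, J) \<ominus>\<^bsub>QT I J\<^esub> G (I, J)"
  using additive_map_minus[OF Q.abelian_group_axioms QT_group component_hom] by blast

lemma tq_zero:
  assumes "I \<in> OI" "J \<in> OI" "b \<in> carrier R"
  shows "a \<in> I \<Longrightarrow> tq I J a b = \<zero>\<^bsub>QT I J\<^esub>" "a \<in> J \<Longrightarrow> tq I J b a = \<zero>\<^bsub>QT I J\<^esub>"
  using k_bilinear_tq[OF assms(1,2) order_refl order_refl] assms(3) by (auto simp: k_bilinear_def)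

text \<open>Both \<open>1 \<otimes> f\<close> and \<open>f \<otimes> 1\<close> vanish once
  \<open>f\<close> is zero in each factor.\<close>

lemma de_component:
  assumes f: "divisor_gen f" and I: "I = PIdl f"
  shows "d (I, I) \<otimes>\<^bsub>QT I I\<^esub> e_of f (I, I) = \<zero>\<^bsub>QT I I\<^esub>"
proof -
  note fD = divisor_genD[OF f]
  have IO: "I \<in> OI" using fD I by simp
  interpret P: cring "QT I I" by (rule QT_cring[OF IO IO])
  have "f \<in> I" using fD cgenideal_self I by simp
  then have "(r f \<ominus>\<^bsub>Q\<^esub> l f) (I, I) = \<zero>\<^bsub>QT I I\<^esub>"
    unfolding component_minus[OF IO IO incl_closed(2)[OF fD(2)] incl_closed(1)[OF fD(2)]]
    using fD IO by (simp add: incl_component tq_zero a_minus_def)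
  then show ?thesis using e_of[OF fD(2)] IO by (simp add: Q_ops)
qed

text \<open>The condition on the annihilator is the point; the others are read off from the diagonal
  ideal and a dual basis. A lift of \<open>t\<close> to the completed tensor square is corrected by
  a multiple of \<open>e_of f\<close> until \<open>d\<close> can be cancelled.\<close>

lemma frobenius:
  assumes f: "divisor_gen f" and I: "I = PIdl f"
  obtains n \<phi> x where "frobenius_pair k (quot R I) n \<phi> x (d (I, I)) (e_of f (I, I))"
proof -
  note fD = divisor_genD[OF f]
  have IO: "I \<in> OI" using fD I by simp
  interpret I: quotient_algebra k R I by (rule OI_quot[OF IO])
  interpret P: cring "QT I I" by (rule QT_cring[OF IO IO])
  interpret h: ring_hom_cring Q R \<mu>
    by (intro ring_hom_cring.intro ring_hom_cring_axioms.intro cring_Q M_cring codiagonal_hom)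
  have fI: "f \<in> I" using fD cgenideal_self I by simp
  let ?e = "e_of f"
  have e: "?e \<in> carrier Q" "r f \<ominus>\<^bsub>Q\<^esub> l f = d \<otimes>\<^bsub>Q\<^esub> ?e" using e_of fD by auto
  have lrc: "l f \<in> carrier Q" "r f \<in> carrier Q" using fD incl_closed by auto
  have rf: "r f = l f \<oplus>\<^bsub>Q\<^esub> d \<otimes>\<^bsub>Q\<^esub> ?e"
    using lrc by (simp add: e(2)[symmetric] Q.add_minus_cancel)
  obtain n \<phi> x where db: "\<And>i. i < (n::nat) \<Longrightarrow> \<phi> i \<in> Dl I" "\<And>i. i < n \<Longrightarrow> x i \<in> carrier (quot R I)"
    "\<And>b. b \<in> carrier (quot R I) \<Longrightarrow> b = (\<Oplus>\<^bsub>quot R I\<^esub>i\<in>{..<n}. \<phi> i b \<odot>\<^bsub>quot R I\<^esub> x i)"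
    using fin_projective_dual_basis[OF I.module_quot] fD(4) I by blast
  have mult_d: "mul I (d (I, I)) = I"
  proof -
    have "\<mu> d = \<zero>" using diag_iff[OF dc] dc by (metis Q.one_closed Q.r_one)
    then show ?thesis using codiagonal_spec(2)[OF dc IO] I.coset_zero by simp
  qed
  have "frobenius_pair k (quot R I) n \<phi> x (d (I, I)) (?e (I, I))"
  proof (intro frobenius_pair.intro frobenius_pair_axioms.intro QT_tensor_algebra IO db)
    show "d (I, I) \<in> carrier (QT I I)" "?e (I, I) \<in> carrier (QT I I)"
      using Q_component dc e IO by auto
    show "\<exists>t\<in>carrier (QT I I). d (I, I) \<otimes>\<^bsub>QT I I\<^esub> t =
        tens k (quot R I) (quot R I) \<one>\<^bsub>quot R I\<^esub> b \<ominus>\<^bsub>QT I I\<^esub> tens k (quot R I) (quot R I) b \<one>\<^bsub>quot R I\<^esub>"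
      if "b \<in> carrier (quot R I)" for b
    proof -
      obtain a where a: "a \<in> carrier R" "b = I +> a" using \<open>b \<in> carrier (quot R I)\<close> I.quot_carrier by auto
      obtain G where G: "G \<in> carrier Q" "r a \<ominus>\<^bsub>Q\<^esub> l a = d \<otimes>\<^bsub>Q\<^esub> G" using incl_diff[OF a(1)] by blast
      have "d (I, I) \<otimes>\<^bsub>QT I I\<^esub> G (I, I) = (r a \<ominus>\<^bsub>Q\<^esub> l a) (I, I)" using G IO by (simp add: Q_ops)
      also have "\<dots> = tq I I \<one> a \<ominus>\<^bsub>QT I I\<^esub> tq I I a \<one>"
        using a IO by (simp add: component_minus incl_closed incl_component)
      finally show ?thesis using Q_component[OF G(1) IO IO] a by (auto simp: I.coset_one)
    qed
    show "tensor_lift (quot R I) (\<otimes>\<^bsub>quot R I\<^esub>) (d (I, I)) = \<zero>\<^bsub>quot R I\<^esub>"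
      using mult_d by (simp add: mul_def I.quot_simps)
    show "d (I, I) \<otimes>\<^bsub>QT I I\<^esub> ?e (I, I) = \<zero>\<^bsub>QT I I\<^esub>" by (rule de_component[OF f I])
    fix t assume t: "t \<in> carrier (QT I I)" "d (I, I) \<otimes>\<^bsub>QT I I\<^esub> t = \<zero>\<^bsub>QT I I\<^esub>"
    obtain x where x: "x \<in> carrier Q" "x (I, I) = t" using QT_lift[OF IO IO t(1)] .
    have "(d \<otimes>\<^bsub>Q\<^esub> x) (I, I) = \<zero>\<^bsub>QT I I\<^esub>" using t x IO by (simp add: Q_ops)
    then obtain U V where UV: "U \<in> carrier Q" "V \<in> carrier Q" "d \<otimes>\<^bsub>Q\<^esub> x = l f \<otimes>\<^bsub>Q\<^esub> U \<oplus>\<^bsub>Q\<^esub> r f \<otimes>\<^bsub>Q\<^esub> V"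
      using kernel_component[OF fD(1) I IO] fD(4) I x dc by (metis Q.m_closed)
    \<comment> \<open>With \<open>r f = l f + d e\<close>, the equation
      \<open>d x = (l f) U + (r f) V\<close> becomes
      \<open>d (x - e V) = (l f) (U + V)\<close>.\<close>
    define W where "W = U \<oplus>\<^bsub>Q\<^esub> V"
    define z where "z = x \<ominus>\<^bsub>Q\<^esub> ?e \<otimes>\<^bsub>Q\<^esub> V"
    have WQ: "W \<in> carrier Q" "z \<in> carrier Q" using UV x e by (auto simp: W_def z_def)
    have dxe: "d \<otimes>\<^bsub>Q\<^esub> x = l f \<otimes>\<^bsub>Q\<^esub> W \<oplus>\<^bsub>Q\<^esub> d \<otimes>\<^bsub>Q\<^esub> (?e \<otimes>\<^bsub>Q\<^esub> V)"
      unfolding UV(3) rf W_def using UV lrc e dc by (simp add: Q.l_distr Q.r_distr Q.a_ac Q.m_assoc)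
    have dz: "d \<otimes>\<^bsub>Q\<^esub> z = l f \<otimes>\<^bsub>Q\<^esub> W"
    proof -
      have "d \<otimes>\<^bsub>Q\<^esub> z = d \<otimes>\<^bsub>Q\<^esub> x \<oplus>\<^bsub>Q\<^esub> \<ominus>\<^bsub>Q\<^esub> (d \<otimes>\<^bsub>Q\<^esub> (?e \<otimes>\<^bsub>Q\<^esub> V))"
        using UV x e dc by (simp add: z_def a_minus_def Q.r_distr Q.r_minus)
      then show ?thesis using WQ UV lrc e dc by (simp add: dxe Q.a_assoc Q.r_neg)
    qed
    \<comment> \<open>The codiagonal kills \<open>d\<close> and sends \<open>l f\<close> to the
      regular element \<open>f\<close>, so \<open>W\<close> is a multiple of \<open>d\<close>.
      Cancelling \<open>d\<close> then gives \<open>z = (l f) W'\<close>, which vanishes at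
      \<open>(I, I)\<close>.\<close>
    have "\<mu> (l f \<otimes>\<^bsub>Q\<^esub> W) = \<zero>"
      using diag_iff[of "l f \<otimes>\<^bsub>Q\<^esub> W"] dz WQ lrc by (metis Q.m_closed)
    then have "f \<otimes> \<mu> W = \<zero>" using WQ lrc fD codiagonal_incl by simp
    then have "\<mu> W = \<zero>" using fD(1) WQ h.hom_closed unfolding regular_elt_def by blast
    then obtain W' where W': "W' \<in> carrier Q" "W = d \<otimes>\<^bsub>Q\<^esub> W'" using diag_iff WQ by blast
    have "d \<otimes>\<^bsub>Q\<^esub> z = d \<otimes>\<^bsub>Q\<^esub> (l f \<otimes>\<^bsub>Q\<^esub> W')" using dz W' lrc dc by (simp add: Q.m_lcomm)
    then have z: "z = l f \<otimes>\<^bsub>Q\<^esub> W'" using Q.regular_cancel[OF d_regular WQ(2), of "l f \<otimes>\<^bsub>Q\<^esub> W'"] W' lrc by simp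
    \<comment> \<open>Modulo \<open>d\<close> the element \<open>V\<close> equals
      \<open>l a\<close>, and \<open>d e\<close> vanishes at \<open>(I, I)\<close>; hence
      \<open>e V\<close> and \<open>(l a) e\<close> have the same component there.\<close>
    define a where "a = \<mu> V"
    have a: "a \<in> carrier R" using UV by (simp add: a_def)
    have "\<mu> (V \<ominus>\<^bsub>Q\<^esub> l a) = \<zero>"
      using UV a by (simp add: a_minus_def incl_closed codiagonal_incl a_def M.r_neg)
    then obtain V' where V': "V' \<in> carrier Q" "V \<ominus>\<^bsub>Q\<^esub> l a = d \<otimes>\<^bsub>Q\<^esub> V'"
      using diag_iff[of "V \<ominus>\<^bsub>Q\<^esub> l a"] UV a by (auto simp: incl_closed)
    have V: "V = l a \<oplus>\<^bsub>Q\<^esub> d \<otimes>\<^bsub>Q\<^esub> V'"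
      using UV a by (simp add: V'(2)[symmetric] Q.add_minus_cancel incl_closed)
    have xe: "x = l f \<otimes>\<^bsub>Q\<^esub> W' \<oplus>\<^bsub>Q\<^esub> ?e \<otimes>\<^bsub>Q\<^esub> V"
      using z[symmetric] x UV e by (simp add: z_def a_minus_def Q.a_assoc Q.l_neg)
    have "x = l f \<otimes>\<^bsub>Q\<^esub> W' \<oplus>\<^bsub>Q\<^esub> (l a \<otimes>\<^bsub>Q\<^esub> ?e \<oplus>\<^bsub>Q\<^esub> (d \<otimes>\<^bsub>Q\<^esub> ?e) \<otimes>\<^bsub>Q\<^esub> V')"
      unfolding xe V using a V' W' e dc lrc by (simp add: incl_closed Q.r_distr Q.m_ac)
    then have "t = (l f \<otimes>\<^bsub>Q\<^esub> W' \<oplus>\<^bsub>Q\<^esub> (l a \<otimes>\<^bsub>Q\<^esub> ?e \<oplus>\<^bsub>Q\<^esub> (d \<otimes>\<^bsub>Q\<^esub> ?e) \<otimes>\<^bsub>Q\<^esub> V')) (I, I)" using x by simp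
    also have "\<dots> = tq I I a \<one> \<otimes>\<^bsub>QT I I\<^esub> ?e (I, I)"
      using a IO fI e W' V' de_component[OF f I] by (simp add: Q_ops incl_component tq_zero Q_component tq_closed)
    finally show "\<exists>b\<in>carrier (quot R I). t = tens k (quot R I) (quot R I) b \<one>\<^bsub>quot R I\<^esub> \<otimes>\<^bsub>QT I I\<^esub> ?e (I, I)"
      using a coset_closed[OF IO a] by (auto simp: I.coset_one)
  qed
  then show ?thesis using that by blast
qed

lemma dual_coeff_frobenius:
  assumes "I = PIdl f" "frobenius_pair k (quot R I) n \<phi> x (d (I, I)) (e_of f (I, I))"
  shows "dual_coeff f \<psi> = frobenius_pair.c (quot R I) (e_of f (I, I)) \<psi>"
  using frobenius_pair.c_def[OF assms(2)] frobenius_pair.L_def[OF assms(2)] assms(1) by (simp add: dual_coeff_def)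

lemma dual_coeff_closed:
  assumes f: "divisor_gen f" and "\<psi> \<in> Dl (PIdl f)"
  shows "dual_coeff f \<psi> \<in> carrier (quot R (PIdl f))"
proof -
  obtain n \<phi> x where fr: "frobenius_pair k (quot R (PIdl f)) n \<phi> x (d (PIdl f, PIdl f)) (e_of f (PIdl f, PIdl f))"
    using frobenius[OF f refl] .
  show ?thesis using frobenius_pair.c_closed[OF fr assms(2)] dual_coeff_frobenius[OF refl fr] by simp
qed

lemma dual_coeff_translate:
  assumes f: "divisor_gen f" and "\<psi> \<in> Dl (PIdl f)" "b \<in> carrier (quot R (PIdl f))"
  shows "dual_coeff f (\<lambda>X\<in>carrier (quot R (PIdl f)). \<psi> (b \<otimes>\<^bsub>quot R (PIdl f)\<^esub> X)) = b \<otimes>\<^bsub>quot R (PIdl f)\<^esub> dual_coeff f \<psi>"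
proof -
  obtain n \<phi> x where fr: "frobenius_pair k (quot R (PIdl f)) n \<phi> x (d (PIdl f, PIdl f)) (e_of f (PIdl f, PIdl f))"
    using frobenius[OF f refl] .
  show ?thesis using frobenius_pair.c_translate[OF fr assms(2,3)] dual_coeff_frobenius[OF refl fr] by simp
qed

lemma ex_generator:
  assumes f: "divisor_gen f"
  obtains \<epsilon> where "\<epsilon> \<in> Dl (PIdl f)"
    "\<And>b. b \<in> carrier (quot R (PIdl f)) \<Longrightarrow> dual_coeff f (\<lambda>X\<in>carrier (quot R (PIdl f)). \<epsilon> (b \<otimes>\<^bsub>quot R (PIdl f)\<^esub> X)) = b"
    "\<And>\<psi> X. \<psi> \<in> Dl (PIdl f) \<Longrightarrow> X \<in> carrier (quot R (PIdl f)) \<Longrightarrow> \<psi> X = \<epsilon> (dual_coeff f \<psi> \<otimes>\<^bsub>quot R (PIdl f)\<^esub> X)"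
proof -
  obtain n \<phi> x where fr: "frobenius_pair k (quot R (PIdl f)) n \<phi> x (d (PIdl f, PIdl f)) (e_of f (PIdl f, PIdl f))"
    using frobenius[OF f refl] .
  show ?thesis using frobenius_pair.ex_generator[OF fr] that unfolding dual_coeff_frobenius[OF refl fr] by blast
qed

text \<open>\<open>1 \<otimes> fh - fh \<otimes> 1 = (h \<otimes> 1)(1 \<otimes> f - f \<otimes> 1) + (1 \<otimes> f)(1 \<otimes> h - h \<otimes> 1)\<close>\<close>

lemma dual_coeff_mult:
  assumes f: "divisor_gen f" and g: "divisor_gen (f \<otimes> h)" and h: "h \<in> carrier R"
    and \<psi>: "\<psi> \<in> Dl (PIdl f)" and \<psi>': "\<psi>' \<in> Dl (PIdl (f \<otimes> h))"
    and eq: "\<And>a. a \<in> carrier R \<Longrightarrow> \<psi>' (PIdl (f \<otimes> h) +> a) = \<psi> (PIdl f +> a)"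
  obtains a where "a \<in> carrier R" "dual_coeff f \<psi> = PIdl f +> a" "dual_coeff (f \<otimes> h) \<psi>' = PIdl (f \<otimes> h) +> (h \<otimes> a)"
proof -
  define g where "g = f \<otimes> h"
  define I where "I = PIdl f"
  define J where "J = PIdl g"
  have g': "divisor_gen g" using g by (simp add: g_def)
  note fD = divisor_genD[OF f] and gD = divisor_genD[OF g']
  have IO: "I \<in> OI" and JO: "J \<in> OI" using fD gD by (simp_all add: I_def J_def)
  have JI: "J \<subseteq> I"
  proof
    fix z assume "z \<in> J"
    then obtain b where "b \<in> carrier R" "z = b \<otimes> (f \<otimes> h)" unfolding J_def g_def PIdl_mem_iff by blast
    then have "z = (b \<otimes> h) \<otimes> f" "b \<otimes> h \<in> carrier R" using fD h by (simp_all add: m_ac)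
    then show "z \<in> I" by (auto simp: I_def PIdl_mem_iff)
  qed
  interpret I: quotient_algebra k R I by (rule OI_quot[OF IO])
  interpret J: quotient_algebra k R J by (rule OI_quot[OF JO])
  obtain n \<phi> x where fr: "frobenius_pair k (quot R I) n \<phi> x (d (I, I)) (e_of f (I, I))"
    using frobenius[OF f I_def] .
  obtain n' \<phi>' x' where fr': "frobenius_pair k (quot R J) n' \<phi>' x' (d (J, J)) (e_of g (J, J))"
    using frobenius[OF g' J_def] .
  interpret F: frobenius_pair k "quot R I" n \<phi> x "d (I, I)" "e_of f (I, I)" by (rule fr)
  interpret G: frobenius_pair k "quot R J" n' \<phi>' x' "d (J, J)" "e_of g (J, J)" by (rule fr')
  have \<psi>I: "\<psi> \<in> Dl I" and \<psi>J: "\<psi>' \<in> Dl J" using \<psi> \<psi>' by (simp_all add: I_def J_def g_def)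
  have eq': "\<psi>' (J +> a) = \<psi> (I +> a)" if "a \<in> carrier R" for a using eq[OF that] by (simp add: I_def J_def g_def)
  obtain z where z: "z \<in> carrier Q" "r h \<ominus>\<^bsub>Q\<^esub> l h = d \<otimes>\<^bsub>Q\<^esub> z" using incl_diff[OF h] by blast
  note e = e_of[OF fD(2)]
  have lc: "l f \<in> carrier Q" "r f \<in> carrier Q" "l h \<in> carrier Q" "r h \<in> carrier Q" using fD h incl_closed by auto
  have eg: "e_of g = l h \<otimes>\<^bsub>Q\<^esub> e_of f \<oplus>\<^bsub>Q\<^esub> r f \<otimes>\<^bsub>Q\<^esub> z"
  proof (rule e_of_eqI)
    have "r g \<ominus>\<^bsub>Q\<^esub> l g = r f \<otimes>\<^bsub>Q\<^esub> r h \<ominus>\<^bsub>Q\<^esub> l f \<otimes>\<^bsub>Q\<^esub> l h"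
      using fD h ring_hom_mult[OF incl_hom(1)] ring_hom_mult[OF incl_hom(2)] by (simp add: g_def)
    also have "\<dots> = l h \<otimes>\<^bsub>Q\<^esub> (r f \<ominus>\<^bsub>Q\<^esub> l f) \<oplus>\<^bsub>Q\<^esub> r f \<otimes>\<^bsub>Q\<^esub> (r h \<ominus>\<^bsub>Q\<^esub> l h)"
    proof -
      have "l h \<otimes>\<^bsub>Q\<^esub> (r f \<ominus>\<^bsub>Q\<^esub> l f) \<oplus>\<^bsub>Q\<^esub> r f \<otimes>\<^bsub>Q\<^esub> (r h \<ominus>\<^bsub>Q\<^esub> l h) =
          (l h \<otimes>\<^bsub>Q\<^esub> r f \<ominus>\<^bsub>Q\<^esub> l f \<otimes>\<^bsub>Q\<^esub> l h) \<oplus>\<^bsub>Q\<^esub> (r f \<otimes>\<^bsub>Q\<^esub> r h \<ominus>\<^bsub>Q\<^esub> l h \<otimes>\<^bsub>Q\<^esub> r f)"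
        using lc by (simp add: a_minus_def Q.r_distr Q.r_minus Q.m_comm)
      then show ?thesis using lc by (simp add: Q.minus_add_minus)
    qed
    also have "\<dots> = d \<otimes>\<^bsub>Q\<^esub> (l h \<otimes>\<^bsub>Q\<^esub> e_of f \<oplus>\<^bsub>Q\<^esub> r f \<otimes>\<^bsub>Q\<^esub> z)"
      using lc dc e z by (simp add: Q.r_distr Q.m_lcomm)
    finally show "r g \<ominus>\<^bsub>Q\<^esub> l g = d \<otimes>\<^bsub>Q\<^esub> (l h \<otimes>\<^bsub>Q\<^esub> e_of f \<oplus>\<^bsub>Q\<^esub> r f \<otimes>\<^bsub>Q\<^esub> z)" .
  qed (use lc e z in auto)
  \<comment> \<open>The contractions in \<open>R/J\<close> and in \<open>R/I\<close> are computed by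
    the same element of \<open>R\<close> on pure tensors, and this persists for sums.\<close>
  have compat: "\<exists>a\<in>carrier R. G.L \<psi>' t = J +> a \<and> F.L \<psi> (trans J J I I t) = I +> a"
    if "t \<in> carrier (QT J J)" for t
    using that JO JO
  proof (induction t rule: QT_induct)
    case (tens a b)
    have pk: "\<psi> (I +> b) \<in> carrier k" using F.Dual_closed[OF \<psi>I] I.coset_mem_carrier tens by blast
    have "G.L \<psi>' (tq J J a b) = J +> (\<psi> (I +> b) \<odot> a)"
      using tens \<psi>J pk by (simp add: G.L_tn J.coset_mem_carrier eq' J.coset_smult)
    moreover have "F.L \<psi> (trans J J I I (tq J J a b)) = I +> (\<psi> (I +> b) \<odot> a)"
      using tens \<psi>I pk by (simp add: trans(2)[OF JO JO IO IO JI JI] F.L_tn I.coset_mem_carrier I.coset_smult)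
    ultimately show ?case using pk tens by blast
  next
    case (add X Y)
    then obtain a b where ab: "a \<in> carrier R" "G.L \<psi>' X = J +> a" "F.L \<psi> (trans J J I I X) = I +> a"
      "b \<in> carrier R" "G.L \<psi>' Y = J +> b" "F.L \<psi> (trans J J I I Y) = I +> b" by blast
    note t = trans(1)[OF JO JO IO IO JI JI]
    have "G.L \<psi>' (X \<oplus>\<^bsub>QT J J\<^esub> Y) = J +> (a \<oplus> b)"
      using add ab \<psi>J by (simp add: G.L_add J.coset_add)
    moreover have "F.L \<psi> (trans J J I I (X \<oplus>\<^bsub>QT J J\<^esub> Y)) = I +> (a \<oplus> b)"
      using add ab \<psi>I by (simp add: additive_map_add[OF t] additive_map_closed[OF t] F.L_add I.coset_add)
    ultimately show ?case using ab by blast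
  qed
  have efc: "e_of f (J, J) \<in> carrier (QT J J)" by (rule Q_component[OF e(1) JO JO])
  obtain a where a: "a \<in> carrier R" "G.L \<psi>' (e_of f (J, J)) = J +> a" "F.L \<psi> (e_of f (I, I)) = I +> a"
    using compat[OF efc] Q_trans[OF e(1) JO JO IO IO JI JI] by auto
  \<comment> \<open>The functional factors through \<open>R/I\<close> and so vanishes on multiples
    of \<open>f\<close>; the summand \<open>(r f) z\<close> of \<open>e_of g\<close> contributes
    nothing.\<close>
  have zero: "\<psi>' ((J +> f) \<otimes>\<^bsub>quot R J\<^esub> X) = \<zero>\<^bsub>k\<^esub>" if X: "X \<in> carrier (quot R J)" for X
  proof -
    obtain b where b: "b \<in> carrier R" "X = J +> b" using X J.quot_carrier by auto
    have "f \<otimes> b \<in> I" using b fD by (auto simp: I_def PIdl_mem_iff m_comm)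
    then have "I +> (f \<otimes> b) = \<zero>\<^bsub>quot R I\<^esub>" using I.coset_eq_zero_iff b fD by (simp add: I.quot_simps)
    moreover have "\<psi> \<zero>\<^bsub>quot R I\<^esub> = \<zero>\<^bsub>k\<^esub>"
      using \<psi>I additive_map_zero[OF I.abelian_group_quot R.abelian_group_axioms] by (simp add: F.Dual_iff)
    ultimately show ?thesis using b fD by (simp add: J.coset_mult eq')
  qed
  have "dual_coeff g \<psi>' = G.L \<psi>' (e_of g (J, J))" by (simp add: dual_coeff_frobenius[OF J_def fr'] G.c_def)
  also have "e_of g (J, J) = tq J J h \<one> \<otimes>\<^bsub>QT J J\<^esub> e_of f (J, J) \<oplus>\<^bsub>QT J J\<^esub> tq J J \<one> f \<otimes>\<^bsub>QT J J\<^esub> z (J, J)"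
    using JO by (simp add: eg Q_ops incl_component)
  also have "G.L \<psi>' \<dots> = (J +> h) \<otimes>\<^bsub>quot R J\<^esub> G.L \<psi>' (e_of f (J, J))"
  proof -
    have zc: "z (J, J) \<in> carrier (QT J J)" by (rule Q_component[OF z(1) JO JO])
    have hq: "J +> h \<in> carrier (quot R J)" and fq: "J +> f \<in> carrier (quot R J)"
      using h fD J.coset_mem_carrier by auto
    have "G.L \<psi>' (G.lam (J +> h) \<otimes>\<^bsub>QT J J\<^esub> e_of f (J, J) \<oplus>\<^bsub>QT J J\<^esub> G.rho (J +> f) \<otimes>\<^bsub>QT J J\<^esub> z (J, J)) =
        G.L \<psi>' (G.lam (J +> h) \<otimes>\<^bsub>QT J J\<^esub> e_of f (J, J)) \<oplus>\<^bsub>quot R J\<^esub> G.L \<psi>' (G.rho (J +> f) \<otimes>\<^bsub>QT J J\<^esub> z (J, J))"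
      by (intro G.L_add \<psi>J QT_closed(2)[OF JO JO] G.lam_closed hq fq efc zc)
    also have "\<dots> = (J +> h) \<otimes>\<^bsub>quot R J\<^esub> G.L \<psi>' (e_of f (J, J))"
      using G.L_lam[OF \<psi>J hq efc] G.L_rho_zero[OF \<psi>J fq zero zc] hq G.L_closed[OF \<psi>J efc]
        cring.cring_simprules(16)[OF J.cring_quot] cring.cring_simprules(5)[OF J.cring_quot]
      by simp
    finally show ?thesis by (simp add: J.coset_one)
  qed
  also have "\<dots> = J +> (h \<otimes> a)" using a h by (simp add: J.coset_mult)
  finally have "dual_coeff g \<psi>' = J +> (h \<otimes> a)" .
  moreover have "dual_coeff f \<psi> = I +> a" using a(3) by (simp add: dual_coeff_frobenius[OF I_def fr] F.c_def)
  ultimately show ?thesis using that a(1) by (simp add: I_def J_def g_def)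
qed

end

section \<open>Differentials\<close>

context multicurve
begin

interpretation Q: cring Q by (rule cring_Q)

abbreviation "Om \<equiv> differentials k R T"
abbreviation "\<alpha> \<equiv> diff_class k R T d"

text \<open>The record inside \<open>differentials\<close>, before division by the square of the
  diagonal ideal, in literally the same form.\<close>

definition DI :: "('r, 'r tensor_square) module" where
  "DI = \<lparr>carrier = diag_ideal k R T, mult = mult Q, one = one Q, zero = zero Q, add = add Q,
        smult = (\<lambda>a F. l a \<otimes>\<^bsub>Q\<^esub> F)\<rparr>"

abbreviation "DI2 \<equiv> ideal_prod Q (diag_ideal k R T) (diag_ideal k R T)"

lemma DI_simps: "carrier DI = diag_ideal k R T" "add DI = add Q" "zero DI = zero Q" "smult DI a F = l a \<otimes>\<^bsub>Q\<^esub> F"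
  by (simp_all add: DI_def)

lemma diag_mem_iff: "F \<in> diag_ideal k R T \<longleftrightarrow> (\<exists>G\<in>carrier Q. F = d \<otimes>\<^bsub>Q\<^esub> G)"
  using d dc by (auto simp: difference_function_def PIdl_mem_iff Q.m_comm)

lemma diag_square_iff: "F \<in> DI2 \<longleftrightarrow> (\<exists>G\<in>carrier Q. F = d \<otimes>\<^bsub>Q\<^esub> (d \<otimes>\<^bsub>Q\<^esub> G))"
proof
  assume "F \<in> DI2"
  then show "\<exists>G\<in>carrier Q. F = d \<otimes>\<^bsub>Q\<^esub> (d \<otimes>\<^bsub>Q\<^esub> G)"
  proof (induction rule: ideal_prod.induct)
    case (prod i j)
    then obtain G H where G: "G \<in> carrier Q" "i = d \<otimes>\<^bsub>Q\<^esub> G" and H: "H \<in> carrier Q" "j = d \<otimes>\<^bsub>Q\<^esub> H"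
      unfolding diag_mem_iff by blast
    then have "i \<otimes>\<^bsub>Q\<^esub> j = d \<otimes>\<^bsub>Q\<^esub> (d \<otimes>\<^bsub>Q\<^esub> (G \<otimes>\<^bsub>Q\<^esub> H))" using dc by (simp add: Q.m_ac)
    then show ?case using G H by blast
  next
    case (sum s1 s2)
    then obtain G H where G: "G \<in> carrier Q" "s1 = d \<otimes>\<^bsub>Q\<^esub> (d \<otimes>\<^bsub>Q\<^esub> G)" and H: "H \<in> carrier Q" "s2 = d \<otimes>\<^bsub>Q\<^esub> (d \<otimes>\<^bsub>Q\<^esub> H)" by blast
    then have "s1 \<oplus>\<^bsub>Q\<^esub> s2 = d \<otimes>\<^bsub>Q\<^esub> (d \<otimes>\<^bsub>Q\<^esub> (G \<oplus>\<^bsub>Q\<^esub> H))" using dc by (simp add: Q.r_distr)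
    then show ?case using G H by blast
  qed
next
  assume "\<exists>G\<in>carrier Q. F = d \<otimes>\<^bsub>Q\<^esub> (d \<otimes>\<^bsub>Q\<^esub> G)"
  then obtain G where G: "G \<in> carrier Q" "F = d \<otimes>\<^bsub>Q\<^esub> (d \<otimes>\<^bsub>Q\<^esub> G)" by blast
  have "d = d \<otimes>\<^bsub>Q\<^esub> \<one>\<^bsub>Q\<^esub>" using dc by simp
  then have "d \<in> diag_ideal k R T" unfolding diag_mem_iff by blast
  moreover have "d \<otimes>\<^bsub>Q\<^esub> G \<in> diag_ideal k R T" using G unfolding diag_mem_iff by blast
  ultimately show "F \<in> DI2" unfolding G(2) by (rule ideal_prod.prod)
qed

lemma diag_ideal: "ideal (diag_ideal k R T) Q"
  using d Q.cgenideal_ideal[OF dc] by (simp add: difference_function_def)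

lemma DI_module: "Module.module R DI"
proof -
  interpret D: ideal "diag_ideal k R T" Q by (rule diag_ideal)
  have sm: "l a \<otimes>\<^bsub>Q\<^esub> F \<in> diag_ideal k R T" if "a \<in> carrier R" "F \<in> diag_ideal k R T" for a F
    using that by (simp add: D.I_l_closed incl_closed)
  have ex: "\<exists>y\<in>diag_ideal k R T. y \<oplus>\<^bsub>Q\<^esub> x = \<zero>\<^bsub>Q\<^esub>" if "x \<in> diag_ideal k R T" for x
    using that D.a_inv_closed Q.l_neg D.Icarr by blast
  show ?thesis
  proof (intro moduleI abelian_groupI M_cring)
    fix x assume "x \<in> carrier DI" then show "\<exists>y\<in>carrier DI. y \<oplus>\<^bsub>DI\<^esub> x = \<zero>\<^bsub>DI\<^esub>" using ex by (simp add: DI_simps)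
  qed (auto simp: DI_simps D.a_closed D.Icarr Q.a_ac sm incl_closed ring_hom_add[OF incl_hom(1)] ring_hom_mult[OF incl_hom(1)]
      ring_hom_one[OF incl_hom(1)] Q.l_distr Q.r_distr Q.m_assoc)
qed

lemma DI_quotient: "quotient_module R DI DI2"
proof -
  interpret D: Module.module R DI by (rule DI_module)
  interpret I2: ideal DI2 Q by (rule Q.ideal_prod_is_ideal[OF diag_ideal diag_ideal])
  have sub: "DI2 \<subseteq> diag_ideal k R T"
  proof
    fix F assume "F \<in> DI2"
    then obtain G where "G \<in> carrier Q" "F = d \<otimes>\<^bsub>Q\<^esub> (d \<otimes>\<^bsub>Q\<^esub> G)" unfolding diag_square_iff by blast
    moreover from this have "d \<otimes>\<^bsub>Q\<^esub> G \<in> carrier Q" using dc by simp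
    ultimately show "F \<in> diag_ideal k R T" unfolding diag_mem_iff by blast
  qed
  \<comment> \<open>Negation in the record \<open>DI\<close> is defined within its own carrier and
    has to be identified with negation in the completed tensor square.\<close>
  have inv: "\<ominus>\<^bsub>DI\<^esub> F \<in> DI2" if F: "F \<in> DI2" for F
  proof -
    have m: "\<ominus>\<^bsub>Q\<^esub> F \<in> DI2" by (rule I2.a_inv_closed[OF F])
    have "\<ominus>\<^bsub>Q\<^esub> F \<oplus>\<^bsub>DI\<^esub> F = \<zero>\<^bsub>DI\<^esub>" using Q.l_neg[OF I2.Icarr[OF F]] by (simp add: DI_simps)
    then have "\<ominus>\<^bsub>DI\<^esub> F = \<ominus>\<^bsub>Q\<^esub> F"
      using subsetD[OF sub F] subsetD[OF sub m] by (intro D.M.minus_equality) (simp_all add: DI_simps)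
    then show ?thesis using m by simp
  qed
  show ?thesis
  proof (intro quotient_module.intro DI_module quotient_module_axioms.intro additive_subgroup.intro)
    show "subgroup DI2 (add_monoid DI)"
    proof (rule group.subgroupI[OF D.M.a_group])
      show "DI2 \<subseteq> carrier (add_monoid DI)" using sub by (simp add: DI_simps)
      show "DI2 \<noteq> {}" using I2.zero_closed by blast
      show "inv\<^bsub>add_monoid DI\<^esub> F \<in> DI2" if "F \<in> DI2" for F using inv[OF that] by (simp add: a_inv_def)
      show "F \<otimes>\<^bsub>add_monoid DI\<^esub> G \<in> DI2" if "F \<in> DI2" "G \<in> DI2" for F G
        using I2.a_closed[OF that] by (simp add: DI_simps)
    qed
    show "a \<odot>\<^bsub>DI\<^esub> F \<in> DI2" if "a \<in> carrier R" "F \<in> DI2" for a F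
      using that I2.I_l_closed by (simp add: DI_simps incl_closed)
  qed
qed

lemma Om_eq: "Om = quot DI DI2"
  by (simp add: differentials_def Let_def DI_def)

lemma diff_class_eq: "diff_class k R T F = DI2 +>\<^bsub>DI\<^esub> F"
  by (simp add: diff_class_def a_r_coset_def' DI_simps)

lemma Om_module: "Module.module R Om"
  unfolding Om_eq by (rule quotient_module.module_quot[OF DI_quotient])

lemma d_diag: "d \<in> diag_ideal k R T"
  unfolding diag_mem_iff using dc by (metis Q.one_closed Q.r_one)

lemma l_d_diag: "a \<in> carrier R \<Longrightarrow> l a \<otimes>\<^bsub>Q\<^esub> d \<in> diag_ideal k R T"
  by (rule ideal.I_l_closed[OF diag_ideal d_diag incl_closed(1)])

lemma alpha_closed: "\<alpha> \<in> carrier Om"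
  unfolding Om_eq diff_class_eq by (rule quotient_module.coset_mem_carrier[OF DI_quotient]) (simp add: DI_simps d_diag)

lemma smult_alpha: "a \<in> carrier R \<Longrightarrow> a \<odot>\<^bsub>Om\<^esub> \<alpha> = diff_class k R T (l a \<otimes>\<^bsub>Q\<^esub> d)"
  using quotient_module.coset_smult[OF DI_quotient, of a d] d_diag by (simp add: Om_eq diff_class_eq DI_simps)

text \<open>The difference of \<open>G\<close> and \<open>l (\<mu> G)\<close> is a multiple of
  \<open>d\<close>, so after multiplication by \<open>d\<close> it lies in the square of the
  diagonal ideal.\<close>

lemma smult_alpha_mod:
  assumes G: "G \<in> carrier Q"
  shows "diff_class k R T (d \<otimes>\<^bsub>Q\<^esub> G) = \<mu> G \<odot>\<^bsub>Om\<^esub> \<alpha>"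
proof -
  interpret N: quotient_module R DI DI2 by (rule DI_quotient)
  interpret h: ring_hom_cring Q R \<mu>
    by (intro ring_hom_cring.intro ring_hom_cring_axioms.intro cring_Q M_cring codiagonal_hom)
  define a where "a = \<mu> G"
  have a: "a \<in> carrier R" using G by (simp add: a_def)
  have "\<mu> (G \<ominus>\<^bsub>Q\<^esub> l a) = \<zero>"
    using G a by (simp add: a_minus_def incl_closed codiagonal_incl a_def M.r_neg)
  then obtain G' where G': "G' \<in> carrier Q" "G \<ominus>\<^bsub>Q\<^esub> l a = d \<otimes>\<^bsub>Q\<^esub> G'"
    using diag_iff[of "G \<ominus>\<^bsub>Q\<^esub> l a"] G a by (auto simp: incl_closed)
  have GG: "G = l a \<oplus>\<^bsub>Q\<^esub> d \<otimes>\<^bsub>Q\<^esub> G'"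
    using G a by (simp add: G'(2)[symmetric] Q.add_minus_cancel incl_closed)
  have "d \<otimes>\<^bsub>Q\<^esub> G = l a \<otimes>\<^bsub>Q\<^esub> d \<oplus>\<^bsub>DI\<^esub> d \<otimes>\<^bsub>Q\<^esub> (d \<otimes>\<^bsub>Q\<^esub> G')"
    using a G' dc by (subst GG) (simp add: DI_simps Q.r_distr incl_closed Q.m_comm)
  moreover have c: "l a \<otimes>\<^bsub>Q\<^esub> d \<in> carrier DI" "d \<otimes>\<^bsub>Q\<^esub> (d \<otimes>\<^bsub>Q\<^esub> G') \<in> carrier DI"
    using l_d_diag[OF a] diag_mem_iff G'(1) dc by (auto simp: DI_simps)
  moreover have "d \<otimes>\<^bsub>Q\<^esub> (d \<otimes>\<^bsub>Q\<^esub> G') \<in> DI2" unfolding diag_square_iff using G' by blast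
  moreover from this have "DI2 +>\<^bsub>DI\<^esub> (d \<otimes>\<^bsub>Q\<^esub> (d \<otimes>\<^bsub>Q\<^esub> G')) = \<zero>\<^bsub>quot DI DI2\<^esub>"
    using N.coset_eq_zero_iff[OF c(2)] by (simp add: N.quot_simps)
  ultimately show ?thesis
    using N.coset_add[OF c] abelian_monoid.r_zero[OF abelian_group.axioms(1)[OF N.abelian_group_quot] N.coset_mem_carrier[OF c(1)]] smult_alpha[OF a]
    by (simp add: a_def[symmetric] diff_class_eq)
qed

text \<open>If \<open>(l a) d\<close> is a multiple of the square of \<open>d\<close>, cancelling
  \<open>d\<close> puts \<open>l a\<close> into the diagonal ideal, and the codiagonal sends
  \<open>l a\<close> to \<open>a\<close>. Surjectivity is \<open>smult_alpha_mod\<close>.\<close>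

lemma Om_bij: "bij_betw (\<lambda>a. a \<odot>\<^bsub>Om\<^esub> \<alpha>) (carrier R) (carrier Om)"
proof -
  interpret N: quotient_module R DI DI2 by (rule DI_quotient)
  interpret O: Module.module R Om by (rule Om_module)
  interpret h: ring_hom_cring Q R \<mu>
    by (intro ring_hom_cring.intro ring_hom_cring_axioms.intro cring_Q M_cring codiagonal_hom)
  have add: "additive_map R Om (\<lambda>a. a \<odot>\<^bsub>Om\<^esub> \<alpha>)"
    by (rule additive_mapI) (simp_all add: alpha_closed O.smult_l_distr)
  have ker: "a = \<zero>" if a: "a \<in> carrier R" "a \<odot>\<^bsub>Om\<^esub> \<alpha> = \<zero>\<^bsub>Om\<^esub>" for a
  proof -
    have mem: "l a \<otimes>\<^bsub>Q\<^esub> d \<in> carrier DI" using l_d_diag[OF a(1)] by (simp add: DI_simps)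
    have "DI2 +>\<^bsub>DI\<^esub> (l a \<otimes>\<^bsub>Q\<^esub> d) = DI2"
      using smult_alpha[OF a(1)] a(2) by (simp only: diff_class_eq Om_eq N.quot_simps(2))
    then obtain G where G: "G \<in> carrier Q" "l a \<otimes>\<^bsub>Q\<^esub> d = d \<otimes>\<^bsub>Q\<^esub> (d \<otimes>\<^bsub>Q\<^esub> G)"
      using N.coset_eq_zero_iff[OF mem] diag_square_iff by blast
    then have "l a = d \<otimes>\<^bsub>Q\<^esub> G"
      using Q.regular_cancel[OF d_regular, of "l a" "d \<otimes>\<^bsub>Q\<^esub> G"] a dc by (simp add: incl_closed Q.m_comm)
    then have "\<mu> (l a) = \<zero>" using diag_iff[OF incl_closed(1)[OF a(1)]] G(1) by blast
    then show ?thesis using a by (simp add: codiagonal_incl)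
  qed
  show ?thesis
    unfolding bij_betw_def
  proof
    show "inj_on (\<lambda>a. a \<odot>\<^bsub>Om\<^esub> \<alpha>) (carrier R)"
    proof (rule inj_onI)
      fix a b assume ab: "a \<in> carrier R" "b \<in> carrier R" "a \<odot>\<^bsub>Om\<^esub> \<alpha> = b \<odot>\<^bsub>Om\<^esub> \<alpha>"
      then have "(a \<ominus> b) \<odot>\<^bsub>Om\<^esub> \<alpha> = \<zero>\<^bsub>Om\<^esub>"
        using additive_map_minus[OF M.abelian_group_axioms O.M.abelian_group_axioms add ab(1,2)]
        by (simp add: alpha_closed O.M.r_neg a_minus_def)
      then show "a = b" using ker[of "a \<ominus> b"] ab M.minus_eq_zero_iff by auto
    qed
    have "X \<in> (\<lambda>a. a \<odot>\<^bsub>Om\<^esub> \<alpha>) ` carrier R" if X: "X \<in> carrier Om" for X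
    proof -
      obtain F where "F \<in> diag_ideal k R T" "X = diff_class k R T F"
        using X N.quot_carrier by (auto simp: Om_eq diff_class_eq DI_simps)
      then obtain G where G: "G \<in> carrier Q" "X = diff_class k R T (d \<otimes>\<^bsub>Q\<^esub> G)" unfolding diag_mem_iff by blast
      then show ?thesis using smult_alpha_mod[OF G(1)] h.hom_closed[OF G(1)] by blast
    qed
    then show "(\<lambda>a. a \<odot>\<^bsub>Om\<^esub> \<alpha>) ` carrier R = carrier Om"
      using alpha_closed by auto
  qed
qed

end

section \<open>Fractions with regular denominators\<close>

text \<open>Regular denominators can be cancelled, so the auxiliary factor in
  \<open>fraction\<close> disappears and equality of fractions becomes cross multiplication.\<close>

locale regular_fractions = cring A for A :: "('a, 'x) ring_scheme" (structure) +
  fixes S :: "'a set"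
  assumes S_regular: "s \<in> S \<Longrightarrow> regular_elt A s"
begin

abbreviation "S' \<equiv> mult_closure A S"
abbreviation "fr \<equiv> fraction A S"
abbreviation "Loc \<equiv> localise A S"

lemma S'_regular: "s \<in> S' \<Longrightarrow> regular_elt A s"
proof (induction rule: mult_closure.induct)
  case one
  then show ?case by (simp add: regular_elt_def)
next
  case (mult s t)
  then show ?case using S_regular regular_mult by blast
qed

lemma S'_carrier: "s \<in> S' \<Longrightarrow> s \<in> carrier A"
  using S'_regular by (simp add: regular_elt_def)

lemma S'_one: "\<one> \<in> S'" by (rule mult_closure.one)

lemma S'_mult: "s \<in> S' \<Longrightarrow> t \<in> S' \<Longrightarrow> s \<otimes> t \<in> S'"
proof (induction rule: mult_closure.induct)
  case one
  then show ?case using S'_carrier by simp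
next
  case (mult s u)
  have "s \<otimes> (u \<otimes> t) \<in> S'"
    by (rule mult_closure.mult[OF mult.hyps(1)]) (use mult in blast)
  then show ?case using mult S_regular[OF mult.hyps(1)] S'_carrier
    by (simp add: m_assoc regular_elt_def)
qed

lemma S'_incl: "s \<in> S \<Longrightarrow> s \<in> S'"
  using mult_closure.mult[OF _ S'_one, of s] S_regular by (simp add: regular_elt_def)

lemma mem_fr_iff:
  assumes "a \<in> carrier A" "s \<in> S'"
  shows "(b, t) \<in> fr a s \<longleftrightarrow> b \<in> carrier A \<and> t \<in> S' \<and> a \<otimes> t = b \<otimes> s"
proof -
  have "a \<otimes> t = b \<otimes> s" if "b \<in> carrier A" "t \<in> S'" "u \<in> S'" "u \<otimes> (a \<otimes> t) = u \<otimes> (b \<otimes> s)" for u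
    using regular_cancel[OF S'_regular[OF that(3)] _ _ that(4)] that assms S'_carrier by simp
  then show ?thesis using S'_one by (auto simp: fraction_def)
qed

lemma fr_self: "a \<in> carrier A \<Longrightarrow> s \<in> S' \<Longrightarrow> (a, s) \<in> fr a s"
  by (simp add: mem_fr_iff)

lemma fr_eq_iff:
  assumes a: "a \<in> carrier A" "s \<in> S'" and b: "b \<in> carrier A" "t \<in> S'"
  shows "fr a s = fr b t \<longleftrightarrow> a \<otimes> t = b \<otimes> s"
proof
  assume "fr a s = fr b t"
  then show "a \<otimes> t = b \<otimes> s" using fr_self[OF b] mem_fr_iff[OF a] by simp
next
  assume eq: "a \<otimes> t = b \<otimes> s"
  have sub: "fr a s \<subseteq> fr b t" if a: "a \<in> carrier A" "s \<in> S'" and b: "b \<in> carrier A" "t \<in> S'" and eq: "a \<otimes> t = b \<otimes> s" for a s b t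
  proof
    fix p assume p: "p \<in> fr a s"
    obtain c u where cu: "p = (c, u)" by (cases p)
    then have c: "c \<in> carrier A" "u \<in> S'" "a \<otimes> u = c \<otimes> s" using p mem_fr_iff[OF a] by auto
    note cr = a(1) b(1) c(1) S'_carrier[OF a(2)] S'_carrier[OF b(2)] S'_carrier[OF c(2)]
    have "s \<otimes> (b \<otimes> u) = (b \<otimes> s) \<otimes> u" using cr by (simp add: m_ac)
    also have "\<dots> = (a \<otimes> t) \<otimes> u" by (simp only: eq)
    also have "\<dots> = (a \<otimes> u) \<otimes> t" using cr by (simp add: m_ac)
    also have "\<dots> = s \<otimes> (c \<otimes> t)" using cr by (simp only: c(3)) (simp add: m_ac)
    finally have "b \<otimes> u = c \<otimes> t"
      using regular_cancel[OF S'_regular[OF a(2)]] cr by simp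
    then show "p \<in> fr b t" using cu c mem_fr_iff[OF b] by simp
  qed
  show "fr a s = fr b t" using sub[OF a b eq] sub[OF b a eq[symmetric]] by blast
qed

lemma Loc_carrier: "carrier Loc = {fr a s | a s. a \<in> carrier A \<and> s \<in> S'}"
  by (simp add: localise_def)

lemma fr_closed: "a \<in> carrier A \<Longrightarrow> s \<in> S' \<Longrightarrow> fr a s \<in> carrier Loc"
  by (auto simp: Loc_carrier)

text \<open>The operations of \<open>localise\<close> are unions over all representatives; when the
  value does not depend on these, the union is that value.\<close>

lemma fr_union2:
  assumes a: "a \<in> carrier A" "s \<in> S'" and b: "b \<in> carrier A" "t \<in> S'"
    and c: "\<And>a' s' b' t'. a' \<in> carrier A \<Longrightarrow> s' \<in> S' \<Longrightarrow> b' \<in> carrier A \<Longrightarrow> t' \<in> S' \<Longrightarrow> a \<otimes> s' = a' \<otimes> s \<Longrightarrow> b \<otimes> t' = b' \<otimes> t \<Longrightarrow>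
      h a' s' b' t' = h a s b t"
  shows "(\<Union>(a', s')\<in>fr a s. \<Union>(b', t')\<in>fr b t. h a' s' b' t') = h a s b t"
proof -
  have "(\<Union>(a', s')\<in>fr a s. \<Union>(b', t')\<in>fr b t. h a' s' b' t') = (\<Union>p\<in>fr a s. \<Union>q\<in>fr b t. h a s b t)"
    by (intro SUP_cong refl) (use c mem_fr_iff[OF a] mem_fr_iff[OF b] in \<open>auto split: prod.splits\<close>)
  then show ?thesis using fr_self[OF a] fr_self[OF b] by auto
qed

lemma fr_add:
  assumes a: "a \<in> carrier A" "s \<in> S'" and b: "b \<in> carrier A" "t \<in> S'"
  shows "fr a s \<oplus>\<^bsub>Loc\<^esub> fr b t = fr ((a \<otimes> t) \<oplus> (b \<otimes> s)) (s \<otimes> t)"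
proof -
  have "fr a s \<oplus>\<^bsub>Loc\<^esub> fr b t = (\<Union>(a', s')\<in>fr a s. \<Union>(b', t')\<in>fr b t. fr ((a' \<otimes> t') \<oplus> (b' \<otimes> s')) (s' \<otimes> t'))"
    by (simp add: localise_def)
  also have "\<dots> = fr ((a \<otimes> t) \<oplus> (b \<otimes> s)) (s \<otimes> t)"
  proof (rule fr_union2[OF a b])
    fix a' s' b' t' assume *: "a' \<in> carrier A" "s' \<in> S'" "b' \<in> carrier A" "t' \<in> S'"
      and eq: "a \<otimes> s' = a' \<otimes> s" "b \<otimes> t' = b' \<otimes> t"
    note cr = a(1) b(1) * S'_carrier[OF a(2)] S'_carrier[OF b(2)] S'_carrier[OF *(2)] S'_carrier[OF *(4)]
    have "((a' \<otimes> t') \<oplus> (b' \<otimes> s')) \<otimes> (s \<otimes> t) = (a' \<otimes> s) \<otimes> (t' \<otimes> t) \<oplus> (b' \<otimes> t) \<otimes> (s' \<otimes> s)"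
      using cr by (simp add: l_distr r_distr m_ac)
    also have "\<dots> = ((a \<otimes> t) \<oplus> (b \<otimes> s)) \<otimes> (s' \<otimes> t')"
      using cr by (simp only: eq[symmetric]) (simp add: l_distr r_distr m_ac)
    finally show "fr ((a' \<otimes> t') \<oplus> (b' \<otimes> s')) (s' \<otimes> t') = fr ((a \<otimes> t) \<oplus> (b \<otimes> s)) (s \<otimes> t)"
      using cr a b * by (subst fr_eq_iff) (simp_all add: S'_mult)
  qed
  finally show ?thesis .
qed

lemma fr_mult:
  assumes a: "a \<in> carrier A" "s \<in> S'" and b: "b \<in> carrier A" "t \<in> S'"
  shows "fr a s \<otimes>\<^bsub>Loc\<^esub> fr b t = fr (a \<otimes> b) (s \<otimes> t)"
proof -
  have "fr a s \<otimes>\<^bsub>Loc\<^esub> fr b t = (\<Union>(a', s')\<in>fr a s. \<Union>(b', t')\<in>fr b t. fr (a' \<otimes> b') (s' \<otimes> t'))"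
    by (simp add: localise_def)
  also have "\<dots> = fr (a \<otimes> b) (s \<otimes> t)"
  proof (rule fr_union2[OF a b])
    fix a' s' b' t' assume *: "a' \<in> carrier A" "s' \<in> S'" "b' \<in> carrier A" "t' \<in> S'"
      and eq: "a \<otimes> s' = a' \<otimes> s" "b \<otimes> t' = b' \<otimes> t"
    note cr = a(1) b(1) * S'_carrier[OF a(2)] S'_carrier[OF b(2)] S'_carrier[OF *(2)] S'_carrier[OF *(4)]
    have "(a' \<otimes> b') \<otimes> (s \<otimes> t) = (a' \<otimes> s) \<otimes> (b' \<otimes> t)" using cr by (simp add: m_ac)
    also have "\<dots> = (a \<otimes> b) \<otimes> (s' \<otimes> t')" using cr by (simp only: eq[symmetric]) (simp add: m_ac)
    finally show "fr (a' \<otimes> b') (s' \<otimes> t') = fr (a \<otimes> b) (s \<otimes> t)"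
      using cr a b * by (subst fr_eq_iff) (simp_all add: S'_mult)
  qed
  finally show ?thesis .
qed

lemma fr_smult:
  assumes c: "c \<in> carrier A" and a: "a \<in> carrier A" "s \<in> S'"
  shows "c \<odot>\<^bsub>Loc\<^esub> fr a s = fr (c \<otimes> a) s"
proof -
  have "fr (c \<otimes> a') s' = fr (c \<otimes> a) s" if *: "a' \<in> carrier A" "s' \<in> S'" "a \<otimes> s' = a' \<otimes> s" for a' s'
    using * a c S'_carrier by (subst fr_eq_iff) (simp_all add: m_assoc)
  then have "(\<Union>(a', s')\<in>fr a s. fr (c \<otimes> a') s') = (\<Union>p\<in>fr a s. fr (c \<otimes> a) s)"
    by (intro SUP_cong refl) (use mem_fr_iff[OF a] in \<open>auto split: prod.splits\<close>)
  then show ?thesis using fr_self[OF a] by (auto simp: localise_def)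
qed

lemma fr_add_same:
  assumes "a \<in> carrier A" "b \<in> carrier A" "s \<in> S'"
  shows "fr a s \<oplus>\<^bsub>Loc\<^esub> fr b s = fr (a \<oplus> b) s"
  using assms S'_carrier by (simp add: fr_add) (subst fr_eq_iff, simp_all add: S'_mult l_distr r_distr m_ac)

lemma fr_expand: "a \<in> carrier A \<Longrightarrow> s \<in> S' \<Longrightarrow> t \<in> S' \<Longrightarrow> fr a s = fr (a \<otimes> t) (s \<otimes> t)"
  using S'_carrier by (subst fr_eq_iff) (simp_all add: S'_mult m_ac)

lemma Loc_zero: "\<zero>\<^bsub>Loc\<^esub> = fr \<zero> \<one>" by (simp add: localise_def)

lemma common_denominator:
  assumes "X \<in> carrier Loc" "Y \<in> carrier Loc"
  obtains a b s where "a \<in> carrier A" "b \<in> carrier A" "s \<in> S'" "X = fr a s" "Y = fr b s"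
proof -
  obtain a s b t where *: "X = fr a s" "a \<in> carrier A" "s \<in> S'" "Y = fr b t" "b \<in> carrier A" "t \<in> S'"
    using assms by (auto simp: Loc_carrier)
  have "X = fr (a \<otimes> t) (s \<otimes> t)" using * fr_expand[of a s t] by simp
  moreover have "Y = fr (b \<otimes> s) (s \<otimes> t)" using * fr_expand[of b t s] S'_carrier by (simp add: m_comm)
  ultimately show ?thesis using that[of "a \<otimes> t" "b \<otimes> s" "s \<otimes> t"] * S'_carrier S'_mult by auto
qed

lemma Loc_module: "Module.module A Loc"
proof -
  have zero: "\<zero>\<^bsub>Loc\<^esub> = fr \<zero> s" if "s \<in> S'" for s
    unfolding Loc_zero using that S'_one S'_carrier by (subst fr_eq_iff) auto
  show ?thesis
  proof (intro moduleI abelian_groupI is_cring)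
    fix X Y assume X: "X \<in> carrier Loc" and Y: "Y \<in> carrier Loc"
    obtain a b s where *: "a \<in> carrier A" "b \<in> carrier A" "s \<in> S'" "X = fr a s" "Y = fr b s"
      using common_denominator[OF X Y] .
    show "X \<oplus>\<^bsub>Loc\<^esub> Y \<in> carrier Loc" "X \<oplus>\<^bsub>Loc\<^esub> Y = Y \<oplus>\<^bsub>Loc\<^esub> X"
      using * by (simp_all add: fr_add_same fr_closed a_comm)
    show "c \<odot>\<^bsub>Loc\<^esub> (X \<oplus>\<^bsub>Loc\<^esub> Y) = c \<odot>\<^bsub>Loc\<^esub> X \<oplus>\<^bsub>Loc\<^esub> c \<odot>\<^bsub>Loc\<^esub> Y" if "c \<in> carrier A" for c
      using * that by (simp add: fr_add_same fr_smult r_distr)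
    fix Z assume Z: "Z \<in> carrier Loc"
    obtain c t where c: "c \<in> carrier A" "t \<in> S'" "Z = fr c t" using Z by (auto simp: Loc_carrier)
    have e: "X = fr (a \<otimes> t) (s \<otimes> t)" "Y = fr (b \<otimes> t) (s \<otimes> t)" "Z = fr (c \<otimes> s) (s \<otimes> t)"
      using * c fr_expand[of a s t] fr_expand[of b s t] fr_expand[of c t s] S'_carrier by (simp_all add: m_comm)
    show "X \<oplus>\<^bsub>Loc\<^esub> Y \<oplus>\<^bsub>Loc\<^esub> Z = X \<oplus>\<^bsub>Loc\<^esub> (Y \<oplus>\<^bsub>Loc\<^esub> Z)"
      unfolding e using * c S'_carrier by (simp add: fr_add_same S'_mult a_assoc)
  next
    fix X assume X: "X \<in> carrier Loc"
    obtain a s where *: "a \<in> carrier A" "s \<in> S'" "X = fr a s" using X by (auto simp: Loc_carrier)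
    show "\<zero>\<^bsub>Loc\<^esub> \<oplus>\<^bsub>Loc\<^esub> X = X" using * by (simp add: zero[OF *(2)] fr_add_same)
    show "\<exists>Y\<in>carrier Loc. Y \<oplus>\<^bsub>Loc\<^esub> X = \<zero>\<^bsub>Loc\<^esub>"
      using * by (intro bexI[of _ "fr (\<ominus> a) s"]) (simp_all add: zero[OF *(2)] fr_add_same l_neg fr_closed)
    show "\<one> \<odot>\<^bsub>Loc\<^esub> X = X" using * by (simp add: fr_smult)
    show "c \<odot>\<^bsub>Loc\<^esub> X \<in> carrier Loc" if "c \<in> carrier A" for c using that * by (simp add: fr_smult fr_closed)
    show "(c \<oplus> c') \<odot>\<^bsub>Loc\<^esub> X = c \<odot>\<^bsub>Loc\<^esub> X \<oplus>\<^bsub>Loc\<^esub> c' \<odot>\<^bsub>Loc\<^esub> X"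
      "(c \<otimes> c') \<odot>\<^bsub>Loc\<^esub> X = c \<odot>\<^bsub>Loc\<^esub> (c' \<odot>\<^bsub>Loc\<^esub> X)" if "c \<in> carrier A" "c' \<in> carrier A" for c c'
      using that * by (simp_all add: fr_smult fr_add_same l_distr m_assoc)
  qed (simp add: Loc_zero fr_closed S'_one)
qed

end

section \<open>Polar parts\<close>

context multicurve
begin

interpretation Q: cring Q by (rule cring_Q)

lemma regular_fractions: "regular_fractions R (divisorial k R)"
  by (intro regular_fractions.intro M_cring regular_fractions_axioms.intro) (simp add: divisorial_def)

interpretation Fr: regular_fractions R "divisorial k R" by (rule regular_fractions)

abbreviation "mf \<equiv> mero_frac k R"
abbreviation "Mer \<equiv> meromorphic k R"
abbreviation "hol \<equiv> holomorphic k R"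
abbreviation "inv_id f \<equiv> inverse_ideal k R (PIdl f)"
abbreviation "pol f \<equiv> polar_parts k R (PIdl f)"

lemma Mer_eq: "Mer = Fr.Loc" by (simp add: meromorphic_def)

lemma Mer_module: "Module.module R Mer" unfolding Mer_eq by (rule Fr.Loc_module)

lemma divisor_gen_denominator: "divisor_gen f \<Longrightarrow> f \<in> Fr.S'"
  by (rule Fr.S'_incl) (simp add: divisorial_def divisor_genD)

lemma inv_id_simps: "add (inv_id f) = add Mer" "zero (inv_id f) = zero Mer" "smult (inv_id f) = smult Mer"
  by (simp_all add: inverse_ideal_def)

lemma hol_mem_iff: "g \<in> hol \<longleftrightarrow> (\<exists>a\<in>carrier R. g = mf a \<one>)"
  by (auto simp: holomorphic_def)

text \<open>For \<open>g\<close> in the inverse ideal, \<open>g f\<close> is some holomorphic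
  \<open>a\<close>, whence \<open>g = a/f\<close>. Conversely, \<open>f\<close> clears the
  denominator of \<open>a/f\<close>.\<close>

lemma inv_id_carrier:
  assumes f: "divisor_gen f"
  shows "carrier (inv_id f) = {mf a f | a. a \<in> carrier R}"
proof -
  note fD = divisor_genD[OF f] and fS = divisor_gen_denominator[OF f]
  have "g \<in> carrier (inv_id f) \<longleftrightarrow> (\<exists>a. g = mf a f \<and> a \<in> carrier R)" for g
  proof
    assume "g \<in> carrier (inv_id f)"
    then have g: "g \<in> carrier Mer" "\<And>a. a \<in> PIdl f \<Longrightarrow> g \<otimes>\<^bsub>Mer\<^esub> mf a \<one> \<in> hol"
      by (auto simp: inverse_ideal_def)
    obtain b s where b: "b \<in> carrier R" "s \<in> Fr.S'" "g = mf b s" using g(1) by (auto simp: Mer_eq Fr.Loc_carrier)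
    have "g \<otimes>\<^bsub>Mer\<^esub> mf f \<one> \<in> hol" using g(2) cgenideal_self[OF fD(2)] by blast
    then obtain a where a: "a \<in> carrier R" "mf (b \<otimes> f) s = mf a \<one>"
      using b fD Fr.S'_one Fr.S'_carrier by (auto simp: hol_mem_iff Mer_eq Fr.fr_mult)
    then have "b \<otimes> f = a \<otimes> s" using b fD Fr.S'_one by (simp add: Fr.fr_eq_iff)
    then have "g = mf a f" using a b fS by (simp add: Fr.fr_eq_iff)
    then show "\<exists>a. g = mf a f \<and> a \<in> carrier R" using a by blast
  next
    assume "\<exists>a. g = mf a f \<and> a \<in> carrier R"
    then obtain a where a: "g = mf a f" "a \<in> carrier R" by blast
    have "g \<otimes>\<^bsub>Mer\<^esub> mf c \<one> \<in> hol" if c: "c \<in> PIdl f" for c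
    proof -
      obtain b where b: "b \<in> carrier R" "c = b \<otimes> f" using c unfolding PIdl_mem_iff by blast
      have "g \<otimes>\<^bsub>Mer\<^esub> mf c \<one> = mf (a \<otimes> b) \<one>"
        using a b fD fS Fr.S'_one by (simp add: Mer_eq Fr.fr_mult) (subst Fr.fr_eq_iff, simp_all add: m_assoc)
      then show ?thesis using a b by (auto simp: hol_mem_iff)
    qed
    then show "g \<in> carrier (inv_id f)" using a fS by (simp add: inverse_ideal_def Mer_eq Fr.fr_closed)
  qed
  then show ?thesis by blast
qed

lemma mf_add: "divisor_gen f \<Longrightarrow> a \<in> carrier R \<Longrightarrow> b \<in> carrier R \<Longrightarrow> mf a f \<oplus>\<^bsub>inv_id f\<^esub> mf b f = mf (a \<oplus> b) f"
  by (simp add: inv_id_simps Mer_eq Fr.fr_add_same divisor_gen_denominator)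

lemma mf_smult: "divisor_gen f \<Longrightarrow> a \<in> carrier R \<Longrightarrow> b \<in> carrier R \<Longrightarrow> a \<odot>\<^bsub>inv_id f\<^esub> mf b f = mf (a \<otimes> b) f"
  by (simp add: inv_id_simps Mer_eq Fr.fr_smult divisor_gen_denominator)

lemma mf_zero: "divisor_gen f \<Longrightarrow> \<zero>\<^bsub>inv_id f\<^esub> = mf \<zero> f"
  using divisor_gen_denominator[of f] divisor_genD(2)[of f] Fr.S'_one
  by (simp add: inv_id_simps Mer_eq Fr.Loc_zero Fr.fr_eq_iff)

lemma inv_id_module:
  assumes f: "divisor_gen f"
  shows "Module.module R (inv_id f)"
proof (intro moduleI abelian_groupI M_cring)
  fix x assume "x \<in> carrier (inv_id f)"
  then obtain a where a: "a \<in> carrier R" "x = mf a f" by (auto simp: inv_id_carrier[OF f])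
  show "\<exists>y\<in>carrier (inv_id f). y \<oplus>\<^bsub>inv_id f\<^esub> x = \<zero>\<^bsub>inv_id f\<^esub>"
    using a by (intro bexI[of _ "mf (\<ominus> a) f"]) (auto simp: mf_add[OF f] mf_zero[OF f] inv_id_carrier[OF f] M.l_neg)
qed (auto simp: inv_id_carrier[OF f] mf_add[OF f] mf_smult[OF f] mf_zero[OF f] M.a_ac l_distr r_distr m_assoc)

lemma hol_mem_inv_id:
  assumes f: "divisor_gen f" and x: "x \<in> carrier R"
  shows "mf x f \<in> hol \<longleftrightarrow> x \<in> PIdl f"
proof -
  have "mf x f = mf a \<one> \<longleftrightarrow> x = a \<otimes> f" if "a \<in> carrier R" for a
    using that x divisor_gen_denominator[OF f] divisor_genD(2)[OF f] Fr.S'_one by (simp add: Fr.fr_eq_iff)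
  then show ?thesis by (auto simp: hol_mem_iff PIdl_mem_iff)
qed

lemma hol_subset:
  assumes f: "divisor_gen f" and g: "g \<in> hol"
  obtains a where "a \<in> carrier R" "g = mf (a \<otimes> f) f"
proof -
  obtain a where a: "a \<in> carrier R" "g = mf a \<one>" using g hol_mem_iff by blast
  then have "g = mf (a \<otimes> f) f"
    using divisor_gen_denominator[OF f] divisor_genD(2)[OF f] Fr.S'_one by (simp add: Fr.fr_eq_iff)
  then show ?thesis using that a by blast
qed

lemma hol_quotient:
  assumes f: "divisor_gen f"
  shows "quotient_module R (inv_id f) hol"
proof -
  interpret N: Module.module R "inv_id f" by (rule inv_id_module[OF f])
  note fD = divisor_genD[OF f]
  have PI: "ideal (PIdl f) R" by (rule OI_ideal[OF fD(3)])
  have mem: "mf (a \<otimes> f) f \<in> hol" if "a \<in> carrier R" for a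
    using that fD hol_mem_inv_id[OF f, of "a \<otimes> f"] by (auto simp: PIdl_mem_iff)
  show ?thesis
  proof (intro quotient_module.intro N.module_axioms quotient_module_axioms.intro additive_subgroup.intro)
    show "subgroup hol (add_monoid (inv_id f))"
    proof (rule group.subgroupI[OF N.M.a_group])
      show "hol \<subseteq> carrier (add_monoid (inv_id f))"
        using hol_subset[OF f] fD by (auto simp: inv_id_carrier[OF f] elim!: hol_subset[OF f])
      show "hol \<noteq> {}" by (auto simp: holomorphic_def)
      fix g assume g: "g \<in> hol"
      obtain a where a: "a \<in> carrier R" "g = mf (a \<otimes> f) f" using hol_subset[OF f g] .
      have "mf (\<ominus> a \<otimes> f) f \<oplus>\<^bsub>inv_id f\<^esub> g = \<zero>\<^bsub>inv_id f\<^esub>"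
        using a fD by (simp add: mf_add[OF f] mf_zero[OF f] l_minus M.l_neg)
      then have "\<ominus>\<^bsub>inv_id f\<^esub> g = mf (\<ominus> a \<otimes> f) f"
        using a fD by (intro N.M.minus_equality) (auto simp: inv_id_carrier[OF f])
      then show "inv\<^bsub>add_monoid (inv_id f)\<^esub> g \<in> hol" using mem[of "\<ominus> a"] a by (simp add: a_inv_def)
      fix h assume h: "h \<in> hol"
      obtain b where b: "b \<in> carrier R" "h = mf (b \<otimes> f) f" using hol_subset[OF f h] .
      show "g \<otimes>\<^bsub>add_monoid (inv_id f)\<^esub> h \<in> hol"
        using a b fD mem[of "a \<oplus> b"] by (simp add: mf_add[OF f] l_distr)
    qed
    fix a g assume a: "a \<in> carrier R" and g: "g \<in> hol"
    obtain b where b: "b \<in> carrier R" "g = mf (b \<otimes> f) f" using hol_subset[OF f g] .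
    show "a \<odot>\<^bsub>inv_id f\<^esub> g \<in> hol" using a b fD mem[of "a \<otimes> b"] by (simp add: mf_smult[OF f] m_assoc)
  qed
qed

lemma pol_module: "divisor_gen f \<Longrightarrow> Module.module R (pol f)"
  unfolding polar_parts_def by (rule quotient_module.module_quot[OF hol_quotient])

definition polar_class :: "'r \<Rightarrow> 'r set \<Rightarrow> ('r \<times> 'r) set set" where
  "polar_class f X = (\<lambda>x. mf x f) ` X"

lemma polar_class_coset:
  assumes f: "divisor_gen f" and x: "x \<in> carrier R"
  shows "polar_class f (PIdl f +> x) = hol +>\<^bsub>inv_id f\<^esub> mf x f"
proof -
  note fD = divisor_genD[OF f]
  have h: "h \<oplus>\<^bsub>inv_id f\<^esub> mf x f = mf (a \<otimes> f \<oplus> x) f" if "a \<in> carrier R" "h = mf (a \<otimes> f) f" for a h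
    using that x fD by (simp add: mf_add[OF f])
  show ?thesis
  proof
    show "polar_class f (PIdl f +> x) \<subseteq> hol +>\<^bsub>inv_id f\<^esub> mf x f"
    proof
      fix g assume "g \<in> polar_class f (PIdl f +> x)"
      then obtain i where i: "i \<in> PIdl f" "g = mf (i \<oplus> x) f" by (auto simp: polar_class_def a_r_coset_def')
      obtain a where a: "a \<in> carrier R" "i = a \<otimes> f" using i(1) unfolding PIdl_mem_iff by blast
      have "mf i f \<in> hol" using hol_mem_inv_id[OF f, of i] i a fD by simp
      then show "g \<in> hol +>\<^bsub>inv_id f\<^esub> mf x f" using h[OF a(1) refl] a i by (auto simp: a_r_coset_def' intro!: bexI[of _ "mf i f"])
    qed
    show "hol +>\<^bsub>inv_id f\<^esub> mf x f \<subseteq> polar_class f (PIdl f +> x)"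
    proof
      fix g assume "g \<in> hol +>\<^bsub>inv_id f\<^esub> mf x f"
      then obtain h' where h': "h' \<in> hol" "g = h' \<oplus>\<^bsub>inv_id f\<^esub> mf x f" by (auto simp: a_r_coset_def')
      obtain a where a: "a \<in> carrier R" "h' = mf (a \<otimes> f) f" using hol_subset[OF f h'(1)] .
      have "g = mf (a \<otimes> f \<oplus> x) f" using h[OF a] h' by simp
      moreover have "a \<otimes> f \<oplus> x \<in> PIdl f +> x"
      proof -
        have "a \<otimes> f \<in> PIdl f" using a by (auto simp: PIdl_mem_iff)
        then show ?thesis by (auto simp: a_r_coset_def')
      qed
      ultimately show "g \<in> polar_class f (PIdl f +> x)" by (auto simp: polar_class_def)
    qed
  qed
qed

text \<open>Division by \<open>f\<close> identifies \<open>R/f\<close> with the polar parts as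
  \<open>R\<close>-modules; injectivity is the cancellation of \<open>f\<close>.\<close>

lemma polar_class_props:
  assumes f: "divisor_gen f"
  shows "additive_map (quot R (PIdl f)) (pol f) (polar_class f)"
    and "bij_betw (polar_class f) (carrier (quot R (PIdl f))) (carrier (pol f))"
    and "\<And>a X. a \<in> carrier R \<Longrightarrow> X \<in> carrier (quot R (PIdl f)) \<Longrightarrow>
      polar_class f ((PIdl f +> a) \<otimes>\<^bsub>quot R (PIdl f)\<^esub> X) = a \<odot>\<^bsub>pol f\<^esub> polar_class f X"
proof -
  note fD = divisor_genD[OF f]
  interpret I: quotient_algebra k R "PIdl f" by (rule OI_quot[OF fD(3)])
  interpret P: quotient_module R "inv_id f" hol by (rule hol_quotient[OF f])
  have mc: "mf x f \<in> carrier (inv_id f)" if "x \<in> carrier R" for x using that by (auto simp: inv_id_carrier[OF f])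
  have pol: "pol f = quot (inv_id f) hol" by (simp add: polar_parts_def)
  show add: "additive_map (quot R (PIdl f)) (pol f) (polar_class f)"
    by (rule additive_mapI)
      (auto simp: I.quot_carrier polar_class_coset[OF f] pol P.coset_mem_carrier mc I.coset_add P.coset_add mf_add[OF f])
  show "polar_class f ((PIdl f +> a) \<otimes>\<^bsub>quot R (PIdl f)\<^esub> X) = a \<odot>\<^bsub>pol f\<^esub> polar_class f X"
    if "a \<in> carrier R" "X \<in> carrier (quot R (PIdl f))" for a X
    using that by (auto simp: I.quot_carrier polar_class_coset[OF f] pol mc I.coset_mult P.coset_smult mf_smult[OF f])
  show "bij_betw (polar_class f) (carrier (quot R (PIdl f))) (carrier (pol f))"
    unfolding bij_betw_def
  proof
    show "polar_class f ` carrier (quot R (PIdl f)) = carrier (pol f)"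
      by (force simp: I.quot_carrier pol P.quot_carrier inv_id_carrier[OF f] polar_class_coset[OF f])
    show "inj_on (polar_class f) (carrier (quot R (PIdl f)))"
    proof (rule inj_onI)
      fix X Y assume "X \<in> carrier (quot R (PIdl f))" "Y \<in> carrier (quot R (PIdl f))" and eq: "polar_class f X = polar_class f Y"
      then obtain x y where x: "x \<in> carrier R" "X = PIdl f +> x" and y: "y \<in> carrier R" "Y = PIdl f +> y"
        by (auto simp: I.quot_carrier)
      have "mf x f \<in> hol +>\<^bsub>inv_id f\<^esub> mf y f"
        using eq x y P.a_rcos_self[OF mc[OF x(1)]] by (simp add: polar_class_coset[OF f])
      then obtain h where h: "h \<in> hol" "mf x f = h \<oplus>\<^bsub>inv_id f\<^esub> mf y f" by (auto simp: a_r_coset_def')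
      obtain a where a: "a \<in> carrier R" "h = mf (a \<otimes> f) f" using hol_subset[OF f h(1)] .
      have "mf x f = mf (a \<otimes> f \<oplus> y) f" using h a y fD by (simp add: mf_add[OF f])
      then have "x \<otimes> f = (a \<otimes> f \<oplus> y) \<otimes> f"
        using x a y fD divisor_gen_denominator[OF f] by (simp add: Fr.fr_eq_iff)
      moreover have ac: "a \<otimes> f \<oplus> y \<in> carrier R" using a y fD by simp
      ultimately have "f \<otimes> x = f \<otimes> (a \<otimes> f \<oplus> y)"
        using m_comm[OF fD(2) x(1)] m_comm[OF fD(2) ac] by simp
      then have "x = a \<otimes> f \<oplus> y" by (rule regular_cancel[OF fD(1) x(1) ac])
      then have "x \<ominus> y = a \<otimes> f" using a y fD by (simp add: a_minus_def M.a_assoc M.r_neg)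
      then have "x \<ominus> y \<in> PIdl f" using a by (auto simp: PIdl_mem_iff)
      then show "X = Y" using x y I.coset_eq_iff by simp
    qed
  qed
qed

end

section \<open>The duality isomorphism\<close>

context multicurve
begin

interpretation Q: cring Q by (rule cring_Q)
interpretation Fr: regular_fractions R "divisorial k R" by (rule regular_fractions)
interpretation Om: Module.module R Om by (rule Om_module)

definition Psi :: "'r \<Rightarrow> ('r set \<Rightarrow> 'k) \<Rightarrow> (('r \<times> 'r) set set \<times> 'r tensor_square set \<Rightarrow>\<^sub>0 int) set" where
  "Psi f \<phi> = tens R (pol f) Om (polar_class f (dual_coeff f \<phi>)) \<alpha>"

lemma formula_eq_Psi: "duality_formula k R T (PIdl f) d f \<phi> = Psi f \<phi>"
  by (simp add: duality_formula_def Let_def Psi_def polar_class_def dual_coeff_def e_of_def)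

lemma PIdl_subset_factor:
  assumes "g \<in> carrier R" "f \<in> carrier R" "PIdl g \<subseteq> PIdl f"
  obtains h where "h \<in> carrier R" "g = f \<otimes> h"
proof -
  have "g \<in> PIdl f" using cgenideal_self[OF assms(1)] assms(3) by blast
  then obtain h where "h \<in> carrier R" "g = h \<otimes> f" unfolding PIdl_mem_iff by blast
  then show ?thesis using that assms m_comm by blast
qed

lemma pol_tensor: "divisor_gen f \<Longrightarrow> tensor_product R (pol f) Om"
  by (intro tensor_product.intro pol_module Om_module)

text \<open>The numerators for \<open>f\<close> and \<open>fh\<close> are \<open>a\<close> and
  \<open>ha\<close>, and \<open>ha/(fh) = a/f\<close>. For equal ideals this gives independence of
  the generator, for different ones the naturality.\<close>

lemma Psi_mult:
  assumes f: "divisor_gen f" and g: "divisor_gen (f \<otimes> h)" and h: "h \<in> carrier R"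
    and \<psi>: "\<psi> \<in> Dl (PIdl f)" and \<psi>': "\<psi>' \<in> Dl (PIdl (f \<otimes> h))"
    and eq: "\<And>a. a \<in> carrier R \<Longrightarrow> \<psi>' (PIdl (f \<otimes> h) +> a) = \<psi> (PIdl f +> a)"
  shows "polar_class (f \<otimes> h) (dual_coeff (f \<otimes> h) \<psi>') = polar_class f (dual_coeff f \<psi>)"
proof -
  obtain a where a: "a \<in> carrier R" "dual_coeff f \<psi> = PIdl f +> a"
    "dual_coeff (f \<otimes> h) \<psi>' = PIdl (f \<otimes> h) +> (h \<otimes> a)"
    using dual_coeff_mult[OF f g h \<psi> \<psi>' eq] by blast
  note fD = divisor_genD[OF f]
  have "mf (h \<otimes> a) (f \<otimes> h) = mf a f"
    using a h fD divisor_gen_denominator[OF f] divisor_gen_denominator[OF g]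
    by (simp add: Fr.fr_eq_iff m_ac)
  then show ?thesis
    unfolding a(2,3) using a(1) h
    by (simp add: polar_class_coset[OF f] polar_class_coset[OF g]) (simp add: a_r_coset_def' inv_id_simps)
qed

lemma Psi_generator_indep:
  assumes f: "divisor_gen f" and g: "divisor_gen g" and eq: "PIdl g = PIdl f" and \<phi>: "\<phi> \<in> Dl (PIdl f)"
  shows "Psi g \<phi> = Psi f \<phi>"
proof -
  note fD = divisor_genD[OF f] and gD = divisor_genD[OF g]
  obtain h where h: "h \<in> carrier R" "g = f \<otimes> h" using PIdl_subset_factor[OF gD(2) fD(2)] eq by blast
  have "polar_class g (dual_coeff g \<phi>) = polar_class f (dual_coeff f \<phi>)"
    using Psi_mult[OF f _ h(1) \<phi>] g \<phi> eq by (simp add: h(2)[symmetric])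
  then show ?thesis by (simp add: Psi_def eq)
qed

text \<open>Allows the development to be instantiated again with another difference function and the
  same parameter.\<close>

lemma multicurve_other:
  assumes "difference_function k R T d'"
  shows "multicurve k R T y d'"
  using multicurve_axioms assms unfolding multicurve_def multicurve_axioms_def by blast

text \<open>If \<open>d = d' u\<close>, the element \<open>e\<close> for \<open>d'\<close> is
  \<open>u\<close> times that for \<open>d\<close>. Modulo \<open>d\<close> the factor
  \<open>u\<close> is the scalar \<open>a = \<mu> u\<close>, so the numerator is multiplied by
  \<open>a\<close>, while \<alpha> is \<open>a\<close> times the class of \<open>d'\<close>. The
  scalar moves across the tensor sign.\<close>

lemma Psi_difference_indep:
  assumes d': "difference_function k R T d'" and f: "divisor_gen f" and \<phi>: "\<phi> \<in> Dl (PIdl f)"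
  shows "multicurve.Psi k R T d' f \<phi> = Psi f \<phi>"
proof -
  interpret D: multicurve k R T y d' by (rule multicurve_other[OF d'])
  define I where "I = PIdl f"
  note fD = divisor_genD[OF f]
  have IO: "I \<in> OI" using fD by (simp add: I_def)
  interpret I: quotient_algebra k R I by (rule OI_quot[OF IO])
  interpret P: cring "QT I I" by (rule QT_cring[OF IO IO])
  interpret h: ring_hom_cring Q R \<mu>
    by (intro ring_hom_cring.intro ring_hom_cring_axioms.intro cring_Q M_cring codiagonal_hom)
  have "d \<in> diag_ideal k R T" by (rule d_diag)
  then obtain u where u: "u \<in> carrier Q" "d = d' \<otimes>\<^bsub>Q\<^esub> u" unfolding D.diag_mem_iff by blast
  note e = e_of[OF fD(2)]
  have e': "D.e_of f = u \<otimes>\<^bsub>Q\<^esub> e_of f"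
  proof (rule D.e_of_eqI)
    have "d \<otimes>\<^bsub>Q\<^esub> e_of f = (d' \<otimes>\<^bsub>Q\<^esub> u) \<otimes>\<^bsub>Q\<^esub> e_of f" by (rule arg_cong[OF u(2)])
    then show "r f \<ominus>\<^bsub>Q\<^esub> l f = d' \<otimes>\<^bsub>Q\<^esub> (u \<otimes>\<^bsub>Q\<^esub> e_of f)"
      using e(2) Q.m_assoc[OF D.dc u(1) e(1)] by simp
  qed (use u e in auto)
  define a where "a = \<mu> u"
  have a: "a \<in> carrier R" using u by (simp add: a_def)
  have "\<mu> (u \<ominus>\<^bsub>Q\<^esub> l a) = \<zero>"
    using u a by (simp add: a_minus_def incl_closed codiagonal_incl a_def M.r_neg)
  then obtain G where G: "G \<in> carrier Q" "u \<ominus>\<^bsub>Q\<^esub> l a = d \<otimes>\<^bsub>Q\<^esub> G"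
    using diag_iff[of "u \<ominus>\<^bsub>Q\<^esub> l a"] u a by (auto simp: incl_closed)
  have "u = l a \<oplus>\<^bsub>Q\<^esub> d \<otimes>\<^bsub>Q\<^esub> G"
    using Q.add_minus_cancel[OF incl_closed(1)[OF a] u(1)] G(2) by simp
  then have "D.e_of f = (l a \<oplus>\<^bsub>Q\<^esub> d \<otimes>\<^bsub>Q\<^esub> G) \<otimes>\<^bsub>Q\<^esub> e_of f" using e' by simp
  also have "\<dots> = l a \<otimes>\<^bsub>Q\<^esub> e_of f \<oplus>\<^bsub>Q\<^esub> (d \<otimes>\<^bsub>Q\<^esub> e_of f) \<otimes>\<^bsub>Q\<^esub> G"
    using incl_closed(1)[OF a] G(1) e(1) dc by (simp add: Q.l_distr Q.r_distr Q.m_ac)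
  finally have comp: "D.e_of f (I, I) = tq I I a \<one> \<otimes>\<^bsub>QT I I\<^esub> e_of f (I, I)"
    using a IO e G de_component[OF f I_def] by (simp add: Q_ops incl_component Q_component tq_closed)
  obtain n \<phi>' x where fr: "frobenius_pair k (quot R I) n \<phi>' x (d (I, I)) (e_of f (I, I))"
    using frobenius[OF f I_def] .
  interpret F: frobenius_pair k "quot R I" n \<phi>' x "d (I, I)" "e_of f (I, I)" by (rule fr)
  have "D.dual_coeff f \<phi> = F.L \<phi> (D.e_of f (I, I))" by (simp only: D.dual_coeff_def F.L_def I_def[symmetric])
  also have "\<dots> = F.L \<phi> (tq I I a \<one> \<otimes>\<^bsub>QT I I\<^esub> e_of f (I, I))" by (rule arg_cong[OF comp])
  also have "tq I I a \<one> = tens k (quot R I) (quot R I) (I +> a) \<one>\<^bsub>quot R I\<^esub>" by (simp only: I.coset_one)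
  also have "F.L \<phi> (\<dots> \<otimes>\<^bsub>QT I I\<^esub> e_of f (I, I)) = (I +> a) \<otimes>\<^bsub>quot R I\<^esub> F.L \<phi> (e_of f (I, I))"
    using F.L_lam[OF \<phi>[folded I_def] I.coset_mem_carrier[OF a] Q_component[OF e(1) IO IO]] by simp
  also have "F.L \<phi> (e_of f (I, I)) = dual_coeff f \<phi>" by (simp only: dual_coeff_frobenius[OF I_def fr] F.c_def)
  finally have cc': "D.dual_coeff f \<phi> = (I +> a) \<otimes>\<^bsub>quot R I\<^esub> dual_coeff f \<phi>" .
  have ccl: "dual_coeff f \<phi> \<in> carrier (quot R I)" using dual_coeff_closed[OF f \<phi>] by (simp add: I_def)
  have pcc: "polar_class f (dual_coeff f \<phi>) \<in> carrier (pol f)" using additive_map_closed[OF polar_class_props(1)[OF f]] ccl by (simp add: I_def)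
  have al: "\<alpha> = a \<odot>\<^bsub>Om\<^esub> diff_class k R T d'"
    using D.smult_alpha_mod[OF u(1)] by (simp add: u(2)[symmetric] a_def)
  interpret tp: tensor_product R "pol f" Om by (rule pol_tensor[OF f])
  have "D.Psi f \<phi> = tp.tn (polar_class f ((I +> a) \<otimes>\<^bsub>quot R I\<^esub> dual_coeff f \<phi>)) (diff_class k R T d')"
    by (simp add: D.Psi_def cc' D.polar_class_def polar_class_def)
  also have "\<dots> = tp.tn (a \<odot>\<^bsub>pol f\<^esub> polar_class f (dual_coeff f \<phi>)) (diff_class k R T d')"
    using polar_class_props(3)[OF f a] ccl by (simp add: I_def)
  also have "\<dots> = tp.tn (polar_class f (dual_coeff f \<phi>)) \<alpha>"
    unfolding al by (rule tp.tn_balanced[OF a pcc D.alpha_closed])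
  finally show ?thesis by (simp add: Psi_def)
qed

lemma formula_eq:
  assumes "difference_function k R T d'" "divisor_gen f" "divisor_gen g" "PIdl g = PIdl f" "\<phi> \<in> Dl (PIdl f)"
  shows "duality_formula k R T (PIdl f) d' g \<phi> = Psi f \<phi>"
proof -
  interpret D: multicurve k R T y d' by (rule multicurve_other[OF assms(1)])
  have "duality_formula k R T (PIdl f) d' g \<phi> = D.Psi g \<phi>"
    using D.formula_eq_Psi[of g \<phi>] assms(4) by simp
  also have "\<dots> = Psi g \<phi>" using Psi_difference_indep[OF assms(1,3)] assms(4,5) by simp
  also have "\<dots> = Psi f \<phi>" by (rule Psi_generator_indep[OF assms(2-5)])
  finally show ?thesis .
qed

lemma dual_simps: "carrier (dual k R I) = Dl I"
  "add (dual k R I) = (\<lambda>\<phi> \<psi>. \<lambda>X\<in>carrier (quot R I). \<phi> X \<oplus>\<^bsub>k\<^esub> \<psi> X)"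
  "smult (dual k R I) = (\<lambda>a \<phi>. \<lambda>X\<in>carrier (quot R I). \<phi> ((I +> a) \<otimes>\<^bsub>quot R I\<^esub> X))"
  by (simp_all add: dual_def)

lemma duality_map_eq:
  assumes f: "divisor_gen f" and \<phi>: "\<phi> \<in> Dl (PIdl f)"
  shows "duality_map k R T (PIdl f) \<phi> = Psi f \<phi>"
proof -
  have "(THE \<omega>. \<forall>d' g. difference_function k R T d' \<and> regular_elt R g \<and> PIdl f = PIdl g \<longrightarrow>
       \<omega> = duality_formula k R T (PIdl f) d' g \<phi>) = Psi f \<phi>"
  proof (rule the_equality)
    show "\<forall>d' g. difference_function k R T d' \<and> regular_elt R g \<and> PIdl f = PIdl g \<longrightarrow>
       Psi f \<phi> = duality_formula k R T (PIdl f) d' g \<phi>"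
    proof (intro allI impI)
      fix d' g assume *: "difference_function k R T d' \<and> regular_elt R g \<and> PIdl f = PIdl g"
      then have "divisor_gen g" using f by (simp add: divisor_gen_def)
      then show "Psi f \<phi> = duality_formula k R T (PIdl f) d' g \<phi>"
        using formula_eq[OF _ f _ _ \<phi>, of d' g] * by simp
    qed
    fix \<omega> assume "\<forall>d' g. difference_function k R T d' \<and> regular_elt R g \<and> PIdl f = PIdl g \<longrightarrow>
       \<omega> = duality_formula k R T (PIdl f) d' g \<phi>"
    \<comment> \<open>The universal condition pins down \<omega> because an admissible choice
      exists, namely the fixed \<open>d\<close> together with \<open>f\<close>.\<close>
    then show "\<omega> = Psi f \<phi>" using d divisor_genD(1)[OF f] formula_eq_Psi by blast
  qed
  then show ?thesis using \<phi> by (simp add: duality_map_def dual_simps)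
qed

text \<open>Everything is read through the generator \<epsilon> of the dual: a functional
  \<open>\<psi>\<close> is the translate of \<epsilon> by \<open>dual_coeff f \<psi>\<close>, so
  sums of functionals become sums of coefficients.\<close>

lemma dual_coeff_props:
  assumes f: "divisor_gen f"
  shows "\<And>\<phi> \<psi>. \<phi> \<in> Dl (PIdl f) \<Longrightarrow> \<psi> \<in> Dl (PIdl f) \<Longrightarrow>
      (\<lambda>X\<in>carrier (quot R (PIdl f)). \<phi> X \<oplus>\<^bsub>k\<^esub> \<psi> X) \<in> Dl (PIdl f) \<and>
      dual_coeff f (\<lambda>X\<in>carrier (quot R (PIdl f)). \<phi> X \<oplus>\<^bsub>k\<^esub> \<psi> X) = dual_coeff f \<phi> \<oplus>\<^bsub>quot R (PIdl f)\<^esub> dual_coeff f \<psi>"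
    and "bij_betw (dual_coeff f) (Dl (PIdl f)) (carrier (quot R (PIdl f)))"
    and "\<And>a \<phi>. a \<in> carrier R \<Longrightarrow> \<phi> \<in> Dl (PIdl f) \<Longrightarrow> a \<odot>\<^bsub>dual k R (PIdl f)\<^esub> \<phi> \<in> Dl (PIdl f)"
proof -
  note fD = divisor_genD[OF f]
  let ?I = "PIdl f" and ?B = "quot R (PIdl f)"
  interpret I: quotient_algebra k R ?I by (rule OI_quot[OF fD(3)])
  interpret B: cring ?B by (rule I.cring_quot)
  obtain n \<phi>' x where fr: "frobenius_pair k ?B n \<phi>' x (d (?I, ?I)) (e_of f (?I, ?I))"
    using frobenius[OF f refl] .
  interpret F: frobenius_pair k ?B n \<phi>' x "d (?I, ?I)" "e_of f (?I, ?I)" by (rule fr)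
  obtain \<epsilon> where \<epsilon>: "\<epsilon> \<in> Dl ?I"
    "\<And>b. b \<in> carrier ?B \<Longrightarrow> dual_coeff f (\<lambda>X\<in>carrier ?B. \<epsilon> (b \<otimes>\<^bsub>?B\<^esub> X)) = b"
    "\<And>\<psi> X. \<psi> \<in> Dl ?I \<Longrightarrow> X \<in> carrier ?B \<Longrightarrow> \<psi> X = \<epsilon> (dual_coeff f \<psi> \<otimes>\<^bsub>?B\<^esub> X)"
    using ex_generator[OF f] by blast
  have eps: "\<psi> = (\<lambda>X\<in>carrier ?B. \<epsilon> (dual_coeff f \<psi> \<otimes>\<^bsub>?B\<^esub> X))" if "\<psi> \<in> Dl ?I" for \<psi>
    by (rule extensionalityI[of _ "carrier ?B"]) (use that \<epsilon>(3)[OF that] in \<open>auto simp: F.Dual_iff\<close>)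
  show "(\<lambda>X\<in>carrier ?B. \<phi> X \<oplus>\<^bsub>k\<^esub> \<psi> X) \<in> Dl ?I \<and>
      dual_coeff f (\<lambda>X\<in>carrier ?B. \<phi> X \<oplus>\<^bsub>k\<^esub> \<psi> X) = dual_coeff f \<phi> \<oplus>\<^bsub>?B\<^esub> dual_coeff f \<psi>"
    if *: "\<phi> \<in> Dl ?I" "\<psi> \<in> Dl ?I" for \<phi> \<psi>
  proof -
    have c: "dual_coeff f \<phi> \<in> carrier ?B" "dual_coeff f \<psi> \<in> carrier ?B" using dual_coeff_closed[OF f] * by auto
    have "(\<lambda>X\<in>carrier ?B. \<phi> X \<oplus>\<^bsub>k\<^esub> \<psi> X) = (\<lambda>X\<in>carrier ?B. \<epsilon> ((dual_coeff f \<phi> \<oplus>\<^bsub>?B\<^esub> dual_coeff f \<psi>) \<otimes>\<^bsub>?B\<^esub> X))"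
    proof (rule restrict_ext)
      fix X assume X: "X \<in> carrier ?B"
      show "\<phi> X \<oplus>\<^bsub>k\<^esub> \<psi> X = \<epsilon> ((dual_coeff f \<phi> \<oplus>\<^bsub>?B\<^esub> dual_coeff f \<psi>) \<otimes>\<^bsub>?B\<^esub> X)"
        unfolding \<epsilon>(3)[OF *(1) X] \<epsilon>(3)[OF *(2) X] using c X F.Dual_add[OF \<epsilon>(1)] by (simp add: B.l_distr)
    qed
    then show ?thesis using \<epsilon>(2)[of "dual_coeff f \<phi> \<oplus>\<^bsub>?B\<^esub> dual_coeff f \<psi>"] F.Dual_translate[OF \<epsilon>(1), of "dual_coeff f \<phi> \<oplus>\<^bsub>?B\<^esub> dual_coeff f \<psi>"] c by simp
  qed
  show "a \<odot>\<^bsub>dual k R ?I\<^esub> \<phi> \<in> Dl ?I" if "a \<in> carrier R" "\<phi> \<in> Dl ?I" for a \<phi>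
    using F.Dual_translate[OF that(2) I.coset_mem_carrier[OF that(1)]] by (simp add: dual_simps)
  show "bij_betw (dual_coeff f) (Dl ?I) (carrier ?B)"
  proof (rule bij_betw_byWitness[where f' = "\<lambda>b. \<lambda>X\<in>carrier ?B. \<epsilon> (b \<otimes>\<^bsub>?B\<^esub> X)"])
    show "\<forall>\<psi>\<in>Dl ?I. (\<lambda>X\<in>carrier ?B. \<epsilon> (dual_coeff f \<psi> \<otimes>\<^bsub>?B\<^esub> X)) = \<psi>" using eps by metis
    show "\<forall>b\<in>carrier ?B. dual_coeff f (\<lambda>X\<in>carrier ?B. \<epsilon> (b \<otimes>\<^bsub>?B\<^esub> X)) = b" using \<epsilon>(2) by blast
    show "dual_coeff f ` Dl ?I \<subseteq> carrier ?B" using dual_coeff_closed[OF f] by blast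
    show "(\<lambda>b. \<lambda>X\<in>carrier ?B. \<epsilon> (b \<otimes>\<^bsub>?B\<^esub> X)) ` carrier ?B \<subseteq> Dl ?I" using F.Dual_translate[OF \<epsilon>(1)] by blast
  qed
qed

lemma pol_forms_bij: "divisor_gen f \<Longrightarrow> bij_betw (\<lambda>P. tens R (pol f) Om P \<alpha>) (carrier (pol f)) (carrier (polar_forms k R T (PIdl f)))"
  unfolding polar_forms_def by (rule tensor_free_rank_one[OF pol_module Om_module alpha_closed Om_bij])

text \<open>Three bijections are composed: from functionals to numerators, division by
  \<open>f\<close>, and tensoring with the generator \<alpha>.\<close>

lemma Psi_bij:
  assumes f: "divisor_gen f"
  shows "bij_betw (Psi f) (Dl (PIdl f)) (carrier (polar_forms k R T (PIdl f)))"
  using bij_betw_trans[OF bij_betw_trans[OF dual_coeff_props(2)[OF f] polar_class_props(2)[OF f]] pol_forms_bij[OF f]]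
  by (simp add: Psi_def[abs_def] comp_def)

lemma duality_map_iso:
  assumes f: "divisor_gen f"
  shows "duality_map k R T (PIdl f) \<in> lin_isos R (dual k R (PIdl f)) (polar_forms k R T (PIdl f))"
proof -
  let ?I = "PIdl f" and ?B = "quot R (PIdl f)"
  note fD = divisor_genD[OF f]
  interpret I: quotient_algebra k R ?I by (rule OI_quot[OF fD(3)])
  interpret tp: tensor_product R "pol f" Om by (rule pol_tensor[OF f])
  have pf: "polar_forms k R T ?I = tp.T" by (simp add: polar_forms_def)
  have closed: "Psi f \<phi> \<in> carrier (polar_forms k R T ?I)" if "\<phi> \<in> Dl ?I" for \<phi>
    using Psi_bij[OF f] that by (auto simp: bij_betw_def)
  note pca = polar_class_props(1)[OF f]
  have pcc: "polar_class f (dual_coeff f \<phi>) \<in> carrier (pol f)" if "\<phi> \<in> Dl ?I" for \<phi>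
    by (rule additive_map_closed[OF pca dual_coeff_closed[OF f that]])
  show ?thesis
    unfolding lin_isos_def lin_maps_def
  proof (intro CollectI conjI ballI)
    show "duality_map k R T ?I \<in> carrier (dual k R ?I) \<rightarrow>\<^sub>E carrier (polar_forms k R T ?I)"
      using closed duality_map_eq[OF f] by (auto simp: dual_simps duality_map_def)
    show "bij_betw (duality_map k R T ?I) (carrier (dual k R ?I)) (carrier (polar_forms k R T ?I))"
      using Psi_bij[OF f] bij_betw_cong[of "Dl ?I" "duality_map k R T ?I" "Psi f"] duality_map_eq[OF f] by (simp add: dual_simps)
  next
    fix \<phi> \<psi> assume "\<phi> \<in> carrier (dual k R ?I)" "\<psi> \<in> carrier (dual k R ?I)"
    then have *: "\<phi> \<in> Dl ?I" "\<psi> \<in> Dl ?I" by (simp_all add: dual_simps)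
    have s: "\<phi> \<oplus>\<^bsub>dual k R ?I\<^esub> \<psi> = (\<lambda>X\<in>carrier ?B. \<phi> X \<oplus>\<^bsub>k\<^esub> \<psi> X)" by (simp add: dual_simps)
    have "Psi f (\<phi> \<oplus>\<^bsub>dual k R ?I\<^esub> \<psi>) = Psi f \<phi> \<oplus>\<^bsub>tp.T\<^esub> Psi f \<psi>"
      unfolding Psi_def s using dual_coeff_props(1)[OF f *] dual_coeff_closed[OF f] * pcc alpha_closed
      by (simp add: additive_map_add[OF pca] tp.tn_add_left)
    then show "duality_map k R T ?I (\<phi> \<oplus>\<^bsub>dual k R ?I\<^esub> \<psi>) =
        duality_map k R T ?I \<phi> \<oplus>\<^bsub>polar_forms k R T ?I\<^esub> duality_map k R T ?I \<psi>"
      using duality_map_eq[OF f] dual_coeff_props(1)[OF f *] * by (simp add: s pf)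
  next
    fix a \<phi> assume a: "a \<in> carrier R" and "\<phi> \<in> carrier (dual k R ?I)"
    then have *: "\<phi> \<in> Dl ?I" by (simp add: dual_simps)
    have s: "a \<odot>\<^bsub>dual k R ?I\<^esub> \<phi> = (\<lambda>X\<in>carrier ?B. \<phi> ((?I +> a) \<otimes>\<^bsub>?B\<^esub> X))" by (simp add: dual_simps)
    have "Psi f (a \<odot>\<^bsub>dual k R ?I\<^esub> \<phi>) = a \<odot>\<^bsub>tp.T\<^esub> Psi f \<phi>"
      unfolding Psi_def s dual_coeff_translate[OF f * I.coset_mem_carrier[OF a]]
      using a * pcc dual_coeff_closed[OF f] alpha_closed by (simp add: polar_class_props(3)[OF f] tp.smult_tn)
    then show "duality_map k R T ?I (a \<odot>\<^bsub>dual k R ?I\<^esub> \<phi>) = a \<odot>\<^bsub>polar_forms k R T ?I\<^esub> duality_map k R T ?I \<phi>"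
      using duality_map_eq[OF f] dual_coeff_props(3)[OF f a *] * by (simp add: pf)
  qed
qed

text \<open>As \<open>x/f = xh/(fh)\<close> and both modules take their operations from the
  meromorphic functions, the polar parts of the smaller divisor are literally among those of the
  larger one.\<close>

lemma pol_balanced_quot:
  assumes f: "divisor_gen f" and g: "divisor_gen (f \<otimes> h)" and h: "h \<in> carrier R" and P: "P \<in> carrier (pol f)"
  shows "P \<in> carrier (pol (f \<otimes> h))"
    and "\<And>P'. P' \<in> carrier (pol f) \<Longrightarrow> P \<oplus>\<^bsub>pol f\<^esub> P' = P \<oplus>\<^bsub>pol (f \<otimes> h)\<^esub> P'"
    and "\<And>a. a \<in> carrier R \<Longrightarrow> a \<odot>\<^bsub>pol f\<^esub> P = a \<odot>\<^bsub>pol (f \<otimes> h)\<^esub> P"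
proof -
  note fD = divisor_genD[OF f]
  interpret P: quotient_module R "inv_id f" hol by (rule hol_quotient[OF f])
  interpret G: quotient_module R "inv_id (f \<otimes> h)" hol by (rule hol_quotient[OF g])
  obtain x where x: "x \<in> carrier R" "P = hol +>\<^bsub>inv_id f\<^esub> mf x f"
    using P P.quot_carrier by (auto simp: polar_parts_def inv_id_carrier[OF f])
  have e: "mf x f = mf (x \<otimes> h) (f \<otimes> h)"
    using x h fD divisor_gen_denominator[OF f] divisor_gen_denominator[OF g] by (simp add: Fr.fr_eq_iff m_ac)
  have "P = hol +>\<^bsub>inv_id (f \<otimes> h)\<^esub> mf (x \<otimes> h) (f \<otimes> h)"
    unfolding x(2) e by (simp add: a_r_coset_def' inv_id_simps)
  moreover have "mf (x \<otimes> h) (f \<otimes> h) \<in> carrier (inv_id (f \<otimes> h))"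
    using x h by (auto simp: inv_id_carrier[OF g])
  ultimately show "P \<in> carrier (pol (f \<otimes> h))" using G.coset_mem_carrier by (simp add: polar_parts_def)
  show "P \<oplus>\<^bsub>pol f\<^esub> P' = P \<oplus>\<^bsub>pol (f \<otimes> h)\<^esub> P'" for P'
    by (simp add: polar_parts_def quot_def FactRing_def set_add_def' inv_id_simps)
  show "a \<odot>\<^bsub>pol f\<^esub> P = a \<odot>\<^bsub>pol (f \<otimes> h)\<^esub> P" for a
    by (simp add: polar_parts_def quot_def inv_id_simps a_r_coset_def')
qed

lemma polar_to_polar_Psi:
  assumes f: "divisor_gen f" and g: "divisor_gen (f \<otimes> h)" and h: "h \<in> carrier R" and \<phi>: "\<phi> \<in> Dl (PIdl f)"
  shows "polar_to_polar k R T (PIdl (f \<otimes> h)) (Psi f \<phi>) =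
    tens R (pol (f \<otimes> h)) Om (polar_class f (dual_coeff f \<phi>)) \<alpha>"
proof -
  interpret tf: tensor_product R "pol f" Om by (rule pol_tensor[OF f])
  interpret tg: tensor_product R "pol (f \<otimes> h)" Om by (rule pol_tensor[OF g])
  note pb = pol_balanced_quot[OF f g h]
  have bal: "tf.balanced (polar_forms k R T (PIdl (f \<otimes> h))) (\<lambda>G w. tg.tn G w)"
    unfolding polar_forms_def
    by (rule tf.balancedI)
      (simp_all add: pb tg.tn_closed tg.tn_add_left tg.tn_add_right tg.tn_balanced)
  have "polar_class f (dual_coeff f \<phi>) \<in> carrier (pol f)"
    by (rule additive_map_closed[OF polar_class_props(1)[OF f] dual_coeff_closed[OF f \<phi>]])
  then show ?thesis
    unfolding polar_to_polar_def Psi_def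
    using tf.tensor_lift_tn[OF _ bal _ alpha_closed] tg.abelian_group_T by (simp add: polar_forms_def)
qed

text \<open>Inclusion of the ideals means \<open>g = fh\<close>, so \<open>Psi_mult\<close> applies
  to the functional pulled back along the reduction. The third conclusion, free of the differential
  factor, is the form needed for \<open>local_residue_mult\<close>.\<close>

lemma duality_natural:
  assumes f: "divisor_gen f" and g: "divisor_gen g" and sub: "PIdl g \<subseteq> PIdl f" and \<phi>: "\<phi> \<in> Dl (PIdl f)"
  shows "(\<lambda>X\<in>carrier (quot R (PIdl g)). \<phi> (PIdl f <+>\<^bsub>R\<^esub> X)) \<in> Dl (PIdl g)"
    and "duality_map k R T (PIdl g) (\<lambda>X\<in>carrier (quot R (PIdl g)). \<phi> (PIdl f <+>\<^bsub>R\<^esub> X)) =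
      polar_to_polar k R T (PIdl g) (duality_map k R T (PIdl f) \<phi>)"
    and "polar_class g (dual_coeff g (\<lambda>X\<in>carrier (quot R (PIdl g)). \<phi> (PIdl f <+>\<^bsub>R\<^esub> X))) = polar_class f (dual_coeff f \<phi>)"
proof -
  note fD = divisor_genD[OF f] and gD = divisor_genD[OF g]
  obtain h where h: "h \<in> carrier R" "g = f \<otimes> h" using PIdl_subset_factor[OF gD(2) fD(2) sub] .
  interpret I: quotient_algebra k R "PIdl f" by (rule OI_quot[OF fD(3)])
  interpret J: quotient_algebra k R "PIdl g" by (rule OI_quot[OF gD(3)])
  define \<psi> where "\<psi> = (\<lambda>X\<in>carrier (quot R (PIdl g)). \<phi> (PIdl f <+>\<^bsub>R\<^esub> X))"
  have \<psi>_coset: "\<psi> (PIdl g +> a) = \<phi> (PIdl f +> a)" if "a \<in> carrier R" for a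
    using that by (simp add: \<psi>_def J.coset_mem_carrier set_add_coset[OF gD(3) fD(3) sub])
  have \<psi>: "\<psi> \<in> Dl (PIdl g)"
    unfolding lin_maps_def
  proof (intro CollectI conjI ballI)
    have "\<phi> X \<in> carrier k" if "X \<in> carrier (quot R (PIdl f))" for X
      using \<phi> that by (auto simp: lin_maps_def self_module_def)
    then show "\<psi> \<in> carrier (quot R (PIdl g)) \<rightarrow>\<^sub>E carrier (self_module k)"
      by (auto simp: J.quot_carrier \<psi>_coset self_module_def I.coset_mem_carrier) (auto simp: \<psi>_def J.quot_carrier)
    show "\<psi> (X \<oplus>\<^bsub>quot R (PIdl g)\<^esub> Y) = \<psi> X \<oplus>\<^bsub>self_module k\<^esub> \<psi> Y"
      if "X \<in> carrier (quot R (PIdl g))" "Y \<in> carrier (quot R (PIdl g))" for X Y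
      using that \<phi> by (auto simp: J.quot_carrier J.coset_add \<psi>_coset I.coset_add[symmetric] I.coset_mem_carrier lin_maps_def)
    show "\<psi> (a \<odot>\<^bsub>quot R (PIdl g)\<^esub> X) = a \<odot>\<^bsub>self_module k\<^esub> \<psi> X"
      if "a \<in> carrier k" "X \<in> carrier (quot R (PIdl g))" for a X
      using that \<phi> by (auto simp: J.quot_carrier J.coset_smult \<psi>_coset I.coset_smult[symmetric] I.coset_mem_carrier lin_maps_def)
  qed
  then show "(\<lambda>X\<in>carrier (quot R (PIdl g)). \<phi> (PIdl f <+>\<^bsub>R\<^esub> X)) \<in> Dl (PIdl g)" by (simp add: \<psi>_def)
  have polar_class_eq: "polar_class g (dual_coeff g \<psi>) = polar_class f (dual_coeff f \<phi>)"
    using Psi_mult[OF f _ h(1) \<phi>, of \<psi>] g \<psi> \<psi>_coset by (simp add: h(2)[symmetric])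
  then show "polar_class g (dual_coeff g (\<lambda>X\<in>carrier (quot R (PIdl g)). \<phi> (PIdl f <+>\<^bsub>R\<^esub> X))) = polar_class f (dual_coeff f \<phi>)" by (simp add: \<psi>_def)
  have "duality_map k R T (PIdl g) \<psi> = polar_to_polar k R T (PIdl g) (duality_map k R T (PIdl f) \<phi>)"
    unfolding duality_map_eq[OF g \<psi>] duality_map_eq[OF f \<phi>]
    using polar_to_polar_Psi[OF f _ h(1) \<phi>] g polar_class_eq by (simp add: h(2)[symmetric] Psi_def)
  then show "duality_map k R T (PIdl g) (\<lambda>X\<in>carrier (quot R (PIdl g)). \<phi> (PIdl f <+>\<^bsub>R\<^esub> X)) =
      polar_to_polar k R T (PIdl g) (duality_map k R T (PIdl f) \<phi>)" by (simp add: \<psi>_def)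
qed

end

lemma (in abelian_monoid) finsum_lessThan_add:
  fixes n m :: nat
  assumes "F \<in> {..<n + m} \<rightarrow> carrier G"
  shows "(\<Oplus>i\<in>{..<n + m}. F i) = (\<Oplus>i\<in>{..<n}. F i) \<oplus> (\<Oplus>j\<in>{..<m}. F (n + j))"
  using assms
proof (induct m)
  case 0
  have "F \<in> {..<n} \<rightarrow> carrier G" using 0 by simp
  then show ?case by simp
next
  case (Suc m)
  then have "F (n + m) \<in> carrier G" "F \<in> {..<n + m} \<rightarrow> carrier G" by (auto simp: Pi_def)
  moreover have "(\<lambda>j. F (n + j)) \<in> {..<m} \<rightarrow> carrier G" "F \<in> {..<n} \<rightarrow> carrier G" using Suc.prems by (auto simp: Pi_def)
  ultimately show ?case using Suc.hyps by (simp add: lessThan_Suc a_ac)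
qed

section \<open>Power series in the parameter\<close>

context multicurve
begin

text \<open>Functionals on all of \<open>R\<close>, with no continuity demanded: a functional that
  vanishes on \<open>sR\<close> for a divisorial \<open>s\<close> need not vanish on an open
  ideal.\<close>

definition k_form :: "('r \<Rightarrow> 'k) \<Rightarrow> bool" where
  "k_form \<phi> \<longleftrightarrow> additive_map R k \<phi> \<and> (\<forall>c\<in>carrier k. \<forall>a\<in>carrier R. \<phi> (c \<odot> a) = c \<otimes>\<^bsub>k\<^esub> \<phi> a)"

lemma k_formI:
  assumes "\<And>a. a \<in> carrier R \<Longrightarrow> \<phi> a \<in> carrier k"
    and "\<And>a b. a \<in> carrier R \<Longrightarrow> b \<in> carrier R \<Longrightarrow> \<phi> (a \<oplus> b) = \<phi> a \<oplus>\<^bsub>k\<^esub> \<phi> b"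
    and "\<And>c a. c \<in> carrier k \<Longrightarrow> a \<in> carrier R \<Longrightarrow> \<phi> (c \<odot> a) = c \<otimes>\<^bsub>k\<^esub> \<phi> a"
  shows "k_form \<phi>"
  using assms by (auto simp: k_form_def intro!: additive_mapI)

lemma k_form_closed: "k_form \<phi> \<Longrightarrow> a \<in> carrier R \<Longrightarrow> \<phi> a \<in> carrier k"
  by (auto simp: k_form_def additive_map_def)

lemma k_form_add: "k_form \<phi> \<Longrightarrow> a \<in> carrier R \<Longrightarrow> b \<in> carrier R \<Longrightarrow> \<phi> (a \<oplus> b) = \<phi> a \<oplus>\<^bsub>k\<^esub> \<phi> b"
  by (simp add: k_form_def additive_map_add)

lemma k_form_smult: "k_form \<phi> \<Longrightarrow> c \<in> carrier k \<Longrightarrow> a \<in> carrier R \<Longrightarrow> \<phi> (c \<odot> a) = c \<otimes>\<^bsub>k\<^esub> \<phi> a"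
  by (simp add: k_form_def)

lemma k_linearD:
  assumes "k_linear g"
  shows "a \<in> carrier R \<Longrightarrow> b \<in> carrier R \<Longrightarrow> g (a \<oplus> b) = g a \<oplus> g b"
    "c \<in> carrier k \<Longrightarrow> a \<in> carrier R \<Longrightarrow> g (c \<odot> a) = c \<odot> g a"
  using assms by (auto simp: k_linear_def additive_map_add)

definition partial_sum :: "(nat \<Rightarrow> 'k) \<Rightarrow> nat \<Rightarrow> 'r" where
  "partial_sum a N = (\<Oplus>n\<in>{..<N}. a n \<odot> yp n)"

lemma partial_sum_closed: "a \<in> UNIV \<rightarrow> carrier k \<Longrightarrow> partial_sum a N \<in> carrier R"
  unfolding partial_sum_def by (rule M.finsum_closed) (simp add: yp_closed Pi_iff)

lemma partial_sum_Suc: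
  "a \<in> UNIV \<rightarrow> carrier k \<Longrightarrow> partial_sum a (Suc N) = partial_sum a N \<oplus> a N \<odot> yp N"
  unfolding partial_sum_def lessThan_Suc
  by (subst M.finsum_insert) (simp_all add: yp_closed Pi_iff M.a_comm M.finsum_closed)

lemma smult_mem_y: "c \<in> carrier k \<Longrightarrow> N \<le> n \<Longrightarrow> c \<odot> yp n \<in> PIdl (yp N)"
proof -
  assume c: "c \<in> carrier k" and "N \<le> n"
  have "c \<odot> yp n = (c \<odot> \<one>) \<otimes> yp n" using c yp_closed by (simp add: smult_assoc2)
  then have "c \<odot> yp n \<in> PIdl (yp n)" using c by (auto simp: PIdl_mem_iff)
  then show ?thesis using y_mono[OF \<open>N \<le> n\<close>] by blast
qed

lemma OI_coset_mono:
  "J \<in> OI \<Longrightarrow> K \<in> OI \<Longrightarrow> J \<subseteq> K \<Longrightarrow> a \<in> carrier R \<Longrightarrow> b \<in> carrier R \<Longrightarrow> J +> a = J +> b \<Longrightarrow> K +> a = K +> b"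
  by (metis set_add_coset)

lemma partial_sum_coset:
  assumes a: "a \<in> UNIV \<rightarrow> carrier k" and "N \<le> N'"
  shows "PIdl (yp N) +> partial_sum a N' = PIdl (yp N) +> partial_sum a N"
  using assms(2)
proof (induction N' rule: dec_induct)
  case (step n)
  interpret J: quotient_algebra k R "PIdl (yp N)" by (rule OI_quot[OF y_ideal])
  interpret B: abelian_group "quot R (PIdl (yp N))" by (rule J.abelian_group_quot)
  have c: "a n \<in> carrier k" using a by auto
  have "PIdl (yp N) +> (a n \<odot> yp n) = \<zero>\<^bsub>quot R (PIdl (yp N))\<^esub>"
    using smult_mem_y[OF c step(1)] J.coset_eq_zero_iff c yp_closed by (simp add: J.quot_simps)
  then show ?case
    using step a c yp_closed J.coset_add[of "partial_sum a n" "a n \<odot> yp n"]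
      B.r_zero[OF J.coset_mem_carrier[OF partial_sum_closed[OF a]]]
    by (simp add: partial_sum_Suc partial_sum_closed)
qed simp

text \<open>Modulo an open ideal that contains a power of \<open>y\<close> the partial sums become
  constant, so \<open>OI_complete\<close> supplies the limit. Cofinality of the powers allows it to
  be characterised by these alone.\<close>

lemma ex1_series:
  assumes a: "a \<in> UNIV \<rightarrow> carrier k"
  shows "\<exists>!s. s \<in> carrier R \<and> (\<forall>N. PIdl (yp N) +> s = PIdl (yp N) +> partial_sum a N)"
proof -
  note pc = partial_sum_closed[OF a]
  have "\<forall>J\<in>OI. \<exists>N. PIdl (yp N) \<subseteq> J" by (meson y_cofinal)
  then obtain N where N: "\<And>J. J \<in> OI \<Longrightarrow> PIdl (yp (N J)) \<subseteq> J" by metis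
  have indep: "K +> partial_sum a n = K +> partial_sum a m"
    if K: "K \<in> OI" "PIdl (yp n) \<subseteq> K" "PIdl (yp m) \<subseteq> K" for K n m
  proof (cases "n \<le> m")
    case True
    show ?thesis by (rule OI_coset_mono[OF y_ideal K(1,2) pc pc partial_sum_coset[OF a True, symmetric]])
  next
    case False
    then have "m \<le> n" by simp
    show ?thesis by (rule OI_coset_mono[OF y_ideal K(1,3) pc pc partial_sum_coset[OF a \<open>m \<le> n\<close>]])
  qed
  have "\<exists>!s. s \<in> carrier R \<and> (\<forall>J\<in>OI. J +> s = J +> partial_sum a (N J))"
  proof (rule OI_complete)
    show "J +> partial_sum a (N J) \<in> carrier (quot R J)" if "J \<in> OI" for J by (rule coset_closed[OF that pc])
    fix J K assume J: "J \<in> OI" and K: "K \<in> OI" and sub: "J \<subseteq> K"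
    have "K +> partial_sum a (N K) = K +> partial_sum a (N J)"
      using N[OF J] N[OF K] sub by (intro indep K) auto
    then show "J +> partial_sum a (N J) \<subseteq> K +> partial_sum a (N K)"
      using sub by (auto simp: a_r_coset_def')
  qed
  then obtain s where s: "s \<in> carrier R" "\<And>J. J \<in> OI \<Longrightarrow> J +> s = J +> partial_sum a (N J)" by blast
  show ?thesis
  proof (rule ex1I[of _ s])
    have "PIdl (yp n) +> s = PIdl (yp n) +> partial_sum a n" for n
      using s(2)[OF y_ideal[of n]] indep[OF y_ideal N[OF y_ideal] order_refl] by simp
    then show "s \<in> carrier R \<and> (\<forall>N. PIdl (yp N) +> s = PIdl (yp N) +> partial_sum a N)" using s by blast
    fix t assume t: "t \<in> carrier R \<and> (\<forall>N. PIdl (yp N) +> t = PIdl (yp N) +> partial_sum a N)"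
    show "t = s"
    proof (rule OI_coset_eqI)
      fix J assume J: "J \<in> OI"
      have "J +> t = J +> partial_sum a (N J)"
        using t pc by (intro OI_coset_mono[OF y_ideal J N[OF J]]) auto
      then show "J +> t = J +> s" using s(2)[OF J] by simp
    qed (use t s in auto)
  qed
qed

definition series :: "(nat \<Rightarrow> 'k) \<Rightarrow> 'r" where
  "series a = (THE s. s \<in> carrier R \<and> (\<forall>N. PIdl (yp N) +> s = PIdl (yp N) +> partial_sum a N))"

lemma series:
  assumes "a \<in> UNIV \<rightarrow> carrier k"
  shows "series a \<in> carrier R" "PIdl (yp N) +> series a = PIdl (yp N) +> partial_sum a N"
  using theI'[OF ex1_series[OF assms]] by (simp_all add: series_def)

lemma series_eqI:
  assumes "a \<in> UNIV \<rightarrow> carrier k" "s \<in> carrier R" "\<And>N. PIdl (yp N) +> s = PIdl (yp N) +> partial_sum a N"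
  shows "series a = s"
  unfolding series_def by (rule the1_equality[OF ex1_series[OF assms(1)]]) (use assms in blast)

lemma series_add:
  assumes a: "a \<in> UNIV \<rightarrow> carrier k" and b: "b \<in> UNIV \<rightarrow> carrier k"
  shows "series (\<lambda>n. a n \<oplus>\<^bsub>k\<^esub> b n) = series a \<oplus> series b"
proof (rule series_eqI)
  have p: "partial_sum (\<lambda>n. a n \<oplus>\<^bsub>k\<^esub> b n) N = partial_sum a N \<oplus> partial_sum b N" for N
  proof -
    have "partial_sum (\<lambda>n. a n \<oplus>\<^bsub>k\<^esub> b n) N = (\<Oplus>n\<in>{..<N}. a n \<odot> yp n \<oplus> b n \<odot> yp n)"
      unfolding partial_sum_def using a b by (intro M.finsum_cong') (simp_all add: smult_l_distr yp_closed Pi_iff)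
    also have "\<dots> = partial_sum a N \<oplus> partial_sum b N"
      unfolding partial_sum_def using a b by (intro M.finsum_addf) (simp_all add: yp_closed Pi_iff)
    finally show ?thesis .
  qed
  fix N
  interpret J: quotient_algebra k R "PIdl (yp N)" by (rule OI_quot[OF y_ideal])
  show "PIdl (yp N) +> (series a \<oplus> series b) = PIdl (yp N) +> partial_sum (\<lambda>n. a n \<oplus>\<^bsub>k\<^esub> b n) N"
    using series[OF a] series[OF b] partial_sum_closed[OF a] partial_sum_closed[OF b]
    by (simp add: p J.coset_add[symmetric])
qed (use a b in \<open>auto simp: series\<close>)

lemma series_smult:
  assumes a: "a \<in> UNIV \<rightarrow> carrier k" and c: "c \<in> carrier k"
  shows "series (\<lambda>n. c \<otimes>\<^bsub>k\<^esub> a n) = c \<odot> series a"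
proof (rule series_eqI)
  have p: "partial_sum (\<lambda>n. c \<otimes>\<^bsub>k\<^esub> a n) N = c \<odot> partial_sum a N" for N
  proof -
    have "partial_sum (\<lambda>n. c \<otimes>\<^bsub>k\<^esub> a n) N = (\<Oplus>n\<in>{..<N}. c \<odot> (a n \<odot> yp n))"
      unfolding partial_sum_def using a c by (intro M.finsum_cong') (simp_all add: smult_assoc1 yp_closed Pi_iff)
    also have "\<dots> = c \<odot> partial_sum a N"
      unfolding partial_sum_def using a c by (intro finsum_smult_ldistr[symmetric]) (simp_all add: yp_closed Pi_iff)
    finally show ?thesis .
  qed
  fix N
  interpret J: quotient_algebra k R "PIdl (yp N)" by (rule OI_quot[OF y_ideal])
  show "PIdl (yp N) +> (c \<odot> series a) = PIdl (yp N) +> partial_sum (\<lambda>n. c \<otimes>\<^bsub>k\<^esub> a n) N"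
    using series[OF a] partial_sum_closed[OF a] c by (simp add: p J.coset_smult[symmetric])
qed (use a c in \<open>auto simp: series\<close>)

text \<open>Splitting off the constant term becomes \<open>G_Suc\<close>, from which the recursion
  \<open>tr_G\<close> follows. Multiplication by \<open>y\<close> shifts the cutoff, so a partial
  sum with one more term is compared modulo the same power.\<close>

lemma series_Suc:
  assumes a: "a \<in> UNIV \<rightarrow> carrier k"
  shows "series a = a 0 \<odot> \<one> \<oplus> y \<otimes> series (\<lambda>n. a (Suc n))"
proof (rule series_eqI[OF a])
  have a': "(\<lambda>n. a (Suc n)) \<in> UNIV \<rightarrow> carrier k" and a0: "a 0 \<in> carrier k" using a by auto
  have p: "partial_sum a (Suc N) = a 0 \<odot> \<one> \<oplus> y \<otimes> partial_sum (\<lambda>n. a (Suc n)) N" for N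
  proof (induction N)
    case 0
    then show ?case using a0 yc by (simp add: partial_sum_Suc[OF a]) (simp add: partial_sum_def)
  next
    case (Suc N)
    have s: "a (Suc N) \<odot> yp (Suc N) = y \<otimes> (a (Suc N) \<odot> yp N)"
    proof -
      have c: "a (Suc N) \<in> carrier k" using a by auto
      have "a (Suc N) \<odot> yp (Suc N) = (a (Suc N) \<odot> yp N) \<otimes> y"
        using c yc yp_closed smult_assoc2[OF c yp_closed yc, of N] by simp
      then show ?thesis using c yc yp_closed by (simp add: m_comm)
    qed
    have c: "a (Suc N) \<odot> yp N \<in> carrier R" using a yp_closed by auto
    have "partial_sum a (Suc (Suc N)) = partial_sum a (Suc N) \<oplus> y \<otimes> (a (Suc N) \<odot> yp N)"
      by (simp only: partial_sum_Suc[OF a, of "Suc N"] s)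
    also have "\<dots> = a 0 \<odot> \<one> \<oplus> y \<otimes> (partial_sum (\<lambda>n. a (Suc n)) N \<oplus> a (Suc N) \<odot> yp N)"
      using a0 yc c partial_sum_closed[OF a'] by (simp add: Suc M.a_assoc r_distr)
    finally show ?case by (simp only: partial_sum_Suc[OF a'])
  qed
  fix N
  interpret J: quotient_algebra k R "PIdl (yp N)" by (rule OI_quot[OF y_ideal])
  have "PIdl (yp N) +> (a 0 \<odot> \<one> \<oplus> y \<otimes> series (\<lambda>n. a (Suc n))) =
      PIdl (yp N) +> (a 0 \<odot> \<one> \<oplus> y \<otimes> partial_sum (\<lambda>n. a (Suc n)) N)"
    using a0 yc series[OF a'] partial_sum_closed[OF a']
    by (simp add: J.coset_add[symmetric] J.coset_mult[symmetric])
  then show "PIdl (yp N) +> (a 0 \<odot> \<one> \<oplus> y \<otimes> series (\<lambda>n. a (Suc n))) = PIdl (yp N) +> partial_sum a N"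
    using partial_sum_coset[OF a, of N "Suc N"] by (simp add: p)
qed (use a yc in \<open>auto simp: series Pi_def\<close>)

lemma series_zero: "series (\<lambda>n. \<zero>\<^bsub>k\<^esub>) = \<zero>"
  using series_smult[of "\<lambda>n. \<zero>\<^bsub>k\<^esub>" "\<zero>\<^bsub>k\<^esub>"] series(1)[of "\<lambda>n. \<zero>\<^bsub>k\<^esub>"] by simp

section \<open>Extension of functionals to fractions\<close>

text \<open>Projectivity of \<open>R/f\<close> over \<open>k\<close>, written with functionals on
  \<open>R\<close> that vanish on \<open>Rf\<close>, so that products of denominators can be treated
  without changing quotients.\<close>

definition proj_gen :: "'r \<Rightarrow> bool" where
  "proj_gen f \<longleftrightarrow> regular_elt R f \<and> (\<exists>n x lm. (\<forall>i<n::nat. x i \<in> carrier R \<and> k_form (lm i) \<and> (\<forall>z\<in>PIdl f. lm i z = \<zero>\<^bsub>k\<^esub>)) \<and>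
     (\<forall>a\<in>carrier R. a \<ominus> (\<Oplus>i\<in>{..<n}. lm i a \<odot> x i) \<in> PIdl f))"

text \<open>A witness of \<open>proj_gen\<close> together with the division \<open>q\<close> that it
  induces. The sum is a projection with kernel \<open>fR\<close>, and \<open>q\<close> is a left
  inverse of multiplication by \<open>f\<close>.\<close>

definition projection_data :: "'r \<Rightarrow> nat \<Rightarrow> (nat \<Rightarrow> 'r) \<Rightarrow> (nat \<Rightarrow> 'r \<Rightarrow> 'k) \<Rightarrow> ('r \<Rightarrow> 'r) \<Rightarrow> bool" where
  "projection_data f n x lm q \<longleftrightarrow> regular_elt R f \<and>
     (\<forall>i<n. x i \<in> carrier R \<and> k_form (lm i) \<and> (\<forall>a\<in>carrier R. lm i (f \<otimes> a) = \<zero>\<^bsub>k\<^esub>)) \<and> k_linear q \<and>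
     (\<forall>a\<in>carrier R. a = (\<Oplus>i\<in>{..<n}. lm i a \<odot> x i) \<oplus> f \<otimes> q a \<and> q (f \<otimes> a) = a)"

lemma projection_dataD:
  assumes "projection_data f n x lm q"
  shows "regular_elt R f" "f \<in> carrier R"
    "\<And>i. i < n \<Longrightarrow> x i \<in> carrier R" "\<And>i. i < n \<Longrightarrow> k_form (lm i)" "\<And>i a. i < n \<Longrightarrow> a \<in> carrier R \<Longrightarrow> lm i (f \<otimes> a) = \<zero>\<^bsub>k\<^esub>"
    "k_linear q" "\<And>a. a \<in> carrier R \<Longrightarrow> a = (\<Oplus>i\<in>{..<n}. lm i a \<odot> x i) \<oplus> f \<otimes> q a"
    "\<And>a. a \<in> carrier R \<Longrightarrow> q (f \<otimes> a) = a"
  using assms unfolding projection_data_def regular_elt_def by blast+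

text \<open>The remainder \<open>a - s a\<close> is divisible by \<open>f\<close>, and regularity
  makes the quotient unique and hence linear. The construction is that of
  \<open>kernel_component\<close> without the continuity, which presupposes an open ideal
  there.\<close>

lemma proj_genE:
  assumes "proj_gen f"
  obtains n x lm q where "projection_data f n x lm q"
proof -
  obtain n x lm where f: "regular_elt R f" and x: "\<And>i. i < (n::nat) \<Longrightarrow> x i \<in> carrier R" and lm: "\<And>i. i < n \<Longrightarrow> k_form (lm i)"
    and kill: "\<And>i z. i < n \<Longrightarrow> z \<in> PIdl f \<Longrightarrow> lm i z = \<zero>\<^bsub>k\<^esub>"
    and res: "\<And>a. a \<in> carrier R \<Longrightarrow> a \<ominus> (\<Oplus>i\<in>{..<n}. lm i a \<odot> x i) \<in> PIdl f"
    using assms unfolding proj_gen_def by blast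
  have fc: "f \<in> carrier R" using f by (simp add: regular_elt_def)
  have kill': "lm i (f \<otimes> a) = \<zero>\<^bsub>k\<^esub>" if "i < n" "a \<in> carrier R" for i a
    using that fc by (intro kill) (auto simp: PIdl_mem_iff m_comm)
  define s where "s a = (\<Oplus>i\<in>{..<n}. lm i a \<odot> x i)" for a
  have sc: "s a \<in> carrier R" if "a \<in> carrier R" for a
    unfolding s_def using that x by (intro M.finsum_closed) (auto simp: k_form_closed[OF lm])
  have s_add: "s (a \<oplus> b) = s a \<oplus> s b" if "a \<in> carrier R" "b \<in> carrier R" for a b
  proof -
    have "s (a \<oplus> b) = (\<Oplus>i\<in>{..<n}. lm i a \<odot> x i \<oplus> lm i b \<odot> x i)"
      unfolding s_def using that x
      by (intro M.finsum_cong') (auto simp: smult_l_distr k_form_add[OF lm] k_form_closed[OF lm])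
    also have "\<dots> = s a \<oplus> s b"
      unfolding s_def using that x by (intro M.finsum_addf) (auto simp: k_form_closed[OF lm])
    finally show ?thesis .
  qed
  have s_smult: "s (c \<odot> a) = c \<odot> s a" if "c \<in> carrier k" "a \<in> carrier R" for a c
  proof -
    have "s (c \<odot> a) = (\<Oplus>i\<in>{..<n}. c \<odot> (lm i a \<odot> x i))"
      unfolding s_def using that x
      by (intro M.finsum_cong') (auto simp: smult_assoc1 k_form_smult[OF lm] k_form_closed[OF lm])
    also have "\<dots> = c \<odot> s a"
      unfolding s_def using that x by (intro finsum_smult_ldistr[symmetric]) (auto simp: k_form_closed[OF lm])
    finally show ?thesis .
  qed
  have "\<exists>b. b \<in> carrier R \<and> a \<ominus> s a = f \<otimes> b" if a: "a \<in> carrier R" for a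
    using res[OF a] fc unfolding s_def[symmetric] PIdl_mem_iff by (metis m_comm)
  then obtain q where q: "\<And>a. a \<in> carrier R \<Longrightarrow> q a \<in> carrier R" "\<And>a. a \<in> carrier R \<Longrightarrow> a \<ominus> s a = f \<otimes> q a"
    by metis
  have q_eqI: "q a = b" if "a \<in> carrier R" "b \<in> carrier R" "a \<ominus> s a = f \<otimes> b" for a b
    using regular_cancel[OF f q(1)[OF that(1)] that(2)] q(2)[OF that(1)] that(3) by simp
  have q_lin: "k_linear q"
    unfolding k_linear_def
  proof (intro conjI ballI additive_mapI)
    show "q (a \<oplus> b) = q a \<oplus> q b" if "a \<in> carrier R" "b \<in> carrier R" for a b
    proof (rule q_eqI)
      have "(a \<oplus> b) \<ominus> s (a \<oplus> b) = (a \<ominus> s a) \<oplus> (b \<ominus> s b)"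
        using that sc by (simp add: s_add a_minus_def M.minus_add M.a_ac)
      then show "(a \<oplus> b) \<ominus> s (a \<oplus> b) = f \<otimes> (q a \<oplus> q b)"
        using that q fc by (simp add: r_distr)
    qed (use that q in auto)
    show "q (c \<odot> a) = c \<odot> q a" if "c \<in> carrier k" "a \<in> carrier R" for c a
    proof (rule q_eqI)
      have "c \<odot> a \<ominus> s (c \<odot> a) = c \<odot> (a \<ominus> s a)"
        using that sc by (simp add: s_smult a_minus_def smult_r_distr smult_r_minus)
      also have "\<dots> = f \<otimes> (c \<odot> q a)"
        using that q fc by (metis m_comm smult_assoc2 smult_closed)
      finally show "c \<odot> a \<ominus> s (c \<odot> a) = f \<otimes> (c \<odot> q a)" .
    qed (use that q in auto)
  qed (use q in auto)
  have dec: "a = s a \<oplus> f \<otimes> q a" if "a \<in> carrier R" for a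
    using M.add_minus_cancel[OF sc[OF that] that] q(2)[OF that] by simp
  have qf: "q (f \<otimes> a) = a" if a: "a \<in> carrier R" for a
  proof (rule q_eqI)
    have "s (f \<otimes> a) = (\<Oplus>i\<in>{..<n}. \<zero>)"
      unfolding s_def using a x by (intro M.finsum_cong') (auto simp: kill')
    then show "f \<otimes> a \<ominus> s (f \<otimes> a) = f \<otimes> a" using a fc by (simp add: a_minus_def)
  qed (use a fc in auto)
  show ?thesis
    by (rule that[of n x lm q]) (use f x lm kill' q_lin dec[unfolded s_def] qf in \<open>unfold projection_data_def, blast\<close>)
qed

lemma proj_gen_one: "proj_gen \<one>"
proof -
  have "regular_elt R \<one>" by (simp add: regular_elt_def)
  \<comment> \<open>The quotient by 1 is zero, so the empty dual basis serves.\<close>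
  moreover have "a \<ominus> (\<Oplus>i\<in>{..<0::nat}. undefined i \<odot> undefined i) \<in> PIdl \<one>" if "a \<in> carrier R" for a
    using that by (auto simp: PIdl_mem_iff)
  ultimately show ?thesis unfolding proj_gen_def by (intro conjI exI[of _ "0::nat"]) auto
qed

text \<open>Multiplication by \<open>f\<close> embeds \<open>R/g\<close> into \<open>R/fg\<close>
  with quotient \<open>R/f\<close>. Accordingly the generators are the \<open>x i\<close> and the
  \<open>f \<otimes> z j\<close>, and the coordinates of the second kind are those of
  \<open>q a\<close>.\<close>

lemma proj_gen_mult:
  assumes f: "proj_gen f" and g: "proj_gen g"
  shows "proj_gen (f \<otimes> g)"
proof -
  obtain n x lm q where F0: "projection_data f n x lm q" by (rule proj_genE[OF f])
  note F = projection_dataD[OF F0]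
  obtain m z mu p where G0: "projection_data g m z mu p" by (rule proj_genE[OF g])
  note G = projection_dataD[OF G0]
  define X where "X i = (if i < n then x i else f \<otimes> z (i - n))" for i
  define LM where "LM i = (if i < n then lm i else (\<lambda>a. mu (i - n) (q a)))" for i
  have qc: "q a \<in> carrier R" if "a \<in> carrier R" for a using k_linear_closed[OF F(6) that] .
  have pc: "p a \<in> carrier R" if "a \<in> carrier R" for a using k_linear_closed[OF G(6) that] .
  have LMf: "k_form (LM i)" if "i < n + m" for i
  proof (cases "i < n")
    case False
    then have "k_form (mu (i - n))" using that G(4) by auto
    then have "k_form (\<lambda>a. mu (i - n) (q a))"
      by (intro k_formI) (simp_all add: k_form_closed k_form_add k_form_smult qc k_linearD[OF F(6)])
    then show ?thesis using False by (simp add: LM_def)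
  qed (simp add: LM_def F(4))
  have Xc: "X i \<in> carrier R" if "i < n + m" for i using that F G by (auto simp: X_def)
  have kill: "LM i u = \<zero>\<^bsub>k\<^esub>" if i: "i < n + m" and u: "u \<in> PIdl (f \<otimes> g)" for i u
  proof -
    obtain a where a: "a \<in> carrier R" "u = a \<otimes> (f \<otimes> g)" using u unfolding PIdl_mem_iff by blast
    then have u': "u = f \<otimes> (g \<otimes> a)" using F G by (simp add: m_ac)
    have "LM i (f \<otimes> (g \<otimes> a)) = \<zero>\<^bsub>k\<^esub>"
      \<comment> \<open>On \<open>f(ga)\<close> the coordinates for \<open>f\<close> vanish, and
        \<open>q\<close> returns \<open>ga\<close>, which the coordinates for \<open>g\<close>
        annihilate.\<close>
      using i a(1) F(2,5,8) G(2,5) by (auto simp: LM_def)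
    then show ?thesis by (simp only: u')
  qed
  have main: "a \<ominus> (\<Oplus>i\<in>{..<n + m}. LM i a \<odot> X i) \<in> PIdl (f \<otimes> g)" if a: "a \<in> carrier R" for a
  proof -
    define S where "S = (\<Oplus>i\<in>{..<n}. lm i a \<odot> x i)"
    define U where "U = (\<Oplus>j\<in>{..<m}. mu j (q a) \<odot> z j)"
    have Sc: "S \<in> carrier R" and Uc: "U \<in> carrier R"
      unfolding S_def U_def using a F G qc by (auto intro!: M.finsum_closed simp: k_form_closed)
    have "(\<Oplus>i\<in>{..<n + m}. LM i a \<odot> X i) = (\<Oplus>i\<in>{..<n}. LM i a \<odot> X i) \<oplus> (\<Oplus>j\<in>{..<m}. LM (n + j) a \<odot> X (n + j))"
      using a by (intro M.finsum_lessThan_add) (auto simp: k_form_closed[OF LMf] Xc)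
    also have "(\<Oplus>i\<in>{..<n}. LM i a \<odot> X i) = S"
      unfolding S_def using a F by (intro M.finsum_cong') (auto simp: LM_def X_def k_form_closed)
    also have "(\<Oplus>j\<in>{..<m}. LM (n + j) a \<odot> X (n + j)) = (\<Oplus>j\<in>{..<m}. f \<otimes> (mu j (q a) \<odot> z j))"
    proof (rule M.finsum_cong')
      fix j assume "j \<in> {..<m}"
      then have c: "mu j (q a) \<in> carrier k" "z j \<in> carrier R" using G a qc by (auto simp: k_form_closed)
      have "mu j (q a) \<odot> (f \<otimes> z j) = f \<otimes> (mu j (q a) \<odot> z j)"
        using c F(2) by (metis m_comm smult_assoc2 smult_closed)
      then show "LM (n + j) a \<odot> X (n + j) = f \<otimes> (mu j (q a) \<odot> z j)" by (simp add: LM_def X_def)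
    qed (use a F G qc in \<open>auto simp: k_form_closed\<close>)
    also have "\<dots> = f \<otimes> U"
      unfolding U_def using a F G qc by (intro finsum_rdistr[symmetric]) (auto simp: k_form_closed)
    finally have sum: "(\<Oplus>i\<in>{..<n + m}. LM i a \<odot> X i) = S \<oplus> f \<otimes> U" .
    define w where "w = p (q a)"
    have wc: "w \<in> carrier R" using a qc pc by (simp add: w_def)
    have "q a = U \<oplus> g \<otimes> w" using G(7)[OF qc[OF a]] by (simp add: U_def w_def)
    then have "a = S \<oplus> f \<otimes> (U \<oplus> g \<otimes> w)" using F(7)[OF a] by (simp add: S_def)
    also have "\<dots> = (f \<otimes> g \<otimes> w) \<oplus> (S \<oplus> f \<otimes> U)"
      using Sc Uc wc F G by (simp add: r_distr M.a_ac m_assoc)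
    finally have "a \<ominus> (S \<oplus> f \<otimes> U) = f \<otimes> g \<otimes> w \<oplus> (S \<oplus> f \<otimes> U) \<ominus> (S \<oplus> f \<otimes> U)" by simp
    also have "\<dots> = f \<otimes> g \<otimes> w"
    proof -
      have "S \<oplus> f \<otimes> U \<in> carrier R" "f \<otimes> g \<otimes> w \<in> carrier R" using Sc Uc F G wc by auto
      then show ?thesis unfolding a_minus_def by (simp only: M.a_assoc M.r_neg M.a_inv_closed M.r_zero)
    qed
    also have "\<dots> = w \<otimes> (f \<otimes> g)" using wc F(2) G(2) by (simp add: m_comm)
    finally show ?thesis unfolding sum PIdl_mem_iff using wc by blast
  qed
  show ?thesis
    unfolding proj_gen_def
    by (intro conjI exI[of _ "n + m"] exI[of _ X] exI[of _ LM] allI ballI impI regular_mult F(1) G(1) LMf Xc kill main)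
qed

end

section \<open>Compatible families of functionals\<close>

context multicurve
begin

text \<open>The model is \<open>\<phi> m a = res(a/(s y^m))\<close> for a fixed denominator
  \<open>s\<close>; the condition is the cancellation of \<open>y\<close>.\<close>

definition compatible :: "(nat \<Rightarrow> 'r \<Rightarrow> 'k) \<Rightarrow> bool" where
  "compatible \<phi> \<longleftrightarrow> (\<forall>m. k_form (\<phi> m)) \<and> (\<forall>m. \<forall>a\<in>carrier R. \<phi> (Suc m) (y \<otimes> a) = \<phi> m a)"

lemma compatibleD:
  assumes "compatible \<phi>"
  shows "k_form (\<phi> m)" "a \<in> carrier R \<Longrightarrow> \<phi> (Suc m) (y \<otimes> a) = \<phi> m a"
  using assms by (simp_all add: compatible_def)

lemma compatible_power:
  assumes "compatible \<phi>" "a \<in> carrier R"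
  shows "\<phi> (m + N) (yp N \<otimes> a) = \<phi> m a"
  using assms(2)
proof (induction N arbitrary: a)
  case (Suc N)
  have "yp (Suc N) \<otimes> a = y \<otimes> (yp N \<otimes> a)"
    using Suc.prems yc yp_closed by (simp add: m_ac)
  then have "\<phi> (m + Suc N) (yp (Suc N) \<otimes> a) = \<phi> (m + N) (yp N \<otimes> a)"
    using compatibleD(2)[OF assms(1), of "yp N \<otimes> a" "m + N"] Suc.prems yp_closed by simp
  then show ?case using Suc by simp
qed simp

lemma k_form_minusI: "k_form \<phi> \<Longrightarrow> k_form \<psi> \<Longrightarrow> k_form (\<lambda>a. \<phi> a \<ominus>\<^bsub>k\<^esub> \<psi> a)"
  by (rule k_formI)
    (simp_all add: k_form_closed k_form_add k_form_smult a_minus_def R.minus_add R.a_ac R.r_distr R.r_minus)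

lemma k_form_addI: "k_form \<phi> \<Longrightarrow> k_form \<psi> \<Longrightarrow> k_form (\<lambda>a. \<phi> a \<oplus>\<^bsub>k\<^esub> \<psi> a)"
  by (rule k_formI)
    (simp_all add: k_form_closed k_form_add k_form_smult R.a_ac R.r_distr)

lemma k_form_comp: "k_form \<phi> \<Longrightarrow> k_linear g \<Longrightarrow> k_form (\<lambda>a. \<phi> (g a))"
  by (rule k_formI) (simp_all add: k_form_closed k_form_add k_form_smult k_linear_closed k_linearD)

lemma smult_mult_right:
  "c \<in> carrier k \<Longrightarrow> a \<in> carrier R \<Longrightarrow> b \<in> carrier R \<Longrightarrow> a \<otimes> (c \<odot> b) = c \<odot> (a \<otimes> b)"
  using smult_assoc2[of c b a] m_comm[of a] by simp

lemma k_linear_mult: "a \<in> carrier R \<Longrightarrow> k_linear (\<lambda>x. a \<otimes> x)"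
  unfolding k_linear_def by (intro conjI ballI additive_mapI) (simp_all add: r_distr smult_mult_right)

lemma k_linear_comp: "k_linear g \<Longrightarrow> k_linear h \<Longrightarrow> k_linear (\<lambda>x. g (h x))"
  unfolding k_linear_def[of "\<lambda>x. g (h x)"]
  by (intro conjI ballI additive_mapI) (simp_all add: k_linear_closed k_linearD)

text \<open>For a compatible family, \<open>G \<phi> (Suc m) (y \<otimes> x)\<close> is
  \<open>G \<phi> m x\<close>: multiplication of the argument by \<open>y\<close> shifts the index.
  The recursion \<open>G_Suc\<close> shifts it in a second way, and the comparison of the two is
  what the trace argument exploits.\<close>

definition G :: "(nat \<Rightarrow> 'r \<Rightarrow> 'k) \<Rightarrow> nat \<Rightarrow> 'r \<Rightarrow> 'r" where
  "G \<phi> m x = series (\<lambda>n. \<phi> (n + m) x)"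

lemma G_props:
  assumes \<phi>: "\<And>m. k_form (\<phi> m)"
  shows G_closed: "x \<in> carrier R \<Longrightarrow> G \<phi> m x \<in> carrier R"
    and G_linear: "k_linear (G \<phi> m)"
    and G_Suc: "x \<in> carrier R \<Longrightarrow> G \<phi> m x = \<phi> m x \<odot> \<one> \<oplus> y \<otimes> G \<phi> (Suc m) x"
proof -
  have c: "(\<lambda>n. \<phi> (n + m) x) \<in> UNIV \<rightarrow> carrier k" if "x \<in> carrier R" for x m
    using k_form_closed[OF \<phi> that] by blast
  show closed: "x \<in> carrier R \<Longrightarrow> G \<phi> m x \<in> carrier R" for x
    unfolding G_def by (rule series(1)[OF c])
  show "k_linear (G \<phi> m)"
    unfolding k_linear_def
  proof (intro conjI ballI additive_mapI)
    show "G \<phi> m (x \<oplus> z) = G \<phi> m x \<oplus> G \<phi> m z" if "x \<in> carrier R" "z \<in> carrier R" for x z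
      using series_add[OF c c] that by (simp add: G_def k_form_add[OF \<phi>])
    show "G \<phi> m (a \<odot> x) = a \<odot> G \<phi> m x" if "a \<in> carrier k" "x \<in> carrier R" for a x
      using series_smult[OF c] that by (simp add: G_def k_form_smult[OF \<phi>])
  qed (rule closed)
  show "G \<phi> m x = \<phi> m x \<odot> \<one> \<oplus> y \<otimes> G \<phi> (Suc m) x" if "x \<in> carrier R"
    using series_Suc[OF c[OF that]] by (simp add: G_def)
qed

end

section \<open>Traces modulo a denominator and the extension of compatible families\<close>

locale projection = multicurve +
  fixes f :: 'b and n :: nat and x :: "nat \<Rightarrow> 'b" and lm :: "nat \<Rightarrow> 'b \<Rightarrow> 'a" and q :: "'b \<Rightarrow> 'b"
  assumes data: "projection_data f n x lm q"
begin

lemmas D = projection_dataD[OF data]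

text \<open>If \<open>g\<close> is \<open>k\<close>-linear and maps \<open>fR\<close> into itself,
  this is the trace of the induced endomorphism of \<open>R/f\<close>; the formula itself makes
  sense for every \<open>g\<close>.\<close>

definition tr :: "('b \<Rightarrow> 'b) \<Rightarrow> 'a" where
  "tr g = (\<Oplus>\<^bsub>k\<^esub>i\<in>{..<n}. lm i (g (x i)))"

lemma lm_closed: "i < n \<Longrightarrow> a \<in> carrier R \<Longrightarrow> lm i a \<in> carrier k"
  by (rule k_form_closed[OF D(4)])

lemma tr_cong: "(\<And>a. a \<in> carrier R \<Longrightarrow> g a = h a) \<Longrightarrow> (\<And>a. a \<in> carrier R \<Longrightarrow> h a \<in> carrier R) \<Longrightarrow> tr g = tr h"
  unfolding tr_def by (intro R.finsum_cong') (auto simp: lm_closed D(3))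

lemma tr_closed: "(\<And>a. a \<in> carrier R \<Longrightarrow> g a \<in> carrier R) \<Longrightarrow> tr g \<in> carrier k"
  unfolding tr_def by (intro R.finsum_closed) (auto simp: lm_closed D(3))

lemma tr_add:
  assumes "\<And>a. a \<in> carrier R \<Longrightarrow> g a \<in> carrier R" "\<And>a. a \<in> carrier R \<Longrightarrow> h a \<in> carrier R"
  shows "tr (\<lambda>a. g a \<oplus> h a) = tr g \<oplus>\<^bsub>k\<^esub> tr h"
proof -
  have "tr (\<lambda>a. g a \<oplus> h a) = (\<Oplus>\<^bsub>k\<^esub>i\<in>{..<n}. lm i (g (x i)) \<oplus>\<^bsub>k\<^esub> lm i (h (x i)))"
    unfolding tr_def using assms by (intro R.finsum_cong') (auto simp: lm_closed D(3) k_form_add[OF D(4)])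
  also have "\<dots> = tr g \<oplus>\<^bsub>k\<^esub> tr h"
    unfolding tr_def using assms by (intro R.finsum_addf) (auto simp: lm_closed D(3))
  finally show ?thesis .
qed

lemma tr_smult:
  assumes "\<And>a. a \<in> carrier R \<Longrightarrow> g a \<in> carrier R" "c \<in> carrier k"
  shows "tr (\<lambda>a. c \<odot> g a) = c \<otimes>\<^bsub>k\<^esub> tr g"
proof -
  have "tr (\<lambda>a. c \<odot> g a) = (\<Oplus>\<^bsub>k\<^esub>i\<in>{..<n}. c \<otimes>\<^bsub>k\<^esub> lm i (g (x i)))"
    unfolding tr_def using assms by (intro R.finsum_cong') (auto simp: lm_closed D(3) k_form_smult[OF D(4)])
  also have "\<dots> = c \<otimes>\<^bsub>k\<^esub> tr g"
    unfolding tr_def using assms by (intro R.finsum_rdistr[symmetric]) (auto simp: lm_closed D(3))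
  finally show ?thesis .
qed

lemma form_expand:
  assumes \<psi>: "k_form \<psi>" "\<And>a. a \<in> carrier R \<Longrightarrow> \<psi> (f \<otimes> a) = \<zero>\<^bsub>k\<^esub>" and b: "b \<in> carrier R"
  shows "\<psi> b = (\<Oplus>\<^bsub>k\<^esub>j\<in>{..<n}. lm j b \<otimes>\<^bsub>k\<^esub> \<psi> (x j))"
proof -
  have add: "additive_map R k \<psi>" using \<psi> by (simp add: k_form_def)
  have qb: "q b \<in> carrier R" by (rule k_linear_closed[OF D(6) b])
  have sc: "(\<lambda>j. lm j b \<odot> x j) \<in> {..<n} \<rightarrow> carrier R" using b by (auto simp: lm_closed D(3))
  have "\<psi> b = \<psi> ((\<Oplus>j\<in>{..<n}. lm j b \<odot> x j) \<oplus> f \<otimes> q b)"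
    by (rule arg_cong[OF D(7)[OF b]])
  also have "\<dots> = \<psi> (\<Oplus>j\<in>{..<n}. lm j b \<odot> x j)"
    using M.finsum_closed[OF sc] qb D(2) by (simp add: k_form_add[OF \<psi>(1)] \<psi>(2) k_form_closed[OF \<psi>(1)])
  also have "\<dots> = (\<Oplus>\<^bsub>k\<^esub>j\<in>{..<n}. \<psi> (lm j b \<odot> x j))"
    by (rule additive_map_finsum[OF M.abelian_group_axioms R.abelian_group_axioms add sc])
  also have "\<dots> = (\<Oplus>\<^bsub>k\<^esub>j\<in>{..<n}. lm j b \<otimes>\<^bsub>k\<^esub> \<psi> (x j))"
    using b by (intro R.finsum_cong') (auto simp: lm_closed D(3) k_form_smult[OF \<psi>(1)] k_form_closed[OF \<psi>(1)])
  finally show ?thesis .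
qed

text \<open>Expanding \<open>b\<close> in the dual basis and applying \<open>\<psi>\<close> gives
  the same sum as the diagonal coefficients of the rank one map.\<close>

lemma tr_rank_one:
  assumes \<psi>: "k_form \<psi>" "\<And>a. a \<in> carrier R \<Longrightarrow> \<psi> (f \<otimes> a) = \<zero>\<^bsub>k\<^esub>" and b: "b \<in> carrier R"
  shows "tr (\<lambda>a. \<psi> a \<odot> b) = \<psi> b"
proof -
  have "tr (\<lambda>a. \<psi> a \<odot> b) = (\<Oplus>\<^bsub>k\<^esub>j\<in>{..<n}. lm j b \<otimes>\<^bsub>k\<^esub> \<psi> (x j))"
    unfolding tr_def using b
    by (intro R.finsum_cong') (auto simp: k_form_smult[OF D(4)] lm_closed k_form_closed[OF \<psi>(1)] D(3) R.m_comm)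
  then show ?thesis by (simp only: form_expand[OF assms, symmetric])
qed

lemma tr_comp:
  assumes g: "k_linear g" and h: "k_linear h" and gf: "\<And>a. a \<in> carrier R \<Longrightarrow> \<exists>b\<in>carrier R. g (f \<otimes> a) = f \<otimes> b"
  shows "tr (\<lambda>a. g (h a)) = (\<Oplus>\<^bsub>k\<^esub>i\<in>{..<n}. \<Oplus>\<^bsub>k\<^esub>j\<in>{..<n}. lm j (h (x i)) \<otimes>\<^bsub>k\<^esub> lm i (g (x j)))"
proof -
  note gc = k_linear_closed[OF g] and hc = k_linear_closed[OF h]
  show ?thesis
    unfolding tr_def
  proof (rule R.finsum_cong')
    fix i assume "i \<in> {..<n}"
    then have i: "i < n" by simp
    have "lm i (g (f \<otimes> a)) = \<zero>\<^bsub>k\<^esub>" if "a \<in> carrier R" for a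
      using gf[OF that] D(5)[OF i] by auto
    then show "lm i (g (h (x i))) = (\<Oplus>\<^bsub>k\<^esub>j\<in>{..<n}. lm j (h (x i)) \<otimes>\<^bsub>k\<^esub> lm i (g (x j)))"
      using form_expand[OF k_form_comp[OF D(4)[OF i] g], of "h (x i)"] hc D(3)[OF i] by simp
  qed (auto intro!: R.finsum_closed simp: lm_closed gc hc D(3))
qed

text \<open>Both traces are the double sum of \<open>tr_comp\<close>, with the two indices
  exchanged. That the maps preserve \<open>fR\<close> is what lets their coefficients be composed
  modulo \<open>f\<close>.\<close>

lemma tr_commute:
  assumes g: "k_linear g" and h: "k_linear h"
    and gf: "\<And>a. a \<in> carrier R \<Longrightarrow> \<exists>b\<in>carrier R. g (f \<otimes> a) = f \<otimes> b"
    and hf: "\<And>a. a \<in> carrier R \<Longrightarrow> \<exists>b\<in>carrier R. h (f \<otimes> a) = f \<otimes> b"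
  shows "tr (\<lambda>a. g (h a)) = tr (\<lambda>a. h (g a))"
proof -
  note gc = k_linear_closed[OF g] and hc = k_linear_closed[OF h]
  have "tr (\<lambda>a. g (h a)) = (\<Oplus>\<^bsub>k\<^esub>i\<in>{..<n}. \<Oplus>\<^bsub>k\<^esub>j\<in>{..<n}. lm j (h (x i)) \<otimes>\<^bsub>k\<^esub> lm i (g (x j)))"
    by (rule tr_comp[OF g h gf])
  also have "\<dots> = (\<Oplus>\<^bsub>k\<^esub>j\<in>{..<n}. \<Oplus>\<^bsub>k\<^esub>i\<in>{..<n}. lm j (h (x i)) \<otimes>\<^bsub>k\<^esub> lm i (g (x j)))"
    by (rule R.finsum_swap) (simp_all add: lm_closed gc hc D(3))
  also have "\<dots> = (\<Oplus>\<^bsub>k\<^esub>j\<in>{..<n}. \<Oplus>\<^bsub>k\<^esub>i\<in>{..<n}. lm i (g (x j)) \<otimes>\<^bsub>k\<^esub> lm j (h (x i)))"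
    by (intro R.finsum_cong' R.finsum_closed refl Pi_I) (auto simp: lm_closed gc hc D(3) R.m_comm intro!: R.finsum_closed)
  also have "\<dots> = tr (\<lambda>a. h (g a))" by (rule tr_comp[OF h g hf, symmetric])
  finally show ?thesis .
qed

text \<open>By \<open>G_Suc\<close> the operator is a rank one map plus the operator on the right.
  The identity serves twice: for families that vanish on \<open>fR\<close> and are compatible, and
  for the defect \<open>\<kappa>\<close> in \<open>compatible_extend\<close>.\<close>

lemma tr_G:
  assumes \<phi>: "\<And>m. k_form (\<phi> m)" "\<And>m a. a \<in> carrier R \<Longrightarrow> \<phi> m (f \<otimes> a) = \<zero>\<^bsub>k\<^esub>" and b: "b \<in> carrier R"
  shows "tr (\<lambda>a. b \<otimes> G \<phi> m a) = \<phi> m b \<oplus>\<^bsub>k\<^esub> tr (\<lambda>a. (y \<otimes> b) \<otimes> G \<phi> (Suc m) a)"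
proof -
  note Gc = G_closed[of \<phi>, OF \<phi>(1)] and fc = k_form_closed[OF \<phi>(1)]
  have e: "b \<otimes> G \<phi> m a = \<phi> m a \<odot> b \<oplus> (y \<otimes> b) \<otimes> G \<phi> (Suc m) a" if a: "a \<in> carrier R" for a
  proof -
    have "b \<otimes> (\<phi> m a \<odot> \<one>) = \<phi> m a \<odot> b" using a b fc by (simp add: smult_mult_right)
    moreover have "b \<otimes> (y \<otimes> G \<phi> (Suc m) a) = (y \<otimes> b) \<otimes> G \<phi> (Suc m) a"
      using a b yc Gc by (simp add: m_ac)
    ultimately show ?thesis using a b fc Gc yc G_Suc[of \<phi>, OF \<phi>(1) a, of m] by (simp add: r_distr)
  qed
  have "tr (\<lambda>a. b \<otimes> G \<phi> m a) = tr (\<lambda>a. \<phi> m a \<odot> b \<oplus> (y \<otimes> b) \<otimes> G \<phi> (Suc m) a)"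
    by (rule tr_cong[OF e]) (use b fc Gc yc in auto)
  also have "\<dots> = tr (\<lambda>a. \<phi> m a \<odot> b) \<oplus>\<^bsub>k\<^esub> tr (\<lambda>a. (y \<otimes> b) \<otimes> G \<phi> (Suc m) a)"
    by (rule tr_add) (use b fc Gc yc in auto)
  also have "tr (\<lambda>a. \<phi> m a \<odot> b) = \<phi> m b" by (rule tr_rank_one[OF \<phi> b])
  finally show ?thesis .
qed

text \<open>With \<open>g = b G (Suc m)\<close> and \<open>Y\<close> the multiplication by
  \<open>y\<close>, compatibility gives \<open>g \<circ> Y = b G m\<close>, while
  \<open>Y \<circ> g = y b G (Suc m)\<close>. The traces agree by \<open>tr_commute\<close> and
  differ by \<open>\<phi> m b\<close> according to \<open>tr_G\<close>.\<close>

lemma compatible_zero: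
  assumes \<phi>: "compatible \<phi>" and zero: "\<And>m a. a \<in> carrier R \<Longrightarrow> \<phi> m (f \<otimes> a) = \<zero>\<^bsub>k\<^esub>" and b: "b \<in> carrier R"
  shows "\<phi> m b = \<zero>\<^bsub>k\<^esub>"
proof -
  note kf = compatibleD(1)[OF \<phi>]
  note Gc = G_closed[of \<phi>, OF kf] and fc = k_form_closed[OF kf]
  define g where "g a = b \<otimes> G \<phi> (Suc m) a" for a
  define Y where "Y a = y \<otimes> a" for a
  have g: "k_linear g" unfolding g_def by (rule k_linear_comp[OF k_linear_mult[OF b] G_linear[of \<phi>, OF kf]])
  have Y: "k_linear Y" unfolding Y_def by (rule k_linear_mult[OF yc])
  \<comment> \<open>All coefficients vanish on \<open>fR\<close>; the zero series is written as a
    multiple of \<open>f\<close>, which is the form that \<open>tr_commute\<close> requires.\<close>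
  have "G \<phi> (Suc m) (f \<otimes> a) = f \<otimes> \<zero>" if "a \<in> carrier R" for a
    using that D(2) by (simp add: G_def zero series_zero)
  then have gf: "\<exists>c\<in>carrier R. g (f \<otimes> a) = f \<otimes> c" if "a \<in> carrier R" for a
    using that b D(2) unfolding g_def by (intro bexI[of _ "\<zero>"]) auto
  have Yf: "\<exists>c\<in>carrier R. Y (f \<otimes> a) = f \<otimes> c" if "a \<in> carrier R" for a
    unfolding Y_def using that D(2) yc by (intro bexI[of _ "y \<otimes> a"]) (simp_all add: m_ac)
  have "tr (\<lambda>a. b \<otimes> G \<phi> m a) = tr (\<lambda>a. g (Y a))"
    by (rule tr_cong) (use b yc Gc in \<open>simp_all add: g_def Y_def G_def compatibleD(2)[OF \<phi>]\<close>)
  also have "\<dots> = tr (\<lambda>a. Y (g a))" by (rule tr_commute[OF g Y gf Yf])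
  also have "\<dots> = tr (\<lambda>a. (y \<otimes> b) \<otimes> G \<phi> (Suc m) a)"
    by (rule tr_cong) (use b yc Gc in \<open>simp_all add: g_def Y_def m_assoc\<close>)
  finally have *: "tr (\<lambda>a. (y \<otimes> b) \<otimes> G \<phi> (Suc m) a) = \<phi> m b \<oplus>\<^bsub>k\<^esub> tr (\<lambda>a. (y \<otimes> b) \<otimes> G \<phi> (Suc m) a)"
    using tr_G[OF kf zero b] by simp
  have "tr (\<lambda>a. (y \<otimes> b) \<otimes> G \<phi> (Suc m) a) \<in> carrier k" by (rule tr_closed) (use b yc Gc in auto)
  then show ?thesis using * fc[OF b, of m] R.add.r_cancel_one' by metis
qed

lemma compatible_unique:
  assumes \<phi>: "compatible \<phi>" and \<psi>: "compatible \<psi>"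
    and eq: "\<And>m a. a \<in> carrier R \<Longrightarrow> \<phi> m (f \<otimes> a) = \<psi> m (f \<otimes> a)" and b: "b \<in> carrier R"
  shows "\<phi> m b = \<psi> m b"
proof -
  note fc = k_form_closed[OF compatibleD(1)[OF \<phi>]] k_form_closed[OF compatibleD(1)[OF \<psi>]]
  have "compatible (\<lambda>m a. \<phi> m a \<ominus>\<^bsub>k\<^esub> \<psi> m a)"
    unfolding compatible_def by (intro conjI allI ballI k_form_minusI compatibleD(1)[OF \<phi>] compatibleD(1)[OF \<psi>])
      (simp add: compatibleD(2)[OF \<phi>] compatibleD(2)[OF \<psi>])
  then have "\<phi> m b \<ominus>\<^bsub>k\<^esub> \<psi> m b = \<zero>\<^bsub>k\<^esub>"
    by (rule compatible_zero[OF _ _ b]) (use fc D(2) in \<open>simp add: eq a_minus_def R.r_neg\<close>)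
  then show ?thesis using R.minus_eq_zero_iff fc b by blast
qed

text \<open>The functionals \<open>\<rho> m \<circ> q\<close> have the right values on
  \<open>fR\<close> but need not be compatible. Their defect \<open>\<kappa>\<close> vanishes on
  \<open>fR\<close>, and by \<open>tr_G\<close> the trace \<open>\<theta>\<close> has the opposite
  defect, so the sum is compatible.\<close>

lemma compatible_extend:
  assumes \<rho>: "compatible \<rho>"
  shows "\<exists>\<Phi>. compatible \<Phi> \<and> (\<forall>m. \<forall>a\<in>carrier R. \<Phi> m (f \<otimes> a) = \<rho> m a)"
proof -
  note kf = compatibleD(1)[OF \<rho>]
  note qc = k_linear_closed[OF D(6)] and fc = k_form_closed[OF kf]
  define \<kappa> where "\<kappa> m a = \<rho> (Suc m) (q (y \<otimes> a)) \<ominus>\<^bsub>k\<^esub> \<rho> m (q a)" for m a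
  have kap: "k_form (\<kappa> m)" for m
    unfolding \<kappa>_def
    by (intro k_form_minusI k_form_comp[OF kf] k_linear_comp[OF D(6)] k_linear_mult yc D(6))
  have kap0: "\<kappa> m (f \<otimes> a) = \<zero>\<^bsub>k\<^esub>" if a: "a \<in> carrier R" for m a
  proof -
    have "y \<otimes> (f \<otimes> a) = f \<otimes> (y \<otimes> a)" using a yc D(2) by (simp add: m_ac)
    then show ?thesis
      using a yc fc[OF a, of m] by (simp add: \<kappa>_def D(8) compatibleD(2)[OF \<rho>] a_minus_def R.r_neg)
  qed
  note Gc = G_closed[of \<kappa>, OF kap]
  define \<theta> where "\<theta> m b = tr (\<lambda>a. b \<otimes> G \<kappa> m a)" for m b
  have th: "k_form (\<theta> m)" for m
  proof (rule k_formI)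
    show "\<theta> m b \<in> carrier k" if "b \<in> carrier R" for b unfolding \<theta>_def by (rule tr_closed) (use that Gc in auto)
    show "\<theta> m (b \<oplus> c) = \<theta> m b \<oplus>\<^bsub>k\<^esub> \<theta> m c" if *: "b \<in> carrier R" "c \<in> carrier R" for b c
    proof -
      have "\<theta> m (b \<oplus> c) = tr (\<lambda>a. b \<otimes> G \<kappa> m a \<oplus> c \<otimes> G \<kappa> m a)"
        unfolding \<theta>_def by (rule tr_cong) (use * Gc in \<open>simp_all add: l_distr\<close>)
      also have "\<dots> = \<theta> m b \<oplus>\<^bsub>k\<^esub> \<theta> m c" unfolding \<theta>_def by (rule tr_add) (use * Gc in auto)
      finally show ?thesis .
    qed
    show "\<theta> m (c \<odot> b) = c \<otimes>\<^bsub>k\<^esub> \<theta> m b" if *: "c \<in> carrier k" "b \<in> carrier R" for b c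
    proof -
      have "\<theta> m (c \<odot> b) = tr (\<lambda>a. c \<odot> (b \<otimes> G \<kappa> m a))"
        unfolding \<theta>_def by (rule tr_cong) (use * Gc in \<open>simp_all add: smult_assoc2\<close>)
      also have "\<dots> = c \<otimes>\<^bsub>k\<^esub> \<theta> m b" unfolding \<theta>_def by (rule tr_smult) (use * Gc in auto)
      finally show ?thesis .
    qed
  qed
  note thc = k_form_closed[OF th]
  have step: "\<theta> m b = \<kappa> m b \<oplus>\<^bsub>k\<^esub> \<theta> (Suc m) (y \<otimes> b)" if "b \<in> carrier R" for m b
    unfolding \<theta>_def by (rule tr_G[OF kap kap0 that])
  \<comment> \<open>A factor \<open>f\<close> in front of the series is killed by every coordinate
    functional, so the correction does not disturb the values on \<open>fR\<close>.\<close>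
  have th0: "\<theta> m (f \<otimes> a) = \<zero>\<^bsub>k\<^esub>" if a: "a \<in> carrier R" for m a
  proof -
    have "lm i ((f \<otimes> a) \<otimes> G \<kappa> m (x i)) = \<zero>\<^bsub>k\<^esub>" if i: "i < n" for i
      using D(5)[OF i, of "a \<otimes> G \<kappa> m (x i)"] a D(2) D(3)[OF i] Gc by (simp add: m_assoc)
    then have "\<theta> m (f \<otimes> a) = (\<Oplus>\<^bsub>k\<^esub>i\<in>{..<n}. \<zero>\<^bsub>k\<^esub>)"
      unfolding \<theta>_def tr_def by (intro R.finsum_cong') auto
    then show ?thesis by simp
  qed
  define \<Phi> where "\<Phi> m a = \<rho> m (q a) \<oplus>\<^bsub>k\<^esub> \<theta> m a" for m a
  have "compatible \<Phi>"
    unfolding compatible_def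
  proof (intro conjI allI ballI)
    show "k_form (\<Phi> m)" for m
      unfolding \<Phi>_def by (intro k_form_addI k_form_comp[OF kf] D(6) th)
    fix m a assume a: "a \<in> carrier R"
    have ya: "y \<otimes> a \<in> carrier R" using a yc by simp
    define u v w where "u = \<rho> (Suc m) (q (y \<otimes> a))" and "v = \<rho> m (q a)" and "w = \<theta> (Suc m) (y \<otimes> a)"
    have c: "u \<in> carrier k" "v \<in> carrier k" "w \<in> carrier k"
      using a ya fc qc thc by (simp_all add: u_def v_def w_def)
    have "\<Phi> m a = v \<oplus>\<^bsub>k\<^esub> ((u \<ominus>\<^bsub>k\<^esub> v) \<oplus>\<^bsub>k\<^esub> w)"
      by (simp only: \<Phi>_def step[OF a] \<kappa>_def u_def v_def w_def)
    also have "\<dots> = (v \<oplus>\<^bsub>k\<^esub> (u \<ominus>\<^bsub>k\<^esub> v)) \<oplus>\<^bsub>k\<^esub> w" using c by (simp add: R.a_assoc)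
    also have "\<dots> = u \<oplus>\<^bsub>k\<^esub> w" using R.add_minus_cancel[OF c(2,1)] by simp
    finally show "\<Phi> (Suc m) (y \<otimes> a) = \<Phi> m a" by (simp add: \<Phi>_def u_def w_def)
  qed
  moreover have "\<Phi> m (f \<otimes> a) = \<rho> m a" if "a \<in> carrier R" for m a
    using that fc[OF that, of m] by (simp add: \<Phi>_def th0 D(8))
  ultimately show ?thesis by blast
qed

end

section \<open>The residue map\<close>

context multicurve
begin

interpretation Fr: regular_fractions R "divisorial k R" by (rule regular_fractions)

text \<open>A dual basis of the quotient is pulled back to \<open>R\<close>. The ideal need not be
  open, so the quotient algebra is taken directly and not through \<open>OI_quot\<close>.\<close>

lemma divisorial_proj_gen:
  assumes "f \<in> divisorial k R"
  shows "proj_gen f"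
proof -
  have f: "regular_elt R f" "fin_projective k (quot R (PIdl f))" using assms by (simp_all add: divisorial_def)
  have fc: "f \<in> carrier R" using f by (simp add: regular_elt_def)
  define I where "I = PIdl f"
  interpret I: quotient_algebra k R I
    unfolding I_def by (intro quotient_algebra.intro algebra_axioms cgenideal_ideal fc)
  have mod: "Module.module k (quot R I)" by (rule algebra.module[OF I.algebra_quot])
  interpret B: Module.module k "quot R I" by (rule mod)
  obtain n \<phi> X where \<phi>: "\<And>i. i < (n::nat) \<Longrightarrow> \<phi> i \<in> lin_maps k (quot R I) (self_module k)"
    and X: "\<And>i. i < n \<Longrightarrow> X i \<in> carrier (quot R I)"
    and basis: "\<And>b. b \<in> carrier (quot R I) \<Longrightarrow> b = (\<Oplus>\<^bsub>quot R I\<^esub>i\<in>{..<n}. \<phi> i b \<odot>\<^bsub>quot R I\<^esub> X i)"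
    using fin_projective_dual_basis[OF mod f(2)[folded I_def]] by blast
  have "\<exists>z\<in>carrier R. X i = I +> z" if "i < n" for i
    using X[OF that] by (auto simp: I.quot_carrier)
  then obtain z where z: "\<And>i. i < n \<Longrightarrow> z i \<in> carrier R" "\<And>i. i < n \<Longrightarrow> X i = I +> z i" by metis
  define lm where "lm i a = \<phi> i (I +> a)" for i a
  have lm: "k_form (lm i)" if i: "i < n" for i
  proof (rule k_formI)
    show "lm i a \<in> carrier k" if "a \<in> carrier R" for a
      using \<phi>[OF i] I.coset_mem_carrier[OF that] by (auto simp: lm_def lin_maps_def self_module_def)
    show "lm i (a \<oplus> b) = lm i a \<oplus>\<^bsub>k\<^esub> lm i b" if "a \<in> carrier R" "b \<in> carrier R" for a b
      using \<phi>[OF i] that by (simp add: lm_def I.coset_add[symmetric] I.coset_mem_carrier lin_maps_def self_module_def)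
    show "lm i (c \<odot> a) = c \<otimes>\<^bsub>k\<^esub> lm i a" if "c \<in> carrier k" "a \<in> carrier R" for a c
      using \<phi>[OF i] that by (simp add: lm_def I.coset_smult[symmetric] I.coset_mem_carrier lin_maps_def self_module_def)
  qed
  have kill: "lm i w = \<zero>\<^bsub>k\<^esub>" if i: "i < n" and w: "w \<in> PIdl f" for i w
  proof -
    have wc: "w \<in> carrier R" using w fc unfolding PIdl_mem_iff by auto
    have "I +> w = I +> \<zero>"
      using w[folded I_def] by (simp only: I.coset_zero I.coset_eq_zero_iff[OF wc])
    then have "lm i w = lm i \<zero>" by (simp add: lm_def)
    also have "\<dots> = \<zero>\<^bsub>k\<^esub>"
      using additive_map_zero[OF M.abelian_group_axioms R.abelian_group_axioms, of "lm i"] lm[OF i] by (simp add: k_form_def)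
    finally show ?thesis .
  qed
  have main: "a \<ominus> (\<Oplus>i\<in>{..<n}. lm i a \<odot> z i) \<in> PIdl f" if a: "a \<in> carrier R" for a
  proof -
    have c: "(\<lambda>i. lm i a \<odot> z i) \<in> {..<n} \<rightarrow> carrier R" using k_form_closed[OF lm a] z by auto
    have add: "additive_map R (quot R I) (\<lambda>a. I +> a)"
      by (rule additive_mapI) (simp_all add: I.coset_mem_carrier I.coset_add)
    have "I +> (\<Oplus>i\<in>{..<n}. lm i a \<odot> z i) = (\<Oplus>\<^bsub>quot R I\<^esub>i\<in>{..<n}. I +> (lm i a \<odot> z i))"
      by (rule additive_map_finsum[OF M.abelian_group_axioms I.abelian_group_quot add c])
    also have "\<dots> = (\<Oplus>\<^bsub>quot R I\<^esub>i\<in>{..<n}. \<phi> i (I +> a) \<odot>\<^bsub>quot R I\<^esub> X i)"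
    proof (rule B.M.finsum_cong')
      fix i assume "i \<in> {..<n}"
      then have i: "i < n" by simp
      have l: "lm i a \<in> carrier k" by (rule k_form_closed[OF lm[OF i] a])
      show "I +> (lm i a \<odot> z i) = \<phi> i (I +> a) \<odot>\<^bsub>quot R I\<^esub> X i"
        using I.coset_smult[OF l z(1)[OF i]] z(2)[OF i] by (simp add: lm_def)
    next
      show "(\<lambda>i. \<phi> i (I +> a) \<odot>\<^bsub>quot R I\<^esub> X i) \<in> {..<n} \<rightarrow> carrier (quot R I)"
        using k_form_closed[OF lm a] X by (auto simp: lm_def)
    qed simp
    also have "\<dots> = I +> a" by (rule basis[OF I.coset_mem_carrier[OF a], symmetric])
    finally have "I +> a = I +> (\<Oplus>i\<in>{..<n}. lm i a \<odot> z i)" by simp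
    then show ?thesis using I.coset_eq_iff[OF a M.finsum_closed[OF c]] by (simp add: I_def)
  qed
  show ?thesis
    unfolding proj_gen_def
    by (intro conjI exI[of _ n] exI[of _ z] exI[of _ lm] allI ballI impI f(1) lm z(1) kill main)
qed

text \<open>Denominators are products of divisorial elements, so projectivity has to pass to
  products; this is the purpose of \<open>proj_gen_mult\<close>.\<close>

lemma denominator_proj_gen: "s \<in> Fr.S' \<Longrightarrow> proj_gen s"
proof (induction rule: mult_closure.induct)
  case one
  then show ?case by (rule proj_gen_one)
next
  case (mult s t)
  then show ?case using divisorial_proj_gen proj_gen_mult by blast
qed

lemma denominator_unique:
  assumes s: "s \<in> Fr.S'" and "compatible \<phi>" "compatible \<psi>"
    and "\<And>m a. a \<in> carrier R \<Longrightarrow> \<phi> m (s \<otimes> a) = \<psi> m (s \<otimes> a)" and "b \<in> carrier R"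
  shows "\<phi> m b = \<psi> m b"
proof -
  obtain n x lm q where "projection_data s n x lm q" by (rule proj_genE[OF denominator_proj_gen[OF s]])
  then interpret projection k R T y d s n x lm q
    by (intro projection.intro multicurve_axioms projection_axioms.intro)
  show ?thesis by (rule compatible_unique[OF assms(2-5)])
qed

text \<open>The residue that duality prescribes for \<open>(x/f) \<otimes> \<alpha>\<close>: the
  value at 1 of the functional with numerator \<open>x\<close>.\<close>

definition local_residue :: "'r \<Rightarrow> 'r \<Rightarrow> 'k" where
  "local_residue f x = (SOME \<psi>. \<psi> \<in> Dl (PIdl f) \<and> dual_coeff f \<psi> = PIdl f +> x) \<one>\<^bsub>quot R (PIdl f)\<^esub>"

lemma local_residue_eq:
  assumes f: "divisor_gen f" and \<psi>: "\<psi> \<in> Dl (PIdl f)" "dual_coeff f \<psi> = PIdl f +> x"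
  shows "local_residue f x = \<psi> \<one>\<^bsub>quot R (PIdl f)\<^esub>"
proof -
  have "(SOME \<psi>. \<psi> \<in> Dl (PIdl f) \<and> dual_coeff f \<psi> = PIdl f +> x) = \<psi>"
  proof (rule some_equality)
    fix \<psi>' assume "\<psi>' \<in> Dl (PIdl f) \<and> dual_coeff f \<psi>' = PIdl f +> x"
    then show "\<psi>' = \<psi>" using bij_betw_imp_inj_on[OF dual_coeff_props(2)[OF f]] \<psi> unfolding inj_on_def by simp
  qed (use \<psi> in simp)
  then show ?thesis by (simp add: local_residue_def)
qed

lemma local_residue_functional:
  assumes f: "divisor_gen f" and x: "x \<in> carrier R"
  obtains \<psi> where "\<psi> \<in> Dl (PIdl f)" "dual_coeff f \<psi> = PIdl f +> x" "local_residue f x = \<psi> \<one>\<^bsub>quot R (PIdl f)\<^esub>"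
proof -
  interpret I: quotient_algebra k R "PIdl f" by (rule OI_quot[OF divisor_genD(3)[OF f]])
  have "PIdl f +> x \<in> dual_coeff f ` Dl (PIdl f)"
    using bij_betw_imp_surj_on[OF dual_coeff_props(2)[OF f]] I.coset_mem_carrier[OF x] by simp
  then obtain \<psi> where \<psi>: "PIdl f +> x = dual_coeff f \<psi>" "\<psi> \<in> Dl (PIdl f)" by (rule imageE)
  show ?thesis by (rule that[OF \<psi>(2) \<psi>(1)[symmetric] local_residue_eq[OF f \<psi>(2) \<psi>(1)[symmetric]]])
qed

text \<open>For the generator \<epsilon> of the dual, the value of \<open>\<psi>\<close> at 1 is the
  value of \<epsilon> at \<open>dual_coeff f \<psi>\<close>. Hence the local residue is \<epsilon>
  after reduction modulo \<open>f\<close>.\<close>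

lemma local_residue_k_form:
  assumes f: "divisor_gen f"
  shows "k_form (local_residue f)"
proof -
  interpret I: quotient_algebra k R "PIdl f" by (rule OI_quot[OF divisor_genD(3)[OF f]])
  interpret B: cring "quot R (PIdl f)" by (rule I.cring_quot)
  obtain \<epsilon> where \<epsilon>: "\<epsilon> \<in> Dl (PIdl f)"
    "\<And>b. b \<in> carrier (quot R (PIdl f)) \<Longrightarrow> dual_coeff f (\<lambda>X\<in>carrier (quot R (PIdl f)). \<epsilon> (b \<otimes>\<^bsub>quot R (PIdl f)\<^esub> X)) = b"
    "\<And>\<psi> X. \<psi> \<in> Dl (PIdl f) \<Longrightarrow> X \<in> carrier (quot R (PIdl f)) \<Longrightarrow> \<psi> X = \<epsilon> (dual_coeff f \<psi> \<otimes>\<^bsub>quot R (PIdl f)\<^esub> X)"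
    using ex_generator[OF f] by blast
  have eq: "local_residue f x = \<epsilon> (PIdl f +> x)" if x: "x \<in> carrier R" for x
  proof -
    obtain \<psi> where \<psi>: "\<psi> \<in> Dl (PIdl f)" "dual_coeff f \<psi> = PIdl f +> x" "local_residue f x = \<psi> \<one>\<^bsub>quot R (PIdl f)\<^esub>"
      by (rule local_residue_functional[OF f x])
    then show ?thesis using \<epsilon>(3)[OF \<psi>(1) B.one_closed] I.coset_mem_carrier[OF x] by simp
  qed
  show ?thesis
  proof (rule k_formI)
    show "local_residue f a \<in> carrier k" if "a \<in> carrier R" for a
      using \<epsilon>(1) that by (auto simp: eq I.coset_mem_carrier lin_maps_def self_module_def)
    show "local_residue f (a \<oplus> b) = local_residue f a \<oplus>\<^bsub>k\<^esub> local_residue f b" if "a \<in> carrier R" "b \<in> carrier R" for a b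
      using \<epsilon>(1) that by (simp add: eq I.coset_add[symmetric] I.coset_mem_carrier lin_maps_def self_module_def)
    show "local_residue f (c \<odot> a) = c \<otimes>\<^bsub>k\<^esub> local_residue f a" if "c \<in> carrier k" "a \<in> carrier R" for a c
      using \<epsilon>(1) that by (simp add: eq I.coset_smult[symmetric] I.coset_mem_carrier lin_maps_def self_module_def)
  qed
qed

text \<open>The fractions \<open>hx/(fh)\<close> and \<open>x/f\<close> agree. By
  \<open>duality_natural\<close> the functional for \<open>f\<close>, pulled back to the quotient by
  \<open>fh\<close>, has this polar class, and its value at 1 is unchanged.\<close>

lemma local_residue_mult:
  assumes f: "divisor_gen f" and g: "divisor_gen (f \<otimes> h)" and h: "h \<in> carrier R" and x: "x \<in> carrier R"
  shows "local_residue (f \<otimes> h) (h \<otimes> x) = local_residue f x"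
proof -
  let ?g = "f \<otimes> h"
  note fD = divisor_genD[OF f] and gD = divisor_genD[OF g]
  have sub: "PIdl ?g \<subseteq> PIdl f"
  proof
    fix z assume "z \<in> PIdl ?g"
    then obtain a where a: "a \<in> carrier R" "z = a \<otimes> ?g" unfolding PIdl_mem_iff by blast
    then have "z = (a \<otimes> h) \<otimes> f" using h fD by (simp add: m_ac)
    then show "z \<in> PIdl f" unfolding PIdl_mem_iff using a h by blast
  qed
  interpret I: quotient_algebra k R "PIdl f" by (rule OI_quot[OF fD(3)])
  interpret J: quotient_algebra k R "PIdl ?g" by (rule OI_quot[OF gD(3)])
  obtain \<psi> where \<psi>: "\<psi> \<in> Dl (PIdl f)" "dual_coeff f \<psi> = PIdl f +> x" "local_residue f x = \<psi> \<one>\<^bsub>quot R (PIdl f)\<^esub>"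
    by (rule local_residue_functional[OF f x])
  define \<psi>' where "\<psi>' = (\<lambda>X\<in>carrier (quot R (PIdl ?g)). \<psi> (PIdl f <+>\<^bsub>R\<^esub> X))"
  note nat = duality_natural(1,3)[OF f g sub \<psi>(1), folded \<psi>'_def]
  have hx: "h \<otimes> x \<in> carrier R" using h x by simp
  have "mf (h \<otimes> x) ?g = mf x f"
    using x h fD divisor_gen_denominator[OF f] divisor_gen_denominator[OF g] by (simp add: Fr.fr_eq_iff m_ac)
  then have "polar_class ?g (PIdl ?g +> (h \<otimes> x)) = polar_class f (PIdl f +> x)"
    by (simp add: polar_class_coset[OF f x] polar_class_coset[OF g hx]) (simp add: a_r_coset_def' inv_id_simps)
  then have "polar_class ?g (dual_coeff ?g \<psi>') = polar_class ?g (PIdl ?g +> (h \<otimes> x))" using nat(2) \<psi>(2) by simp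
  then have "dual_coeff ?g \<psi>' = PIdl ?g +> (h \<otimes> x)"
    using inj_onD[OF bij_betw_imp_inj_on[OF polar_class_props(2)[OF g]] _ dual_coeff_closed[OF g nat(1)] J.coset_mem_carrier[OF hx]] by blast
  then have "local_residue ?g (h \<otimes> x) = \<psi>' \<one>\<^bsub>quot R (PIdl ?g)\<^esub>" by (rule local_residue_eq[OF g nat(1)])
  also have "\<dots> = \<psi>' (PIdl ?g +> \<one>)" by (simp only: J.coset_one)
  also have "\<dots> = \<psi> (PIdl f +> \<one>)"
    using set_add_coset[OF gD(3) fD(3) sub] J.coset_mem_carrier by (simp add: \<psi>'_def)
  also have "\<dots> = local_residue f x" by (simp only: I.coset_one \<psi>(3))
  finally show ?thesis .
qed

lemma y_divisor_gen: "divisor_gen (yp m)"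
  using y_divisor yp_regular by (simp add: divisor_gen_def)

lemma local_residue_y_compatible: "compatible (\<lambda>m. local_residue (yp m))"
  unfolding compatible_def
  using local_residue_k_form[OF y_divisor_gen] local_residue_mult[OF y_divisor_gen _ yc] y_divisor_gen[of "Suc m" for m] by simp

text \<open>The residue of \<open>a/(s y^m)\<close>, for which \<open>sa/(s y^m) = a/y^m\<close>
  fixes the values on \<open>sR\<close>. Level 0 is the residue of \<open>a/s\<close>.\<close>

definition residue_ext :: "'r \<Rightarrow> nat \<Rightarrow> 'r \<Rightarrow> 'k" where
  "residue_ext s = (SOME \<Phi>. compatible \<Phi> \<and> (\<forall>m. \<forall>a\<in>carrier R. \<Phi> m (s \<otimes> a) = local_residue (yp m) a))"

lemma residue_ext:
  assumes s: "s \<in> Fr.S'"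
  shows "compatible (residue_ext s)" "a \<in> carrier R \<Longrightarrow> residue_ext s m (s \<otimes> a) = local_residue (yp m) a"
proof -
  obtain n x lm q where "projection_data s n x lm q" by (rule proj_genE[OF denominator_proj_gen[OF s]])
  then interpret projection k R T y d s n x lm q
    by (intro projection.intro multicurve_axioms projection_axioms.intro)
  have "compatible (residue_ext s) \<and> (\<forall>m. \<forall>a\<in>carrier R. residue_ext s m (s \<otimes> a) = local_residue (yp m) a)"
    unfolding residue_ext_def by (rule someI_ex[OF compatible_extend[OF local_residue_y_compatible]])
  then show "compatible (residue_ext s)" "a \<in> carrier R \<Longrightarrow> residue_ext s m (s \<otimes> a) = local_residue (yp m) a" by blast+
qed

lemma residue_ext_eqI:
  assumes s: "s \<in> Fr.S'" and \<phi>: "compatible \<phi>" "\<And>m a. a \<in> carrier R \<Longrightarrow> \<phi> m (s \<otimes> a) = local_residue (yp m) a" and b: "b \<in> carrier R"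
  shows "residue_ext s m b = \<phi> m b"
  by (rule denominator_unique[OF s residue_ext(1)[OF s] \<phi>(1) _ b]) (simp add: residue_ext(2)[OF s] \<phi>(2))

text \<open>The family \<open>b \<mapsto> res(tb/(st y^m))\<close> also extends the local residues
  from \<open>sR\<close>, so uniqueness identifies it with the family of \<open>s\<close>. This
  makes \<open>mero_res\<close> independent of the fraction chosen.\<close>

lemma residue_ext_mult:
  assumes s: "s \<in> Fr.S'" and t: "t \<in> Fr.S'" and b: "b \<in> carrier R"
  shows "residue_ext s m b = residue_ext (s \<otimes> t) m (t \<otimes> b)"
proof (rule residue_ext_eqI[OF s _ _ b])
  note c = Fr.S'_carrier[OF s] Fr.S'_carrier[OF t] and st = Fr.S'_mult[OF s t]
  have "y \<otimes> (t \<otimes> a) = t \<otimes> (y \<otimes> a)" if "a \<in> carrier R" for a using that c yc by (simp add: m_ac)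
  then show "compatible (\<lambda>m b. residue_ext (s \<otimes> t) m (t \<otimes> b))"
    unfolding compatible_def
    using k_form_comp[OF compatibleD(1)[OF residue_ext(1)[OF st]] k_linear_mult[OF c(2)]] compatibleD(2)[OF residue_ext(1)[OF st]] c
    by (metis m_closed)
  show "residue_ext (s \<otimes> t) m (t \<otimes> (s \<otimes> a)) = local_residue (yp m) a" if "a \<in> carrier R" for m a
  proof -
    have "t \<otimes> (s \<otimes> a) = (s \<otimes> t) \<otimes> a" using that c by (simp add: m_ac)
    then show ?thesis using residue_ext(2)[OF st that] by simp
  qed
qed

text \<open>If \<open>y^N = fh\<close>, then \<open>a/(f y^m) = ha/y^(m+N)\<close>, so the local
  residues at powers of \<open>y\<close> give an explicit extension. At level 0 it is the local
  residue at \<open>f\<close> by \<open>local_residue_mult\<close>.\<close>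

lemma residue_ext_divisor:
  assumes f: "divisor_gen f" and x: "x \<in> carrier R"
  shows "residue_ext f 0 x = local_residue f x"
proof -
  note fD = divisor_genD[OF f] and fS = divisor_gen_denominator[OF f]
  obtain N where N: "PIdl (yp N) \<subseteq> PIdl f" by (rule y_cofinal[OF fD(3)])
  obtain h where h: "h \<in> carrier R" "yp N = f \<otimes> h" by (rule PIdl_subset_factor[OF yp_closed fD(2) N])
  define \<phi> where "\<phi> m a = local_residue (yp (m + N)) (h \<otimes> a)" for m a
  have "residue_ext f 0 x = \<phi> 0 x"
  proof (rule residue_ext_eqI[OF fS _ _ x])
    show "compatible \<phi>"
      unfolding compatible_def
    proof (intro conjI allI ballI)
      show "k_form (\<phi> m)" for m
        unfolding \<phi>_def by (rule k_form_comp[OF local_residue_k_form[OF y_divisor_gen] k_linear_mult[OF h(1)]])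
      fix m a assume a: "a \<in> carrier R"
      have "h \<otimes> (y \<otimes> a) = y \<otimes> (h \<otimes> a)" using a h yc by (simp add: m_ac)
      then show "\<phi> (Suc m) (y \<otimes> a) = \<phi> m a"
        using compatibleD(2)[OF local_residue_y_compatible, of "h \<otimes> a" "m + N"] a h by (simp add: \<phi>_def)
    qed
    fix m a assume a: "a \<in> carrier R"
    have "h \<otimes> (f \<otimes> a) = yp N \<otimes> a" unfolding h(2) using a h(1) fD by (simp add: m_ac)
    then show "\<phi> m (f \<otimes> a) = local_residue (yp m) a"
      using compatible_power[OF local_residue_y_compatible a, of m N] by (simp add: \<phi>_def)
  qed
  also have "\<phi> 0 x = local_residue (f \<otimes> h) (h \<otimes> x)" by (simp add: \<phi>_def h(2))
  also have "\<dots> = local_residue f x"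
    by (rule local_residue_mult[OF f _ h(1) x]) (use y_divisor_gen[of N] h(2) in simp)
  finally show ?thesis .
qed

definition mero_res :: "('r \<times> 'r) set \<Rightarrow> 'k" where
  "mero_res g = (THE c. \<exists>a s. a \<in> carrier R \<and> s \<in> Fr.S' \<and> g = mf a s \<and> c = residue_ext s 0 a)"

lemma mero_res_mf:
  assumes a: "a \<in> carrier R" and s: "s \<in> Fr.S'"
  shows "mero_res (mf a s) = residue_ext s 0 a"
  unfolding mero_res_def
proof (rule the_equality)
  show "\<exists>b t. b \<in> carrier R \<and> t \<in> Fr.S' \<and> mf a s = mf b t \<and> residue_ext s 0 a = residue_ext t 0 b" using a s by blast
  fix c assume "\<exists>b t. b \<in> carrier R \<and> t \<in> Fr.S' \<and> mf a s = mf b t \<and> c = residue_ext t 0 b"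
  then obtain b t where b: "b \<in> carrier R" "t \<in> Fr.S'" "mf a s = mf b t" "c = residue_ext t 0 b" by blast
  note cr = Fr.S'_carrier[OF s] Fr.S'_carrier[OF b(2)]
  have "t \<otimes> a = s \<otimes> b"
    using b(3) Fr.fr_eq_iff[OF a s b(1,2)] cr a b(1) by (simp add: m_comm)
  then have "residue_ext s 0 a = residue_ext (t \<otimes> s) 0 (s \<otimes> b)"
    using residue_ext_mult[OF s b(2) a, of 0] cr by (simp add: m_comm)
  then show "c = residue_ext s 0 a" using residue_ext_mult[OF b(2) s b(1), of 0] b(4) by simp
qed

lemma mero_res_closed: "g \<in> carrier Mer \<Longrightarrow> mero_res g \<in> carrier k"
  using k_form_closed[OF compatibleD(1)[OF residue_ext(1)]] by (auto simp: Mer_eq Fr.Loc_carrier mero_res_mf)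

lemma mero_res_add:
  assumes "g \<in> carrier Mer" "g' \<in> carrier Mer"
  shows "mero_res (g \<oplus>\<^bsub>Mer\<^esub> g') = mero_res g \<oplus>\<^bsub>k\<^esub> mero_res g'"
proof -
  obtain a b s where *: "a \<in> carrier R" "b \<in> carrier R" "s \<in> Fr.S'" "g = mf a s" "g' = mf b s"
    by (rule Fr.common_denominator[OF assms[unfolded Mer_eq]])
  then show ?thesis
    using k_form_add[OF compatibleD(1)[OF residue_ext(1)[OF *(3)]]] by (simp add: Mer_eq Fr.fr_add_same mero_res_mf)
qed

lemma scalar_mult: "c \<in> carrier k \<Longrightarrow> a \<in> carrier R \<Longrightarrow> (c \<odot> \<one>) \<otimes> a = c \<odot> a"
  using smult_assoc2[of c "\<one>" a] by simp

lemma mero_res_smult: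
  assumes c: "c \<in> carrier k" and "g \<in> carrier Mer"
  shows "mero_res ((c \<odot> \<one>) \<odot>\<^bsub>Mer\<^esub> g) = c \<otimes>\<^bsub>k\<^esub> mero_res g"
proof -
  obtain a s where *: "a \<in> carrier R" "s \<in> Fr.S'" "g = mf a s" using assms(2) by (auto simp: Mer_eq Fr.Loc_carrier)
  have "c \<odot> \<one> \<in> carrier R" using c by simp
  then show ?thesis
    using * c k_form_smult[OF compatibleD(1)[OF residue_ext(1)[OF *(2)]] c]
    by (simp add: Mer_eq Fr.fr_smult mero_res_mf scalar_mult)
qed

lemma mero_res_divisor: "divisor_gen f \<Longrightarrow> x \<in> carrier R \<Longrightarrow> mero_res (mf x f) = local_residue f x"
  by (simp add: mero_res_mf divisor_gen_denominator residue_ext_divisor)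

text \<open>Such a map gives the compatible family \<open>b \<mapsto> \<sigma>(b/(s y^m))\<close>,
  whose values on \<open>sR\<close> are prescribed by the divisors of the powers of
  \<open>y\<close>. Uniqueness of the extension then covers denominators that generate no open
  ideal.\<close>

lemma mero_res_unique:
  assumes closed: "\<And>g. g \<in> carrier Mer \<Longrightarrow> \<sigma> g \<in> carrier k"
    and add: "\<And>g g'. g \<in> carrier Mer \<Longrightarrow> g' \<in> carrier Mer \<Longrightarrow> \<sigma> (g \<oplus>\<^bsub>Mer\<^esub> g') = \<sigma> g \<oplus>\<^bsub>k\<^esub> \<sigma> g'"
    and smult: "\<And>c g. c \<in> carrier k \<Longrightarrow> g \<in> carrier Mer \<Longrightarrow> \<sigma> ((c \<odot> \<one>) \<odot>\<^bsub>Mer\<^esub> g) = c \<otimes>\<^bsub>k\<^esub> \<sigma> g"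
    and div: "\<And>f x. divisor_gen f \<Longrightarrow> x \<in> carrier R \<Longrightarrow> \<sigma> (mf x f) = local_residue f x"
    and g: "g \<in> carrier Mer"
  shows "\<sigma> g = mero_res g"
proof -
  obtain a s where a: "a \<in> carrier R" "s \<in> Fr.S'" "g = mf a s" using g by (auto simp: Mer_eq Fr.Loc_carrier)
  note sc = Fr.S'_carrier[OF a(2)]
  have yS: "yp m \<in> Fr.S'" for m by (rule divisor_gen_denominator[OF y_divisor_gen])
  have sy: "s \<otimes> yp m \<in> Fr.S'" for m by (rule Fr.S'_mult[OF a(2) yS])
  have mc: "mf b (s \<otimes> yp m) \<in> carrier Mer" if "b \<in> carrier R" for b m
    using Fr.fr_closed[OF that sy] by (simp add: Mer_eq)
  \<comment> \<open>The factor \<open>yp 0\<close> is 1; it is kept to match level 0 of the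
    family.\<close>
  have "residue_ext s 0 a = \<sigma> (mf a (s \<otimes> yp 0))"
  proof (rule residue_ext_eqI[OF a(2) _ _ a(1)])
    show "compatible (\<lambda>m b. \<sigma> (mf b (s \<otimes> yp m)))"
      unfolding compatible_def
    proof (intro conjI allI ballI k_formI)
      show "\<sigma> (mf b (s \<otimes> yp m)) \<in> carrier k" if "b \<in> carrier R" for b m using closed[OF mc[OF that]] .
      show "\<sigma> (mf (b \<oplus> b') (s \<otimes> yp m)) = \<sigma> (mf b (s \<otimes> yp m)) \<oplus>\<^bsub>k\<^esub> \<sigma> (mf b' (s \<otimes> yp m))"
        if "b \<in> carrier R" "b' \<in> carrier R" for b b' m
        using add[OF mc[OF that(1)] mc[OF that(2)], of m m] Fr.fr_add_same[OF that sy] by (simp add: Mer_eq)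
      show "\<sigma> (mf (c \<odot> b) (s \<otimes> yp m)) = c \<otimes>\<^bsub>k\<^esub> \<sigma> (mf b (s \<otimes> yp m))"
        if "c \<in> carrier k" "b \<in> carrier R" for c b m
        using smult[OF that(1) mc[OF that(2)], of m] Fr.fr_smult[OF _ that(2) sy, of "c \<odot> \<one>"] that
        by (simp add: Mer_eq scalar_mult)
      show "\<sigma> (mf (y \<otimes> b) (s \<otimes> yp (Suc m))) = \<sigma> (mf b (s \<otimes> yp m))" if "b \<in> carrier R" for b m
      proof -
        have "mf (y \<otimes> b) (s \<otimes> yp (Suc m)) = mf b (s \<otimes> yp m)"
          using that sc yc yp_closed[of m]
          by (subst Fr.fr_eq_iff[OF _ sy that sy]) (simp_all add: m_ac)
        then show ?thesis by simp
      qed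
    qed
    fix m b assume b: "b \<in> carrier R"
    have "mf (s \<otimes> b) (s \<otimes> yp m) = mf b (yp m)"
      using b sc yp_closed by (subst Fr.fr_eq_iff[OF _ sy b yS]) (simp_all add: m_ac)
    then show "\<sigma> (mf (s \<otimes> b) (s \<otimes> yp m)) = local_residue (yp m) b" using div[OF y_divisor_gen b] by simp
  qed
  then show ?thesis using a sc by (simp add: mero_res_mf)
qed

end

section \<open>Residues of meromorphic forms\<close>

context multicurve
begin

interpretation Fr: regular_fractions R "divisorial k R" by (rule regular_fractions)
interpretation tM: tensor_product R Mer Om by (intro tensor_product.intro Mer_module Om_module)

lemma mero_forms_eq: "mero_forms k R T = tM.T"
  by (simp add: mero_forms_def)

lemma mero_forms_bij: "bij_betw (\<lambda>g. tM.tn g \<alpha>) (carrier Mer) (carrier tM.T)"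
  by (rule tensor_free_rank_one[OF Mer_module Om_module alpha_closed Om_bij])

lemma mf_mem_Mer: "divisor_gen f \<Longrightarrow> x \<in> carrier R \<Longrightarrow> mf x f \<in> carrier Mer"
  by (simp add: Mer_eq Fr.fr_closed divisor_gen_denominator)

lemma inverse_forms_image:
  assumes f: "divisor_gen f" and z: "z \<in> carrier (inverse_forms k R T (PIdl f))"
  obtains x where "x \<in> carrier R" "z = tens R (inv_id f) Om (mf x f) \<alpha>"
proof -
  have "bij_betw (\<lambda>g. tens R (inv_id f) Om g \<alpha>) (carrier (inv_id f)) (carrier (inverse_forms k R T (PIdl f)))"
    unfolding inverse_forms_def by (rule tensor_free_rank_one[OF inv_id_module[OF f] Om_module alpha_closed Om_bij])
  then have "z \<in> (\<lambda>g. tens R (inv_id f) Om g \<alpha>) ` carrier (inv_id f)" using z by (simp add: bij_betw_def)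
  then show ?thesis using that by (auto simp: inv_id_carrier[OF f])
qed

lemma inverse_form_maps:
  assumes f: "divisor_gen f" and x: "x \<in> carrier R"
  shows "tens R (inv_id f) Om (mf x f) \<alpha> \<in> carrier (inverse_forms k R T (PIdl f))"
    and "inverse_to_mero k R T (tens R (inv_id f) Om (mf x f) \<alpha>) = tM.tn (mf x f) \<alpha>"
    and "inverse_to_polar k R T (PIdl f) (tens R (inv_id f) Om (mf x f) \<alpha>) =
      tens R (pol f) Om (polar_class f (PIdl f +> x)) \<alpha>"
proof -
  interpret tI: tensor_product R "inv_id f" Om by (intro tensor_product.intro inv_id_module[OF f] Om_module)
  interpret tp: tensor_product R "pol f" Om by (rule pol_tensor[OF f])
  interpret P: quotient_module R "inv_id f" hol by (rule hol_quotient[OF f])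
  have g: "mf x f \<in> carrier (inv_id f)" using x by (auto simp: inv_id_carrier[OF f])
  show "tens R (inv_id f) Om (mf x f) \<alpha> \<in> carrier (inverse_forms k R T (PIdl f))"
    unfolding inverse_forms_def by (rule tI.tn_closed[OF g alpha_closed])
  have sub: "h \<in> carrier Mer" if "h \<in> carrier (inv_id f)" for h
    using that by (auto simp: inv_id_carrier[OF f] mf_mem_Mer[OF f])
  have "tI.balanced tM.T (\<lambda>g w. tM.tn g w)"
    by (rule tI.balancedI) (simp_all add: sub tM.tn_closed tM.tn_add_left tM.tn_add_right tM.tn_balanced inv_id_simps)
  then show "inverse_to_mero k R T (tens R (inv_id f) Om (mf x f) \<alpha>) = tM.tn (mf x f) \<alpha>"
    unfolding inverse_to_mero_def mero_forms_eq
    by (rule tI.tensor_lift_tn[OF tM.abelian_group_T _ g alpha_closed])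
  have pol: "pol f = quot (inv_id f) hol" by (simp add: polar_parts_def)
  have hc: "hol +>\<^bsub>inv_id f\<^esub> h \<in> carrier (pol f)" if "h \<in> carrier (inv_id f)" for h
    using P.coset_mem_carrier[OF that] by (simp add: pol)
  have ha: "hol +>\<^bsub>inv_id f\<^esub> (h \<oplus>\<^bsub>inv_id f\<^esub> h') = (hol +>\<^bsub>inv_id f\<^esub> h) \<oplus>\<^bsub>pol f\<^esub> (hol +>\<^bsub>inv_id f\<^esub> h')"
    if "h \<in> carrier (inv_id f)" "h' \<in> carrier (inv_id f)" for h h'
    using P.coset_add[OF that] by (simp add: pol)
  have hs: "hol +>\<^bsub>inv_id f\<^esub> (a \<odot>\<^bsub>inv_id f\<^esub> h) = a \<odot>\<^bsub>pol f\<^esub> (hol +>\<^bsub>inv_id f\<^esub> h)"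
    if "a \<in> carrier R" "h \<in> carrier (inv_id f)" for a h
    using P.coset_smult[OF that] by (simp add: pol)
  have "tI.balanced tp.T (\<lambda>g w. tp.tn (hol +>\<^bsub>inv_id f\<^esub> g) w)"
    by (rule tI.balancedI) (simp_all add: hc ha hs tp.tn_closed tp.tn_add_left tp.tn_add_right tp.tn_balanced)
  then show "inverse_to_polar k R T (PIdl f) (tens R (inv_id f) Om (mf x f) \<alpha>) =
      tp.tn (polar_class f (PIdl f +> x)) \<alpha>"
    unfolding inverse_to_polar_def polar_forms_def polar_class_coset[OF f x]
    by (rule tI.tensor_lift_tn[OF tp.abelian_group_T _ g alpha_closed])
qed

lemma duality_map_inv:
  assumes f: "divisor_gen f" and \<psi>: "\<psi> \<in> carrier (dual k R (PIdl f))"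
  shows "inv_into (carrier (dual k R (PIdl f))) (duality_map k R T (PIdl f)) (duality_map k R T (PIdl f) \<psi>) = \<psi>"
  using duality_map_iso[OF f] \<psi> by (intro inv_into_f_f) (auto simp: lin_isos_def bij_betw_def)

text \<open>Every element of the inverse forms is \<open>(x/f) \<otimes> \<alpha>\<close>, and there
  the inverse of the duality map evaluated at 1 is \<open>local_residue f x\<close>. The condition
  over all divisors becomes one about fractions.\<close>

lemma residue_map_iff:
  "is_residue_map k R T \<rho> \<longleftrightarrow>
     \<rho> \<in> lin_maps k (restrict_scalars R (mero_forms k R T)) (self_module k) \<and>
     (\<forall>f x. divisor_gen f \<and> x \<in> carrier R \<longrightarrow> \<rho> (tM.tn (mf x f) \<alpha>) = local_residue f x)"
proof -
  have val: "(inv_into (carrier (dual k R (PIdl f))) (duality_map k R T (PIdl f))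
      (inverse_to_polar k R T (PIdl f) (tens R (inv_id f) Om (mf x f) \<alpha>))) \<one>\<^bsub>quot R (PIdl f)\<^esub> = local_residue f x"
    if f: "divisor_gen f" and x: "x \<in> carrier R" for f x
  proof -
    obtain \<psi> where \<psi>: "\<psi> \<in> Dl (PIdl f)" "dual_coeff f \<psi> = PIdl f +> x" "local_residue f x = \<psi> \<one>\<^bsub>quot R (PIdl f)\<^esub>"
      by (rule local_residue_functional[OF f x])
    have "inverse_to_polar k R T (PIdl f) (tens R (inv_id f) Om (mf x f) \<alpha>) = duality_map k R T (PIdl f) \<psi>"
      by (simp only: inverse_form_maps(3)[OF f x] duality_map_eq[OF f \<psi>(1)] Psi_def \<psi>(2))
    then show ?thesis using duality_map_inv[OF f, of \<psi>] \<psi> by (simp add: dual_simps)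
  qed
  have "(\<forall>I. divisor k R T I \<longrightarrow> (\<forall>z\<in>carrier (inverse_forms k R T I).
        \<rho> (inverse_to_mero k R T z) =
          (inv_into (carrier (dual k R I)) (duality_map k R T I) (inverse_to_polar k R T I z)) \<one>\<^bsub>quot R I\<^esub>)) \<longleftrightarrow>
     (\<forall>f x. divisor_gen f \<and> x \<in> carrier R \<longrightarrow> \<rho> (tM.tn (mf x f) \<alpha>) = local_residue f x)" (is "?l \<longleftrightarrow> ?r")
  proof (intro iffI allI impI ballI)
    fix f x assume l: ?l and *: "divisor_gen f \<and> x \<in> carrier R"
    then have f: "divisor_gen f" and x: "x \<in> carrier R" by auto
    have "divisor k R T (PIdl f)" using f by (simp add: divisor_gen_def)
    from l[rule_format, OF this inverse_form_maps(1)[OF f x]] show "\<rho> (tM.tn (mf x f) \<alpha>) = local_residue f x"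
      by (simp only: val[OF f x] inverse_form_maps(2)[OF f x])
  next
    fix I z assume r: ?r and I: "divisor k R T I" and z: "z \<in> carrier (inverse_forms k R T I)"
    obtain f where f: "I = PIdl f" "divisor_gen f" using I by (auto simp: divisor_def divisor_gen_def)
    obtain x where x: "x \<in> carrier R" "z = tens R (inv_id f) Om (mf x f) \<alpha>"
      by (rule inverse_forms_image[OF f(2) z[unfolded f(1)]])
    show "\<rho> (inverse_to_mero k R T z) =
          (inv_into (carrier (dual k R I)) (duality_map k R T I) (inverse_to_polar k R T I z)) \<one>\<^bsub>quot R I\<^esub>"
      unfolding f(1) x(2) val[OF f(2) x(1)] inverse_form_maps(2)[OF f(2) x(1)] using r f(2) x(1) by blast
  qed
  then show ?thesis by (simp add: is_residue_map_def)
qed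

text \<open>The bijection \<open>g \<mapsto> g \<otimes> \<alpha>\<close> carries existence and
  uniqueness over to \<open>mero_res\<close> on the meromorphic functions.\<close>

lemma ex1_residue_map: "\<exists>!\<rho>. is_residue_map k R T \<rho>"
proof -
  let ?F = "restrict_scalars R (mero_forms k R T)"
  have F: "carrier ?F = carrier tM.T" "add ?F = add tM.T" "\<And>c z. c \<odot>\<^bsub>?F\<^esub> z = (c \<odot> \<one>) \<odot>\<^bsub>tM.T\<^esub> z"
    by (simp_all add: restrict_scalars_def mero_forms_eq)
  have c1: "c \<odot> \<one> \<in> carrier R" if "c \<in> carrier k" for c using that by simp
  have form: "\<exists>g\<in>carrier Mer. z = tM.tn g \<alpha>" if "z \<in> carrier tM.T" for z
    using that mero_forms_bij by (auto simp: bij_betw_def)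
  note tc = tM.tn_closed[OF _ alpha_closed]
  have Mer_closed: "g \<oplus>\<^bsub>Mer\<^esub> g' \<in> carrier Mer" "a \<odot>\<^bsub>Mer\<^esub> g \<in> carrier Mer"
    if "g \<in> carrier Mer" "g' \<in> carrier Mer" "a \<in> carrier R" for g g' a
  proof -
    interpret Mr: Module.module R Mer by (rule Mer_module)
    show "g \<oplus>\<^bsub>Mer\<^esub> g' \<in> carrier Mer" "a \<odot>\<^bsub>Mer\<^esub> g \<in> carrier Mer" using that by simp_all
  qed
  define \<rho> where "\<rho> = (\<lambda>z\<in>carrier tM.T. mero_res (the_inv_into (carrier Mer) (\<lambda>g. tM.tn g \<alpha>) z))"
  have \<rho>: "\<rho> (tM.tn g \<alpha>) = mero_res g" if "g \<in> carrier Mer" for g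
    using tc[OF that] the_inv_into_f_f[OF bij_betw_imp_inj_on[OF mero_forms_bij] that] by (simp add: \<rho>_def)
  show ?thesis
  proof (rule ex1I[of _ \<rho>])
    show "is_residue_map k R T \<rho>"
      unfolding residue_map_iff
    proof (intro conjI allI impI)
      show "\<rho> \<in> lin_maps k ?F (self_module k)"
        unfolding lin_maps_def
      proof (intro CollectI conjI ballI)
        have "\<rho> z \<in> carrier k" if z: "z \<in> carrier tM.T" for z
          using form[OF z] \<rho> mero_res_closed by auto
        then show "\<rho> \<in> carrier ?F \<rightarrow>\<^sub>E carrier (self_module k)"
          by (auto simp: F self_module_def) (simp add: \<rho>_def)
        fix z assume "z \<in> carrier ?F"
        then obtain g where g: "g \<in> carrier Mer" "z = tM.tn g \<alpha>" using form F(1) by blast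
        show "\<rho> (c \<odot>\<^bsub>?F\<^esub> z) = c \<odot>\<^bsub>self_module k\<^esub> \<rho> z" if c: "c \<in> carrier k" for c
          using g(1) c by (simp add: F g(2) tM.smult_tn[OF c1[OF c] g(1) alpha_closed] \<rho> Mer_closed(2)[OF g(1) g(1) c1[OF c]]
            mero_res_smult self_module_def)
        fix w assume "w \<in> carrier ?F"
        then obtain h where h: "h \<in> carrier Mer" "w = tM.tn h \<alpha>" using form F(1) by blast
        show "\<rho> (z \<oplus>\<^bsub>?F\<^esub> w) = \<rho> z \<oplus>\<^bsub>self_module k\<^esub> \<rho> w"
          using g(1) h(1) Mer_closed(1)[OF g(1) h(1) M.zero_closed]
          by (simp add: F g(2) h(2) tM.tn_add_left[OF g(1) h(1) alpha_closed, symmetric] \<rho> mero_res_add self_module_def)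
      qed
      fix f x assume "divisor_gen f \<and> x \<in> carrier R"
      then show "\<rho> (tM.tn (mf x f) \<alpha>) = local_residue f x" by (simp add: \<rho> mf_mem_Mer mero_res_divisor)
    qed
    fix \<rho>' assume *: "is_residue_map k R T \<rho>'"
    then have lin: "\<rho>' \<in> lin_maps k ?F (self_module k)"
      and div: "\<And>f x. divisor_gen f \<Longrightarrow> x \<in> carrier R \<Longrightarrow> \<rho>' (tM.tn (mf x f) \<alpha>) = local_residue f x"
      unfolding residue_map_iff by blast+
    have rc: "\<rho>' z \<in> carrier k" if "z \<in> carrier tM.T" for z
      using lin that by (auto simp: lin_maps_def self_module_def F)
    have radd: "\<rho>' (z \<oplus>\<^bsub>tM.T\<^esub> w) = \<rho>' z \<oplus>\<^bsub>k\<^esub> \<rho>' w" if "z \<in> carrier tM.T" "w \<in> carrier tM.T" for z w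
      using lin that by (simp add: lin_maps_def self_module_def F)
    have rsmult: "\<rho>' ((c \<odot> \<one>) \<odot>\<^bsub>tM.T\<^esub> z) = c \<otimes>\<^bsub>k\<^esub> \<rho>' z" if "c \<in> carrier k" "z \<in> carrier tM.T" for c z
      using lin that by (simp add: lin_maps_def self_module_def F)
    have "\<rho>' (tM.tn g \<alpha>) = mero_res g" if g: "g \<in> carrier Mer" for g
    proof (rule mero_res_unique[where \<sigma> = "\<lambda>g. \<rho>' (tM.tn g \<alpha>)", OF _ _ _ div g])
      show "\<rho>' (tM.tn g \<alpha>) \<in> carrier k" if "g \<in> carrier Mer" for g by (rule rc[OF tc[OF that]])
      show "\<rho>' (tM.tn (g \<oplus>\<^bsub>Mer\<^esub> g') \<alpha>) = \<rho>' (tM.tn g \<alpha>) \<oplus>\<^bsub>k\<^esub> \<rho>' (tM.tn g' \<alpha>)"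
        if "g \<in> carrier Mer" "g' \<in> carrier Mer" for g g'
        using radd[OF tc[OF that(1)] tc[OF that(2)]] tM.tn_add_left[OF that alpha_closed] by simp
      show "\<rho>' (tM.tn ((c \<odot> \<one>) \<odot>\<^bsub>Mer\<^esub> g) \<alpha>) = c \<otimes>\<^bsub>k\<^esub> \<rho>' (tM.tn g \<alpha>)"
        if "c \<in> carrier k" "g \<in> carrier Mer" for c g
        using rsmult[OF that(1) tc[OF that(2)]] tM.smult_tn[OF c1[OF that(1)] that(2) alpha_closed] by simp
    qed
    then have "\<rho>' z = \<rho> z" if "z \<in> carrier tM.T" for z using form[OF that] \<rho> by auto
    moreover have "\<rho>' \<in> extensional (carrier tM.T)" using lin by (simp add: lin_maps_def F PiE_def)
    ultimately show "\<rho>' = \<rho>" by (intro extensionalityI[of _ "carrier tM.T"]) (simp_all add: \<rho>_def)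
  qed
qed

lemma residue_corresponds:
  assumes f: "divisor_gen f" and \<phi>: "\<phi> \<in> carrier (dual k R (PIdl f))" and c: "corresponds k R T (PIdl f) \<phi> \<mu>'"
  shows "\<phi> \<one>\<^bsub>quot R (PIdl f)\<^esub> = residue k R T \<mu>'"
proof -
  let ?I = "PIdl f"
  have "is_residue_map k R T (residue k R T)" unfolding residue_def by (rule theI'[OF ex1_residue_map])
  moreover have "divisor k R T ?I" using f by (simp add: divisor_gen_def)
  moreover obtain z where z: "z \<in> carrier (inverse_forms k R T ?I)" "inverse_to_mero k R T z = \<mu>'"
    "inverse_to_polar k R T ?I z = duality_map k R T ?I \<phi>"
    using c unfolding corresponds_def by blast
  ultimately have "residue k R T \<mu>' =
      (inv_into (carrier (dual k R ?I)) (duality_map k R T ?I) (inverse_to_polar k R T ?I z)) \<one>\<^bsub>quot R ?I\<^esub>"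
    unfolding is_residue_map_def by blast
  then show ?thesis by (simp only: z(3) duality_map_inv[OF f \<phi>])
qed

end

section \<open>Choice of parameter and difference function, and conclusion\<close>

lemma formal_multicurveE:
  assumes "formal_multicurve k R T"
  obtains y d where "multicurve k R T y d"
proof -
  have alg: "algebra k R" and formal: "formal_ring R T"
    using assms by (simp_all add: formal_multicurve_def)
  obtain y where y: "regular_elt R y" "\<forall>m::nat. openin T (PIdl\<^bsub>R\<^esub> (y [^]\<^bsub>R\<^esub> m)) \<and> fin_free k (quot R (PIdl\<^bsub>R\<^esub> (y [^]\<^bsub>R\<^esub> m)))"
    "homeomorphic_map T (limit_topology R {PIdl\<^bsub>R\<^esub> (y [^]\<^bsub>R\<^esub> m) | m::nat. True})
       (to_limit R {PIdl\<^bsub>R\<^esub> (y [^]\<^bsub>R\<^esub> m) | m::nat. True})"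
    using assms unfolding formal_multicurve_def Let_def by blast
  obtain d where "difference_function k R T d"
    using assms unfolding formal_multicurve_def by blast
  then have "multicurve k R T y d"
    by (intro multicurve.intro formal_algebra.intro alg formal_algebra_axioms.intro formal multicurve_axioms.intro)
      (use y in simp_all)
  then show ?thesis by (rule that)
qed

theorem theorem21p12:
  fixes k :: "'k ring" and R :: "('k, 'r) module" and T :: "'r topology" and I :: "'r set"
  assumes multicurve: "formal_multicurve k R T"
    and divisor: "divisor k R T I"
  shows
    "\<comment> \<open>the formula for the isomorphism does not depend on the choices\<close>
     (\<forall>d f. difference_function k R T d \<and> regular_elt R f \<and> I = PIdl\<^bsub>R\<^esub> f \<longrightarrow>
        (\<forall>\<phi>\<in>carrier (dual k R I). duality_map k R T I \<phi> = duality_formula k R T I d f \<phi>)) \<and>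
     \<comment> \<open>it is an isomorphism of modules over the ring of functions on the multicurve\<close>
     duality_map k R T I \<in> lin_isos R (dual k R I) (polar_forms k R T I) \<and>
     \<comment> \<open>it is natural with respect to inclusions of divisors\<close>
     (\<forall>E. divisor k R T E \<and> E \<subseteq> I \<longrightarrow>
        (\<forall>\<phi>\<in>carrier (dual k R I).
           duality_map k R T E (\<lambda>X\<in>carrier (quot R E). \<phi> (I <+>\<^bsub>R\<^esub> X)) =
           polar_to_polar k R T E (duality_map k R T I \<phi>))) \<and>
     \<comment> \<open>the residue map is well defined\<close>
     (\<exists>!\<rho>. is_residue_map k R T \<rho>) \<and>
     \<comment> \<open>it computes the value at 1 of the functional that corresponds to a meromorphic form\<close>
     (\<forall>\<phi>\<in>carrier (dual k R I). \<forall>\<mu>\<in>carrier (mero_forms k R T).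
        corresponds k R T I \<phi> \<mu> \<longrightarrow> \<phi> \<one>\<^bsub>quot R I\<^esub> = residue k R T \<mu>)"
proof -
  obtain y d where "multicurve k R T y d" by (rule formal_multicurveE[OF multicurve])
  then interpret C: multicurve k R T y d .
  have gen: "\<exists>g. J = PIdl\<^bsub>R\<^esub> g \<and> C.divisor_gen g" if "divisor k R T J" for J
    using that by (auto simp: divisor_def C.divisor_gen_def)
  obtain g where g: "I = PIdl\<^bsub>R\<^esub> g" "C.divisor_gen g" using gen[OF divisor] by blast
  show ?thesis
  proof (intro conjI allI impI ballI)
    fix d' f \<phi> assume *: "difference_function k R T d' \<and> regular_elt R f \<and> I = PIdl\<^bsub>R\<^esub> f"
      and \<phi>: "\<phi> \<in> carrier (dual k R I)"
    have f: "C.divisor_gen f" using * divisor by (simp add: C.divisor_gen_def)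
    have \<phi>': "\<phi> \<in> C.Dl (PIdl\<^bsub>R\<^esub> f)" using \<phi> * by (simp add: C.dual_simps)
    have "duality_map k R T (PIdl\<^bsub>R\<^esub> f) \<phi> = duality_formula k R T (PIdl\<^bsub>R\<^esub> f) d' f \<phi>"
      using C.duality_map_eq[OF f \<phi>'] C.formula_eq[OF _ f f refl \<phi>', of d'] * by simp
    then show "duality_map k R T I \<phi> = duality_formula k R T I d' f \<phi>" using * by simp
  next
    show "duality_map k R T I \<in> lin_isos R (dual k R I) (polar_forms k R T I)"
      unfolding g(1) by (rule C.duality_map_iso[OF g(2)])
  next
    fix E \<phi> assume E: "divisor k R T E \<and> E \<subseteq> I" and \<phi>: "\<phi> \<in> carrier (dual k R I)"
    obtain h where h: "E = PIdl\<^bsub>R\<^esub> h" "C.divisor_gen h" using gen E by blast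
    have sub: "PIdl\<^bsub>R\<^esub> h \<subseteq> PIdl\<^bsub>R\<^esub> g" using E h(1) g(1) by simp
    have "\<phi> \<in> C.Dl (PIdl\<^bsub>R\<^esub> g)" using \<phi> g(1) by (simp add: C.dual_simps)
    then show "duality_map k R T E (\<lambda>X\<in>carrier (quot R E). \<phi> (I <+>\<^bsub>R\<^esub> X)) =
        polar_to_polar k R T E (duality_map k R T I \<phi>)"
      unfolding h(1) g(1) by (rule C.duality_natural(2)[OF g(2) h(2) sub])
  next
    show "\<exists>!\<rho>. is_residue_map k R T \<rho>" by (rule C.ex1_residue_map)
  next
    fix \<phi> \<mu> assume "\<phi> \<in> carrier (dual k R I)" "corresponds k R T I \<phi> \<mu>"
    then show "\<phi> \<one>\<^bsub>quot R I\<^esub> = residue k R T \<mu>"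
      unfolding g(1) by (rule C.residue_corresponds[OF g(2)])
  qed
qed

end
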